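(* Let $d\ge1$ and $s\in(0,1)$. Let $m$ and $p$ be real numbers with $m\ge p$ and $1<p\le \frac{d(m-1)}{2s}$. Assume that $f:\mathbb{R}\to\mathbb{R}$ satisfies $f(0)=0$ and, for some constants $C>0$ and $\lambda>0$, $$|f(u)-f(v)|\le C|u-v|\left(|u|^{m-1}e^{\lambda|u|^p}+|v|^{m-1}e^{\lambda|v|^p}\right)\quad\text{for all }u,v\in\mathbb{R}.$$ Then there exists $\varepsilon>0$ such that, for every initial data $u_0\in\exp L^p(\mathbb{R}^d)$ with $\|u_0\|_{\exp L^p}\le\varepsilon$, the problem $$\partial_t u+\mathcal{L}u=f(u)\ \ (t>0,\ x\in\mathbb{R}^d),\qquad u(0,x)=u_0(x)\ \ (x\in\mathbb{R}^d)$$ admits a global weak-mild solution $u\in L^\infty((0,\infty),\exp L^p(\mathbb{R}^d))$. Moreover, the solution satisfies $$\lim_{t\to0}\|u(t)-e^{-t\mathcal{L}}u_0\|_{\exp L^p}=0.$$ In addition, for every exponent $q$ satisfying the condition below there exists a constant $C>0$ such that $$\|u(t)\|_{L^q(\mathbb{R}^d)}\le C\,t_s^{-\left(\frac1{m-1}-\frac{d}{2sq}\right)}\quad\text{for all }t>0,\qquad t_s:=\max\{t^s,t\},$$ where the condition on $q$ is: (i) if $s<\frac{d(p-1)}{2p}$, then $\frac{d(m-1)}{s}<2q<\frac{d(m-1)}{s}\frac{1}{(2-m)_+}$; (ii) if $s=\frac{d(p-1)}{2p}$, then $\frac{d(m-1)}{s}<2q<\frac{d(m-1)}{s}\frac{1}{(2-m)_+}$;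 (iii) if $s>\frac{d(p-1)}{2p}$ and $(2-m)_+<\frac{d(p-1)}{2ps}$, then $\frac{2(m-1)p}{p-1}<2q<\frac{d(m-1)}{s}\frac{1}{(2-m)_+}$.
   Context: For $s\in(0,1)$, $\mathcal{L}=-\Delta+(-\Delta)^s$ on $\mathbb{R}^d$, where $(-\Delta)^s v(x)=C_{d,s}\,\mathrm{P.V.}\int_{\mathbb{R}^d}\frac{v(x)-v(y)}{|x-y|^{d+2s}}\,dy$ with $C_{d,s}=\frac{s4^s\Gamma((d+2s)/2)}{\pi^{d/2}\Gamma(1-s)}$. The heat semigroup of $\mathcal{L}$ is $e^{-t\mathcal{L}}\varphi(x)=\int_{\mathbb{R}^d}P_t^s(x-y)\varphi(y)\,dy$ for $t>0$ (and the identity for $t=0$), where $P_t^s(x)=(4\pi t)^{-d/2}\int_{\mathbb{R}^d}e^{-|x-\xi|^2/(4t)}H_t^s(\xi)\,d\xi$ and $H^s_t$ is the heat kernel of $-(-\Delta)^s$ (i.e. the convolution kernel of $e^{-t(-\Delta)^s}$). For $1\le p<\infty$, $\exp L^p(\mathbb{R}^d)$ is the space of $u\in L^1_{\mathrm{loc}}(\mathbb{R}^d)$ with $\int_{\mathbb{R}^d}\left(\exp(|u(x)|^p/\mu^p)-1\right)dx<\infty$ for some $\mu>0$, a Banach space under the Luxemburg norm $\|u\|_{\exp L^p}=\inf\{\mu>0:\int_{\mathbb{R}^d}(\exp(|u(x)|^p/\mu^p)-1)\,dx\le 1\}$. Weak-mild solution: given $u_0\in\exp L^p(\mathbb{R}^d)$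 and $T>0$, a function $u\in L^\infty((0,T),\exp L^p(\mathbb{R}^d))$ is a weak-mild solution if $u(t)=e^{-t\mathcal{L}}u_0+\int_0^te^{-(t-\tau)\mathcal{L}}f(u(\tau))\,d\tau$ holds in $\exp L^p(\mathbb{R}^d)$ for almost every $t\in(0,T)$, and $u(t)\to u_0$ in the weak$^*$ topology as $t\to0$, i.e. $\lim_{t\to0}\int_{\mathbb{R}^d}(u(t,x)-u_0(x))\varphi(x)\,dx=0$ for all $\varphi\in L^1(\ln L)^{1/p}(\mathbb{R}^d)$. Here $L^1(\ln L)^{1/p}(\mathbb{R}^d)=\{g\in L^1_{\mathrm{loc}}(\mathbb{R}^d):\int_{\mathbb{R}^d}|g(x)|\ln^{1/p}(2+|g(x)|)\,dx<\infty\}$, a predual of $\exp L^p(\mathbb{R}^d)$. "Global" means $T=\infty$. $(a)_+=\max\{a,0\}$ denotes the positive part; when $(2-m)_+=0$ the upper bound $\frac{d(m-1)}{s}\frac{1}{(2-m)_+}$ is read as $+\infty$ (with $q<\infty$). *)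

theory Defs
  imports "HOL-Analysis.Analysis"
begin

text \<open>The space \<open>\<real>\<^sup>d\<close> is an arbitrary type of class \<^class>\<open>euclidean_space\<close> of dimension
  \<open>d = DIM('a)\<close>; elements of function spaces are represented by functions, equality in
  these spaces being equality almost everywhere.\<close>

definition frac_const :: "real \<Rightarrow> real \<Rightarrow> real" where
  "frac_const d s = s * 4 powr s * Gamma ((d + 2 * s) / 2) / (pi powr (d / 2) * Gamma (1 - s))"

definition frac_laplacian ::
    "real \<Rightarrow> ('a::euclidean_space \<Rightarrow> 'b::{banach, second_countable_topology}) \<Rightarrow> 'a \<Rightarrow> 'b" where
  "frac_laplacian s v x =
     frac_const (real DIM('a)) s *\<^sub>R
       Lim (at_right 0) (\<lambda>\<epsilon>. LINT y:{y. \<epsilon> < dist x y}|lebesgue.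
         (1 / norm (x - y) powr (real DIM('a) + 2 * s)) *\<^sub>R (v x - v y))"

text \<open>Plane waves \<open>e\<^sub>\<xi>(y) = exp (i \<xi>\<cdot>y)\<close> satisfy \<open>(-\<Delta>)\<^sup>s e\<^sub>\<xi> = \<sigma>(\<xi>) e\<^sub>\<xi>\<close>, where
  \<open>\<sigma>(\<xi>) = ((-\<Delta>)\<^sup>s e\<^sub>\<xi>)(0)\<close> is the Fourier symbol of \<open>(-\<Delta>)\<^sup>s\<close> (it equals \<open>|\<xi>|\<close> to the
  power \<open>2s\<close>).\<close>

definition frac_symbol :: "real \<Rightarrow> 'a::euclidean_space \<Rightarrow> complex" where
  "frac_symbol s \<xi> = frac_laplacian s (\<lambda>y. cis (\<xi> \<bullet> y)) 0"

text \<open>The operator \<open>exp (-t (-\<Delta>)\<^sup>s)\<close> is the Fourier multiplier with symbol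
  \<open>exp (-t \<sigma>(\<xi>))\<close>, so its convolution kernel is the inverse Fourier transform of that
  symbol. The integral below is real, and \<^const>\<open>Re\<close> only adjusts the type.\<close>

definition frac_heat_kernel :: "real \<Rightarrow> real \<Rightarrow> 'a::euclidean_space \<Rightarrow> real" where
  "frac_heat_kernel s t x =
     Re (LINT \<xi>|lebesgue. cis (\<xi> \<bullet> x) * exp (- (of_real t * frac_symbol s \<xi>)))
       / (2 * pi) ^ DIM('a)"

definition mixed_heat_kernel :: "real \<Rightarrow> real \<Rightarrow> 'a::euclidean_space \<Rightarrow> real" where
  "mixed_heat_kernel s t x =
     (4 * pi * t) powr (- (real DIM('a) / 2)) *
       (LINT \<xi>|lebesgue. exp (- ((norm (x - \<xi>))\<^sup>2 / (4 * t))) * frac_heat_kernel s t \<xi>)"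

definition heat_semigroup ::
    "real \<Rightarrow> real \<Rightarrow> ('a::euclidean_space \<Rightarrow> real) \<Rightarrow> 'a \<Rightarrow> real" where
  "heat_semigroup s t \<phi> x =
     (if t = 0 then \<phi> x else LINT y|lebesgue. mixed_heat_kernel s t (x - y) * \<phi> y)"

text \<open>Since the Bochner integral of a non-integrable function is \<open>0\<close>, convergence of the
  convolution has to be recorded separately.\<close>

definition heat_semigroup_converges ::
    "real \<Rightarrow> real \<Rightarrow> ('a::euclidean_space \<Rightarrow> real) \<Rightarrow> bool" where
  "heat_semigroup_converges s t \<phi> \<longleftrightarrow>
     (AE x in lebesgue. integrable lebesgue (\<lambda>y. mixed_heat_kernel s t (x - y) * \<phi> y))"

definition L1_loc :: "('a::euclidean_space \<Rightarrow> real) set" where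
  "L1_loc = {g. \<forall>K. compact K \<longrightarrow> set_integrable lebesgue K g}"

definition expL :: "real \<Rightarrow> ('a::euclidean_space \<Rightarrow> real) set" where
  "expL p = {g \<in> L1_loc. \<exists>\<mu>>0.
     (\<integral>\<^sup>+x. ennreal (exp (\<bar>g x\<bar> powr p / \<mu> powr p) - 1) \<partial>lebesgue) < \<infinity>}"

text \<open>The Luxemburg norm takes values in \<^typ>\<open>ennreal\<close>, so that the infimum of the empty set
  is \<open>\<infinity>\<close>; it is finite on \<^const>\<open>expL\<close>.\<close>

definition expL_norm :: "real \<Rightarrow> ('a::euclidean_space \<Rightarrow> real) \<Rightarrow> ennreal" where
  "expL_norm p g = Inf {ennreal \<mu> | \<mu>. 0 < \<mu> \<and>
     (\<integral>\<^sup>+x. ennreal (exp (\<bar>g x\<bar> powr p / \<mu> powr p) - 1) \<partial>lebesgue) \<le> 1}"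

definition L1_lnL :: "real \<Rightarrow> ('a::euclidean_space \<Rightarrow> real) set" where
  "L1_lnL r = {g \<in> L1_loc.
     (\<integral>\<^sup>+x. ennreal (\<bar>g x\<bar> * ln (2 + \<bar>g x\<bar>) powr r) \<partial>lebesgue) < \<infinity>}"

definition Lq :: "real \<Rightarrow> ('a::euclidean_space \<Rightarrow> real) set" where
  "Lq q = {g \<in> borel_measurable lebesgue. integrable lebesgue (\<lambda>x. \<bar>g x\<bar> powr q)}"

definition Lq_norm :: "real \<Rightarrow> ('a::euclidean_space \<Rightarrow> real) \<Rightarrow> real" where
  "Lq_norm q g = (LINT x|lebesgue. \<bar>g x\<bar> powr q) powr (1 / q)"

text \<open>Strong (Bochner) measurability of a curve with values in \<open>exp L\<^sup>p\<close>, defined on a set of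
  times. The library notions require the value space to be a type, whereas \<open>exp L\<^sup>p\<close>
  depends on the real parameter \<open>p\<close>.\<close>

definition expL_measurable ::
    "real \<Rightarrow> real set \<Rightarrow> (real \<Rightarrow> 'a::euclidean_space \<Rightarrow> real) \<Rightarrow> bool" where
  "expL_measurable p I g \<longleftrightarrow>
     (AE t in lebesgue_on I. g t \<in> expL p) \<and>
     (\<exists>S. (\<forall>n. simple_function (lebesgue_on I) (S n) \<and> (\<forall>t\<in>I. S n t \<in> expL p)) \<and>
          (AE t in lebesgue_on I. (\<lambda>n. expL_norm p (\<lambda>x. S n t x - g t x)) \<longlonglongrightarrow> 0))"

text \<open>The Bochner integral in \<open>exp L\<^sup>p\<close> over an interval \<open>(a, b)\<close> of finite length. For the
  finitely valued curves \<open>S n\<close> it is the pointwise integral in time.\<close>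

definition has_expL_integral ::
    "real \<Rightarrow> real \<Rightarrow> real \<Rightarrow> (real \<Rightarrow> 'a::euclidean_space \<Rightarrow> real) \<Rightarrow> ('a \<Rightarrow> real) \<Rightarrow> bool" where
  "has_expL_integral p a b g J \<longleftrightarrow>
     expL_measurable p {a<..<b} g \<and> J \<in> expL p \<and>
     (\<exists>S. (\<forall>n. simple_function (lebesgue_on {a<..<b}) (S n) \<and>
               (\<forall>\<tau>\<in>{a<..<b}. S n \<tau> \<in> expL p)) \<and>
          (\<lambda>n. \<integral>\<^sup>+\<tau>. expL_norm p (\<lambda>x. S n \<tau> x - g \<tau> x) \<partial>lebesgue_on {a<..<b}) \<longlonglongrightarrow> 0 \<and>
          (\<lambda>n. expL_norm p (\<lambda>x. (LINT \<tau>|lebesgue_on {a<..<b}. S n \<tau> x) - J x)) \<longlonglongrightarrow> 0)"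

definition Linf_expL :: "real \<Rightarrow> real set \<Rightarrow> (real \<Rightarrow> 'a::euclidean_space \<Rightarrow> real) set" where
  "Linf_expL p I = {u. (\<forall>t\<in>I. u t \<in> expL p) \<and> expL_measurable p I u \<and>
     (\<exists>B::real. AE t in lebesgue_on I. expL_norm p (u t) \<le> ennreal B)}"

definition weak_mild_solution ::
    "real \<Rightarrow> real \<Rightarrow> (real \<Rightarrow> real) \<Rightarrow> ('a::euclidean_space \<Rightarrow> real) \<Rightarrow> ereal \<Rightarrow>
     (real \<Rightarrow> 'a \<Rightarrow> real) \<Rightarrow> bool" where
  "weak_mild_solution s p f u0 T u \<longleftrightarrow>
     u0 \<in> expL p \<and> u \<in> Linf_expL p {t. 0 < t \<and> ereal t < T} \<and>
     (AE t in lebesgue_on {t. 0 < t \<and> ereal t < T}.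
        (AE \<tau> in lebesgue_on {0<..<t}. heat_semigroup_converges s (t - \<tau>) (\<lambda>y. f (u \<tau> y))) \<and>
        (\<exists>J. has_expL_integral p 0 t
               (\<lambda>\<tau>. heat_semigroup s (t - \<tau>) (\<lambda>y. f (u \<tau> y))) J \<and>
             (AE x in lebesgue. u t x = heat_semigroup s t u0 x + J x))) \<and>
     (\<forall>\<phi>\<in>L1_lnL (1 / p).
        ((\<lambda>t. LINT x|lebesgue. (u t x - u0 x) * \<phi> x) \<longlongrightarrow> 0) (at_right 0))"

abbreviation global_weak_mild_solution ::
    "real \<Rightarrow> real \<Rightarrow> (real \<Rightarrow> real) \<Rightarrow> ('a::euclidean_space \<Rightarrow> real) \<Rightarrow>
     (real \<Rightarrow> 'a \<Rightarrow> real) \<Rightarrow> bool" where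
  "global_weak_mild_solution s p f u0 u \<equiv> weak_mild_solution s p f u0 \<infinity> u"

text \<open>The bound \<open>2q < (d(m-1)/s) / (2-m)\<^sub>+\<close>, which is void when \<open>(2-m)\<^sub>+ = 0\<close>.\<close>

definition below_upper_exponent :: "real \<Rightarrow> real \<Rightarrow> real \<Rightarrow> real \<Rightarrow> bool" where
  "below_upper_exponent d s m q \<longleftrightarrow>
     (max (2 - m) 0 \<noteq> 0 \<longrightarrow> 2 * q < d * (m - 1) / s * (1 / max (2 - m) 0))"

definition decay_exponent :: "real \<Rightarrow> real \<Rightarrow> real \<Rightarrow> real \<Rightarrow> real \<Rightarrow> bool" where
  "decay_exponent d s m p q \<longleftrightarrow>
     (s < d * (p - 1) / (2 * p) \<and>
        d * (m - 1) / s < 2 * q \<and> below_upper_exponent d s m q) \<or>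
     (s = d * (p - 1) / (2 * p) \<and>
        d * (m - 1) / s < 2 * q \<and> below_upper_exponent d s m q) \<or>
     (s > d * (p - 1) / (2 * p) \<and> max (2 - m) 0 < d * (p - 1) / (2 * p * s) \<and>
        2 * (m - 1) * p / (p - 1) < 2 * q \<and> below_upper_exponent d s m q)"

end

theory Submission
  imports Defs "HOL-Probability.Probability"
begin

text \<open>
  The solution is sought as \<open>u(t) = S(t) u\<^sub>0 + D(t)\<close>. The kernel of \<open>S(t)\<close> is the inverse Fourier
  transform of \<open>exp (- t \<psi>)\<close>, \<open>\<psi>(\<xi>) = |\<xi>|\<^sup>2 + \<sigma>(\<xi>)\<close>. Truncating the Levy density makes \<open>exp (- t \<sigma>)\<close> a limit of
  powers of positive definite functions, so the kernel is nonnegative; a Gaussian regularisation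
  gives it mass one. Since \<open>\<psi>\<close> dominates both \<open>|\<xi>|\<^sup>2\<close> and a multiple of \<open>|\<xi>|\<close> to the power \<open>2s\<close>,
  the kernel is at most a constant times \<open>min (t powr (-d/2)) (t powr (-d/(2s)))\<close>.

  Put \<open>\<alpha> = 1/(m-1)\<close>, \<open>\<beta> = (p-1)/(m-1)\<close> and \<open>r = d(m-1)/(2s)\<close>. As \<open>r \<ge> p\<close>, a small datum in \<open>exp L\<^sup>p\<close> lies in
  \<open>L\<^sup>r\<close>, and therefore \<open>|S(t) u\<^sub>0| \<le> c t\<^sub>s powr (-\<alpha>)\<close>. The correction \<open>D\<close> is the Picard limit in the set of
  functions with \<open>|D(t)| \<le> A max(1,t) powr (-\<alpha>)\<close> and \<open>L\<^sup>1\<close> norm at most \<open>A max(1,t) powr \<beta>\<close>. For such \<open>D\<close> the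
  source \<open>f(u)\<close> has \<open>L\<^sup>1\<close> norm \<open>O(max(1,\<tau>) powr (\<beta>-1))\<close>, is \<open>O(\<tau> powr (-1-\<alpha>))\<close> pointwise for \<open>\<tau> \<ge> 1\<close>, and is bounded
  in \<open>L\<^sup>d\<close> for \<open>\<tau> \<le> 1\<close>, where the kernel maps \<open>L\<^sup>d\<close> to \<open>L\<^sup>\<infinity>\<close> with the integrable norm \<open>O(t powr (-1/2))\<close>;
  the condition \<open>\<alpha> + \<beta> = \<alpha> p \<le> d/(2s)\<close> closes the estimate.

  The kernel depends continuously on time in \<open>L\<^sup>1 \<inter> L\<^sup>\<infinity>\<close>, so the Duhamel integrand is a continuous curve in
  \<open>exp L\<^sup>p\<close> and the pointwise integral is a Bochner integral. Weak-star convergence at \<open>t = 0\<close> follows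
  from Young's inequality for the pair \<open>exp L\<^sup>p\<close>, \<open>L (ln L)\<close> by truncating the test function. The decay in
  \<open>L\<^sup>q\<close>, \<open>q > r\<close>, interpolates between \<open>L\<^sup>r\<close> and the pointwise bound.
\<close>

text \<open>The linear part and the correction are measured differently. As t tends to 0 the flow
  S(t) u0 of an unbounded datum is in general neither uniformly bounded nor convergent to u0 in exp
  L^p, so near t = 0 it is held only by a modular bound. The correction D is held in L^1 and
  L^\<infinity> at once: this pair of bounds controls exp L^p, passes to pointwise limits and
  survives convolution, and the Duhamel estimates become estimates of nonnegative functions by
  Tonelli. The exponents are forced. \<alpha> solves \<alpha> m = 1 + \<alpha>: f gains the one
  power of time that integration in time costs. \<beta> = \<alpha> (p - 1) makes the sup bound to
  the power p - 1, times the L^1 bound, constant in time, which keeps D bounded in exp L^p for all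
  times. The exponent d = DIM('a) for early sources is the one for which the kernel bound t^(-d/2)
  interpolates to t^(-1/2), an integrable singularity in every dimension; its price is a factor d in
  the smallness condition. Estimates are carried out for Borel functions and hold at every point;
  Lebesgue classes return only at the end.\<close>

abbreviation mass :: "('a::euclidean_space \<Rightarrow> real) \<Rightarrow> ennreal" where
  "mass g \<equiv> \<integral>\<^sup>+x. ennreal \<bar>g x\<bar> \<partial>lborel"

abbreviation time_integral :: "real \<Rightarrow> real \<Rightarrow> (real \<Rightarrow> real) \<Rightarrow> ennreal" where
  "time_integral a b g \<equiv> \<integral>\<^sup>+\<tau>. ennreal (if a < \<tau> \<and> \<tau> < b then g \<tau> else 0) \<partial>lborel"

section \<open>Lebesgue integrals on Euclidean space\<close>

lemma nn_integral_lborel_affine: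
  fixes f :: "'a::euclidean_space \<Rightarrow> ennreal"
  assumes [measurable]: "f \<in> borel_measurable borel" and c: "c \<noteq> 0"
  shows "(\<integral>\<^sup>+x. f x \<partial>lborel) = ennreal (\<bar>c\<bar> ^ DIM('a)) * (\<integral>\<^sup>+x. f (t + c *\<^sub>R x) \<partial>lborel)"
  by (subst lborel_affine[OF c, of t])
     (simp add: nn_integral_density nn_integral_distr nn_integral_cmult)

lemma integrable_lborel_affine:
  fixes f :: "'a::euclidean_space \<Rightarrow> 'b :: {banach, second_countable_topology}"
  assumes f: "integrable lborel f" and c: "c \<noteq> 0"
  shows "integrable lborel (\<lambda>x. f (t + c *\<^sub>R x))"
proof -
  have [measurable]: "f \<in> borel_measurable borel" using f by auto
  have "(\<integral>\<^sup>+x. ennreal (norm (f x)) \<partial>lborel) < \<infinity>"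
    using f by (simp add: integrable_iff_bounded)
  then show ?thesis
    using c by (subst (asm) nn_integral_lborel_affine[where c=c and t=t])
      (auto simp: integrable_iff_bounded ennreal_mult_less_top)
qed

lemma integrable_lborel_affine_iff:
  fixes f :: "'a::euclidean_space \<Rightarrow> 'b :: {banach, second_countable_topology}"
  assumes c: "c \<noteq> 0"
  shows "integrable lborel (\<lambda>x. f (t + c *\<^sub>R x)) \<longleftrightarrow> integrable lborel f"
  using integrable_lborel_affine[of f c t]
    integrable_lborel_affine[of "\<lambda>x. f (t + c *\<^sub>R x)" "1/c" "- (1/c) *\<^sub>R t"] c
  by (auto simp: algebra_simps)

lemma integral_lborel_affine:
  fixes f :: "'a::euclidean_space \<Rightarrow> 'b :: {banach, second_countable_topology}"
  assumes c: "c \<noteq> 0"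
  shows "(\<integral>x. f x \<partial>lborel) = (\<bar>c\<bar> ^ DIM('a)) *\<^sub>R (\<integral>x. f (t + c *\<^sub>R x) \<partial>lborel)"
proof cases
  assume f[measurable]: "integrable lborel f"
  then have [measurable]: "f \<in> borel_measurable borel" by auto
  show ?thesis
    using f c integrable_lborel_affine[OF f c]
    by (subst lborel_affine[OF c, of t]) (simp add: integral_density integral_distr)
next
  assume "\<not> integrable lborel f" with c show ?thesis
    by (simp add: integrable_lborel_affine_iff not_integrable_integral_eq)
qed

lemma integral_lborel_reflect:
  fixes f :: "'a::euclidean_space \<Rightarrow> 'b :: {banach, second_countable_topology}"
  shows "(\<integral>y. f (x - y) \<partial>lborel) = (\<integral>y. f y \<partial>lborel)"
  using integral_lborel_affine[of "-1" f x] by simp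

lemma integrable_lborel_reflect:
  fixes f :: "'a::euclidean_space \<Rightarrow> 'b :: {banach, second_countable_topology}"
  shows "integrable lborel (\<lambda>y. f (x - y)) \<longleftrightarrow> integrable lborel f"
  using integrable_lborel_affine_iff[of "-1" f x] by simp

lemma nn_integral_lborel_reflect:
  fixes f :: "'a::euclidean_space \<Rightarrow> ennreal"
  assumes "f \<in> borel_measurable borel"
  shows "(\<integral>\<^sup>+y. f (x - y) \<partial>lborel) = (\<integral>\<^sup>+y. f y \<partial>lborel)"
  using nn_integral_lborel_affine[OF assms, of "-1" x] by simp

lemma nn_integral_lborel_shift:
  fixes f :: "'a::euclidean_space \<Rightarrow> ennreal"
  assumes "f \<in> borel_measurable borel"
  shows "(\<integral>\<^sup>+x. f (x - y) \<partial>lborel) = (\<integral>\<^sup>+x. f x \<partial>lborel)"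
  using nn_integral_lborel_affine[OF assms, of "1" "-y"] by simp

section \<open>Powers of the norm at infinity and at the origin\<close>

lemma nn_integral_powr_tail:
  fixes a :: real
  assumes a: "real DIM('a) < a"
  shows "(\<integral>\<^sup>+(y::'a::euclidean_space). indicator {y. 1 \<le> norm y} y * ennreal (norm y powr - a) \<partial>lborel) < \<infinity>"
proof -
  let ?d = "real DIM('a)"
  define V where "V = unit_ball_vol ?d"
  have V: "0 \<le> V" unfolding V_def by (simp add: unit_ball_vol_nonneg)
  define q where "q = 2 powr (?d - a)"
  have q: "0 < q" "q < 1" using a unfolding q_def by (auto simp: powr_less_one)
  \<comment> \<open>Each shell 2^k \<le> |y| \<le> 2^(k+1) is enlarged to a ball, whose volume is
    explicit. The sum is then geometric with ratio q = 2^(d-a), and q < 1 is the condition a >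
    d.\<close>
  have ptw: "indicator {y. 1 \<le> norm y} y * ennreal (norm y powr - a)
     \<le> (\<Sum>k. ennreal (2 powr (- real k * a)) * indicator (cball 0 (2 ^ (Suc k))) y)" for y :: 'a
  proof (cases "1 \<le> norm y")
    case True
    define k where "k = nat \<lfloor>log 2 (norm y)\<rfloor>"
    have pos: "0 < norm y" using True by linarith
    have lg: "0 \<le> log 2 (norm y)" using True pos by (simp only: zero_le_log_cancel_iff one_less_numeral_iff semiring_norm)
    have k1: "real k \<le> log 2 (norm y)" unfolding k_def using lg by linarith
    have k2: "log 2 (norm y) \<le> real (Suc k)" unfolding k_def using lg by linarith
    have e1: "2 powr real k \<le> norm y" using k1 pos by (simp add: le_log_iff)
    have "norm y \<le> 2 powr real (Suc k)" using k2 pos by (simp add: log_le_iff)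
    then have e2: "norm y \<le> 2 ^ Suc k" by (simp only: powr_realpow zero_less_numeral)
    have "norm y powr - a \<le> (2 powr real k) powr (- a)"
      using e1 a by (intro powr_mono2') auto
    also have "\<dots> = 2 powr (- real k * a)" by (simp add: powr_powr)
    finally have "indicator {y. 1 \<le> norm y} y * ennreal (norm y powr - a) \<le>
       ennreal (2 powr (- real k * a)) * indicator (cball 0 (2 ^ (Suc k))) y"
      using e2 True by (auto simp: ennreal_leI)
    also have "\<dots> \<le> (\<Sum>k. ennreal (2 powr (- real k * a)) * indicator (cball 0 (2 ^ (Suc k))) y)"
      by (rule sum_le_suminf[of _ "{k}", simplified]) auto
    finally show ?thesis .
  qed auto
  have "(\<integral>\<^sup>+(y::'a). indicator {y. 1 \<le> norm y} y * ennreal (norm y powr - a) \<partial>lborel)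
    \<le> (\<integral>\<^sup>+(y::'a). (\<Sum>k. ennreal (2 powr (- real k * a)) * indicator (cball 0 (2 ^ (Suc k))) y) \<partial>lborel)"
    by (intro nn_integral_mono ptw)
  also have "\<dots> = (\<Sum>k. (\<integral>\<^sup>+(y::'a). ennreal (2 powr (- real k * a)) * indicator (cball 0 (2 ^ (Suc k))) y \<partial>lborel))"
    by (rule nn_integral_suminf) (intro borel_measurable_times_ennreal borel_measurable_const borel_measurable_indicator; simp)
  also have "\<dots> = (\<Sum>k. ennreal (V * 2 ^ DIM('a) * q ^ k))"
  proof (intro suminf_cong)
    fix k
    have "(\<integral>\<^sup>+(y::'a). ennreal (2 powr (- real k * a)) * indicator (cball 0 (2 ^ (Suc k))) y \<partial>lborel)
      = ennreal (2 powr (- real k * a)) * ennreal (V * (2 ^ (Suc k)) ^ DIM('a))"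
      by (subst nn_integral_cmult_indicator) (auto simp: emeasure_cball V_def)
    also have "\<dots> = ennreal (V * 2 ^ DIM('a) * q ^ k)"
    proof -
      have "q ^ k = 2 powr (real k * (?d - a))"
        unfolding powr_realpow[OF q(1), symmetric] unfolding q_def powr_powr by (simp only: mult.commute)
      moreover have "(2::real) ^ (k * DIM('a)) = 2 powr (real k * ?d)"
        by (subst powr_realpow[symmetric]) simp_all
      ultimately have "2 powr (- real k * a) * 2 ^ (k * DIM('a)) = q ^ k"
        by (simp only: powr_add[symmetric]) (simp add: right_diff_distrib)
      moreover have "((2::real) ^ (Suc k)) ^ DIM('a) = 2 ^ DIM('a) * 2 ^ (k * DIM('a))"
        by (simp only: power_Suc power_mult_distrib power_mult)
      ultimately have eq: "2 powr (- real k * a) * (V * (2 ^ (Suc k)) ^ DIM('a)) = V * 2 ^ DIM('a) * q ^ k"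
        by (simp only: mult_ac)
      show ?thesis using V by (subst ennreal_mult[symmetric]) (simp_all only: eq powr_ge_zero zero_le_power mult_nonneg_nonneg zero_le_numeral zero_le_divide_1_iff)
    qed
    finally show "(\<integral>\<^sup>+(y::'a). ennreal (2 powr (- real k * a)) * indicator (cball 0 (2 ^ (Suc k))) y \<partial>lborel)
      = ennreal (V * 2 ^ DIM('a) * q ^ k)" .
  qed
  also have "\<dots> < \<infinity>"
  proof -
    have "summable (\<lambda>k. V * 2 ^ DIM('a) * q ^ k)"
      using q by (intro summable_mult summable_geometric) auto
    then show ?thesis using V q by (subst suminf_ennreal2) auto
  qed
  finally show ?thesis .
qed

text \<open>The same argument with balls of radius 2^(-k) and ratio 2^(a-d). The origin itself
  contributes nothing, since 0 \<open>powr\<close> anything is 0.\<close>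

lemma nn_integral_powr_origin:
  fixes a :: real
  assumes a: "a < real DIM('a)" "0 \<le> a"
  shows "(\<integral>\<^sup>+(y::'a::euclidean_space). indicator {y. norm y \<le> 1} y * ennreal (norm y powr - a) \<partial>lborel) < \<infinity>"
proof -
  let ?d = "real DIM('a)"
  define V where "V = unit_ball_vol ?d"
  have V: "0 \<le> V" unfolding V_def by (simp add: unit_ball_vol_nonneg)
  define q where "q = 2 powr (a - ?d)"
  have q: "0 < q" "q < 1" using a unfolding q_def by (auto simp: powr_less_one)
  have ptw: "indicator {y. norm y \<le> 1} y * ennreal (norm y powr - a)
     \<le> (\<Sum>k. ennreal (2 powr (real (Suc k) * a)) * indicator (cball 0 ((1/2) ^ k)) y)" for y :: 'a
  proof (cases "norm y \<le> 1 \<and> y \<noteq> 0")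
    case True
    define k where "k = nat \<lfloor>- log 2 (norm y)\<rfloor>"
    have pos: "0 < norm y" using True by simp
    have lg: "0 \<le> - log 2 (norm y)" using True by simp
    have k1: "real k \<le> - log 2 (norm y)" unfolding k_def using lg by linarith
    have k2: "- real (Suc k) \<le> log 2 (norm y)" unfolding k_def using lg by linarith
    have "log 2 (norm y) \<le> - real k" using k1 by simp
    then have "norm y \<le> 2 powr (- real k)" using pos by (simp add: log_le_iff)
    then have e1: "norm y \<le> (1/2)^k" by (simp add: powr_minus powr_realpow power_one_over inverse_eq_divide)
    have e2: "2 powr (- real (Suc k)) \<le> norm y" using k2 pos by (subst le_log_iff[symmetric]) auto
    have "norm y powr - a \<le> (2 powr (- real (Suc k))) powr (- a)"
      using e2 a by (intro powr_mono2') auto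
    also have "\<dots> = 2 powr (real (Suc k) * a)" by (simp only: powr_powr minus_mult_minus)
    finally have "indicator {y. norm y \<le> 1} y * ennreal (norm y powr - a) \<le>
       ennreal (2 powr (real (Suc k) * a)) * indicator (cball 0 ((1/2) ^ k)) y"
      using e1 True by (auto simp: ennreal_leI)
    also have "\<dots> \<le> (\<Sum>k. ennreal (2 powr (real (Suc k) * a)) * indicator (cball 0 ((1/2) ^ k)) y)"
      by (rule sum_le_suminf[of _ "{k}", simplified]) auto
    finally show ?thesis .
  qed auto
  have "(\<integral>\<^sup>+(y::'a). indicator {y. norm y \<le> 1} y * ennreal (norm y powr - a) \<partial>lborel)
    \<le> (\<integral>\<^sup>+(y::'a). (\<Sum>k. ennreal (2 powr (real (Suc k) * a)) * indicator (cball 0 ((1/2) ^ k)) y) \<partial>lborel)"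
    by (intro nn_integral_mono ptw)
  also have "\<dots> = (\<Sum>k. (\<integral>\<^sup>+(y::'a). ennreal (2 powr (real (Suc k) * a)) * indicator (cball 0 ((1/2) ^ k)) y \<partial>lborel))"
    by (rule nn_integral_suminf) (intro borel_measurable_times_ennreal borel_measurable_const borel_measurable_indicator; simp)
  also have "\<dots> = (\<Sum>k. ennreal (V * 2 powr a * q ^ k))"
  proof (intro suminf_cong)
    fix k
    have "(\<integral>\<^sup>+(y::'a). ennreal (2 powr (real (Suc k) * a)) * indicator (cball 0 ((1/2) ^ k)) y \<partial>lborel)
      = ennreal (2 powr (real (Suc k) * a)) * ennreal (V * ((1/2) ^ k) ^ DIM('a))"
      by (subst nn_integral_cmult_indicator) (auto simp: emeasure_cball V_def)
    also have "\<dots> = ennreal (V * 2 powr a * q ^ k)"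
    proof -
      have "q ^ k = 2 powr (real k * (a - ?d))"
        unfolding powr_realpow[OF q(1), symmetric] unfolding q_def powr_powr by (simp only: mult.commute)
      moreover have "((1/2)::real) ^ (k * DIM('a)) = 2 powr (- real k * ?d)"
        using powr_realpow[of "2::real" "k * DIM('a)"] by (simp add: power_one_over powr_minus inverse_eq_divide)
      ultimately have "2 powr (real k * a) * (1/2) ^ (k * DIM('a)) = q ^ k"
        by (simp only: powr_add[symmetric]) (simp add: right_diff_distrib)
      moreover have "2 powr (real (Suc k) * a) = 2 powr a * 2 powr (real k * a)"
        by (simp add: powr_add[symmetric] distrib_right)
      ultimately have eq: "2 powr (real (Suc k) * a) * (V * ((1/2) ^ k) ^ DIM('a)) = V * 2 powr a * q ^ k"
        by (simp only: power_mult[symmetric] mult_ac)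
      show ?thesis using V by (subst ennreal_mult[symmetric]) (simp_all only: eq powr_ge_zero zero_le_power mult_nonneg_nonneg zero_le_numeral zero_le_divide_1_iff)
    qed
    finally show "(\<integral>\<^sup>+(y::'a). ennreal (2 powr (real (Suc k) * a)) * indicator (cball 0 ((1/2) ^ k)) y \<partial>lborel)
      = ennreal (V * 2 powr a * q ^ k)" .
  qed
  also have "\<dots> < \<infinity>"
  proof -
    have "summable (\<lambda>k. V * 2 powr a * q ^ k)"
      using q by (intro summable_mult summable_geometric) auto
    then show ?thesis using V q by (subst suminf_ennreal2) auto
  qed
  finally show ?thesis .
qed

section \<open>The Fourier symbol of the fractional Laplacian\<close>

definition levy_density :: "real \<Rightarrow> 'a::euclidean_space \<Rightarrow> real" where
  "levy_density s y = norm y powr - (real DIM('a) + 2 * s)"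

text \<open>The Levy-Khintchine form of the symbol. The sine part of the plane wave is odd and
  cancels in the principal value, and 1 - cos is quadratic at the origin, so this integral converges
  absolutely.\<close>

definition symb :: "real \<Rightarrow> 'a::euclidean_space \<Rightarrow> real" where
  "symb s \<xi> = frac_const (real DIM('a)) s * (LBINT y. (1 - cos (\<xi> \<bullet> y)) * levy_density s y)"

lemma levy_density_measurable [measurable]: "levy_density s \<in> borel_measurable borel"
  unfolding levy_density_def[abs_def] by measurable

lemma levy_density_nonneg [simp]: "0 \<le> levy_density s y"
  unfolding levy_density_def by simp

lemma levy_density_minus [simp]: "levy_density s (- y) = levy_density s y"
  unfolding levy_density_def by simp

lemma frac_const_pos:
  assumes "0 < s" "s < 1" "0 < d"
  shows "0 < frac_const d s"
  using assms unfolding frac_const_def by (intro divide_pos_pos mult_pos_pos Gamma_real_pos) auto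

lemma integrable_levy_density:
  assumes s: "0 < s" "s < 1"
  shows "integrable lborel (\<lambda>y::'a::euclidean_space. min 1 ((norm y)\<^sup>2) * levy_density s y)"
proof (rule integrableI_bounded)
  let ?d = "real DIM('a)"
  \<comment> \<open>In dimension one d + 2s - 2 may be negative; the maximum with 0 makes the
    exponent fit \<open>nn_integral_powr_origin\<close>, and it stays below d because s < 1.\<close>
  define a where "a = max 0 (?d + 2 * s - 2)"
  have d1: "1 \<le> ?d" by (simp add: Suc_leI)
  have le: "ennreal (norm (min 1 ((norm y)\<^sup>2) * levy_density s y)) \<le>
     indicator {y. norm y \<le> 1} y * ennreal (norm y powr - a) +
     indicator {y. 1 \<le> norm y} y * ennreal (norm y powr - (?d + 2 * s))" for y :: 'a
  proof (cases "norm y \<le> 1")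
    case True
    show ?thesis
    proof (cases "y = 0")
      case False
      have "min 1 ((norm y)\<^sup>2) * levy_density s y \<le> norm y powr 2 * norm y powr - (?d + 2 * s)"
        using False unfolding levy_density_def by (intro mult_right_mono) auto
      also have "\<dots> = norm y powr (2 - ?d - 2 * s)"
        by (simp only: powr_add[symmetric]) (simp add: algebra_simps)
      also have "\<dots> \<le> norm y powr - a"
        using True False unfolding a_def by (intro powr_mono') auto
      finally have *: "min 1 ((norm y)\<^sup>2) * levy_density s y \<le> norm y powr - a" .
      have "ennreal (norm (min 1 ((norm y)\<^sup>2) * levy_density s y)) \<le> ennreal (norm y powr - a)"
        using * by (intro ennreal_leI) (simp add: abs_mult)
      also have "\<dots> \<le> indicator {y. norm y \<le> 1} y * ennreal (norm y powr - a) +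
         indicator {y. 1 \<le> norm y} y * ennreal (norm y powr - (?d + 2 * s))"
        using True by simp
      finally show ?thesis .
    qed (simp add: levy_density_def)
  next
    case False
    then have "1 \<le> (norm y)\<^sup>2" by (simp add: power2_eq_square less_1_mult less_imp_le)
    then show ?thesis using False by (simp add: levy_density_def)
  qed
  have "(\<integral>\<^sup>+(y::'a). ennreal (norm (min 1 ((norm y)\<^sup>2) * levy_density s y)) \<partial>lborel) \<le>
     (\<integral>\<^sup>+(y::'a). indicator {y. norm y \<le> 1} y * ennreal (norm y powr - a) \<partial>lborel) +
     (\<integral>\<^sup>+(y::'a). indicator {y. 1 \<le> norm y} y * ennreal (norm y powr - (?d + 2 * s)) \<partial>lborel)"
    by (subst nn_integral_add[symmetric]; (intro nn_integral_mono le)?; measurable)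
  also have "\<dots> < \<infinity>"
    using nn_integral_powr_origin[of a, where 'a='a] nn_integral_powr_tail[of "?d + 2 * s", where 'a='a] s d1
    unfolding a_def by (simp add: ennreal_add_less_top)
  finally show "(\<integral>\<^sup>+(y::'a). ennreal (norm (min 1 ((norm y)\<^sup>2) * levy_density s y)) \<partial>lborel) < \<infinity>" .
qed measurable

lemma one_minus_cos_le: "1 - cos (z::real) \<le> min 2 (z\<^sup>2)"
proof -
  have "1 - cos z = 2 * (sin (z/2))\<^sup>2" using cos_double_sin[of "z/2"] by simp
  also have "\<dots> \<le> 2 * (z/2)\<^sup>2"
    using abs_sin_x_le_abs_x[of "z/2"] by (intro mult_left_mono) (simp_all only: abs_le_square_iff)
  also have "\<dots> \<le> z\<^sup>2" by (simp add: power_divide)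
  finally show ?thesis using cos_ge_minus_one[of z] by simp
qed

lemma one_minus_cos_inner_le:
  fixes \<xi> y :: "'a::euclidean_space"
  assumes "norm \<xi> \<le> R"
  shows "1 - cos (\<xi> \<bullet> y) \<le> (2 + R\<^sup>2) * min 1 ((norm y)\<^sup>2)"
proof -
  have "(\<xi> \<bullet> y)\<^sup>2 \<le> (norm \<xi> * norm y)\<^sup>2"
    using Cauchy_Schwarz_ineq2[of \<xi> y] by (simp add: abs_le_square_iff[symmetric] abs_mult)
  also have "\<dots> \<le> R\<^sup>2 * (norm y)\<^sup>2"
    using assms by (simp add: power_mult_distrib mult_right_mono power_mono)
  finally have 1: "1 - cos (\<xi> \<bullet> y) \<le> R\<^sup>2 * (norm y)\<^sup>2" using one_minus_cos_le[of "\<xi> \<bullet> y"] by simp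
  have 2: "1 - cos (\<xi> \<bullet> y) \<le> 2" using one_minus_cos_le[of "\<xi> \<bullet> y"] by simp
  show ?thesis
  proof (cases "(norm y)\<^sup>2 \<le> 1")
    case True
    have "R\<^sup>2 * (norm y)\<^sup>2 \<le> (2 + R\<^sup>2) * (norm y)\<^sup>2" by (simp add: mult_right_mono)
    then show ?thesis using 1 True by (simp add: min_def)
  next
    case False
    have "1 - cos (\<xi> \<bullet> y) \<le> 2 + R\<^sup>2" using 2 zero_le_power2[of R] by linarith
    then show ?thesis using False by (simp add: min_def)
  qed
qed

text \<open>One majorant for all frequencies in a ball, as dominated convergence along a convergent
  sequence of frequencies requires.\<close>

lemma levy_integrand_bound:
  fixes \<xi> y :: "'a::euclidean_space"
  assumes "norm \<xi> \<le> R"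
  shows "norm ((1 - cos (\<xi> \<bullet> y)) * levy_density s y)
     \<le> (2 + R\<^sup>2) * (min 1 ((norm y)\<^sup>2) * levy_density s y)"
proof -
  have "(1 - cos (\<xi> \<bullet> y)) * levy_density s y \<le> ((2 + R\<^sup>2) * min 1 ((norm y)\<^sup>2)) * levy_density s y"
    by (intro mult_right_mono one_minus_cos_inner_le assms) simp
  moreover have "norm ((1 - cos (\<xi> \<bullet> y)) * levy_density s y) = (1 - cos (\<xi> \<bullet> y)) * levy_density s y"
    by (simp add: abs_mult)
  ultimately show ?thesis by (simp add: mult.assoc)
qed

lemma integrable_levy_integrand:
  fixes \<xi> :: "'a::euclidean_space"
  assumes s: "0 < s" "s < 1"
  shows "integrable lborel (\<lambda>y. (1 - cos (\<xi> \<bullet> y)) * levy_density s y)"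
proof (rule Bochner_Integration.integrable_bound)
  show "integrable lborel (\<lambda>y::'a. (2 + (norm \<xi>)\<^sup>2) * (min 1 ((norm y)\<^sup>2) * levy_density s y))"
    by (intro integrable_mult_right integrable_levy_density s)
  show "AE y in lborel. norm ((1 - cos (\<xi> \<bullet> y)) * levy_density s y)
     \<le> norm ((2 + (norm \<xi>)\<^sup>2) * (min 1 ((norm y)\<^sup>2) * levy_density s y))"
    by (intro AE_I2 order_trans[OF levy_integrand_bound[OF order_refl]]) (simp add: abs_mult)
qed measurable

lemma symb_zero [simp]: "symb s 0 = 0"
  unfolding symb_def by simp

lemma symb_nonneg:
  fixes \<xi> :: "'a::euclidean_space"
  assumes s: "0 < s" "s < 1"
  shows "0 \<le> symb s \<xi>"
  unfolding symb_def
  using frac_const_pos[OF s, of "real DIM('a)"] by (auto intro!: mult_nonneg_nonneg integral_nonneg_AE)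

text \<open>The integrand is kept only on one ball where the phase is bounded away from the zeros of
  1 - cos. Its radius is of order 1/|\<xi>|, so the volume contributes |\<xi>|^(-d) and the density
  |\<xi>|^(d+2s).\<close>

lemma symb_lower_bound:
  assumes s: "0 < s" "s < 1"
  obtains c where "0 < c" "\<And>\<xi>::'a::euclidean_space. c * norm \<xi> powr (2 * s) \<le> symb s \<xi>"
proof -
  let ?d = "real DIM('a)"
  define V where "V = unit_ball_vol ?d"
  have V: "0 < V" unfolding V_def by simp
  define k where "k = 1 - cos (1/2 :: real)"
  have k: "0 < k" unfolding k_def using cos_monotone_0_pi[of 0 "1/2"] pi_gt3 by simp
  define c where "c = frac_const ?d s * (k * V * (1/4) ^ DIM('a))"
  have c: "0 < c" unfolding c_def using frac_const_pos[OF s, of ?d] k V by simp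
  have "c * norm \<xi> powr (2 * s) \<le> symb s \<xi>" for \<xi> :: 'a
  proof (cases "\<xi> = 0")
    case False
    define n where "n = norm \<xi>"
    have n: "0 < n" using False unfolding n_def by simp
    \<comment> \<open>The centre lies in the direction of \<xi> at phase 3/4, and the radius
      1/(4|\<xi>|) changes the phase by at most 1/4. So the phase stays in [1/2, 1] and |y| \<le>
      1/|\<xi>| on the ball.\<close>
    define z where "z = (3 / (4 * n\<^sup>2)) *\<^sub>R \<xi>"
    define r where "r = 1 / (4 * n)"
    have r: "0 < r" using n unfolding r_def by simp
    have nz: "norm z = 3 / (4 * n)"
      using n unfolding z_def n_def[symmetric] by (simp add: power2_eq_square n_def[symmetric])
    have inz: "\<xi> \<bullet> z = 3 / 4"
      using n unfolding z_def by (simp add: n_def power2_norm_eq_inner)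
    have bound: "indicator (cball z r) y * (k * n powr (?d + 2 * s)) \<le> (1 - cos (\<xi> \<bullet> y)) * levy_density s y" for y :: 'a
    proof (cases "y \<in> cball z r")
      case True
      then have d: "norm (y - z) \<le> r" by (simp add: dist_norm norm_minus_commute)
      have n1: "norm y \<le> 1 / n"
        using norm_triangle_sub[of y z] d nz n unfolding r_def by (simp add: field_simps)
      have "\<bar>\<xi> \<bullet> (y - z)\<bar> \<le> n * r"
        unfolding n_def using d by (intro order_trans[OF Cauchy_Schwarz_ineq2] mult_left_mono) auto
      then have "\<bar>\<xi> \<bullet> y - 3/4\<bar> \<le> 1/4" using n inz unfolding r_def by (simp add: inner_diff_right)
      then have y: "1/2 \<le> \<xi> \<bullet> y" "\<xi> \<bullet> y \<le> 1" by linarith+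
      have "cos (\<xi> \<bullet> y) \<le> cos (1/2)" using y pi_gt3 by (intro cos_monotone_0_pi_le) auto
      then have 1: "k \<le> 1 - cos (\<xi> \<bullet> y)" unfolding k_def by simp
      have "y \<noteq> 0" using y by auto
      then have "(1/n) powr - (?d + 2 * s) \<le> norm y powr - (?d + 2 * s)"
        using n1 s by (intro powr_mono2') auto
      moreover have "(1/n) powr - (?d + 2 * s) = n powr (?d + 2 * s)"
        unfolding powr_minus using n by (simp add: powr_divide)
      ultimately have 2: "n powr (?d + 2 * s) \<le> levy_density s y" by (simp add: levy_density_def)
      show ?thesis using True 1 2 k by (auto intro!: mult_mono)
    qed simp
    have "(LBINT y. indicator (cball z r) y * (k * n powr (?d + 2 * s))) \<le> (LBINT y. (1 - cos (\<xi> \<bullet> y)) * levy_density s y)"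
      by (intro integral_mono integrable_levy_integrand s bound integrable_mult_left integrable_real_indicator)
        (simp_all add: emeasure_lborel_cball_finite[unfolded infinity_ennreal_def])
    moreover have "(LBINT y. indicator (cball z r) y * (k * n powr (?d + 2 * s))) = V * r ^ DIM('a) * (k * n powr (?d + 2 * s))"
      using r by (simp add: measure_def emeasure_cball V_def)
    moreover have "V * r ^ DIM('a) * (k * n powr (?d + 2 * s)) = k * V * (1/4) ^ DIM('a) * n powr (2 * s)"
      using n by (simp add: r_def power_divide power_mult_distrib powr_add powr_realpow)
    ultimately have "k * V * (1/4) ^ DIM('a) * n powr (2 * s) \<le> (LBINT y. (1 - cos (\<xi> \<bullet> y)) * levy_density s y)" by (simp only:)
    from mult_left_mono[OF this, of "frac_const ?d s"] show ?thesis
      using frac_const_pos[OF s, of ?d] unfolding symb_def c_def n_def by (simp add: mult.assoc)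
  qed simp
  with c show thesis by (rule that)
qed

lemma continuous_symb:
  assumes s: "0 < s" "s < 1"
  shows "continuous_on UNIV (symb s :: 'a::euclidean_space \<Rightarrow> real)"
proof (rule continuous_on_sequentiallyI)
  fix X and l :: 'a assume X: "X \<longlonglongrightarrow> l"
  then obtain R where R: "\<And>n. norm (X n) \<le> R"
    using convergent_imp_Bseq[of X] unfolding convergent_def Bseq_def by auto
  have "(\<lambda>n. LBINT y. (1 - cos (X n \<bullet> y)) * levy_density s y) \<longlonglongrightarrow> (LBINT y. (1 - cos (l \<bullet> y)) * levy_density s y)"
  proof (rule integral_dominated_convergence)
    show "integrable lborel (\<lambda>y::'a. (2 + R\<^sup>2) * (min 1 ((norm y)\<^sup>2) * levy_density s y))"
      by (intro integrable_mult_right integrable_levy_density s)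
    show "AE x in lborel. norm ((1 - cos (X i \<bullet> x)) * levy_density s x) \<le> (2 + R\<^sup>2) * (min 1 ((norm x)\<^sup>2) * levy_density s x)" for i
      by (intro AE_I2 levy_integrand_bound R)
    show "AE x in lborel. (\<lambda>i. (1 - cos (X i \<bullet> x)) * levy_density s x) \<longlonglongrightarrow> (1 - cos (l \<bullet> x)) * levy_density s x"
      by (intro AE_I2 tendsto_intros X)
  qed measurable
  then show "(\<lambda>n. symb s (X n)) \<longlonglongrightarrow> symb s l"
    unfolding symb_def by (intro tendsto_mult_left)
qed

lemma symb_measurable: "0 < s \<Longrightarrow> s < 1 \<Longrightarrow> symb s \<in> borel_measurable borel"
  by (intro borel_measurable_continuous_onI continuous_symb)

text \<open>Outside a ball the integrand \<open>G e\<close> is absolutely integrable and takes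
  conjugate values at y and -y, so its integral is real and equals that of the cosine part
  \<open>F e\<close>. The cosine parts are dominated by the convergent integrand of
  \<open>symb\<close>, which gives the principal value.\<close>

lemma frac_symbol_eq:
  fixes \<xi> :: "'a::euclidean_space"
  assumes s: "0 < s" "s < 1"
  shows "frac_symbol s \<xi> = of_real (symb s \<xi>)"
proof -
  let ?d = "real DIM('a)"
  define G where "G e y = indicator {y. e < norm y} y *\<^sub>R (levy_density s y *\<^sub>R (1 - cis (\<xi> \<bullet> y)))" for e and y :: 'a
  have G_meas [measurable]: "G e \<in> borel_measurable borel" for e
    unfolding G_def[abs_def] cis_conv_exp by measurable
  have G_eq: "(LINT y:{y. e < dist 0 y}|lebesgue. (1 / norm (0 - y) powr (?d + 2 * s)) *\<^sub>R (cis (\<xi> \<bullet> 0) - cis (\<xi> \<bullet> y)))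
      = (LBINT y. G e y)" for e
  proof -
    have "(\<lambda>y. indicator {y. e < dist 0 y} y *\<^sub>R ((1 / norm (0 - y) powr (?d + 2 * s)) *\<^sub>R (cis (\<xi> \<bullet> 0) - cis (\<xi> \<bullet> y)))) = G e"
      unfolding G_def levy_density_def powr_minus inverse_eq_divide by (auto simp: fun_eq_iff)
    then show ?thesis unfolding set_lebesgue_integral_def by (simp add: integral_completion)
  qed
  define F where "F e y = indicator {y. e < norm y} y * ((1 - cos (\<xi> \<bullet> y)) * levy_density s y)" for e and y :: 'a
  have F_meas [measurable]: "F e \<in> borel_measurable borel" for e
    unfolding F_def[abs_def] by measurable
  have Fb: "norm (F e y) \<le> (1 - cos (\<xi> \<bullet> y)) * levy_density s y" for e y
    unfolding F_def by (auto simp: indicator_def abs_mult)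
  have GF: "(LBINT y. G e y) = of_real (LBINT y. F e y)" if e: "0 < e" for e
  proof -
    have "integrable lborel (G e)"
    proof (rule Bochner_Integration.integrable_bound)
      show "integrable lborel (\<lambda>y::'a. (2 / min 1 (e\<^sup>2)) * (min 1 ((norm y)\<^sup>2) * levy_density s y))"
        by (intro integrable_mult_right integrable_levy_density s)
      have "norm (G e y) \<le> norm ((2 / min 1 (e\<^sup>2)) * (min 1 ((norm y)\<^sup>2) * levy_density s y))" for y
      proof (cases "e < norm y")
        case True
        have m: "0 < min 1 (e\<^sup>2)" "min 1 (e\<^sup>2) \<le> min 1 ((norm y)\<^sup>2)"
          using e True by (auto simp: min_le_iff_disj intro!: power_mono)
        have "norm (1 - cis (\<xi> \<bullet> y)) \<le> 2" using norm_triangle_ineq4[of 1 "cis (\<xi> \<bullet> y)"] by simp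
        then have "norm (G e y) \<le> levy_density s y * 2" using True unfolding G_def by (simp add: mult_left_mono)
        also have "\<dots> \<le> (2 / min 1 (e\<^sup>2)) * (min 1 ((norm y)\<^sup>2) * levy_density s y)"
          using m mult_right_mono[OF m(2), of "levy_density s y"] by (simp add: field_simps)
        finally show ?thesis by simp
      qed (simp add: G_def)
      then show "AE y in lborel. norm (G e y) \<le> norm ((2 / min 1 (e\<^sup>2)) * (min 1 ((norm y)\<^sup>2) * levy_density s y))" by simp
    qed measurable
    have "G e (- y) = cnj (G e y)" for y
      unfolding G_def by (simp add: complex_eq_iff indicator_def)
    then have "(LBINT y. G e y) = (LBINT y. cnj (G e y))"
      using integral_lborel_reflect[of "G e" 0] by simp
    also have "\<dots> = cnj (LBINT y. G e y)" by simp
    finally have "(LBINT y. G e y) = of_real (Re (LBINT y. G e y))"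
      by (simp add: complex_eq_iff)
    also have "Re (LBINT y. G e y) = (LBINT y. Re (G e y))"
      using \<open>integrable lborel (G e)\<close> by simp
    also have "(\<lambda>y. Re (G e y)) = F e"
      unfolding G_def F_def by (auto simp: fun_eq_iff)
    finally show ?thesis .
  qed
  have lim: "((\<lambda>e. LBINT y. F e y) \<longlongrightarrow> (LBINT y. (1 - cos (\<xi> \<bullet> y)) * levy_density s y)) (at_right 0)"
    unfolding tendsto_at_iff_sequentially
  proof (intro allI impI, unfold o_def)
    fix X :: "nat \<Rightarrow> real" assume X: "\<forall>i. X i \<in> {0<..} - {0}" "X \<longlonglongrightarrow> 0"
    show "(\<lambda>i. LBINT y. F (X i) y) \<longlonglongrightarrow> (LBINT y. (1 - cos (\<xi> \<bullet> y)) * levy_density s y)"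
    proof (rule integral_dominated_convergence[where w="\<lambda>y. (1 - cos (\<xi> \<bullet> y)) * levy_density s y"])
      show "AE y in lborel. (\<lambda>i. F (X i) y) \<longlonglongrightarrow> (1 - cos (\<xi> \<bullet> y)) * levy_density s y"
      proof (intro AE_I2)
        fix y :: 'a
        show "(\<lambda>i. F (X i) y) \<longlonglongrightarrow> (1 - cos (\<xi> \<bullet> y)) * levy_density s y"
        proof (cases "y = 0")
          case False
          then have "\<forall>\<^sub>F i in sequentially. X i < norm y" using order_tendstoD(2)[OF X(2), of "norm y"] by simp
          then have "\<forall>\<^sub>F i in sequentially. F (X i) y = (1 - cos (\<xi> \<bullet> y)) * levy_density s y"
            by eventually_elim (simp add: F_def)
          then show ?thesis by (simp add: tendsto_eventually)
        qed (simp add: F_def)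
      qed
    qed (use Fb in \<open>auto intro!: integrable_levy_integrand s\<close>)
  qed
  have "((\<lambda>e. LBINT y. G e y) \<longlongrightarrow> of_real (LBINT y. (1 - cos (\<xi> \<bullet> y)) * levy_density s y)) (at_right 0)"
    by (rule Lim_transform_eventually[OF tendsto_of_real[OF lim]])
       (auto simp: eventually_at_right_field GF intro!: exI[of _ 1])
  then have "Lim (at_right 0) (\<lambda>e. LBINT y. G e y) = of_real (LBINT y. (1 - cos (\<xi> \<bullet> y)) * levy_density s y)"
    by (intro tendsto_Lim) auto
  then show ?thesis
    unfolding frac_symbol_def frac_laplacian_def G_eq symb_def by (simp add: scaleR_conv_of_real)
qed

section \<open>Gaussian Fourier integrals\<close>

lemma gauss_fourier_real:
  fixes a k :: real
  assumes a: "0 < a"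
  shows "integrable lborel (\<lambda>x. cis (k * x) * of_real (exp (- a * x\<^sup>2)))"
    and "(LBINT x. cis (k * x) * of_real (exp (- a * x\<^sup>2))) = of_real (sqrt (pi / a) * exp (- k\<^sup>2 / (4 * a)))"
proof -
  \<comment> \<open>With c^2 = 2a the substitution x = c x' turns exp(-x^2/2) into exp(-a x'^2), so
    the formula is a rescaled characteristic function of the standard normal law.\<close>
  define c where "c = sqrt (2 * a)"
  have c: "0 < c" "c\<^sup>2 = 2 * a" using a unfolding c_def by auto
  define t where "t = k / c"
  have int1: "integrable lborel (\<lambda>x. of_real (std_normal_density x) * iexp (t * x) :: complex)"
  proof (rule Bochner_Integration.integrable_bound)
    show "integrable lborel std_normal_density" using integrable_std_normal_moment[of 0] by simp
  qed (auto simp: norm_mult)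
  have "(CLINT x|std_normal_distribution. iexp (t * x)) = (CLBINT x. std_normal_density x *\<^sub>R iexp (t * x))"
    by (subst integral_density) (auto simp: normal_density_nonneg)
  then have I: "(CLBINT x. of_real (std_normal_density x) * iexp (t * x)) = of_real (exp (- t\<^sup>2 / 2))"
    using fun_cong[OF char_std_normal_distribution, of t] unfolding char_def by (simp add: scaleR_conv_of_real)
  have eq: "of_real (std_normal_density (0 + c * x)) * iexp (t * (0 + c * x)) =
      of_real (1 / sqrt (2 * pi)) * (cis (k * x) * of_real (exp (- a * x\<^sup>2)))" for x
    using c by (simp add: std_normal_density_def t_def cis_conv_exp power_mult_distrib)
  have "integrable lborel (\<lambda>x. of_real (1 / sqrt (2 * pi)) * (cis (k * x) * of_real (exp (- a * x\<^sup>2))) :: complex)"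
    using lborel_integrable_real_affine[OF int1, of c 0] c(1) unfolding eq by simp
  from integrable_mult_right[OF this, of "of_real (sqrt (2 * pi))"]
  show "integrable lborel (\<lambda>x. cis (k * x) * of_real (exp (- a * x\<^sup>2)))"
    by (simp flip: of_real_mult mult.assoc)
  have "of_real (exp (- t\<^sup>2 / 2)) = c *\<^sub>R (CLBINT x. of_real (1 / sqrt (2 * pi)) * (cis (k * x) * of_real (exp (- a * x\<^sup>2))))"
    using lborel_integral_real_affine[of c "\<lambda>x. of_real (std_normal_density x) * iexp (t * x)" 0] c(1)
    unfolding eq I by simp
  then have *: "of_real (exp (- t\<^sup>2 / 2)) = of_real (c / sqrt (2 * pi)) * (CLBINT x. cis (k * x) * of_real (exp (- a * x\<^sup>2)))"
    by (simp add: scaleR_conv_of_real)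
  have s: "c / sqrt (2 * pi) * sqrt (pi / a) = 1"
    unfolding c_def using a by (simp add: real_sqrt_divide real_sqrt_mult)
  have t: "- t\<^sup>2 / 2 = - k\<^sup>2 / (4 * a)"
    using c a unfolding t_def by (simp add: power_divide)
  have "of_real (sqrt (pi / a) * exp (- t\<^sup>2 / 2)) = of_real (c / sqrt (2 * pi) * sqrt (pi / a)) * (CLBINT x. cis (k * x) * of_real (exp (- a * x\<^sup>2)))"
    using * by (simp add: mult_ac)
  then show "(LBINT x. cis (k * x) * of_real (exp (- a * x\<^sup>2))) = of_real (sqrt (pi / a) * exp (- k\<^sup>2 / (4 * a)))"
    unfolding s t by simp
qed

text \<open>Lebesgue measure is the image of the product measure over the basis, and both the
  character and the Gaussian factor over coordinates.\<close>

lemma gauss_fourier_complex: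
  fixes \<xi> :: "'a::euclidean_space"
  assumes a: "0 < a"
  shows "integrable lborel (\<lambda>x. cis (\<xi> \<bullet> x) * of_real (exp (- a * (norm x)\<^sup>2)))"
    and "(LBINT x. cis (\<xi> \<bullet> x) * of_real (exp (- a * (norm x)\<^sup>2)))
      = of_real (sqrt (pi / a) ^ DIM('a) * exp (- (norm \<xi>)\<^sup>2 / (4 * a)))"
proof -
  interpret product_sigma_finite "\<lambda>_::'a. lborel :: real measure" ..
  define g where "g b x = cis ((\<xi> \<bullet> b) * x) * of_real (exp (- a * x\<^sup>2))" for b and x :: real
  have g: "integrable lborel (g b)" "(LBINT x. g b x) = of_real (sqrt (pi / a) * exp (- (\<xi> \<bullet> b)\<^sup>2 / (4 * a)))" for b
    unfolding g_def using gauss_fourier_real[OF a, of "\<xi> \<bullet> b"] by auto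
  have cis_sum: "cis (\<Sum>b\<in>B. h b) = (\<Prod>b\<in>B. cis (h b))" if "finite B" for B :: "'a set" and h
    using that by (induction B) (auto simp: cis_mult[symmetric])
  have nsq: "(norm x)\<^sup>2 = (\<Sum>b\<in>Basis. (x \<bullet> b)\<^sup>2)" for x :: 'a
    unfolding power2_norm_eq_inner by (subst euclidean_inner) (simp add: power2_eq_square)
  have eq: "cis (\<xi> \<bullet> x) * of_real (exp (- a * (norm x)\<^sup>2)) = (\<Prod>b\<in>Basis. g b (x \<bullet> b))" for x
  proof -
    have "\<xi> \<bullet> x = (\<Sum>b\<in>Basis. (\<xi> \<bullet> b) * (x \<bullet> b))" by (rule euclidean_inner)
    moreover have "exp (- a * (norm x)\<^sup>2) = (\<Prod>b\<in>Basis. exp (- a * (x \<bullet> b)\<^sup>2))"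
      unfolding nsq by (simp add: sum_distrib_left exp_sum)
    ultimately show ?thesis unfolding g_def by (simp add: cis_sum prod.distrib)
  qed
  define T where "T = (\<lambda>f. \<Sum>b\<in>(Basis::'a set). (f b :: real) *\<^sub>R b)"
  have T [measurable]: "T \<in> measurable (\<Pi>\<^sub>M b\<in>Basis. lborel) borel" unfolding T_def by measurable
  have meas [measurable]: "(\<lambda>x. cis (\<xi> \<bullet> x) * of_real (exp (- a * (norm x)\<^sup>2))) \<in> borel_measurable borel"
    unfolding cis_conv_exp by measurable
  have comp: "cis (\<xi> \<bullet> T f) * of_real (exp (- a * (norm (T f))\<^sup>2)) = (\<Prod>b\<in>Basis. g b (f b))" for f
    unfolding eq T_def by (simp add: inner_sum_left inner_Basis if_distrib[of "\<lambda>x. _ * x"] cong: if_cong)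
  have "integrable (\<Pi>\<^sub>M b\<in>Basis. lborel) (\<lambda>f. \<Prod>b\<in>Basis. g b (f b))"
    by (intro product_integrable_prod g) auto
  then show "integrable lborel (\<lambda>x. cis (\<xi> \<bullet> x) * of_real (exp (- a * (norm x)\<^sup>2)))"
    unfolding lborel_eq[where 'a='a] T_def[symmetric] by (subst integrable_distr_eq[OF T meas]) (simp only: comp)
  have "(LBINT x. cis (\<xi> \<bullet> x) * of_real (exp (- a * (norm x)\<^sup>2))) = (\<integral>f. (\<Prod>b\<in>Basis. g b (f b)) \<partial>(\<Pi>\<^sub>M b\<in>Basis. lborel))"
    unfolding lborel_eq[where 'a='a] T_def[symmetric] by (subst integral_distr[OF T meas]) (simp only: comp)
  also have "\<dots> = (\<Prod>b\<in>Basis. LBINT x. g b x)"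
    by (intro product_integral_prod g) auto
  also have "\<dots> = of_real (\<Prod>b\<in>(Basis::'a set). (sqrt (pi / a) * exp (- (\<xi> \<bullet> b)\<^sup>2 / (4 * a))))"
    by (simp add: g)
  also have "(\<Prod>b\<in>(Basis::'a set). (sqrt (pi / a) * exp (- (\<xi> \<bullet> b)\<^sup>2 / (4 * a)))) = sqrt (pi / a) ^ DIM('a) * exp (- (norm \<xi>)\<^sup>2 / (4 * a))"
    unfolding nsq[of \<xi>] by (simp add: prod.distrib exp_sum[symmetric] sum_negf sum_divide_distrib)
  finally show "(LBINT x. cis (\<xi> \<bullet> x) * of_real (exp (- a * (norm x)\<^sup>2)))
      = of_real (sqrt (pi / a) ^ DIM('a) * exp (- (norm \<xi>)\<^sup>2 / (4 * a)))" .
qed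

lemma integrable_gauss:
  assumes a: "0 < a"
  shows "integrable lborel (\<lambda>x::'a::euclidean_space. exp (- a * (norm x)\<^sup>2))"
proof -
  have "integrable lborel (\<lambda>x::'a. Re (cis (0 \<bullet> x) * of_real (exp (- a * (norm x)\<^sup>2))))"
    by (intro integrable_Re gauss_fourier_complex a)
  then show ?thesis by simp
qed

lemma gauss_fourier:
  fixes \<xi> :: "'a::euclidean_space"
  assumes a: "0 < a"
  shows "(LBINT x. cos (\<xi> \<bullet> x) * exp (- a * (norm x)\<^sup>2)) = sqrt (pi / a) ^ DIM('a) * exp (- (norm \<xi>)\<^sup>2 / (4 * a))"
proof -
  have "(LBINT x. cos (\<xi> \<bullet> x) * exp (- a * (norm x)\<^sup>2)) = (LBINT x. Re (cis (\<xi> \<bullet> x) * of_real (exp (- a * (norm x)\<^sup>2))))"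
    by simp
  also have "\<dots> = Re (LBINT x. cis (\<xi> \<bullet> x) * of_real (exp (- a * (norm x)\<^sup>2)))"
    by (intro integral_Re gauss_fourier_complex a)
  finally show ?thesis unfolding gauss_fourier_complex(2)[OF a] by simp
qed

text \<open>Convolution with a Gaussian acts on a frequency mode by a scalar; this is how the heat
  convolution in the kernel turns into a sum of symbols. The addition formula leaves an odd sine
  term, which integrates to 0.\<close>

lemma gauss_fourier_shift:
  fixes \<xi> x :: "'a::euclidean_space"
  assumes a: "0 < a"
  shows "(LBINT z. cos (\<xi> \<bullet> z) * exp (- a * (norm (x - z))\<^sup>2))
    = sqrt (pi / a) ^ DIM('a) * (cos (\<xi> \<bullet> x) * exp (- (norm \<xi>)\<^sup>2 / (4 * a)))"
proof -
  have ig: "integrable lborel (\<lambda>z. cos (\<xi> \<bullet> z) * exp (- a * (norm z)\<^sup>2))" "integrable lborel (\<lambda>z. sin (\<xi> \<bullet> z) * exp (- a * (norm z)\<^sup>2))"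
    by (rule Bochner_Integration.integrable_bound[OF integrable_gauss[OF a]]; auto simp: abs_mult intro!: mult_left_le_one_le)+
  have odd: "(LBINT z. sin (\<xi> \<bullet> z) * exp (- a * (norm z)\<^sup>2)) = 0"
    using integral_lborel_reflect[of "\<lambda>z. sin (\<xi> \<bullet> z) * exp (- a * (norm z)\<^sup>2)" 0] by simp
  have "(LBINT z. cos (\<xi> \<bullet> z) * exp (- a * (norm (x - z))\<^sup>2)) = (LBINT z. cos (\<xi> \<bullet> (x - z)) * exp (- a * (norm z)\<^sup>2))"
    using integral_lborel_reflect[of "\<lambda>z. cos (\<xi> \<bullet> z) * exp (- a * (norm (x - z))\<^sup>2)" x] by simp
  also have "\<dots> = (LBINT z. cos (\<xi> \<bullet> x) * (cos (\<xi> \<bullet> z) * exp (- a * (norm z)\<^sup>2)) + sin (\<xi> \<bullet> x) * (sin (\<xi> \<bullet> z) * exp (- a * (norm z)\<^sup>2)))"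
    by (intro Bochner_Integration.integral_cong) (simp_all add: inner_diff_right cos_diff algebra_simps)
  also have "\<dots> = cos (\<xi> \<bullet> x) * (LBINT z. cos (\<xi> \<bullet> z) * exp (- a * (norm z)\<^sup>2))"
    using ig odd by simp
  finally show ?thesis unfolding gauss_fourier[OF a] by simp
qed

section \<open>The mixed heat kernel\<close>

definition psi :: "real \<Rightarrow> 'a::euclidean_space \<Rightarrow> real" where
  "psi s \<xi> = (norm \<xi>)\<^sup>2 + symb s \<xi>"

text \<open>\<open>psi s\<close> is even, so the inverse Fourier transform reduces to a cosine
  transform. It agrees with the given kernel for positive times by
  \<open>mixed_heat_kernel_eq\<close>.\<close>

definition mker :: "real \<Rightarrow> real \<Rightarrow> 'a::euclidean_space \<Rightarrow> real" where
  "mker s t x = (LBINT \<xi>. cos (\<xi> \<bullet> x) * exp (- (t * psi s \<xi>))) / (2 * pi) ^ DIM('a)"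

lemma integrable_lborel_pair_bound:
  fixes F :: "'a::euclidean_space \<Rightarrow> 'b::euclidean_space \<Rightarrow> real"
  assumes [measurable]: "case_prod F \<in> borel_measurable (lborel \<Otimes>\<^sub>M lborel)"
    and g: "integrable lborel g" and h: "integrable lborel h"
    and le: "\<And>x y. \<bar>F x y\<bar> \<le> g x * h y"
  shows "integrable (lborel \<Otimes>\<^sub>M lborel) (case_prod F)"
proof (rule integrableI_bounded)
  have [measurable]: "g \<in> borel_measurable borel" "h \<in> borel_measurable borel" using g h by auto
  have "(\<integral>\<^sup>+z. ennreal (norm (case_prod F z)) \<partial>(lborel \<Otimes>\<^sub>M lborel))
     \<le> (\<integral>\<^sup>+z. ennreal (norm (g (fst z))) * ennreal (norm (h (snd z))) \<partial>(lborel \<Otimes>\<^sub>M lborel))"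
    by (intro nn_integral_mono) (auto simp: ennreal_mult[symmetric] abs_mult[symmetric] intro!: ennreal_leI order_trans[OF le])
  also have "\<dots> = (\<integral>\<^sup>+x. (\<integral>\<^sup>+y. ennreal (norm (g x)) * ennreal (norm (h y)) \<partial>lborel) \<partial>lborel)"
    by (subst lborel.nn_integral_fst[symmetric]) auto
  also have "\<dots> = (\<integral>\<^sup>+x. ennreal (norm (g x)) \<partial>lborel) * (\<integral>\<^sup>+y. ennreal (norm (h y)) \<partial>lborel)"
    by (subst nn_integral_cmult, measurable, subst nn_integral_multc, measurable)
  also have "\<dots> < \<infinity>" using g h by (auto simp: integrable_iff_bounded ennreal_mult_less_top)
  finally show "(\<integral>\<^sup>+z. ennreal (norm (case_prod F z)) \<partial>(lborel \<Otimes>\<^sub>M lborel)) < \<infinity>" .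
qed measurable

lemma lborel_fubini_bound:
  fixes F :: "'a::euclidean_space \<Rightarrow> 'b::euclidean_space \<Rightarrow> real"
  assumes "case_prod F \<in> borel_measurable (lborel \<Otimes>\<^sub>M lborel)"
    and "integrable lborel g" and "integrable lborel h"
    and "\<And>x y. \<bar>F x y\<bar> \<le> g x * h y"
  shows "(LBINT x. LBINT y. F x y) = (LBINT y. LBINT x. F x y)"
  using lborel_pair.Fubini_integral[OF integrable_lborel_pair_bound[OF assms]] by simp

lemma integrable_exp_norm_powr:
  fixes c a :: real
  assumes c: "0 < c" and a: "0 < a"
  shows "integrable lborel (\<lambda>\<xi>::'a::euclidean_space. exp (- (c * norm \<xi> powr a)))"
proof (rule integrableI_bounded)
  let ?d = "real DIM('a)"
  \<comment> \<open>The n-th power of z/n \<le> exp(z/n) gives exp(-z) \<le> (n/z)^n. With n a \<ge>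
    d + 1 the right side is integrable outside the unit ball.\<close>
  obtain n :: nat where n: "(?d + 1) / a < real n" using reals_Archimedean2 by blast
  have n0: "0 < real n" using n a by (meson add_nonneg_pos divide_pos_pos less_trans of_nat_0_le_iff zero_less_one)
  have na: "?d + 1 \<le> real n * a" using n a by (simp add: field_simps)
  define C where "C = (real n / c) ^ n"
  have C: "0 \<le> C" unfolding C_def using c by simp
  have le: "ennreal (norm (exp (- (c * norm \<xi> powr a)))) \<le>
     indicator {y. norm y \<le> 1} \<xi> + ennreal C * (indicator {y. 1 \<le> norm y} \<xi> * ennreal (norm \<xi> powr - (?d + 1)))" for \<xi> :: 'a
  proof (cases "norm \<xi> \<le> 1")
    case True
    have "ennreal (norm (exp (- (c * norm \<xi> powr a)))) \<le> 1" using c by simp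
    also have "\<dots> \<le> indicator {y. norm y \<le> 1} \<xi> + ennreal C * (indicator {y. 1 \<le> norm y} \<xi> * ennreal (norm \<xi> powr - (?d + 1)))"
      using True by simp
    finally show ?thesis .
  next
    case False
    define z where "z = c * norm \<xi> powr a"
    have np: "0 < norm \<xi>" using False by linarith
    have z: "0 < z" using c np unfolding z_def by simp
    have "z / real n \<le> exp (z / real n)" using exp_ge_add_one_self[of "z / real n"] by linarith
    then have "(z / real n) ^ n \<le> exp (z / real n) ^ n" using z n0 by (intro power_mono) auto
    also have "\<dots> = exp z" using n0 by (simp add: exp_of_nat_mult[symmetric])
    finally have "inverse (exp z) \<le> inverse ((z / real n) ^ n)" using z n0 by (intro le_imp_inverse_le) auto
    then have "exp (- z) \<le> (real n / z) ^ n" by (simp add: exp_minus power_inverse[symmetric])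
    also have "\<dots> = C * (norm \<xi> powr (- (real n * a)))"
    proof -
      have "real n / z = real n / c * norm \<xi> powr (- a)" unfolding z_def powr_minus using np c by (simp add: field_simps)
      moreover have "(norm \<xi> powr (- a)) ^ n = norm \<xi> powr (- (real n * a))"
        using np by (simp add: powr_realpow[symmetric] powr_powr mult.commute)
      ultimately show ?thesis unfolding C_def by (simp only: power_mult_distrib)
    qed
    also have "\<dots> \<le> C * (norm \<xi> powr - (?d + 1))"
      using False na C by (intro mult_left_mono powr_mono) auto
    finally have "ennreal (norm (exp (- (c * norm \<xi> powr a)))) \<le> ennreal C * ennreal (norm \<xi> powr - (?d + 1))"
      unfolding z_def[symmetric] using C by (subst ennreal_mult[symmetric]) (simp_all add: ennreal_leI)
    then show ?thesis using False by simp
  qed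
  have "(\<integral>\<^sup>+(\<xi>::'a). ennreal (norm (exp (- (c * norm \<xi> powr a)))) \<partial>lborel) \<le>
     (\<integral>\<^sup>+(\<xi>::'a). indicator {y. norm y \<le> 1} \<xi> +
       ennreal C * (indicator {y. 1 \<le> norm y} \<xi> * ennreal (norm \<xi> powr - (?d + 1))) \<partial>lborel)"
    by (intro nn_integral_mono le)
  also have "\<dots> = (\<integral>\<^sup>+(\<xi>::'a). indicator {y. norm y \<le> 1} \<xi> \<partial>lborel) +
     (\<integral>\<^sup>+(\<xi>::'a). ennreal C * (indicator {y. 1 \<le> norm y} \<xi> * ennreal (norm \<xi> powr - (?d + 1))) \<partial>lborel)"
    by (rule nn_integral_add) measurable
  also have "(\<integral>\<^sup>+(\<xi>::'a). ennreal C * (indicator {y. 1 \<le> norm y} \<xi> * ennreal (norm \<xi> powr - (?d + 1))) \<partial>lborel)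
     = ennreal C * (\<integral>\<^sup>+(\<xi>::'a). indicator {y. 1 \<le> norm y} \<xi> * ennreal (norm \<xi> powr - (?d + 1)) \<partial>lborel)"
    by (rule nn_integral_cmult) measurable
  also have "{y::'a. norm y \<le> 1} = cball 0 1" by auto
  also have "(\<integral>\<^sup>+(\<xi>::'a). indicator (cball 0 1) \<xi> \<partial>lborel) +
      ennreal C * (\<integral>\<^sup>+(\<xi>::'a). indicator {y. 1 \<le> norm y} \<xi> * ennreal (norm \<xi> powr - (?d + 1)) \<partial>lborel) < \<infinity>"
    using nn_integral_powr_tail[of "?d + 1", where 'a='a]
    by (simp add: ennreal_add_less_top ennreal_mult_less_top emeasure_lborel_cball_finite[unfolded infinity_ennreal_def])
  finally show "(\<integral>\<^sup>+(\<xi>::'a). ennreal (norm (exp (- (c * norm \<xi> powr a)))) \<partial>lborel) < \<infinity>" .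
qed measurable

text \<open>The dilation by t^(-1/a) is the origin of both decay rates of the kernel: a = 2 gives
  t^(-d/2), a = 2s gives t^(-d/(2s)).\<close>

lemma integral_exp_norm_powr_scale:
  fixes c a t :: real
  assumes t: "0 < t" and a: "0 < a"
  shows "(LBINT \<xi>::'a::euclidean_space. exp (- (t * (c * norm \<xi> powr a))))
     = t powr (- (real DIM('a) / a)) * (LBINT \<xi>::'a. exp (- (c * norm \<xi> powr a)))"
proof -
  define k where "k = t powr (- (1 / a))"
  have k: "0 < k" using t unfolding k_def by simp
  have ka: "k powr a = 1 / t" unfolding k_def powr_powr using a t by (simp add: powr_minus_divide)
  have "(LBINT \<xi>::'a. exp (- (t * (c * norm \<xi> powr a)))) = (k ^ DIM('a)) * (LBINT \<xi>::'a. exp (- (t * (c * norm (0 + k *\<^sub>R \<xi>) powr a))))"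
    using integral_lborel_affine[of k "\<lambda>\<xi>::'a. exp (- (t * (c * norm \<xi> powr a)))" 0] k by simp
  also have "(\<lambda>\<xi>::'a. exp (- (t * (c * norm (0 + k *\<^sub>R \<xi>) powr a)))) = (\<lambda>\<xi>. exp (- (c * norm \<xi> powr a)))"
    using k t by (simp add: fun_eq_iff powr_mult ka)
  also have "k ^ DIM('a) = t powr (- (real DIM('a) / a))"
    using k t unfolding k_def by (simp add: powr_realpow[symmetric] powr_powr)
  finally show ?thesis .
qed

context
  fixes s :: real
  assumes s: "0 < s" "s < 1"
begin

lemma symb_borel [measurable]: "symb s \<in> borel_measurable borel"
  using symb_measurable[OF s] .

lemma psi_borel [measurable]: "psi s \<in> borel_measurable borel"
  unfolding psi_def[abs_def] by measurable

lemma continuous_psi: "continuous_on UNIV (psi s)"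
  unfolding psi_def[abs_def] by (intro continuous_intros continuous_symb s)

lemma psi_nonneg: "0 \<le> psi s \<xi>"
  unfolding psi_def using symb_nonneg[OF s, of \<xi>] by simp

lemma norm_le_psi: "(norm \<xi>)\<^sup>2 \<le> psi s \<xi>"
  unfolding psi_def using symb_nonneg[OF s, of \<xi>] by simp

lemma symb_le_psi: "symb s \<xi> \<le> psi s \<xi>"
  unfolding psi_def by simp

lemma psi_zero: "psi s 0 = 0"
  unfolding psi_def by simp

lemma integrable_exp_symb:
  assumes t: "0 < t"
  shows "integrable lborel (\<lambda>\<xi>::'a::euclidean_space. exp (- (t * symb s \<xi>)))"
proof -
  obtain c where c: "0 < c" "\<And>\<xi>::'a. c * norm \<xi> powr (2 * s) \<le> symb s \<xi>" using symb_lower_bound[OF s, where 'a='a] by metis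
  show ?thesis
  proof (rule Bochner_Integration.integrable_bound)
    show "integrable lborel (\<lambda>\<xi>::'a. exp (- ((t * c) * norm \<xi> powr (2 * s))))"
      using c t s by (intro integrable_exp_norm_powr) auto
    have "(t * c) * norm \<xi> powr (2 * s) \<le> t * symb s \<xi>" for \<xi> :: 'a
      using c(2)[of \<xi>] t by (simp add: mult.assoc)
    then show "AE \<xi> in lborel. norm (exp (- (t * symb s \<xi>))) \<le> norm (exp (- ((t * c) * norm (\<xi>::'a) powr (2 * s))))"
      by simp
  qed measurable
qed

lemma integrable_exp_psi:
  assumes t: "0 < t"
  shows "integrable lborel (\<lambda>\<xi>::'a::euclidean_space. exp (- (t * psi s \<xi>)))"
  by (rule Bochner_Integration.integrable_bound[OF integrable_exp_symb[OF t]])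
    (use t in \<open>auto simp: symb_le_psi\<close>)

lemma integrable_cos_exp_psi:
  assumes t: "0 < t"
  shows "integrable lborel (\<lambda>\<xi>::'a::euclidean_space. cos (\<xi> \<bullet> x) * exp (- (t * psi s \<xi>)))"
  by (rule Bochner_Integration.integrable_bound[OF integrable_exp_psi[OF t]])
    (auto simp: abs_mult mult_left_le_one_le)

lemma psi_integral_bound:
  obtains K where "0 < K"
    "\<And>t. 0 < t \<Longrightarrow> (LBINT \<xi>::'a::euclidean_space. exp (- (t * psi s \<xi>))) \<le> K * t powr (- (real DIM('a) / 2))"
    "\<And>t. 0 < t \<Longrightarrow> (LBINT \<xi>::'a. exp (- (t * psi s \<xi>))) \<le> K * t powr (- (real DIM('a) / (2 * s)))"
proof -
  obtain c where c: "0 < c" "\<And>\<xi>::'a. c * norm \<xi> powr (2 * s) \<le> symb s \<xi>" using symb_lower_bound[OF s, where 'a='a] by metis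
  define K1 where "K1 = (LBINT \<xi>::'a. exp (- (1 * norm \<xi> powr 2)))"
  define K2 where "K2 = (LBINT \<xi>::'a. exp (- (c * norm \<xi> powr (2 * s))))"
  define K where "K = 1 + K1 + K2"
  have K12: "0 \<le> K1" "0 \<le> K2" unfolding K1_def K2_def by (auto intro!: integral_nonneg_AE)
  have 1: "(LBINT \<xi>::'a. exp (- (t * psi s \<xi>))) \<le> K * t powr (- (real DIM('a) / 2))" if t: "0 < t" for t
  proof -
    have "(LBINT \<xi>::'a. exp (- (t * psi s \<xi>))) \<le> (LBINT \<xi>::'a. exp (- (t * (1 * norm \<xi> powr 2))))"
      using integrable_exp_norm_powr[of t 2, where 'a='a] t norm_le_psi
      by (intro integral_mono integrable_exp_psi) auto
    also have "\<dots> = t powr (- (real DIM('a) / 2)) * K1"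
      unfolding K1_def using t by (rule integral_exp_norm_powr_scale) simp
    also have "\<dots> \<le> K * t powr (- (real DIM('a) / 2))"
      unfolding K_def using K12 by (simp add: algebra_simps)
    finally show ?thesis .
  qed
  have 2: "(LBINT \<xi>::'a. exp (- (t * psi s \<xi>))) \<le> K * t powr (- (real DIM('a) / (2 * s)))" if t: "0 < t" for t
  proof -
    have "(LBINT \<xi>::'a. exp (- (t * psi s \<xi>))) \<le> (LBINT \<xi>::'a. exp (- (t * (c * norm \<xi> powr (2 * s)))))"
    proof (intro integral_mono integrable_exp_psi)
      show "integrable lborel (\<lambda>\<xi>::'a. exp (- (t * (c * norm \<xi> powr (2 * s)))))"
        using integrable_exp_norm_powr[of "t * c" "2 * s", where 'a='a] t c s by (simp add: mult.assoc)
      show "exp (- (t * psi s \<xi>)) \<le> exp (- (t * (c * norm \<xi> powr (2 * s))))" for \<xi> :: 'a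
        using c(2)[of \<xi>] symb_le_psi[of \<xi>] t by (simp add: order_trans[OF c(2) symb_le_psi])
    qed (use t in auto)
    also have "\<dots> = t powr (- (real DIM('a) / (2 * s))) * K2"
      unfolding K2_def using t s by (intro integral_exp_norm_powr_scale) simp_all
    also have "\<dots> \<le> K * t powr (- (real DIM('a) / (2 * s)))"
      unfolding K_def using K12 by (simp add: algebra_simps)
    finally show ?thesis .
  qed
  show thesis using K12 by (intro that[of K] 1 2) (auto simp: K_def)
qed

lemma frac_heat_kernel_eq:
  "frac_heat_kernel s t (x::'a::euclidean_space) = (LBINT \<xi>. cos (\<xi> \<bullet> x) * exp (- (t * symb s \<xi>))) / (2 * pi) ^ DIM('a)"
  if t: "0 < t"
proof -
  have [measurable]: "(\<lambda>\<xi>. cis (\<xi> \<bullet> x) * of_real (exp (- (t * symb s \<xi>)))) \<in> borel_measurable borel"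
    unfolding cis_conv_exp by measurable
  have int: "integrable lborel (\<lambda>\<xi>. cis (\<xi> \<bullet> x) * of_real (exp (- (t * symb s \<xi>))) :: complex)"
    by (rule Bochner_Integration.integrable_bound[OF integrable_exp_symb[OF t]]) (auto simp: norm_mult)
  have "(LINT \<xi>|lebesgue. cis (\<xi> \<bullet> x) * exp (- (of_real t * frac_symbol s \<xi>)))
      = (LBINT \<xi>. cis (\<xi> \<bullet> x) * of_real (exp (- (t * symb s \<xi>))))"
    unfolding frac_symbol_eq[OF s] of_real_mult[symmetric] of_real_minus[symmetric] exp_of_real
    by (simp add: integral_completion)
  also have "Re \<dots> = (LBINT \<xi>. Re (cis (\<xi> \<bullet> x) * of_real (exp (- (t * symb s \<xi>)))))"
    using int by (rule integral_Re[symmetric])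
  finally show ?thesis unfolding frac_heat_kernel_def by simp
qed

text \<open>By Fubini the Gaussian acts on each mode of the fractional kernel and multiplies it by
  exp(-t |\<xi>|^2), which turns \<open>symb\<close> into \<open>psi\<close>. The normalisation (4
  pi t)^(-d/2) cancels the Gaussian constant (pi/a)^(d/2) for a = 1/(4t).\<close>

lemma mixed_heat_kernel_eq:
  "mixed_heat_kernel s t (x::'a::euclidean_space) = mker s t x"
  if t: "0 < t"
proof -
  let ?D = "(2 * pi) ^ DIM('a) :: real"
  define a where "a = 1 / (4 * t)"
  have a: "0 < a" using t unfolding a_def by simp
  have [measurable]: "frac_heat_kernel s t \<in> borel_measurable (borel :: 'a measure)"
    unfolding frac_heat_kernel_eq[OF t, abs_def] by measurable
  have "(LINT z|lebesgue. exp (- ((norm (x - z))\<^sup>2 / (4 * t))) * frac_heat_kernel s t z)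
     = (LBINT z. exp (- ((norm (x - z))\<^sup>2 / (4 * t))) * frac_heat_kernel s t z)"
    by (rule integral_completion) measurable
  also have "\<dots> = (LBINT z. (LBINT \<xi>. exp (- a * (norm (x - z))\<^sup>2) * (cos (\<xi> \<bullet> z) * exp (- (t * symb s \<xi>)))) / ?D)"
    unfolding frac_heat_kernel_eq[OF t] a_def by simp
  also have "\<dots> = (LBINT z. LBINT \<xi>. exp (- a * (norm (x - z))\<^sup>2) * (cos (\<xi> \<bullet> z) * exp (- (t * symb s \<xi>)))) / ?D"
    by simp
  also have "(LBINT z. LBINT \<xi>. exp (- a * (norm (x - z))\<^sup>2) * (cos (\<xi> \<bullet> z) * exp (- (t * symb s \<xi>))))
    = (LBINT \<xi>. LBINT z. exp (- a * (norm (x - z))\<^sup>2) * (cos (\<xi> \<bullet> z) * exp (- (t * symb s \<xi>))))"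
  proof (rule lborel_fubini_bound)
    show "integrable lborel (\<lambda>z. exp (- a * (norm (x - z))\<^sup>2))"
      using integrable_gauss[OF a] integrable_lborel_reflect[of "\<lambda>z. exp (- a * (norm z)\<^sup>2)" x] by simp
    show "integrable lborel (\<lambda>\<xi>::'a. exp (- (t * symb s \<xi>)))" by (rule integrable_exp_symb[OF t])
  qed (measurable, simp add: abs_mult mult_left_le_one_le)
  also have "\<dots> = (LBINT \<xi>. exp (- (t * symb s \<xi>)) * (LBINT z. cos (\<xi> \<bullet> z) * exp (- a * (norm (x - z))\<^sup>2)))"
    by (simp add: integral_mult_right_zero[symmetric] mult_ac del: integral_mult_right_zero)
  also have "\<dots> = (LBINT \<xi>. sqrt (pi / a) ^ DIM('a) * (cos (\<xi> \<bullet> x) * exp (- (t * psi s \<xi>))))"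
  proof (intro Bochner_Integration.integral_cong refl)
    fix \<xi> :: 'a
    have e: "exp (- (t * symb s \<xi>)) * exp (- (norm \<xi>)\<^sup>2 / (4 * a)) = exp (- (t * psi s \<xi>))"
      using t unfolding exp_add[symmetric] a_def psi_def by (simp add: algebra_simps)
    have "u * (v * (w * z)) = v * (w * (u * z))" for u v w z :: real by (simp only: mult_ac)
    then show "exp (- (t * symb s \<xi>)) * (LBINT z. cos (\<xi> \<bullet> z) * exp (- a * (norm (x - z))\<^sup>2)) = sqrt (pi / a) ^ DIM('a) * (cos (\<xi> \<bullet> x) * exp (- (t * psi s \<xi>)))"
      unfolding gauss_fourier_shift[OF a] e[symmetric] by simp
  qed
  also have "\<dots> = sqrt (pi / a) ^ DIM('a) * (LBINT \<xi>. cos (\<xi> \<bullet> x) * exp (- (t * psi s \<xi>)))" by simp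
  finally have *: "mixed_heat_kernel s t x = ((4 * pi * t) powr (- (real DIM('a) / 2)) * sqrt (pi / a) ^ DIM('a)) * mker s t x"
    unfolding mixed_heat_kernel_def mker_def by (simp only: times_divide_eq_right mult.assoc)
  have "sqrt (pi / a) = (4 * pi * t) powr (1 / 2)"
    using t unfolding a_def by (subst powr_half_sqrt) (auto simp: mult_ac)
  then have "sqrt (pi / a) ^ DIM('a) = (4 * pi * t) powr (real DIM('a) / 2)"
    using t by (simp add: powr_realpow[symmetric] powr_powr)
  then have "(4 * pi * t) powr (- (real DIM('a) / 2)) * sqrt (pi / a) ^ DIM('a) = 1"
    using t by (simp add: powr_minus)
  then show ?thesis unfolding * by simp
qed

lemma mker_bound:
  assumes t: "0 < t"
  shows "\<bar>mker s t (x::'a::euclidean_space)\<bar> \<le> (LBINT \<xi>::'a. exp (- (t * psi s \<xi>))) / (2 * pi) ^ DIM('a)"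
proof -
  have "\<bar>LBINT \<xi>. cos (\<xi> \<bullet> x) * exp (- (t * psi s \<xi>))\<bar> \<le> (LBINT \<xi>::'a. \<bar>cos (\<xi> \<bullet> x) * exp (- (t * psi s \<xi>))\<bar>)"
    by (rule integral_abs_bound)
  also have "\<dots> \<le> (LBINT \<xi>::'a. exp (- (t * psi s \<xi>)))"
    by (intro integral_mono integrable_abs integrable_cos_exp_psi integrable_exp_psi t)
      (simp add: abs_mult mult_left_le_one_le)
  finally show ?thesis unfolding mker_def by (simp add: divide_right_mono)
qed

text \<open>The right-hand side does not depend on x, so uniform continuity of the kernel in time
  reduces to L^1 convergence of the multipliers.\<close>

lemma mker_diff_bound:
  assumes t: "0 < t" "0 < t'"
  shows "\<bar>mker s t x - mker s t' (x::'a::euclidean_space)\<bar>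
     \<le> (LBINT \<xi>::'a. \<bar>exp (- (t * psi s \<xi>)) - exp (- (t' * psi s \<xi>))\<bar>) / (2 * pi) ^ DIM('a)"
proof -
  have "(LBINT \<xi>. cos (\<xi> \<bullet> x) * exp (- (t * psi s \<xi>))) - (LBINT \<xi>. cos (\<xi> \<bullet> x) * exp (- (t' * psi s \<xi>)))
     = (LBINT \<xi>. cos (\<xi> \<bullet> x) * (exp (- (t * psi s \<xi>)) - exp (- (t' * psi s \<xi>))))"
    using integrable_cos_exp_psi[OF t(1), of x] integrable_cos_exp_psi[OF t(2), of x]
    by (simp add: right_diff_distrib)
  also have "\<bar>\<dots>\<bar> \<le> (LBINT \<xi>. \<bar>cos (\<xi> \<bullet> x) * (exp (- (t * psi s \<xi>)) - exp (- (t' * psi s \<xi>)))\<bar>)"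
    by (rule integral_abs_bound)
  also have "\<dots> \<le> (LBINT \<xi>::'a. \<bar>exp (- (t * psi s \<xi>)) - exp (- (t' * psi s \<xi>))\<bar>)"
  proof (intro integral_mono integrable_abs)
    show "integrable lborel (\<lambda>\<xi>. cos (\<xi> \<bullet> x) * (exp (- (t * psi s \<xi>)) - exp (- (t' * psi s \<xi>))))"
      unfolding right_diff_distrib by (intro Bochner_Integration.integrable_diff integrable_cos_exp_psi t)
  qed (use t in \<open>auto intro!: Bochner_Integration.integrable_diff integrable_exp_psi simp: abs_mult mult_left_le_one_le\<close>)
  finally show ?thesis unfolding mker_def by (simp add: divide_right_mono diff_divide_distrib[symmetric])
qed

lemma mker_minus: "mker s t (- x) = mker s t x"
  unfolding mker_def by simp

lemma mker_measurable [measurable]: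
  "(\<lambda>z. mker s (fst z) (snd z)) \<in> borel_measurable (borel \<Otimes>\<^sub>M (borel :: 'a::euclidean_space measure))"
  unfolding mker_def by measurable

end

section \<open>Positivity and mass of the heat kernel\<close>

text \<open>Removing a ball makes the Levy measure finite, so its symbol is the total mass minus a
  cosine transform, as for a compound Poisson process. The full density is recovered as n
  grows.\<close>

definition trunc_density :: "real \<Rightarrow> nat \<Rightarrow> 'a::euclidean_space \<Rightarrow> real" where
  "trunc_density s n y = indicator {y. 1 / Suc n < norm y} y * levy_density s y"

lemma trunc_density_measurable [measurable]: "trunc_density s n \<in> borel_measurable borel"
  unfolding trunc_density_def[abs_def] by measurable

lemma trunc_density_nonneg: "0 \<le> trunc_density s n y"
  unfolding trunc_density_def by simp

lemma trunc_density_le: "trunc_density s n y \<le> levy_density s y"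
  unfolding trunc_density_def by (simp add: indicator_def)

lemma trunc_density_tendsto: "(\<lambda>n. trunc_density s n y) \<longlonglongrightarrow> levy_density s y"
proof (cases "y = 0")
  case False
  then have "\<forall>\<^sub>F n in sequentially. 1 / Suc n < norm y"
    using order_tendstoD(2)[OF LIMSEQ_inverse_real_of_nat, of "norm y"] by (simp add: inverse_eq_divide)
  then have "\<forall>\<^sub>F n in sequentially. trunc_density s n y = levy_density s y"
    by eventually_elim (simp add: trunc_density_def)
  then show ?thesis by (simp add: tendsto_eventually)
qed (simp add: trunc_density_def levy_density_def)

lemma integrable_trunc_density:
  assumes s: "0 < s" "s < 1"
  shows "integrable lborel (trunc_density s n :: 'a::euclidean_space \<Rightarrow> real)"
proof (rule Bochner_Integration.integrable_bound)
  define e where "e = 1 / real (Suc n)"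
  have e: "0 < e" unfolding e_def by simp
  show "integrable lborel (\<lambda>y::'a. (1 / min 1 (e\<^sup>2)) * (min 1 ((norm y)\<^sup>2) * levy_density s y))"
    by (intro integrable_mult_right integrable_levy_density s)
  have "norm (trunc_density s n y) \<le> norm ((1 / min 1 (e\<^sup>2)) * (min 1 ((norm y)\<^sup>2) * levy_density s y))" for y :: 'a
  proof (cases "e < norm y")
    case True
    have m: "0 < min 1 (e\<^sup>2)" "min 1 (e\<^sup>2) \<le> min 1 ((norm y)\<^sup>2)"
      using e True by (auto simp: min_le_iff_disj intro!: power_mono)
    have "norm (trunc_density s n y) \<le> levy_density s y"
      using trunc_density_le[of s n y] trunc_density_nonneg[of s n y] by simp
    also have "\<dots> \<le> (1 / min 1 (e\<^sup>2)) * (min 1 ((norm y)\<^sup>2) * levy_density s y)"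
      using m mult_right_mono[OF m(2), of "levy_density s y"] by (simp add: field_simps)
    finally show ?thesis by simp
  qed (simp add: trunc_density_def e_def)
  then show "AE y::'a in lborel. norm (trunc_density s n y) \<le> norm ((1 / min 1 (e\<^sup>2)) * (min 1 ((norm y)\<^sup>2) * levy_density s y))" by (intro AE_I2)
qed measurable

lemma abs_integral_cos_le:
  assumes w: "integrable lborel w" and "\<And>y. 0 \<le> w y"
  shows "\<bar>LBINT y. cos (\<xi> \<bullet> y) * w y\<bar> \<le> (LBINT y. w y)" "integrable lborel (\<lambda>y. cos (\<xi> \<bullet> y) * w y)"
proof -
  have [measurable]: "w \<in> borel_measurable borel" using w by auto
  show int: "integrable lborel (\<lambda>y. cos (\<xi> \<bullet> y) * w y)"
    by (rule Bochner_Integration.integrable_bound[OF w]) (auto simp: abs_mult mult_left_le_one_le)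
  have "\<bar>LBINT y. cos (\<xi> \<bullet> y) * w y\<bar> \<le> (LBINT y. \<bar>cos (\<xi> \<bullet> y) * w y\<bar>)" by (rule integral_abs_bound)
  also have "\<dots> \<le> (LBINT y. w y)"
    by (intro integral_mono integrable_abs int w) (simp add: abs_mult mult_left_le_one_le assms)
  finally show "\<bar>LBINT y. cos (\<xi> \<bullet> y) * w y\<bar> \<le> (LBINT y. w y)" .
qed

text \<open>The transform of a nonnegative density is positive definite, and products of positive definite
  functions are positive definite; with a Gaussian weight this says that cosine transforms stay
  nonnegative.\<close>

lemma cosine_transform_power_nonneg:
  fixes w :: "'a::euclidean_space \<Rightarrow> real"
  assumes w: "integrable lborel w" "\<And>y. 0 \<le> w y" and a: "0 \<le> a" and b: "0 \<le> b" and t: "0 < t"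
  shows "0 \<le> (LBINT \<xi>. cos (\<xi> \<bullet> x) * ((a + b * (LBINT y. cos (\<xi> \<bullet> y) * w y)) ^ j * exp (- t * (norm \<xi>)\<^sup>2)))"
proof (induction j arbitrary: x)
  case 0
  show ?case
    using gauss_fourier[OF t, of x] t by (simp add: inner_commute)
next
  case (Suc j)
  have [measurable]: "w \<in> borel_measurable borel" using w by auto
  define h where "h \<xi> = (LBINT y. cos (\<xi> \<bullet> y) * w y)" for \<xi>
  have [measurable]: "h \<in> borel_measurable borel" unfolding h_def[abs_def] by measurable
  define W where "W = (LBINT y. w y)"
  have W: "0 \<le> W" unfolding W_def using w by (intro integral_nonneg_AE) auto
  have h: "\<bar>h \<xi>\<bar> \<le> W" for \<xi> unfolding h_def W_def by (rule abs_integral_cos_le[OF w])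
  define M where "M = a + b * W"
  have M: "0 \<le> M" unfolding M_def using a b W by simp
  have hM: "\<bar>a + b * h \<xi>\<bar> \<le> M" for \<xi>
  proof -
    have "\<bar>a + b * h \<xi>\<bar> \<le> a + b * \<bar>h \<xi>\<bar>"
      using abs_triangle_ineq[of a "b * h \<xi>"] a b by (simp add: abs_mult)
    then show ?thesis unfolding M_def using mult_left_mono[OF h[of \<xi>] b] by linarith
  qed
  define G where "G \<xi> = (a + b * h \<xi>) ^ j * exp (- t * (norm \<xi>)\<^sup>2)" for \<xi>
  have [measurable]: "G \<in> borel_measurable borel" unfolding G_def[abs_def] by measurable
  have Gb: "\<bar>G \<xi>\<bar> \<le> M ^ j * exp (- t * (norm \<xi>)\<^sup>2)" for \<xi>
    unfolding G_def by (simp add: abs_mult power_abs power_mono[OF hM])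
  have gi: "integrable lborel (\<lambda>\<xi>::'a. M ^ j * exp (- t * (norm \<xi>)\<^sup>2))"
    by (intro integrable_mult_right integrable_gauss t)
  have int: "integrable lborel (\<lambda>\<xi>. c \<xi> * G \<xi>)" if [measurable]: "c \<in> borel_measurable borel" and "\<And>\<xi>. \<bar>c \<xi>\<bar> \<le> B" for c :: "'a \<Rightarrow> real" and B
  proof (rule Bochner_Integration.integrable_bound)
    show "integrable lborel (\<lambda>\<xi>::'a. B * (M ^ j * exp (- t * (norm \<xi>)\<^sup>2)))" by (intro integrable_mult_right gi)
    have "0 \<le> B" using that(2)[of 0] by linarith
    then show "AE \<xi> in lborel. norm (c \<xi> * G \<xi>) \<le> norm (B * (M ^ j * exp (- t * (norm \<xi>)\<^sup>2)))"
      using that(2) Gb M by (auto simp: abs_mult intro!: mult_mono)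
  qed measurable
  have IH: "0 \<le> (LBINT \<xi>. cos (\<xi> \<bullet> x) * G \<xi>)" for x
    using Suc.IH[of x] unfolding G_def h_def .
  have "(LBINT \<xi>. cos (\<xi> \<bullet> x) * (h \<xi> * G \<xi>)) = (LBINT \<xi>. LBINT y. (cos (\<xi> \<bullet> x) * G \<xi>) * (cos (\<xi> \<bullet> y) * w y))"
    unfolding h_def by (simp only: integral_mult_right_zero) (simp only: mult_ac)
  also have "\<dots> = (LBINT y. LBINT \<xi>. (cos (\<xi> \<bullet> x) * G \<xi>) * (cos (\<xi> \<bullet> y) * w y))"
  proof (rule lborel_fubini_bound[OF _ gi w(1)])
    fix \<xi> y
    have "\<bar>cos (\<xi> \<bullet> x) * G \<xi>\<bar> \<le> 1 * (M ^ j * exp (- t * (norm \<xi>)\<^sup>2))"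
      unfolding abs_mult by (intro mult_mono Gb) auto
    moreover have "\<bar>cos (\<xi> \<bullet> y) * w y\<bar> \<le> w y" using w by (simp add: abs_mult mult_left_le_one_le)
    ultimately show "\<bar>cos (\<xi> \<bullet> x) * G \<xi> * (cos (\<xi> \<bullet> y) * w y)\<bar> \<le> M ^ j * exp (- t * (norm \<xi>)\<^sup>2) * w y"
      unfolding abs_mult[of "cos (\<xi> \<bullet> x) * G \<xi>"] using M by (intro mult_mono) auto
  qed measurable
  \<comment> \<open>The product formula for cosines turns multiplication by \<open>h\<close> into an
    average, against the nonnegative \<open>w\<close>, of the transform at \<open>x - y\<close> and
    \<open>x + y\<close>. This is why the induction hypothesis is kept for arbitrary points.\<close>
  also have "\<dots> = (LBINT y. w y / 2 * ((LBINT \<xi>. cos (\<xi> \<bullet> (x - y)) * G \<xi>) + (LBINT \<xi>. cos (\<xi> \<bullet> (x + y)) * G \<xi>)))"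
  proof (intro Bochner_Integration.integral_cong refl)
    fix y
    have "(LBINT \<xi>. cos (\<xi> \<bullet> x) * G \<xi> * (cos (\<xi> \<bullet> y) * w y)) = (LBINT \<xi>. w y / 2 * (cos (\<xi> \<bullet> (x - y)) * G \<xi> + cos (\<xi> \<bullet> (x + y)) * G \<xi>))"
      by (intro Bochner_Integration.integral_cong refl)
        (simp add: inner_diff_right inner_add_right cos_diff cos_add field_simps)
    also have "\<dots> = w y / 2 * ((LBINT \<xi>. cos (\<xi> \<bullet> (x - y)) * G \<xi>) + (LBINT \<xi>. cos (\<xi> \<bullet> (x + y)) * G \<xi>))"
      by (subst integral_mult_right_zero, subst Bochner_Integration.integral_add) (auto intro!: int[of _ 1])
    finally show "(LBINT \<xi>. cos (\<xi> \<bullet> x) * G \<xi> * (cos (\<xi> \<bullet> y) * w y)) = w y / 2 * ((LBINT \<xi>. cos (\<xi> \<bullet> (x - y)) * G \<xi>) + (LBINT \<xi>. cos (\<xi> \<bullet> (x + y)) * G \<xi>))" .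
  qed
  also have "\<dots> \<ge> 0" by (intro integral_nonneg_AE AE_I2 mult_nonneg_nonneg add_nonneg_nonneg IH) (use w in auto)
  finally have H: "0 \<le> (LBINT \<xi>. cos (\<xi> \<bullet> x) * (h \<xi> * G \<xi>))" .
  have "(LBINT \<xi>. cos (\<xi> \<bullet> x) * ((a + b * h \<xi>) ^ Suc j * exp (- t * (norm \<xi>)\<^sup>2)))
    = (LBINT \<xi>. a * (cos (\<xi> \<bullet> x) * G \<xi>) + b * ((cos (\<xi> \<bullet> x) * h \<xi>) * G \<xi>))"
    unfolding G_def by (intro Bochner_Integration.integral_cong refl) (simp add: algebra_simps)
  also have "\<dots> = a * (LBINT \<xi>. cos (\<xi> \<bullet> x) * G \<xi>) + b * (LBINT \<xi>. (cos (\<xi> \<bullet> x) * h \<xi>) * G \<xi>)"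
  proof -
    have "\<bar>cos (\<xi> \<bullet> x) * h \<xi>\<bar> \<le> 1 * W" for \<xi> unfolding abs_mult by (intro mult_mono h) (auto simp: W)
    then have "integrable lborel (\<lambda>\<xi>. (cos (\<xi> \<bullet> x) * h \<xi>) * G \<xi>)" by (intro int[of _ "1 * W"]) auto
    moreover have "integrable lborel (\<lambda>\<xi>. cos (\<xi> \<bullet> x) * G \<xi>)" by (intro int[of _ 1]) auto
    ultimately show ?thesis by simp
  qed
  also have "\<dots> \<ge> 0" using IH[of x] H a b by (simp add: mult.assoc)
  finally show ?case unfolding h_def .
qed

text \<open>exp(-c (W - h)) is the limit of (1 - c W/j + (c/j) h)^j, a power with nonnegative
  coefficients once j \<ge> c W, so \<open>cosine_transform_power_nonneg\<close> applies before the
  limit.\<close>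

lemma cosine_transform_exp_nonneg:
  fixes w :: "'a::euclidean_space \<Rightarrow> real"
  assumes w: "integrable lborel w" "\<And>y. 0 \<le> w y" and c: "0 \<le> c" and t: "0 < t"
  shows "0 \<le> (LBINT \<xi>. cos (\<xi> \<bullet> x) * (exp (- (c * (LBINT y. (1 - cos (\<xi> \<bullet> y)) * w y))) * exp (- t * (norm \<xi>)\<^sup>2)))"
proof -
  have [measurable]: "w \<in> borel_measurable borel" using w by auto
  define h where "h \<xi> = (LBINT y. cos (\<xi> \<bullet> y) * w y)" for \<xi>
  have [measurable]: "h \<in> borel_measurable borel" unfolding h_def[abs_def] by measurable
  define W where "W = (LBINT y. w y)"
  have W: "0 \<le> W" unfolding W_def using w by (intro integral_nonneg_AE) auto
  have h: "\<bar>h \<xi>\<bar> \<le> W" for \<xi> unfolding h_def W_def by (rule abs_integral_cos_le[OF w])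
  have s: "(LBINT y. (1 - cos (\<xi> \<bullet> y)) * w y) = W - h \<xi>" for \<xi>
    unfolding h_def W_def using w(1) abs_integral_cos_le(2)[OF w, of \<xi>] by (simp add: left_diff_distrib)
  define E where "E j \<xi> = (1 + (- (c * (W - h \<xi>))) / real j) ^ j" for j \<xi>
  \<comment> \<open>Shifting the index by N puts the base of every power into [0, 1], which makes
    the Gaussian a common majorant and the constant coefficient 1 - c W/j nonnegative.\<close>
  obtain N :: nat where N: "c * (2 * W) < real N" using reals_Archimedean2 by blast
  have Nj: "c * (2 * W) < real (j + N)" "0 < real (j + N)" for j
  proof -
    have "0 \<le> c * (2 * W)" using W c by simp
    then have "0 < real N" using N by linarith
    then show "c * (2 * W) < real (j + N)" "0 < real (j + N)" using N by auto
  qed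
  have lim: "(\<lambda>j. LBINT \<xi>. cos (\<xi> \<bullet> x) * (E (j + N) \<xi> * exp (- t * (norm \<xi>)\<^sup>2)))
     \<longlonglongrightarrow> (LBINT \<xi>. cos (\<xi> \<bullet> x) * (exp (- (c * (W - h \<xi>))) * exp (- t * (norm \<xi>)\<^sup>2)))"
  proof (rule integral_dominated_convergence)
    show "integrable lborel (\<lambda>\<xi>::'a. exp (- t * (norm \<xi>)\<^sup>2))" by (rule integrable_gauss[OF t])
    show "AE \<xi> in lborel. (\<lambda>j. cos (\<xi> \<bullet> x) * (E (j + N) \<xi> * exp (- t * (norm \<xi>)\<^sup>2))) \<longlonglongrightarrow> cos (\<xi> \<bullet> x) * (exp (- (c * (W - h \<xi>))) * exp (- t * (norm \<xi>)\<^sup>2))"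
    proof (intro AE_I2 tendsto_intros)
      fix \<xi> :: 'a
      have "(\<lambda>j. E j \<xi>) \<longlonglongrightarrow> exp (- (c * (W - h \<xi>)))"
        unfolding E_def by (rule tendsto_exp_limit_sequentially)
      then show "(\<lambda>j. E (j + N) \<xi>) \<longlonglongrightarrow> exp (- (c * (W - h \<xi>)))" by (rule LIMSEQ_ignore_initial_segment)
    qed
    show "AE \<xi> in lborel. norm (cos (\<xi> \<bullet> x) * (E (j + N) \<xi> * exp (- t * (norm \<xi>)\<^sup>2))) \<le> exp (- t * (norm \<xi>)\<^sup>2)" for j
    proof (intro AE_I2)
      fix \<xi> :: 'a
      have z: "0 \<le> c * (W - h \<xi>)" "c * (W - h \<xi>) \<le> c * (2 * W)"
        using h[of \<xi>] c by (auto intro!: mult_left_mono mult_nonneg_nonneg)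
      then have "c * (W - h \<xi>) / real (j + N) \<le> 1" using Nj[of j] by (simp add: divide_le_eq)
      moreover have "0 \<le> c * (W - h \<xi>) / real (j + N)" using z by simp
      ultimately have "\<bar>E (j + N) \<xi>\<bar> \<le> 1" unfolding E_def power_abs by (intro power_le_one) auto
      then have "\<bar>cos (\<xi> \<bullet> x) * (E (j + N) \<xi> * exp (- t * (norm \<xi>)\<^sup>2))\<bar> \<le> 1 * (1 * exp (- t * (norm \<xi>)\<^sup>2))"
        unfolding abs_mult by (intro mult_mono) auto
      then show "norm (cos (\<xi> \<bullet> x) * (E (j + N) \<xi> * exp (- t * (norm \<xi>)\<^sup>2))) \<le> exp (- t * (norm \<xi>)\<^sup>2)" by simp
    qed
  qed (unfold E_def, measurable)
  have "0 \<le> (LBINT \<xi>. cos (\<xi> \<bullet> x) * (E (j + N) \<xi> * exp (- t * (norm \<xi>)\<^sup>2)))" for j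
  proof -
    let ?r = "real (j + N)"
    have "c * W \<le> c * (2 * W)" using c W by (intro mult_left_mono) auto
    then have "c * W < ?r" using Nj(1)[of j] by linarith
    then have a: "0 \<le> 1 - c * W / ?r" using Nj(2)[of j] by (simp add: divide_le_eq)
    have b: "0 \<le> c / ?r" using c by simp
    have "E (j + N) \<xi> = ((1 - c * W / ?r) + (c / ?r) * (LBINT y. cos (\<xi> \<bullet> y) * w y)) ^ (j + N)" for \<xi>
      unfolding E_def h_def[symmetric] by (rule arg_cong[of _ _ "\<lambda>z. z ^ (j + N)"]) (simp add: right_diff_distrib diff_divide_distrib)
    then show ?thesis using cosine_transform_power_nonneg[OF w a b t, of x "j + N"] by simp
  qed
  then show ?thesis unfolding s by (intro LIMSEQ_le_const[OF lim]) auto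
qed

context
  fixes s :: real
  assumes s: "0 < s" "s < 1"
begin

text \<open>The Laplacian supplies the Gaussian weight exp(-t |\<xi>|^2) that the preceding lemma
  requires; the same weight dominates the passage from the truncated to the full Levy
  density.\<close>

lemma mker_nonneg:
  assumes t: "0 < t"
  shows "0 \<le> mker s t (x::'a::euclidean_space)"
proof -
  note [measurable] = symb_borel[OF s] psi_borel[OF s]
  define K where "K = frac_const (real DIM('a)) s"
  have K: "0 < K" unfolding K_def by (rule frac_const_pos[OF s]) simp
  define S where "S n \<xi> = (LBINT y. (1 - cos (\<xi> \<bullet> y)) * trunc_density s n y)" for n and \<xi> :: 'a
  have [measurable]: "S n \<in> borel_measurable borel" for n unfolding S_def[abs_def] by measurable
  have S0: "0 \<le> S n \<xi>" for n \<xi>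
    unfolding S_def by (intro integral_nonneg_AE AE_I2 mult_nonneg_nonneg trunc_density_nonneg) simp
  have S_lim: "(\<lambda>n. K * S n \<xi>) \<longlonglongrightarrow> symb s \<xi>" for \<xi>
    unfolding symb_def K_def[symmetric] S_def
  proof (intro tendsto_mult_left integral_dominated_convergence[where w="\<lambda>y. (1 - cos (\<xi> \<bullet> y)) * levy_density s y"])
    show "AE y in lborel. (\<lambda>n. (1 - cos (\<xi> \<bullet> y)) * trunc_density s n y) \<longlonglongrightarrow> (1 - cos (\<xi> \<bullet> y)) * levy_density s y"
      by (intro AE_I2 tendsto_mult_left trunc_density_tendsto)
    show "AE y in lborel. norm ((1 - cos (\<xi> \<bullet> y)) * trunc_density s n y) \<le> (1 - cos (\<xi> \<bullet> y)) * levy_density s y" for n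
      using trunc_density_nonneg[of s n, where 'a='a] trunc_density_le[of s n, where 'a='a]
      by (intro AE_I2) (simp add: abs_mult mult_left_mono)
    show "integrable lborel (\<lambda>y. (1 - cos (\<xi> \<bullet> y)) * levy_density s y)" by (rule integrable_levy_integrand[OF s])
  qed measurable
  have lim: "(\<lambda>n. LBINT \<xi>. cos (\<xi> \<bullet> x) * (exp (- (t * K * S n \<xi>)) * exp (- t * (norm \<xi>)\<^sup>2)))
     \<longlonglongrightarrow> (LBINT \<xi>. cos (\<xi> \<bullet> x) * exp (- (t * psi s \<xi>)))"
  proof (rule integral_dominated_convergence)
    show "integrable lborel (\<lambda>\<xi>::'a. exp (- t * (norm \<xi>)\<^sup>2))" by (rule integrable_gauss[OF t])
    show "AE \<xi> in lborel. (\<lambda>n. cos (\<xi> \<bullet> x) * (exp (- (t * K * S n \<xi>)) * exp (- t * (norm \<xi>)\<^sup>2))) \<longlonglongrightarrow> cos (\<xi> \<bullet> x) * exp (- (t * psi s \<xi>))"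
    proof (intro AE_I2)
      fix \<xi> :: 'a
      have "exp (- (t * psi s \<xi>)) = exp (- (t * symb s \<xi>)) * exp (- t * (norm \<xi>)\<^sup>2)"
        unfolding psi_def exp_add[symmetric] by (simp add: algebra_simps)
      moreover have "(\<lambda>n. exp (- (t * K * S n \<xi>))) \<longlonglongrightarrow> exp (- (t * symb s \<xi>))"
        using S_lim[of \<xi>] unfolding mult.assoc by (intro tendsto_intros)
      ultimately show "(\<lambda>n. cos (\<xi> \<bullet> x) * (exp (- (t * K * S n \<xi>)) * exp (- t * (norm \<xi>)\<^sup>2))) \<longlonglongrightarrow> cos (\<xi> \<bullet> x) * exp (- (t * psi s \<xi>))"
        by (auto intro!: tendsto_intros)
    qed
    show "AE \<xi> in lborel. norm (cos (\<xi> \<bullet> x) * (exp (- (t * K * S n \<xi>)) * exp (- t * (norm \<xi>)\<^sup>2))) \<le> exp (- t * (norm \<xi>)\<^sup>2)" for n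
    proof (intro AE_I2)
      fix \<xi> :: 'a
      have "exp (- (t * K * S n \<xi>)) \<le> 1" using t K S0[of n \<xi>] by simp
      then have "\<bar>cos (\<xi> \<bullet> x) * (exp (- (t * K * S n \<xi>)) * exp (- t * (norm \<xi>)\<^sup>2))\<bar> \<le> 1 * (1 * exp (- t * (norm \<xi>)\<^sup>2))"
        unfolding abs_mult by (intro mult_mono) auto
      then show "norm (cos (\<xi> \<bullet> x) * (exp (- (t * K * S n \<xi>)) * exp (- t * (norm \<xi>)\<^sup>2))) \<le> exp (- t * (norm \<xi>)\<^sup>2)" by simp
    qed
  qed measurable
  have "0 \<le> (LBINT \<xi>. cos (\<xi> \<bullet> x) * (exp (- (t * K * S n \<xi>)) * exp (- t * (norm \<xi>)\<^sup>2)))" for n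
    unfolding S_def using t K
    by (intro cosine_transform_exp_nonneg integrable_trunc_density trunc_density_nonneg s) auto
  then have "0 \<le> (LBINT \<xi>. cos (\<xi> \<bullet> x) * exp (- (t * psi s \<xi>)))" by (intro LIMSEQ_le_const[OF lim]) auto
  then show ?thesis unfolding mker_def by simp
qed

text \<open>Testing against a Gaussian in place of the constant 1 makes Fubini available before the
  kernel is known to be integrable. After rescaling, the weight exp(-|\<zeta>|^2) is fixed and
  \<eta> enters only through the argument of \<open>psi\<close>.\<close>

lemma mker_gauss_integral:
  fixes t \<eta> :: real
  assumes t: "0 < t" and \<eta>: "0 < \<eta>"
  shows "integrable lborel (\<lambda>x::'a::euclidean_space. mker s t x * exp (- \<eta> * (norm x)\<^sup>2))"
    and "(LBINT x::'a. mker s t x * exp (- \<eta> * (norm x)\<^sup>2))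
     = (LBINT \<zeta>::'a. exp (- (t * psi s ((2 * sqrt \<eta>) *\<^sub>R \<zeta>))) * exp (- (norm \<zeta>)\<^sup>2)) / sqrt pi ^ DIM('a)"
proof -
  note [measurable] = symb_borel[OF s] psi_borel[OF s]
  have [measurable]: "mker s t \<in> borel_measurable (borel :: 'a measure)"
    unfolding mker_def[abs_def] by measurable
  let ?D = "(2 * pi) ^ DIM('a)"
  let ?Q = "(LBINT \<xi>::'a. exp (- (t * psi s \<xi>))) / ?D"
  show "integrable lborel (\<lambda>x::'a. mker s t x * exp (- \<eta> * (norm x)\<^sup>2))"
  proof (rule Bochner_Integration.integrable_bound)
    show "integrable lborel (\<lambda>x::'a. ?Q * exp (- \<eta> * (norm x)\<^sup>2))"
      by (intro integrable_mult_right integrable_gauss \<eta>)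
    have "\<bar>mker s t x\<bar> \<le> \<bar>?Q\<bar>" for x :: 'a using mker_bound[OF s t, of x] by linarith
    then show "AE x in lborel. norm (mker s t x * exp (- \<eta> * (norm x)\<^sup>2)) \<le> norm (?Q * exp (- \<eta> * (norm (x::'a))\<^sup>2))"
      by (intro AE_I2) (simp only: real_norm_def abs_mult mult_right_mono abs_ge_zero)
  qed measurable
  have "(LBINT x::'a. mker s t x * exp (- \<eta> * (norm x)\<^sup>2))
     = (LBINT x::'a. LBINT \<xi>. exp (- \<eta> * (norm x)\<^sup>2) * (cos (\<xi> \<bullet> x) * exp (- (t * psi s \<xi>)))) / ?D"
    unfolding mker_def by (simp add: mult.commute)
  also have "(LBINT x::'a. LBINT \<xi>. exp (- \<eta> * (norm x)\<^sup>2) * (cos (\<xi> \<bullet> x) * exp (- (t * psi s \<xi>))))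
     = (LBINT \<xi>. LBINT x::'a. exp (- \<eta> * (norm x)\<^sup>2) * (cos (\<xi> \<bullet> x) * exp (- (t * psi s \<xi>))))"
  proof (rule lborel_fubini_bound[OF _ integrable_gauss[OF \<eta>] integrable_exp_psi[OF s t]])
  qed (measurable, simp add: abs_mult mult_left_le_one_le)
  also have "\<dots> = (LBINT \<xi>. exp (- (t * psi s \<xi>)) * (LBINT x::'a. cos (\<xi> \<bullet> x) * exp (- \<eta> * (norm x)\<^sup>2)))"
    by (simp add: integral_mult_right_zero[symmetric] mult_ac del: integral_mult_right_zero)
  also have "\<dots> = sqrt (pi / \<eta>) ^ DIM('a) * (LBINT \<xi>::'a. exp (- (t * psi s \<xi>)) * exp (- (norm \<xi>)\<^sup>2 / (4 * \<eta>)))"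
    unfolding gauss_fourier[OF \<eta>] by (simp add: mult.left_commute)
  also have "(LBINT \<xi>::'a. exp (- (t * psi s \<xi>)) * exp (- (norm \<xi>)\<^sup>2 / (4 * \<eta>)))
     = (2 * sqrt \<eta>) ^ DIM('a) * (LBINT \<zeta>::'a. exp (- (t * psi s ((2 * sqrt \<eta>) *\<^sub>R \<zeta>))) * exp (- (norm \<zeta>)\<^sup>2))"
    using integral_lborel_affine[of "2 * sqrt \<eta>" "\<lambda>\<xi>::'a. exp (- (t * psi s \<xi>)) * exp (- (norm \<xi>)\<^sup>2 / (4 * \<eta>))" 0] \<eta>
    by (simp add: power_mult_distrib)
  also have "sqrt (pi / \<eta>) ^ DIM('a) * ((2 * sqrt \<eta>) ^ DIM('a) * I) / ?D = I / sqrt pi ^ DIM('a)" for I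
  proof -
    have "sqrt (pi / \<eta>) * (2 * sqrt \<eta>) / (2 * pi) = 1 / sqrt pi"
      using \<eta> by (simp add: real_sqrt_divide real_div_sqrt field_simps)
    then have "(sqrt (pi / \<eta>) * (2 * sqrt \<eta>) / (2 * pi)) ^ DIM('a) = 1 / sqrt pi ^ DIM('a)"
      by (simp add: power_divide)
    moreover have "sqrt (pi / \<eta>) ^ DIM('a) * ((2 * sqrt \<eta>) ^ DIM('a) * I) / ?D = (sqrt (pi / \<eta>) * (2 * sqrt \<eta>) / (2 * pi)) ^ DIM('a) * I"
      by (simp only: power_divide power_mult_distrib mult.assoc times_divide_eq_left)
    ultimately show ?thesis by simp
  qed
  finally show "(LBINT x::'a. mker s t x * exp (- \<eta> * (norm x)\<^sup>2))
     = (LBINT \<zeta>::'a. exp (- (t * psi s ((2 * sqrt \<eta>) *\<^sub>R \<zeta>))) * exp (- (norm \<zeta>)\<^sup>2)) / sqrt pi ^ DIM('a)" .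
qed

text \<open>Serves two limits: a fixed time with widening Gaussians gives total mass one, and a
  fixed Gaussian with times tending to 0 gives concentration at the origin.\<close>

lemma mker_gauss_tendsto:
  fixes T E :: "nat \<Rightarrow> real"
  assumes T: "\<And>n. 0 < T n" and E: "\<And>n. 0 < E n" and lim: "\<And>\<zeta>::'a::euclidean_space. (\<lambda>n. T n * psi s ((2 * sqrt (E n)) *\<^sub>R \<zeta>)) \<longlonglongrightarrow> 0"
  shows "(\<lambda>n. LBINT x::'a. mker s (T n) x * exp (- E n * (norm x)\<^sup>2)) \<longlonglongrightarrow> 1"
proof -
  note [measurable] = symb_borel[OF s] psi_borel[OF s]
  have i1: "integrable lborel (\<lambda>\<zeta>::'a. exp (- (norm \<zeta>)\<^sup>2))" using integrable_gauss[of 1] by simp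
  have v: "(LBINT \<zeta>::'a. exp (- (norm \<zeta>)\<^sup>2)) = sqrt pi ^ DIM('a)" using gauss_fourier[of 1 "0::'a"] by simp
  have "(\<lambda>n. LBINT \<zeta>::'a. exp (- (T n * psi s ((2 * sqrt (E n)) *\<^sub>R \<zeta>))) * exp (- (norm \<zeta>)\<^sup>2)) \<longlonglongrightarrow> (LBINT \<zeta>::'a. exp (- (norm \<zeta>)\<^sup>2))"
  proof (rule integral_dominated_convergence[OF _ _ i1])
    show "AE \<zeta>::'a in lborel. (\<lambda>n. exp (- (T n * psi s ((2 * sqrt (E n)) *\<^sub>R \<zeta>))) * exp (- (norm \<zeta>)\<^sup>2)) \<longlonglongrightarrow> exp (- (norm \<zeta>)\<^sup>2)"
    proof (intro AE_I2)
      fix \<zeta> :: 'a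
      have "(\<lambda>n. exp (- (T n * psi s ((2 * sqrt (E n)) *\<^sub>R \<zeta>))) * exp (- (norm \<zeta>)\<^sup>2)) \<longlonglongrightarrow> exp (- 0) * exp (- (norm \<zeta>)\<^sup>2)"
        by (intro tendsto_intros lim)
      then show "(\<lambda>n. exp (- (T n * psi s ((2 * sqrt (E n)) *\<^sub>R \<zeta>))) * exp (- (norm \<zeta>)\<^sup>2)) \<longlonglongrightarrow> exp (- (norm \<zeta>)\<^sup>2)" by simp
    qed
    show "AE \<zeta>::'a in lborel. norm (exp (- (T n * psi s ((2 * sqrt (E n)) *\<^sub>R \<zeta>))) * exp (- (norm \<zeta>)\<^sup>2)) \<le> exp (- (norm \<zeta>)\<^sup>2)" for n
      using T[of n] psi_nonneg[OF s, where 'a='a] by (auto intro!: AE_I2 mult_left_le_one_le)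
  qed measurable
  then have "(\<lambda>n. (LBINT \<zeta>::'a. exp (- (T n * psi s ((2 * sqrt (E n)) *\<^sub>R \<zeta>))) * exp (- (norm \<zeta>)\<^sup>2)) / sqrt pi ^ DIM('a)) \<longlonglongrightarrow> sqrt pi ^ DIM('a) / sqrt pi ^ DIM('a)"
    unfolding v by (intro tendsto_divide tendsto_const) auto
  then show ?thesis unfolding mker_gauss_integral(2)[OF T E] by simp
qed

text \<open>Since the kernel is nonnegative and the Gaussian weights increase to 1, monotone
  convergence yields integrability and the value together.\<close>

lemma mker_nn_integral:
  assumes t: "0 < t"
  shows "(\<integral>\<^sup>+(x::'a::euclidean_space). ennreal (mker s t x) \<partial>lborel) = 1"
proof -
  note [measurable] = symb_borel[OF s] psi_borel[OF s]
  have [measurable]: "mker s t \<in> borel_measurable (borel :: 'a measure)"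
    unfolding mker_def[abs_def] by measurable
  define E where "E n = 1 / real (Suc n)" for n
  have E: "0 < E n" for n unfolding E_def by simp
  have E0: "E \<longlonglongrightarrow> 0" unfolding E_def using LIMSEQ_inverse_real_of_nat by (simp add: inverse_eq_divide)
  have psi_lim: "(\<lambda>n. t * psi s ((2 * sqrt (E n)) *\<^sub>R \<zeta>)) \<longlonglongrightarrow> 0" for \<zeta> :: 'a
  proof -
    have "(\<lambda>n. (2 * sqrt (E n)) *\<^sub>R \<zeta>) \<longlonglongrightarrow> (2 * sqrt 0) *\<^sub>R \<zeta>" by (intro tendsto_intros E0)
    then have "(\<lambda>n. psi s ((2 * sqrt (E n)) *\<^sub>R \<zeta>)) \<longlonglongrightarrow> psi s ((2 * sqrt 0) *\<^sub>R \<zeta>)"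
      by (rule continuous_on_tendsto_compose[OF continuous_psi[OF s]]) auto
    then show ?thesis using tendsto_mult_left[of _ 0 sequentially t] by (simp add: psi_zero[OF s])
  qed
  have "(\<lambda>n. LBINT x::'a. mker s t x * exp (- E n * (norm x)\<^sup>2)) \<longlonglongrightarrow> 1"
    by (rule mker_gauss_tendsto[OF t E psi_lim])
  then have "(\<lambda>n. ennreal (LBINT x::'a. mker s t x * exp (- E n * (norm x)\<^sup>2))) \<longlonglongrightarrow> ennreal 1"
    by (intro tendsto_ennrealI)
  moreover have "ennreal (LBINT x::'a. mker s t x * exp (- E n * (norm x)\<^sup>2)) = (\<integral>\<^sup>+(x::'a). ennreal (mker s t x * exp (- E n * (norm x)\<^sup>2)) \<partial>lborel)" for n
    by (intro nn_integral_eq_integral[symmetric] mker_gauss_integral t E) (auto simp: mker_nonneg[OF t])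
  ultimately have 1: "(\<lambda>n. \<integral>\<^sup>+(x::'a). ennreal (mker s t x * exp (- E n * (norm x)\<^sup>2)) \<partial>lborel) \<longlonglongrightarrow> 1"
    by simp
  have 2: "(\<lambda>n. \<integral>\<^sup>+(x::'a). ennreal (mker s t x * exp (- E n * (norm x)\<^sup>2)) \<partial>lborel) \<longlonglongrightarrow> (\<integral>\<^sup>+(x::'a). ennreal (mker s t x) \<partial>lborel)"
  proof (rule nn_integral_LIMSEQ)
    show "incseq (\<lambda>n (x::'a). ennreal (mker s t x * exp (- E n * (norm x)\<^sup>2)))"
    proof (intro incseq_SucI le_funI ennreal_leI mult_left_mono mker_nonneg t)
      fix n and x :: 'a
      have "E (Suc n) \<le> E n" unfolding E_def by (simp add: frac_le)
      then show "exp (- E n * (norm x)\<^sup>2) \<le> exp (- E (Suc n) * (norm x)\<^sup>2)" by (simp add: mult_right_mono)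
    qed
    fix x :: 'a
    have "(\<lambda>n. mker s t x * exp (- E n * (norm x)\<^sup>2)) \<longlonglongrightarrow> mker s t x * exp (- 0 * (norm x)\<^sup>2)"
      by (intro tendsto_intros E0)
    then show "(\<lambda>n. ennreal (mker s t x * exp (- E n * (norm x)\<^sup>2))) \<longlonglongrightarrow> ennreal (mker s t x)"
      by (intro tendsto_ennrealI) simp
  qed measurable
  show ?thesis using LIMSEQ_unique[OF 1 2] by simp
qed

lemma mker_integrable:
  assumes t: "0 < t"
  shows "integrable lborel (mker s t :: 'a::euclidean_space \<Rightarrow> real)" "(LBINT x::'a. mker s t x) = 1"
proof -
  note [measurable] = symb_borel[OF s] psi_borel[OF s]
  have [measurable]: "mker s t \<in> borel_measurable (borel :: 'a measure)"
    unfolding mker_def[abs_def] by measurable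
  show "integrable lborel (mker s t :: 'a \<Rightarrow> real)"
    by (rule integrableI_bounded) (simp_all add: mker_nonneg[OF t] mker_nn_integral[OF t])
  show "(LBINT x::'a. mker s t x) = 1"
    using mker_nn_integral[OF t, where 'a='a] by (subst integral_eq_nn_integral) (auto simp: mker_nonneg[OF t])
qed

text \<open>Where |x| \<ge> R the defect 1 - exp(-|x|^2) is at least c = 1 - exp(-R^2). By Markov's
  inequality the mass there is at most 1/c times the defect of the Gaussian test, which tends to
  0.\<close>

lemma mker_concentration:
  assumes R: "0 < R"
  shows "((\<lambda>t. \<integral>\<^sup>+(x::'a::euclidean_space). ennreal (mker s t x) * indicator {x. R \<le> norm x} x \<partial>lborel) \<longlongrightarrow> 0) (at_right 0)"
  unfolding tendsto_at_iff_sequentially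
proof (intro allI impI, unfold o_def)
  fix T :: "nat \<Rightarrow> real" assume T': "\<forall>i. T i \<in> {0<..} - {0}" "T \<longlonglongrightarrow> 0"
  then have T: "0 < T n" for n by auto
  note [measurable] = symb_borel[OF s] psi_borel[OF s]
  have [measurable]: "mker s t \<in> borel_measurable (borel :: 'a measure)" for t
    unfolding mker_def[abs_def] by measurable
  define c where "c = 1 - exp (- R\<^sup>2)"
  have c: "0 < c" unfolding c_def using R by simp
  have "(\<lambda>n. LBINT x::'a. mker s (T n) x * exp (- 1 * (norm x)\<^sup>2)) \<longlonglongrightarrow> 1"
  proof (rule mker_gauss_tendsto[where E="\<lambda>_. 1"])
    show "(\<lambda>n. T n * psi s ((2 * sqrt 1) *\<^sub>R \<zeta>)) \<longlonglongrightarrow> 0" for \<zeta> :: 'a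
      using tendsto_mult_right[OF T'(2), of "psi s ((2 * sqrt 1) *\<^sub>R \<zeta>)"] by simp
  qed (use T in auto)
  then have "(\<lambda>n. (1 / c) * (1 - (LBINT x::'a. mker s (T n) x * exp (- 1 * (norm x)\<^sup>2)))) \<longlonglongrightarrow> (1 / c) * (1 - 1)"
    by (intro tendsto_intros)
  then have lim: "(\<lambda>n. ennreal ((1 / c) * (1 - (LBINT x::'a. mker s (T n) x * exp (- 1 * (norm x)\<^sup>2))))) \<longlonglongrightarrow> ennreal 0"
    by (intro tendsto_ennrealI) simp
  have le: "(\<integral>\<^sup>+(x::'a). ennreal (mker s (T n) x) * indicator {x. R \<le> norm x} x \<partial>lborel) \<le> ennreal ((1 / c) * (1 - (LBINT x::'a. mker s (T n) x * exp (- 1 * (norm x)\<^sup>2))))" for n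
  proof -
    have int: "integrable lborel (\<lambda>x::'a. (1 / c) * (mker s (T n) x - mker s (T n) x * exp (- 1 * (norm x)\<^sup>2)))"
      by (intro integrable_mult_right Bochner_Integration.integrable_diff mker_integrable mker_gauss_integral T) simp
    have "(\<integral>\<^sup>+(x::'a). ennreal (mker s (T n) x) * indicator {x. R \<le> norm x} x \<partial>lborel) \<le>
      (\<integral>\<^sup>+(x::'a). ennreal ((1 / c) * (mker s (T n) x - mker s (T n) x * exp (- 1 * (norm x)\<^sup>2))) \<partial>lborel)"
    proof (intro nn_integral_mono)
      fix x :: 'a
      have m: "0 \<le> mker s (T n) x" by (rule mker_nonneg[OF T])
      show "ennreal (mker s (T n) x) * indicator {x. R \<le> norm x} x \<le> ennreal ((1 / c) * (mker s (T n) x - mker s (T n) x * exp (- 1 * (norm x)\<^sup>2)))"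
      proof (cases "R \<le> norm x")
        case True
        then have "exp (- (norm x)\<^sup>2) \<le> exp (- R\<^sup>2)" using R by (simp add: power_mono)
        then have "c \<le> 1 - exp (- (norm x)\<^sup>2)" unfolding c_def by simp
        then have "mker s (T n) x * c \<le> mker s (T n) x * (1 - exp (- (norm x)\<^sup>2))" using m by (rule mult_left_mono)
        then have "mker s (T n) x \<le> (1 / c) * (mker s (T n) x - mker s (T n) x * exp (- 1 * (norm x)\<^sup>2))"
          using c by (simp add: field_simps)
        then show ?thesis using True by (simp add: ennreal_leI)
      qed simp
    qed
    also have "\<dots> = ennreal (LBINT x::'a. (1 / c) * (mker s (T n) x - mker s (T n) x * exp (- 1 * (norm x)\<^sup>2)))"
    proof (rule nn_integral_eq_integral[OF int])
      have "mker s (T n) x * exp (- 1 * (norm x)\<^sup>2) \<le> mker s (T n) x * 1" for x :: 'a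
        by (intro mult_left_mono mker_nonneg T) simp
      then show "AE x::'a in lborel. 0 \<le> (1 / c) * (mker s (T n) x - mker s (T n) x * exp (- 1 * (norm x)\<^sup>2))"
        using c by simp
    qed
    also have "(LBINT x::'a. (1 / c) * (mker s (T n) x - mker s (T n) x * exp (- 1 * (norm x)\<^sup>2))) = (1 / c) * (1 - (LBINT x::'a. mker s (T n) x * exp (- 1 * (norm x)\<^sup>2)))"
      using mker_integrable[OF T, where 'a='a] mker_gauss_integral(1)[OF T, of 1, where 'a='a] by simp
    finally show ?thesis .
  qed
  show "(\<lambda>n. \<integral>\<^sup>+(x::'a). ennreal (mker s (T n) x) * indicator {x. R \<le> norm x} x \<partial>lborel) \<longlonglongrightarrow> 0"
    by (rule tendsto_sandwich[OF always_eventually always_eventually tendsto_const lim[unfolded ennreal_0]])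
      (rule allI, rule zero_le, rule allI, rule le)
qed

lemma exp_psi_L1_continuous:
  assumes t: "0 < t"
  shows "((\<lambda>t'. LBINT \<xi>::'a::euclidean_space. \<bar>exp (- (t' * psi s \<xi>)) - exp (- (t * psi s \<xi>))\<bar>) \<longlongrightarrow> 0) (at t)"
  unfolding tendsto_at_iff_sequentially
proof (intro allI impI, unfold o_def)
  note [measurable] = symb_borel[OF s] psi_borel[OF s]
  fix T :: "nat \<Rightarrow> real" assume T: "\<forall>i. T i \<in> UNIV - {t}" "T \<longlonglongrightarrow> t"
  have "\<forall>\<^sub>F n in sequentially. t / 2 < T n" using order_tendstoD(1)[OF T(2), of "t/2"] t by simp
  then obtain N where N: "\<And>n. n \<ge> N \<Longrightarrow> t / 2 < T n" by (auto simp: eventually_sequentially)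
  \<comment> \<open>From index N on the times exceed t/2, so this function dominates all shifted
    differences of multipliers.\<close>
  have i2: "integrable lborel (\<lambda>\<xi>::'a. 2 * exp (- ((t/2) * psi s \<xi>)))"
    by (intro integrable_mult_right integrable_exp_psi s) (use t in simp)
  have "(\<lambda>n. LBINT \<xi>::'a. \<bar>exp (- (T (n + N) * psi s \<xi>)) - exp (- (t * psi s \<xi>))\<bar>) \<longlonglongrightarrow> (LBINT \<xi>::'a. 0)"
  proof (rule integral_dominated_convergence[OF _ _ i2])
    show "AE \<xi>::'a in lborel. (\<lambda>n. \<bar>exp (- (T (n + N) * psi s \<xi>)) - exp (- (t * psi s \<xi>))\<bar>) \<longlonglongrightarrow> 0"
    proof (intro AE_I2)
      fix \<xi> :: 'a
      have "(\<lambda>n. \<bar>exp (- (T (n + N) * psi s \<xi>)) - exp (- (t * psi s \<xi>))\<bar>) \<longlonglongrightarrow> \<bar>exp (- (t * psi s \<xi>)) - exp (- (t * psi s \<xi>))\<bar>"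
        by (intro tendsto_intros LIMSEQ_ignore_initial_segment T)
      then show "(\<lambda>n. \<bar>exp (- (T (n + N) * psi s \<xi>)) - exp (- (t * psi s \<xi>))\<bar>) \<longlonglongrightarrow> 0" by simp
    qed
    show "AE \<xi>::'a in lborel. norm \<bar>exp (- (T (n + N) * psi s \<xi>)) - exp (- (t * psi s \<xi>))\<bar> \<le> 2 * exp (- ((t/2) * psi s \<xi>))" for n
    proof (intro AE_I2)
      fix \<xi> :: 'a
      have p: "0 \<le> psi s \<xi>" by (rule psi_nonneg[OF s])
      have "(t/2) * psi s \<xi> \<le> T (n + N) * psi s \<xi>" using N[of "n + N"] p by (intro mult_right_mono) auto
      moreover have "(t/2) * psi s \<xi> \<le> t * psi s \<xi>" using t p by (intro mult_right_mono) auto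
      ultimately have "exp (- (T (n + N) * psi s \<xi>)) \<le> exp (- ((t/2) * psi s \<xi>))" "exp (- (t * psi s \<xi>)) \<le> exp (- ((t/2) * psi s \<xi>))" by simp_all
      moreover have "0 < exp (- (T (n + N) * psi s \<xi>))" "0 < exp (- (t * psi s \<xi>))" by simp_all
      ultimately show "norm \<bar>exp (- (T (n + N) * psi s \<xi>)) - exp (- (t * psi s \<xi>))\<bar> \<le> 2 * exp (- ((t/2) * psi s \<xi>))"
        unfolding real_norm_def abs_abs by linarith
    qed
  qed measurable
  then have "(\<lambda>n. LBINT \<xi>::'a. \<bar>exp (- (T (n + N) * psi s \<xi>)) - exp (- (t * psi s \<xi>))\<bar>) \<longlonglongrightarrow> 0" by simp
  then show "(\<lambda>n. LBINT \<xi>::'a. \<bar>exp (- (T n * psi s \<xi>)) - exp (- (t * psi s \<xi>))\<bar>) \<longlonglongrightarrow> 0"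
    by (rule LIMSEQ_offset)
qed

lemma mker_uniform_continuous:
  assumes t: "0 < t" and e: "0 < e"
  shows "\<forall>\<^sub>F t' in at t. \<forall>x::'a::euclidean_space. \<bar>mker s t' x - mker s t x\<bar> \<le> e"
proof -
  let ?D = "(2 * pi) ^ DIM('a) :: real"
  have "\<forall>\<^sub>F t' in at t. (LBINT \<xi>::'a. \<bar>exp (- (t' * psi s \<xi>)) - exp (- (t * psi s \<xi>))\<bar>) < e * ?D"
    using order_tendstoD(2)[OF exp_psi_L1_continuous[OF t, where 'a='a], of "e * ?D"] e by simp
  moreover have "\<forall>\<^sub>F t' in at t. 0 < t'"
    using order_tendstoD(1)[OF tendsto_ident_at, of 0 t UNIV] t by simp
  ultimately show ?thesis
  proof eventually_elim
    case (elim t')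
    show ?case
    proof
      fix x :: 'a
      have "\<bar>mker s t' x - mker s t x\<bar> \<le> (LBINT \<xi>::'a. \<bar>exp (- (t' * psi s \<xi>)) - exp (- (t * psi s \<xi>))\<bar>) / ?D"
        by (rule mker_diff_bound[OF s elim(2) t])
      also have "\<dots> \<le> e" using elim(1) by (simp add: divide_le_eq less_imp_le)
      finally show "\<bar>mker s t' x - mker s t x\<bar> \<le> e" .
    qed
  qed
qed

text \<open>All kernels have the same mass, so pointwise convergence improves to L^1 convergence by
  Scheffe's lemma.\<close>

lemma mker_L1_continuous:
  assumes t: "0 < t"
  shows "((\<lambda>t'. \<integral>\<^sup>+(x::'a::euclidean_space). ennreal \<bar>mker s t' x - mker s t x\<bar> \<partial>lborel) \<longlongrightarrow> 0) (at t)"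
  unfolding tendsto_at_iff_sequentially
proof (intro allI impI, unfold o_def)
  fix T :: "nat \<Rightarrow> real" assume T: "\<forall>i. T i \<in> UNIV - {t}" "T \<longlonglongrightarrow> t"
  have TF: "filterlim T (at t) sequentially" using T by (auto simp: filterlim_at)
  have "\<forall>\<^sub>F n in sequentially. 0 < T n" using order_tendstoD(1)[OF T(2), of 0] t by simp
  then obtain N where N: "\<And>n. n \<ge> N \<Longrightarrow> 0 < T n" by (auto simp: eventually_sequentially)
  have ptw: "(\<lambda>n. mker s (T n) x) \<longlonglongrightarrow> mker s t x" for x :: 'a
  proof (rule tendstoI)
    fix e :: real assume "0 < e"
    then have "\<forall>\<^sub>F t' in at t. \<forall>x::'a. \<bar>mker s t' x - mker s t x\<bar> \<le> e / 2" by (intro mker_uniform_continuous t) simp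
    from eventually_compose_filterlim[OF this TF]
    show "\<forall>\<^sub>F n in sequentially. dist (mker s (T n) x) (mker s t x) < e"
    proof eventually_elim
      case (elim n)
      from elim[rule_format, of x] \<open>0 < e\<close> show ?case by (simp add: dist_real_def)
    qed
  qed
  have "(\<lambda>n. \<integral>\<^sup>+(x::'a). ennreal (norm (mker s (T (n + N)) x - mker s t x)) \<partial>lborel) \<longlonglongrightarrow> 0"
  proof (rule Scheffe_lemma2)
    show "mker s (T (n + N)) \<in> borel_measurable (lborel :: 'a measure)" for n
      using mker_integrable(1)[of "T (n + N)", where 'a='a] N by auto
    show "integrable lborel (mker s t :: 'a \<Rightarrow> real)" by (rule mker_integrable[OF t])
    show "AE x::'a in lborel. (\<lambda>n. mker s (T (n + N)) x) \<longlonglongrightarrow> mker s t x"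
      by (intro AE_I2 LIMSEQ_ignore_initial_segment ptw)
    show "(\<integral>\<^sup>+(x::'a). ennreal (norm (mker s (T (n + N)) x)) \<partial>lborel) \<le> (\<integral>\<^sup>+(x::'a). ennreal (norm (mker s t x)) \<partial>lborel)" for n
    proof -
      have "0 < T (n + N)" using N[of "n + N"] by simp
      note this t
      then have "(\<integral>\<^sup>+(x::'a). ennreal (norm (mker s r x)) \<partial>lborel) = 1" if "r \<in> {T (n + N), t}" for r
        using that mker_nonneg[of r, where 'a='a] mker_nn_integral[of r, where 'a='a] by auto
      then show ?thesis by simp
    qed
  qed
  then show "(\<lambda>n. \<integral>\<^sup>+(x::'a). ennreal \<bar>mker s (T n) x - mker s t x\<bar> \<partial>lborel) \<longlonglongrightarrow> 0"
    unfolding real_norm_def by (rule LIMSEQ_offset)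
qed

end

section \<open>Exponential modulars and convolution\<close>

lemma abs_integral_le_nn_integral:
  fixes f :: "'a \<Rightarrow> real"
  shows "ennreal \<bar>LINT x|M. f x\<bar> \<le> (\<integral>\<^sup>+x. ennreal \<bar>f x\<bar> \<partial>M)"
proof (cases "integrable M f")
  case True
  then show ?thesis using integral_norm_bound_ennreal[of M f] by simp
qed (simp add: not_integrable_integral_eq)

section \<open>Convexity of the Young function\<close>

lemma powr_above_tangent:
  fixes p z z0 :: real
  assumes p: "1 \<le> p" and z: "0 \<le> z" and z0: "0 < z0"
  shows "z0 powr p + p * z0 powr (p - 1) * (z - z0) \<le> z powr p"
proof (cases "z = 0")
  case True
  have "z0 powr (p - 1) * z0 = z0 powr p" using z0 by (simp add: powr_mult_base mult.commute)
  then have "z0 powr p + p * z0 powr (p - 1) * (z - z0) = (1 - p) * z0 powr p"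
    using True by (simp add: algebra_simps)
  then show ?thesis using p True by (simp add: mult_nonpos_nonneg)
next
  case False
  have "z powr p - z0 powr p \<ge> (p * z0 powr (p - 1)) * (z - z0)"
  proof (rule convex_on_imp_above_tangent[OF powr_convex[OF p]])
    show "((\<lambda>x. x powr p) has_field_derivative p * z0 powr (p - 1)) (at z0 within {0<..})"
      using z0 by (auto intro!: derivative_eq_intros)
    show "z0 \<in> interior {0<..}" using z0 by (simp add: interior_open)
  qed (use z z0 False in auto)
  then show ?thesis by simp
qed

definition young :: "real \<Rightarrow> real \<Rightarrow> real" where
  "young p z = exp (z powr p) - 1"

lemma young_zero [simp]: "young p 0 = 0"
  unfolding young_def by simp

lemma young_nonneg: "0 \<le> young p z"
  unfolding young_def by simp

lemma young_mono: "1 \<le> p \<Longrightarrow> 0 \<le> a \<Longrightarrow> a \<le> b \<Longrightarrow> young p a \<le> young p b"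
  unfolding young_def by (simp add: powr_mono2)

lemma young_measurable [measurable]: "young p \<in> borel_measurable borel"
  unfolding young_def[abs_def] by measurable

text \<open>A supporting line is what convexity and Jensen's inequality both rest on. It comes from
  the tangent of z^p, followed by exp x \<ge> 1 + x at x = z^p - z0^p.\<close>

lemma young_above_tangent:
  assumes p: "1 \<le> p" and z0: "0 \<le> z0"
  obtains c where "0 \<le> c" "\<And>z. 0 \<le> z \<Longrightarrow> young p z0 + c * (z - z0) \<le> young p z"
proof (cases "z0 = 0")
  case True
  then show thesis using that[of 0] young_nonneg[of p] by simp
next
  case False
  define c where "c = exp (z0 powr p) * (p * z0 powr (p - 1))"
  have "young p z0 + c * (z - z0) \<le> young p z" if z: "0 \<le> z" for z
  proof -
    have "p * z0 powr (p - 1) * (z - z0) \<le> z powr p - z0 powr p"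
      using powr_above_tangent[OF p z, of z0] z0 False by simp
    then have "c * (z - z0) \<le> exp (z0 powr p) * (z powr p - z0 powr p)"
      unfolding c_def mult.assoc by (intro mult_left_mono) (simp_all add: mult.assoc)
    also have "\<dots> \<le> exp (z0 powr p) * (exp (z powr p - z0 powr p) - 1)"
      using exp_ge_add_one_self[of "z powr p - z0 powr p"] by (intro mult_left_mono, linarith) simp
    also have "\<dots> = exp (z powr p) - exp (z0 powr p)"
      by (simp add: right_diff_distrib exp_diff)
    finally show ?thesis unfolding young_def by simp
  qed
  moreover have "0 \<le> c" unfolding c_def using p by simp
  ultimately show thesis using that by blast
qed

lemma young_convex:
  assumes p: "1 \<le> p" and "0 \<le> a" "0 \<le> b" "0 \<le> l" "l \<le> 1"
  shows "young p (l * a + (1 - l) * b) \<le> l * young p a + (1 - l) * young p b"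
proof -
  define z where "z = l * a + (1 - l) * b"
  have z: "0 \<le> z" unfolding z_def using assms by simp
  obtain c where c: "\<And>w. 0 \<le> w \<Longrightarrow> young p z + c * (w - z) \<le> young p w"
    by (rule young_above_tangent[OF p z]) blast
  have "l * (young p z + c * (a - z)) + (1 - l) * (young p z + c * (b - z)) \<le> l * young p a + (1 - l) * young p b"
    using assms by (intro add_mono mult_left_mono c) auto
  moreover have "l * (young p z + c * (a - z)) + (1 - l) * (young p z + c * (b - z)) = young p z + c * (l * a + (1 - l) * b - z)"
    by (simp add: algebra_simps)
  ultimately show ?thesis unfolding z_def by simp
qed

text \<open>\<open>modular p \<mu> g \<le> 1\<close> is the working form of a Luxemburg bound by
  \<mu>: it composes by inequalities of integrals and leaves the infimum to the very end.\<close>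

definition modular :: "real \<Rightarrow> real \<Rightarrow> ('a::euclidean_space \<Rightarrow> real) \<Rightarrow> ennreal" where
  "modular p \<mu> g = (\<integral>\<^sup>+x. ennreal (young p (\<bar>g x\<bar> / \<mu>)) \<partial>lborel)"

lemma modular_mono:
  assumes p: "1 \<le> p" and "0 < \<nu>" "\<nu> \<le> \<mu>" and le: "\<And>x. \<bar>g x\<bar> \<le> \<bar>h x\<bar>"
  shows "modular p \<mu> g \<le> modular p \<nu> h"
  unfolding modular_def
proof (intro nn_integral_mono ennreal_leI young_mono p)
  fix x
  show "\<bar>g x\<bar> / \<mu> \<le> \<bar>h x\<bar> / \<nu>" using assms le[of x] by (intro frac_le) auto
qed (use assms in auto)

text \<open>The triangle inequality of the Luxemburg norm: (g + h)/(\<mu> + \<nu>) is the convex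
  combination of g/\<mu> and h/\<nu> with weights \<mu>/(\<mu> + \<nu>) and \<nu>/(\<mu> +
  \<nu>).\<close>

lemma modular_add:
  assumes p: "1 \<le> p" and [measurable]: "g \<in> borel_measurable borel" "h \<in> borel_measurable borel"
    and \<mu>: "0 < \<mu>" "0 < \<nu>" and g: "modular p \<mu> g \<le> 1" and h: "modular p \<nu> h \<le> 1"
  shows "modular p (\<mu> + \<nu>) (\<lambda>x. g x + h x) \<le> 1"
proof -
  define l where "l = \<mu> / (\<mu> + \<nu>)"
  have l: "0 \<le> l" "l \<le> 1" "1 - l = \<nu> / (\<mu> + \<nu>)" unfolding l_def using \<mu> by (auto simp: field_simps)
  have le: "young p (\<bar>g x + h x\<bar> / (\<mu> + \<nu>)) \<le> l * young p (\<bar>g x\<bar> / \<mu>) + (1 - l) * young p (\<bar>h x\<bar> / \<nu>)" for x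
  proof -
    have "\<bar>g x + h x\<bar> / (\<mu> + \<nu>) \<le> (\<bar>g x\<bar> + \<bar>h x\<bar>) / (\<mu> + \<nu>)"
      using \<mu> by (intro divide_right_mono) auto
    also have "\<dots> = l * (\<bar>g x\<bar> / \<mu>) + (1 - l) * (\<bar>h x\<bar> / \<nu>)"
      unfolding l(3) unfolding l_def using \<mu> by (simp add: add_divide_distrib)
    finally have "young p (\<bar>g x + h x\<bar> / (\<mu> + \<nu>)) \<le> young p (l * (\<bar>g x\<bar> / \<mu>) + (1 - l) * (\<bar>h x\<bar> / \<nu>))"
      using \<mu> by (intro young_mono p) auto
    also have "\<dots> \<le> l * young p (\<bar>g x\<bar> / \<mu>) + (1 - l) * young p (\<bar>h x\<bar> / \<nu>)"
      using \<mu> l by (intro young_convex p) auto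
    finally show ?thesis .
  qed
  have "modular p (\<mu> + \<nu>) (\<lambda>x. g x + h x) \<le> (\<integral>\<^sup>+x. ennreal l * ennreal (young p (\<bar>g x\<bar> / \<mu>)) + ennreal (1 - l) * ennreal (young p (\<bar>h x\<bar> / \<nu>)) \<partial>lborel)"
    unfolding modular_def
    using l(1,2) young_nonneg[of p] le
    by (intro nn_integral_mono) (simp flip: ennreal_mult ennreal_plus add: ennreal_leI)
  also have "\<dots> = (\<integral>\<^sup>+x. ennreal l * ennreal (young p (\<bar>g x\<bar> / \<mu>)) \<partial>lborel) + (\<integral>\<^sup>+x. ennreal (1 - l) * ennreal (young p (\<bar>h x\<bar> / \<nu>)) \<partial>lborel)"
    by (rule nn_integral_add) measurable
  also have "\<dots> = ennreal l * modular p \<mu> g + ennreal (1 - l) * modular p \<nu> h"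
    unfolding modular_def by (simp add: nn_integral_cmult)
  also have "\<dots> \<le> ennreal l * 1 + ennreal (1 - l) * 1"
    using g h by (intro add_mono mult_left_mono) auto
  also have "\<dots> = 1" using l by (simp flip: ennreal_plus)
  finally show ?thesis .
qed

lemma young_le_of_le_one:
  assumes p: "1 \<le> p" and z: "0 \<le> z" "z \<le> 1"
  shows "young p z \<le> 3 * z powr p"
proof -
  have v: "0 \<le> z powr p" "z powr p \<le> 1" using z p by (auto simp: powr_le1)
  then have "exp (z powr p) \<le> 1 + z powr p + (z powr p)\<^sup>2" by (intro exp_bound) auto
  moreover have "(z powr p)\<^sup>2 \<le> z powr p" using v by (simp add: power2_eq_square mult_left_le_one_le)
  ultimately show ?thesis unfolding young_def using v by linarith
qed

lemma powr_le_young: "z powr p \<le> young p z"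
  unfolding young_def using exp_ge_add_one_self[of "z powr p"] by linarith

text \<open>Embeds the intersection of L^1 and L^\<infinity> into exp L^p. At scale \<mu> \<ge> A
  the argument of the Young function is at most 1, where it is at most three times the p-th power,
  and |g|^p \<le> A^(p-1) |g|.\<close>

lemma modular_bounded:
  assumes p: "1 \<le> p" and [measurable]: "g \<in> borel_measurable borel"
    and A: "0 \<le> A" "\<And>x. \<bar>g x\<bar> \<le> A" and I: "0 \<le> I" "mass g \<le> ennreal I"
    and \<mu>: "0 < \<mu>" "A \<le> \<mu>" "3 * A powr (p - 1) * I \<le> \<mu> powr p"
  shows "modular p \<mu> g \<le> 1"
proof -
  define c where "c = 3 * A powr (p - 1) / \<mu> powr p"
  have c: "0 \<le> c" unfolding c_def by simp
  have le: "young p (\<bar>g x\<bar> / \<mu>) \<le> c * \<bar>g x\<bar>" for x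
  proof (cases "g x = 0")
    case False
    have "young p (\<bar>g x\<bar> / \<mu>) \<le> 3 * (\<bar>g x\<bar> / \<mu>) powr p"
      using \<mu> A(2)[of x] by (intro young_le_of_le_one p) auto
    also have "\<dots> = 3 * (\<bar>g x\<bar> powr (p - 1) * \<bar>g x\<bar>) / \<mu> powr p"
      using \<mu> False by (simp add: powr_divide powr_mult_base mult.commute)
    also have "\<dots> \<le> 3 * (A powr (p - 1) * \<bar>g x\<bar>) / \<mu> powr p"
      using A(2)[of x] p by (intro divide_right_mono mult_left_mono mult_right_mono powr_mono2) auto
    finally show ?thesis unfolding c_def by simp
  qed simp
  have "modular p \<mu> g \<le> (\<integral>\<^sup>+x. ennreal c * ennreal \<bar>g x\<bar> \<partial>lborel)"
    unfolding modular_def using c le by (intro nn_integral_mono) (simp flip: ennreal_mult add: ennreal_leI)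
  also have "\<dots> = ennreal c * mass g"
    by (rule nn_integral_cmult) measurable
  also have "\<dots> \<le> ennreal c * ennreal I" using I by (intro mult_left_mono) auto
  also have "\<dots> = ennreal (c * I)" using c I by (simp add: ennreal_mult)
  also have "\<dots> \<le> 1" using \<mu> unfolding c_def by (simp add: divide_le_eq)
  finally show ?thesis .
qed

section \<open>Convolution estimates\<close>

definition conv :: "('a::euclidean_space \<Rightarrow> real) \<Rightarrow> ('a \<Rightarrow> real) \<Rightarrow> 'a \<Rightarrow> real" where
  "conv Q u x = (LBINT y. Q (x - y) * u y)"

text \<open>The convolution of absolute values, with values in \<open>ennreal\<close>. A finite
  bound on it yields integrability, and it dominates \<open>conv\<close> even where that integral
  diverges and takes its default value 0.\<close>

definition nconv :: "('a::euclidean_space \<Rightarrow> real) \<Rightarrow> ('a \<Rightarrow> real) \<Rightarrow> 'a \<Rightarrow> ennreal" where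
  "nconv Q u x = mass (\<lambda>y. Q (x - y) * u y)"

lemma conv_le_nconv: "ennreal \<bar>conv Q u x\<bar> \<le> nconv Q u x"
  unfolding conv_def nconv_def by (rule abs_integral_le_nn_integral)

lemma conv_measurable [measurable]:
  assumes [measurable]: "Q \<in> borel_measurable borel" "u \<in> borel_measurable borel"
  shows "conv Q u \<in> borel_measurable borel"
  unfolding conv_def[abs_def] by measurable

lemma nconv_measurable [measurable]:
  assumes [measurable]: "Q \<in> borel_measurable borel" "u \<in> borel_measurable borel"
  shows "nconv Q u \<in> borel_measurable borel"
  unfolding nconv_def[abs_def] by measurable

text \<open>The bounded part M meets the mass of the kernel and the integrable excess v meets its
  supremum. With M free to be optimised, this replaces Hoelder's inequality for maps from L^r to
  L^\<infinity>.\<close>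

lemma nconv_bound:
  fixes Q u v :: "'a::euclidean_space \<Rightarrow> real"
  assumes [measurable]: "Q \<in> borel_measurable borel" "v \<in> borel_measurable borel"
    and Q: "mass Q \<le> ennreal \<kappa>" "\<And>x. \<bar>Q x\<bar> \<le> q"
    and u: "\<And>y. \<bar>u y\<bar> \<le> M + v y" and v: "\<And>y. 0 \<le> v y" "(\<integral>\<^sup>+y. ennreal (v y) \<partial>lborel) \<le> ennreal V"
    and nonneg: "0 \<le> \<kappa>" "0 \<le> M" "0 \<le> V"
  shows "nconv Q u x \<le> ennreal (\<kappa> * M + q * V)"
proof -
  have q: "0 \<le> q" using Q(2)[of 0] by linarith
  have "nconv Q u x \<le> (\<integral>\<^sup>+y. ennreal \<bar>Q (x - y)\<bar> * ennreal M + ennreal q * ennreal (v y) \<partial>lborel)"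
    unfolding nconv_def
  proof (intro nn_integral_mono)
    fix y
    have "\<bar>Q (x - y) * u y\<bar> \<le> \<bar>Q (x - y)\<bar> * (M + v y)" unfolding abs_mult by (intro mult_left_mono u) auto
    also have "\<dots> \<le> \<bar>Q (x - y)\<bar> * M + q * v y"
      using mult_right_mono[OF Q(2)[of "x - y"] v(1)[of y]] by (simp add: distrib_left)
    finally show "ennreal \<bar>Q (x - y) * u y\<bar> \<le> ennreal \<bar>Q (x - y)\<bar> * ennreal M + ennreal q * ennreal (v y)"
      using nonneg q v(1) by (simp flip: ennreal_mult ennreal_plus add: ennreal_leI)
  qed
  also have "\<dots> = (\<integral>\<^sup>+y. ennreal \<bar>Q (x - y)\<bar> * ennreal M \<partial>lborel) + (\<integral>\<^sup>+y. ennreal q * ennreal (v y) \<partial>lborel)"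
    by (rule nn_integral_add) measurable
  also have "(\<integral>\<^sup>+y. ennreal \<bar>Q (x - y)\<bar> * ennreal M \<partial>lborel) = mass (\<lambda>y. Q (x - y)) * ennreal M"
    by (rule nn_integral_multc) measurable
  also have "mass (\<lambda>y. Q (x - y)) = mass Q"
    by (rule nn_integral_lborel_reflect[of "\<lambda>y. ennreal \<bar>Q y\<bar>"]) measurable
  also have "(\<integral>\<^sup>+y. ennreal q * ennreal (v y) \<partial>lborel) = ennreal q * (\<integral>\<^sup>+y. ennreal (v y) \<partial>lborel)"
    by (rule nn_integral_cmult) measurable
  also have "mass Q * ennreal M + ennreal q * (\<integral>\<^sup>+y. ennreal (v y) \<partial>lborel) \<le> ennreal \<kappa> * ennreal M + ennreal q * ennreal V"
    by (intro add_mono mult_mono Q v) auto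
  also have "\<dots> = ennreal (\<kappa> * M + q * V)" using nonneg q by (simp add: ennreal_mult)
  finally show ?thesis .
qed

lemma nconv_L1:
  fixes Q u :: "'a::euclidean_space \<Rightarrow> real"
  assumes [measurable]: "Q \<in> borel_measurable borel" "u \<in> borel_measurable borel"
  shows "(\<integral>\<^sup>+x. nconv Q u x \<partial>lborel) = mass Q * mass u"
proof -
  have "(\<integral>\<^sup>+x. nconv Q u x \<partial>lborel) = (\<integral>\<^sup>+y. mass (\<lambda>x. Q (x - y) * u y) \<partial>lborel)"
    unfolding nconv_def by (rule lborel_pair.Fubini') measurable
  also have "\<dots> = (\<integral>\<^sup>+y. mass Q * ennreal \<bar>u y\<bar> \<partial>lborel)"
  proof (intro nn_integral_cong)
    fix y
    have "mass (\<lambda>x. Q (x - y) * u y) = (\<integral>\<^sup>+x. ennreal \<bar>Q (x - y)\<bar> * ennreal \<bar>u y\<bar> \<partial>lborel)"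
      by (simp add: abs_mult ennreal_mult)
    also have "\<dots> = mass (\<lambda>x. Q (x - y)) * ennreal \<bar>u y\<bar>"
      by (rule nn_integral_multc) measurable
    also have "mass (\<lambda>x. Q (x - y)) = mass Q"
      by (rule nn_integral_lborel_shift[of "\<lambda>x. ennreal \<bar>Q x\<bar>"]) measurable
    finally show "mass (\<lambda>x. Q (x - y) * u y) = mass Q * ennreal \<bar>u y\<bar>" .
  qed
  also have "\<dots> = mass Q * mass u"
    by (rule nn_integral_cmult) measurable
  finally show ?thesis .
qed

text \<open>Jensen's inequality for a kernel of mass at most \<open>\<kappa>\<close>: because \<open>young p 0 = 0\<close> the tangent line
  at a point is nonpositive at the origin, so no normalisation of the mass is needed.\<close>

lemma young_conv_le:
  fixes Q u :: "'a::euclidean_space \<Rightarrow> real"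
  assumes p: "1 \<le> p" and [measurable]: "Q \<in> borel_measurable borel" "u \<in> borel_measurable borel"
    and Q: "mass Q \<le> ennreal \<kappa>" and \<kappa>: "0 < \<kappa>" and \<mu>: "0 < \<mu>"
  shows "ennreal (young p (\<bar>conv Q u x\<bar> / (\<kappa> * \<mu>))) \<le> (\<integral>\<^sup>+y. ennreal (\<bar>Q (x - y)\<bar> / \<kappa> * young p (\<bar>u y\<bar> / \<mu>)) \<partial>lborel)"
proof -
  define R where "R y = \<bar>Q (x - y)\<bar> / \<kappa>" for y
  have [measurable]: "R \<in> borel_measurable borel" unfolding R_def[abs_def] by measurable
  have R0: "0 \<le> R y" for y unfolding R_def using \<kappa> by simp
  define J where "J = (\<integral>\<^sup>+y. ennreal (R y * young p (\<bar>u y\<bar> / \<mu>)) \<partial>lborel)"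
  show ?thesis
  \<comment> \<open>In the complementary case either \<open>conv\<close> has its default value 0 or
    the right-hand side is infinite.\<close>
  proof (cases "integrable lborel (\<lambda>y. Q (x - y) * u y) \<and> J < \<infinity>")
    case False
    moreover have "J = \<infinity>" if "\<not> J < \<infinity>"
      using that by (simp add: less_top[symmetric])
    ultimately consider "\<not> integrable lborel (\<lambda>y. Q (x - y) * u y)" | "J = \<infinity>"
      by blast
    then show ?thesis
    proof cases
      case 1
      then have "conv Q u x = 0" unfolding conv_def by (rule not_integrable_integral_eq)
      then show ?thesis by simp
    next
      case 2
      then show ?thesis unfolding J_def R_def by (simp add: mult_ac)
    qed
  next
    case True
    have "mass (\<lambda>y. Q (x - y)) \<le> ennreal \<kappa>"
      using Q nn_integral_lborel_reflect[of "\<lambda>y. ennreal \<bar>Q y\<bar>" x] by simp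
    then have "mass (\<lambda>y. Q (x - y)) < \<infinity>" by (metis ennreal_less_top infinity_ennreal_def le_less_trans)
    then have iQ: "integrable lborel (\<lambda>y. \<bar>Q (x - y)\<bar>)" by (intro integrableI_bounded) auto
    then have iR: "integrable lborel R" unfolding R_def by simp
    have "ennreal (LBINT y. \<bar>Q (x - y)\<bar>) \<le> ennreal \<kappa>"
      using \<open>(mass (\<lambda>y. Q (x - y))) \<le> ennreal \<kappa>\<close> nn_integral_eq_integral[OF iQ] by simp
    then have mass: "(LBINT y. R y) \<le> 1" unfolding R_def using \<kappa> by (simp add: ennreal_le_iff)
    define z where "z = \<bar>conv Q u x\<bar> / (\<kappa> * \<mu>)"
    have z: "0 \<le> z" unfolding z_def using \<kappa> \<mu> by simp
    obtain c where c: "0 \<le> c" "\<And>w. 0 \<le> w \<Longrightarrow> young p z + c * (w - z) \<le> young p w"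
      by (rule young_above_tangent[OF p z]) blast
    have neg: "young p z - c * z \<le> 0" using c(2)[of 0] by simp
    have iu: "integrable lborel (\<lambda>y. R y * (\<bar>u y\<bar> / \<mu>))"
      using integrable_abs[OF conjunct1[OF True]] unfolding R_def by (simp add: abs_mult)
    have zle: "z \<le> (LBINT y. R y * (\<bar>u y\<bar> / \<mu>))"
    proof -
      have "\<bar>conv Q u x\<bar> \<le> (LBINT y. \<bar>Q (x - y) * u y\<bar>)" unfolding conv_def by (rule integral_abs_bound)
      then have "z \<le> (LBINT y. \<bar>Q (x - y) * u y\<bar>) / (\<kappa> * \<mu>)" unfolding z_def using \<kappa> \<mu> by (intro divide_right_mono) auto
      also have "\<dots> = (LBINT y. \<bar>Q (x - y) * u y\<bar> / (\<kappa> * \<mu>))" by simp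
      also have "\<dots> = (LBINT y. R y * (\<bar>u y\<bar> / \<mu>))" unfolding R_def by (simp add: abs_mult)
      finally show ?thesis .
    qed
    have iJ: "integrable lborel (\<lambda>y. R y * young p (\<bar>u y\<bar> / \<mu>))"
      using True unfolding J_def by (intro integrableI_bounded) (auto simp: abs_mult R0 young_nonneg)
    have "young p z \<le> (LBINT y. R y) * (young p z - c * z) + c * (LBINT y. R y * (\<bar>u y\<bar> / \<mu>))"
    proof -
      have "1 * (young p z - c * z) \<le> (LBINT y. R y) * (young p z - c * z)"
        by (rule mult_right_mono_neg[OF mass neg])
      moreover have "c * z \<le> c * (LBINT y. R y * (\<bar>u y\<bar> / \<mu>))" by (rule mult_left_mono[OF zle c(1)])
      ultimately show ?thesis by simp
    qed
    also have "\<dots> = (LBINT y. R y * (young p z - c * z) + c * (R y * (\<bar>u y\<bar> / \<mu>)))"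
      using Bochner_Integration.integral_add[OF integrable_mult_left[OF iR] integrable_mult_right[OF iu], of "young p z - c * z" c] by simp
    also have "\<dots> \<le> (LBINT y. R y * young p (\<bar>u y\<bar> / \<mu>))"
    proof (intro integral_mono iJ)
      fix y
      have "R y * (young p z + c * (\<bar>u y\<bar> / \<mu> - z)) \<le> R y * young p (\<bar>u y\<bar> / \<mu>)"
        using \<mu> by (intro mult_left_mono c R0) auto
      then show "R y * (young p z - c * z) + c * (R y * (\<bar>u y\<bar> / \<mu>)) \<le> R y * young p (\<bar>u y\<bar> / \<mu>)"
        by (simp add: algebra_simps)
    qed (intro Bochner_Integration.integrable_add integrable_mult_left integrable_mult_right iR iu)
    finally have "ennreal (young p z) \<le> ennreal (LBINT y. R y * young p (\<bar>u y\<bar> / \<mu>))" by (rule ennreal_leI)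
    also have "\<dots> = (\<integral>\<^sup>+y. ennreal (R y * young p (\<bar>u y\<bar> / \<mu>)) \<partial>lborel)"
      by (rule nn_integral_eq_integral[OF iJ, symmetric]) (simp add: R0 young_nonneg)
    finally show ?thesis unfolding z_def R_def .
  qed
qed

text \<open>The scale is multiplied by the mass bound of the kernel. With \<kappa> = 1 this bounds
  the semigroup; with small \<kappa> it bounds a difference of two kernels.\<close>

lemma modular_conv:
  fixes Q u :: "'a::euclidean_space \<Rightarrow> real"
  assumes p: "1 \<le> p" and [measurable]: "Q \<in> borel_measurable borel" "u \<in> borel_measurable borel"
    and Q: "mass Q \<le> ennreal \<kappa>" and \<kappa>: "0 < \<kappa>" and \<mu>: "0 < \<mu>"
  shows "modular p (\<kappa> * \<mu>) (conv Q u) \<le> modular p \<mu> u"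
proof -
  let ?Q = "\<lambda>x. \<bar>Q x\<bar> / \<kappa>"
  let ?v = "\<lambda>y. young p (\<bar>u y\<bar> / \<mu>)"
  have "modular p (\<kappa> * \<mu>) (conv Q u) \<le> (\<integral>\<^sup>+x. nconv ?Q ?v x \<partial>lborel)"
    unfolding modular_def nconv_def
    using young_conv_le[OF p assms(2,3) Q \<kappa> \<mu>] \<kappa> by (intro nn_integral_mono) (simp add: abs_mult young_nonneg)
  also have "\<dots> = mass (?Q) * mass (?v)"
    by (rule nconv_L1) measurable
  also have "mass (?Q) = (\<integral>\<^sup>+x. ennreal (1 / \<kappa>) * ennreal \<bar>Q x\<bar> \<partial>lborel)"
    using \<kappa> by (simp flip: ennreal_mult)
  also have "\<dots> = ennreal (1 / \<kappa>) * mass Q"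
    by (rule nn_integral_cmult) measurable
  also have "\<dots> \<le> ennreal (1 / \<kappa>) * ennreal \<kappa>" by (intro mult_left_mono Q) simp
  also have "\<dots> = 1" using \<kappa> by (simp flip: ennreal_mult)
  also have "1 * mass (?v) = modular p \<mu> u"
    unfolding modular_def by (simp add: young_nonneg)
  finally show ?thesis by (simp add: mult_right_mono)
qed

section \<open>Absorbing powers into exponentials\<close>

lemma powr_mult_exp_le:
  fixes b :: real
  assumes b: "0 \<le> b"
  obtains c where "1 \<le> c" "\<And>z. 0 \<le> z \<Longrightarrow> z powr b * exp (z / 4) \<le> c * exp (z / 2)"
proof -
  obtain n :: nat where n: "b \<le> real n" using real_arch_simple by blast
  \<comment> \<open>The successor keeps k nonzero for b = 0; exp(z/4) is then compared with the k-th
    power of z/(4k).\<close>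
  define k where "k = Suc n"
  have kp: "real k \<noteq> 0" unfolding k_def by simp
  define c where "c = 1 + (4 * real k) ^ k"
  have c: "1 \<le> c" unfolding c_def by simp
  have "z powr b * exp (z / 4) \<le> c * exp (z / 2)" if z: "0 \<le> z" for z
  proof -
    have e1: "1 \<le> exp (z / 4)" using z by simp
    have "z powr b \<le> c * exp (z / 4)"
    proof (cases "z \<le> 1")
      case True
      have "z powr b \<le> 1" using z True b by (simp add: powr_le1)
      also have "1 \<le> c * exp (z / 4)" using mult_mono[OF c e1] c by simp
      finally show ?thesis .
    next
      case False
      then have z1: "1 \<le> z" by simp
      have "z powr b \<le> z powr real k" using z1 n unfolding k_def by (intro powr_mono) auto
      also have "\<dots> = z ^ k" using z1 by (simp add: powr_realpow)
      also have "\<dots> = (4 * real k) ^ k * (z / 4 / real k) ^ k"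
        unfolding power_mult_distrib[symmetric] k_def by simp
      also have "\<dots> \<le> (4 * real k) ^ k * exp (z / 4 / real k) ^ k"
      proof (intro mult_left_mono power_mono)
        show "z / 4 / real k \<le> exp (z / 4 / real k)" using exp_ge_add_one_self[of "z / 4 / real k"] by linarith
      qed (use z in auto)
      also have "exp (z / 4 / real k) ^ k = exp (z / 4)" using kp by (subst exp_of_nat_mult[symmetric]) simp
      also have "(4 * real k) ^ k * exp (z / 4) \<le> c * exp (z / 4)" unfolding c_def by (intro mult_right_mono) auto
      finally show ?thesis .
    qed
    then have "z powr b * exp (z / 4) \<le> c * exp (z / 4) * exp (z / 4)" by (intro mult_right_mono) auto
    also have "\<dots> = c * exp (z / 2)" by (simp flip: exp_add)
    finally show ?thesis .
  qed
  with c show thesis by (rule that)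
qed

text \<open>For exponents below p the left side is not bounded by a multiple of the Young function
  near 0, so the majorant is the full exponential 1 + \<open>young\<close>; its constant 1 has to be
  integrated against an integrable weight later.\<close>

lemma powr_exp_le_exp:
  fixes a p :: real
  assumes p: "1 \<le> p" and a: "0 \<le> a"
  obtains c where "1 \<le> c" "\<And>y. 0 \<le> y \<Longrightarrow> y powr a * exp (y powr p / 4) \<le> c * exp (y powr p)"
proof -
  obtain c where c: "1 \<le> c" "\<And>z. 0 \<le> z \<Longrightarrow> z powr (a / p) * exp (z / 4) \<le> c * exp (z / 2)"
    using powr_mult_exp_le[of "a / p"] p a by auto
  have "y powr a * exp (y powr p / 4) \<le> c * exp (y powr p)" if "0 \<le> y" for y
  proof -
    have "y powr a * exp (y powr p / 4) \<le> c * exp (y powr p / 2)"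
      using c(2)[of "y powr p"] p by (simp add: powr_powr)
    also have "\<dots> \<le> c * exp (y powr p)" using c(1) by (intro mult_left_mono) auto
    finally show ?thesis .
  qed
  with c(1) show thesis by (rule that)
qed

text \<open>Since a \<ge> p, a factor z = y^p can be split off. Then z exp(z/2) \<le> exp z - 1,
  which is z/2 \<le> sinh(z/2) multiplied by 2 exp(z/2), recovers the vanishing of the Young
  function at 0.\<close>

lemma powr_exp_le_young:
  fixes a p :: real
  assumes p: "1 \<le> p" and a: "p \<le> a"
  obtains c where "1 \<le> c" "\<And>y. 0 \<le> y \<Longrightarrow> y powr a * exp (y powr p / 4) \<le> c * young p y"
proof -
  define b where "b = (a - p) / p"
  have b: "0 \<le> b" unfolding b_def using p a by simp
  obtain c where c: "1 \<le> c" "\<And>z. 0 \<le> z \<Longrightarrow> z powr b * exp (z / 4) \<le> c * exp (z / 2)"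
    using powr_mult_exp_le[OF b] by auto
  have "y powr a * exp (y powr p / 4) \<le> c * young p y" if "0 \<le> y" for y
  proof -
    define z where "z = y powr p"
    have z: "0 \<le> z" unfolding z_def by simp
    have "a = p + p * b" unfolding b_def using p by simp
    then have "y powr a = z * z powr b" unfolding z_def powr_powr by (simp add: powr_add)
    then have "y powr a * exp (y powr p / 4) = z * (z powr b * exp (z / 4))" by (simp add: z_def)
    also have "\<dots> \<le> z * (c * exp (z / 2))" by (intro mult_left_mono c z)
    also have "\<dots> = c * (z * exp (z / 2))" by simp
    also have "z * exp (z / 2) \<le> exp z - 1"
    proof -
      have "z/2 \<le> (exp (z/2) - inverse (exp (z/2))) / 2" using z by (intro real_le_x_sinh) simp
      then have "z \<le> exp (z/2) - inverse (exp (z/2))" by simp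
      then have "z \<le> exp (z/2) - exp (- (z/2))" by (simp add: exp_minus)
      then have "z * exp (z/2) \<le> (exp (z/2) - exp (- (z/2))) * exp (z/2)" by (intro mult_right_mono) auto
      also have "\<dots> = exp z - 1" by (simp add: left_diff_distrib flip: exp_add)
      finally show ?thesis .
    qed
    finally show ?thesis unfolding young_def z_def using c(1) by (simp add: mult_left_mono)
  qed
  with c(1) show thesis by (rule that)
qed

section \<open>Duhamel's formula\<close>

definition jointly_measurable :: "(real \<Rightarrow> 'a::euclidean_space \<Rightarrow> real) \<Rightarrow> bool" where
  "jointly_measurable h \<longleftrightarrow> (\<lambda>z. h (fst z) (snd z)) \<in> borel_measurable (borel \<Otimes>\<^sub>M borel)"

lemma jointly_measurableD:
  assumes "jointly_measurable h" "f \<in> borel_measurable M" "g \<in> measurable M borel"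
  shows "(\<lambda>z. h (f z) (g z)) \<in> borel_measurable M"
proof -
  have [measurable]: "(\<lambda>z. h (fst z) (snd z)) \<in> borel_measurable (borel \<Otimes>\<^sub>M borel)"
    using assms unfolding jointly_measurable_def by simp
  note [measurable] = assms(2,3)
  have "(\<lambda>z. (\<lambda>w. h (fst w) (snd w)) (f z, g z)) \<in> borel_measurable M" by measurable
  then show ?thesis by simp
qed

section \<open>Time integrals of power singularities\<close>

lemma nn_integral_powr_0:
  fixes b T :: real
  assumes b: "0 < b" and T: "0 \<le> T"
  shows "time_integral 0 T (\<lambda>\<tau>. \<tau> powr (b - 1)) \<le> ennreal (T powr b / b)"
proof -
  have "((\<lambda>x. x powr (b - 1)) has_integral (T powr (b - 1 + 1) / (b - 1 + 1))) {0..T}"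
    using b T by (intro has_integral_powr_from_0) auto
  then have "(\<integral>\<^sup>+\<tau>. ennreal (indicator {0..T} \<tau> * \<tau> powr (b - 1)) \<partial>lborel) = ennreal (T powr b / b)"
    by (intro nn_integral_has_integral_lebesgue) auto
  moreover have "time_integral 0 T (\<lambda>\<tau>. \<tau> powr (b - 1)) \<le> (\<integral>\<^sup>+\<tau>. ennreal (indicator {0..T} \<tau> * \<tau> powr (b - 1)) \<partial>lborel)"
    by (intro nn_integral_mono ennreal_leI) (auto simp: indicator_def)
  ultimately show ?thesis by simp
qed

lemma nn_integral_const_interval:
  fixes T c :: real
  assumes "0 \<le> T" "0 \<le> c"
  shows "time_integral 0 T (\<lambda>\<tau>. c) = ennreal (c * T)"
proof -
  have "time_integral 0 T (\<lambda>\<tau>. c) = (\<integral>\<^sup>+\<tau>. ennreal c * indicator {0<..<T} \<tau> \<partial>lborel)"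
    by (intro nn_integral_cong) (auto simp: indicator_def)
  also have "\<dots> = ennreal (c * T)" using assms by (simp add: nn_integral_cmult_indicator ennreal_mult)
  finally show ?thesis .
qed

lemma nn_integral_inverse_sqrt:
  fixes t :: real
  assumes t: "0 \<le> t"
  shows "time_integral 0 t (\<lambda>\<tau>. (t - \<tau>) powr (- 1 / 2)) \<le> ennreal (2 * sqrt t)"
proof -
  have "time_integral 0 t (\<lambda>\<tau>. (t - \<tau>) powr (- 1 / 2))
     = (\<integral>\<^sup>+\<tau>. ennreal (if 0 < t - \<tau> \<and> t - \<tau> < t then (t - (t - \<tau>)) powr (- 1 / 2) else 0) \<partial>lborel)"
    by (rule nn_integral_lborel_reflect[of "\<lambda>\<tau>. ennreal (if 0 < \<tau> \<and> \<tau> < t then (t - \<tau>) powr (- 1 / 2) else 0)" t, symmetric]) measurable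
  also have "\<dots> = time_integral 0 t (\<lambda>\<tau>. \<tau> powr (1/2 - 1))"
    by (intro nn_integral_cong) auto
  also have "\<dots> \<le> ennreal (t powr (1/2) / (1/2))" using t by (intro nn_integral_powr_0) auto
  also have "t powr (1/2) / (1/2) = 2 * sqrt t" using t by (simp add: powr_half_sqrt)
  finally show ?thesis .
qed

lemma nn_integral_one_plus_inverse_sqrt:
  fixes t c :: real
  assumes t: "0 \<le> t" and c: "0 \<le> c"
  shows "time_integral 0 t (\<lambda>\<tau>. c * (1 + (t - \<tau>) powr (- 1 / 2))) \<le> ennreal (c * (t + 2 * sqrt t))"
proof -
  have "time_integral 0 t (\<lambda>\<tau>. c * (1 + (t - \<tau>) powr (- 1 / 2)))
    = (\<integral>\<^sup>+\<tau>. ennreal (if 0 < \<tau> \<and> \<tau> < t then c else 0) + ennreal c * ennreal (if 0 < \<tau> \<and> \<tau> < t then (t - \<tau>) powr (- 1 / 2) else 0) \<partial>lborel)"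
    using c by (intro nn_integral_cong) (simp add: distrib_left ennreal_mult)
  also have "\<dots> = time_integral 0 t (\<lambda>\<tau>. c) + (\<integral>\<^sup>+\<tau>. ennreal c * ennreal (if 0 < \<tau> \<and> \<tau> < t then (t - \<tau>) powr (- 1 / 2) else 0) \<partial>lborel)"
    by (rule nn_integral_add) measurable
  also have "(\<integral>\<^sup>+\<tau>. ennreal c * ennreal (if 0 < \<tau> \<and> \<tau> < t then (t - \<tau>) powr (- 1 / 2) else 0) \<partial>lborel)
    = ennreal c * time_integral 0 t (\<lambda>\<tau>. (t - \<tau>) powr (- 1 / 2))"
    by (rule nn_integral_cmult) measurable
  also have "time_integral 0 t (\<lambda>\<tau>. c) = ennreal (c * t)"
    by (rule nn_integral_const_interval[OF t c])
  also have "ennreal (c * t) + ennreal c * time_integral 0 t (\<lambda>\<tau>. (t - \<tau>) powr (- 1 / 2))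
    \<le> ennreal (c * t) + ennreal c * ennreal (2 * sqrt t)"
    by (intro add_left_mono mult_left_mono nn_integral_inverse_sqrt t) simp
  also have "\<dots> = ennreal (c * (t + 2 * sqrt t))" using t c by (simp add: distrib_left ennreal_mult)
  finally show ?thesis .
qed

section \<open>Duhamel integrals for an abstract heat kernel\<close>

locale heat_kernel =
  fixes P :: "real \<Rightarrow> 'a::euclidean_space \<Rightarrow> real" and s K :: real
  assumes s: "0 < s" "s < 1" and K: "0 < K"
    and P_joint: "jointly_measurable P"
    and P_nonneg: "\<And>t x. 0 < t \<Longrightarrow> 0 \<le> P t x"
    and P_mass: "\<And>t. 0 < t \<Longrightarrow> (\<integral>\<^sup>+x. ennreal (P t x) \<partial>lborel) = 1"
    and P_minus: "\<And>t x. P t (- x) = P t x"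
    and P_le_local: "\<And>t x. 0 < t \<Longrightarrow> P t x \<le> K * t powr (- (real DIM('a) / 2))"
    and P_le_frac: "\<And>t x. 0 < t \<Longrightarrow> P t x \<le> K * t powr (- (real DIM('a) / (2 * s)))"
    and P_uniform: "\<And>t e. 0 < t \<Longrightarrow> 0 < e \<Longrightarrow> \<forall>\<^sub>F t' in at t. \<forall>x. \<bar>P t' x - P t x\<bar> \<le> e"
    and P_L1: "\<And>t. 0 < t \<Longrightarrow> ((\<lambda>t'. \<integral>\<^sup>+x. ennreal \<bar>P t' x - P t x\<bar> \<partial>lborel) \<longlongrightarrow> 0) (at t)"
    and P_conc: "\<And>R. 0 < R \<Longrightarrow> ((\<lambda>t. \<integral>\<^sup>+x. ennreal (P t x) * indicator {x. R \<le> norm x} x \<partial>lborel) \<longlongrightarrow> 0) (at_right 0)"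
begin

lemmas P_measurable [measurable (raw)] = jointly_measurableD[OF P_joint]

lemma P_borel [measurable]: "P t \<in> borel_measurable borel"
  by measurable

lemma P_abs_mass: "0 < t \<Longrightarrow> mass (P t) = 1"
  using P_mass[of t] P_nonneg[of t] by simp

lemma nconv_P_L1:
  assumes t: "0 < t" and [measurable]: "u \<in> borel_measurable borel"
  shows "(\<integral>\<^sup>+x. nconv (P t) u x \<partial>lborel) = mass u"
proof -
  have "P t \<in> borel_measurable borel" by measurable
  then show ?thesis by (simp add: nconv_L1 P_abs_mass[OF t])
qed

lemma nconv_P_bound:
  assumes t: "0 < t" and [measurable]: "v \<in> borel_measurable borel"
    and q: "\<And>x. P t x \<le> q" and u: "\<And>y. \<bar>u y\<bar> \<le> M + v y" and v: "\<And>y. 0 \<le> v y" "(\<integral>\<^sup>+y. ennreal (v y) \<partial>lborel) \<le> ennreal V"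
    and "0 \<le> M" "0 \<le> V"
  shows "nconv (P t) u x \<le> ennreal (M + q * V)"
proof -
  have "nconv (P t) u x \<le> ennreal (1 * M + q * V)"
  proof (rule nconv_bound)
    show "P t \<in> borel_measurable borel" by measurable
    show "\<bar>P t x\<bar> \<le> q" for x using q[of x] P_nonneg[OF t, of x] by simp
  qed (use assms P_abs_mass[OF t] in auto)
  then show ?thesis by simp
qed

text \<open>The Tonelli majorant of \<open>duh\<close>: its L^1 norm and its pointwise bounds can be
  computed before integrability in time and space is known.\<close>

definition nduh :: "(real \<Rightarrow> 'a \<Rightarrow> real) \<Rightarrow> real \<Rightarrow> 'a \<Rightarrow> ennreal" where
  "nduh h t x = (\<integral>\<^sup>+\<tau>. (if 0 < \<tau> \<and> \<tau> < t then nconv (P (t - \<tau>)) (h \<tau>) x else 0) \<partial>lborel)"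

definition duh :: "(real \<Rightarrow> 'a \<Rightarrow> real) \<Rightarrow> real \<Rightarrow> 'a \<Rightarrow> real" where
  "duh h t x = (LBINT \<tau>. (if 0 < \<tau> \<and> \<tau> < t then conv (P (t - \<tau>)) (h \<tau>) x else 0))"

lemma duh_le_nduh: "ennreal \<bar>duh h t x\<bar> \<le> nduh h t x"
proof -
  have "ennreal \<bar>duh h t x\<bar> \<le> mass (\<lambda>\<tau>. if 0 < \<tau> \<and> \<tau> < t then conv (P (t - \<tau>)) (h \<tau>) x else 0)"
    unfolding duh_def by (rule abs_integral_le_nn_integral)
  also have "\<dots> \<le> nduh h t x"
    unfolding nduh_def by (intro nn_integral_mono) (simp add: conv_le_nconv)
  finally show ?thesis .
qed

lemma duh_joint:
  assumes h: "jointly_measurable h"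
  shows "jointly_measurable (duh h)"
proof -
  note [measurable (raw)] = jointly_measurableD[OF h]
  show ?thesis unfolding jointly_measurable_def duh_def conv_def by measurable
qed

lemma nduh_L1:
  assumes h: "jointly_measurable h"
  shows "(\<integral>\<^sup>+x. nduh h t x \<partial>lborel) = (\<integral>\<^sup>+\<tau>. (if 0 < \<tau> \<and> \<tau> < t then mass (h \<tau>) else 0) \<partial>lborel)"
proof -
  note [measurable (raw)] = jointly_measurableD[OF h]
  have "(\<integral>\<^sup>+x. nduh h t x \<partial>lborel) = (\<integral>\<^sup>+\<tau>. (\<integral>\<^sup>+x. (if 0 < \<tau> \<and> \<tau> < t then nconv (P (t - \<tau>)) (h \<tau>) x else 0) \<partial>lborel) \<partial>lborel)"
    unfolding nduh_def nconv_def by (rule lborel_pair.Fubini') measurable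
  also have "\<dots> = (\<integral>\<^sup>+\<tau>. (if 0 < \<tau> \<and> \<tau> < t then mass (h \<tau>) else 0) \<partial>lborel)"
    by (intro nn_integral_cong) (auto simp: nconv_P_L1)
  finally show ?thesis .
qed

end

text \<open>\<alpha> is the rate of pointwise decay and \<beta> the rate of growth of the L^1 norm.
  The condition on \<alpha> + \<beta> says that the kernel bound t^(-d/(2s)), applied to a source of
  accumulated mass t^\<beta>, still leaves t^(-\<alpha>) for large t.\<close>

locale heat_exponents = heat_kernel P s K for P :: "real \<Rightarrow> 'a::euclidean_space \<Rightarrow> real" and s K +
  fixes \<alpha> \<beta> :: real
  assumes \<alpha>: "0 < \<alpha>" and \<beta>: "0 < \<beta>" "\<beta> \<le> 1" and \<alpha>\<beta>: "\<alpha> + \<beta> \<le> real DIM('a) / (2 * s)"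
begin

text \<open>The mass bound serves the L^1 norm and the early sources seen at late times, the
  pointwise bound the recent sources. The last clause replaces the pointwise bound before time 1,
  where the source may be unbounded.\<close>

definition source :: "real \<Rightarrow> (real \<Rightarrow> 'a \<Rightarrow> real) \<Rightarrow> bool" where
  "source B h \<longleftrightarrow> jointly_measurable h \<and>
     (\<forall>\<tau>>0. mass (h \<tau>) \<le> ennreal (B * max 1 \<tau> powr (\<beta> - 1))) \<and>
     (\<forall>\<tau>\<ge>1. \<forall>y. \<bar>h \<tau> y\<bar> \<le> B * \<tau> powr (- 1 - \<alpha>)) \<and>
     (\<forall>\<tau>. 0 < \<tau> \<longrightarrow> \<tau> \<le> 1 \<longrightarrow> (\<integral>\<^sup>+y. ennreal (\<bar>h \<tau> y\<bar> ^ DIM('a)) \<partial>lborel) \<le> ennreal (B ^ DIM('a)))"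

text \<open>The weights are constant on (0, 1], so only boundedness is asked at short times; that
  the correction vanishes as t tends to 0 is shown afterwards, from the Duhamel formula.\<close>

definition good :: "real \<Rightarrow> (real \<Rightarrow> 'a \<Rightarrow> real) \<Rightarrow> bool" where
  "good A D \<longleftrightarrow> jointly_measurable D \<and>
     (\<forall>t>0. (\<forall>x. \<bar>D t x\<bar> \<le> A * max 1 t powr (- \<alpha>)) \<and>
        mass (D t) \<le> ennreal (A * max 1 t powr \<beta>))"

lemma sourceD:
  assumes "source B h"
  shows "jointly_measurable h"
    and "0 < \<tau> \<Longrightarrow> mass (h \<tau>) \<le> ennreal (B * max 1 \<tau> powr (\<beta> - 1))"
    and "1 \<le> \<tau> \<Longrightarrow> \<bar>h \<tau> y\<bar> \<le> B * \<tau> powr (- 1 - \<alpha>)"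
    and "0 < \<tau> \<Longrightarrow> \<tau> \<le> 1 \<Longrightarrow> (\<integral>\<^sup>+y. ennreal (\<bar>h \<tau> y\<bar> ^ DIM('a)) \<partial>lborel) \<le> ennreal (B ^ DIM('a))"
  using assms unfolding source_def by auto

text \<open>The weight is at most 1, and at most \<tau>^(\<beta>-1) for all \<tau> > 0; the latter
  is integrable at 0 because \<beta> > 0 and integrates exactly to t^\<beta>/\<beta>.\<close>

lemma source_L1:
  assumes h: "source B h" and B: "0 \<le> B" and \<tau>: "0 < \<tau>"
  shows "mass (h \<tau>) \<le> ennreal B"
    and "mass (h \<tau>) \<le> ennreal (B * \<tau> powr (\<beta> - 1))"
proof -
  have "max 1 \<tau> powr (\<beta> - 1) \<le> max 1 \<tau> powr 0" using \<beta> by (intro powr_mono) auto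
  also have "\<dots> = 1" by (simp add: max_def)
  finally have "B * max 1 \<tau> powr (\<beta> - 1) \<le> B" using B by (simp add: mult_left_le)
  then show "mass (h \<tau>) \<le> ennreal B"
    using sourceD(2)[OF h \<tau>] by (meson ennreal_leI order_trans)
  have "max 1 \<tau> powr (\<beta> - 1) \<le> \<tau> powr (\<beta> - 1)" using \<beta> \<tau> by (intro powr_mono2') auto
  then have "B * max 1 \<tau> powr (\<beta> - 1) \<le> B * \<tau> powr (\<beta> - 1)" using B by (simp add: mult_left_mono)
  then show "mass (h \<tau>) \<le> ennreal (B * \<tau> powr (\<beta> - 1))"
    using sourceD(2)[OF h \<tau>] by (meson ennreal_leI order_trans)
qed

lemma le_add_power_div:
  fixes z M :: real
  assumes "0 < M" "0 \<le> z"
  shows "z \<le> M + z ^ Suc n / M ^ n"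
proof (cases "z \<le> M")
  case False
  then have "1 \<le> (z / M) ^ n" using assms by (intro one_le_power) (simp add: le_divide_eq)
  then have "z * 1 \<le> z * (z / M) ^ n" using assms by (intro mult_left_mono) auto
  then show ?thesis using assms by (simp add: power_divide)
qed (use assms in \<open>simp add: add_increasing2\<close>)

lemma nconv_source_local:
  assumes h: "source B h" and B: "0 < B" and \<tau>: "0 < \<tau>" "\<tau> < t"
  shows "nconv (P (t - \<tau>)) (h \<tau>) x \<le> ennreal ((1 + K) * B * (1 + (t - \<tau>) powr (- 1 / 2)))"
proof -
  note [measurable (raw)] = jointly_measurableD[OF sourceD(1)[OF h]]
  define a where "a = t - \<tau>"
  have a: "0 < a" using \<tau> unfolding a_def by simp
  show ?thesis
  proof (cases "\<tau> \<le> 1")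
    case True
    obtain n where n: "DIM('a) = Suc n" using DIM_positive[where 'a='a] gr0_implies_Suc by blast
    \<comment> \<open>The height that balances \<open>nconv_P_bound\<close>: both M and K a^(-d/2)
      B^d / M^(d-1) are multiples of B a^(-1/2).\<close>
    define M where "M = B * a powr (- 1 / 2)"
    have M: "0 < M" unfolding M_def using B a by simp
    have "nconv (P a) (h \<tau>) x \<le> ennreal (M + (K * a powr (- (real DIM('a) / 2))) * (B ^ Suc n / M ^ n))"
    proof (rule nconv_P_bound[OF a, where v="\<lambda>y. \<bar>h \<tau> y\<bar> ^ Suc n / M ^ n"])
      show "P a x \<le> K * a powr (- (real DIM('a) / 2))" for x by (rule P_le_local[OF a])
      show "\<bar>h \<tau> y\<bar> \<le> M + \<bar>h \<tau> y\<bar> ^ Suc n / M ^ n" for y using M by (intro le_add_power_div) auto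
      have "(\<integral>\<^sup>+y. ennreal (\<bar>h \<tau> y\<bar> ^ Suc n / M ^ n) \<partial>lborel) = (\<integral>\<^sup>+y. ennreal (\<bar>h \<tau> y\<bar> ^ Suc n) * ennreal (1 / M ^ n) \<partial>lborel)"
        using M by (intro nn_integral_cong) (simp flip: ennreal_mult)
      also have "\<dots> = (\<integral>\<^sup>+y. ennreal (\<bar>h \<tau> y\<bar> ^ Suc n) \<partial>lborel) * ennreal (1 / M ^ n)"
        by (rule nn_integral_multc) measurable
      also have "\<dots> \<le> ennreal (B ^ Suc n) * ennreal (1 / M ^ n)"
        using sourceD(4)[OF h \<tau>(1) True] unfolding n by (intro mult_right_mono) auto
      also have "\<dots> = ennreal (B ^ Suc n / M ^ n)" using B M by (simp flip: ennreal_mult)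
      finally show "(\<integral>\<^sup>+y. ennreal (\<bar>h \<tau> y\<bar> ^ Suc n / M ^ n) \<partial>lborel) \<le> ennreal (B ^ Suc n / M ^ n)" .
    qed (use M B in \<open>simp_all, measurable\<close>)
    also have "M + (K * a powr (- (real DIM('a) / 2))) * (B ^ Suc n / M ^ n) = (1 + K) * B * a powr (- 1 / 2)"
    proof -
      have "M ^ n = B ^ n * a powr (- real n / 2)"
        unfolding M_def power_mult_distrib using a by (simp add: powr_realpow[symmetric] powr_powr mult.commute)
      then have "B ^ Suc n / M ^ n = B * a powr (real n / 2)"
        using B by (simp add: powr_minus field_simps)
      moreover have "a powr (- (real DIM('a) / 2)) * a powr (real n / 2) = a powr (- 1 / 2)"
        unfolding powr_add[symmetric] n by (simp add: field_simps)
      ultimately have "(K * a powr (- (real DIM('a) / 2))) * (B ^ Suc n / M ^ n) = K * (B * a powr (- 1 / 2))"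
        by (simp only: mult_ac)
      then show ?thesis unfolding M_def by (simp add: algebra_simps)
    qed
    also have "\<dots> \<le> (1 + K) * B * (1 + a powr (- 1 / 2))" using K B by (intro mult_left_mono) auto
    finally show ?thesis unfolding a_def by (simp add: ennreal_leI)
  next
    case False
    have "nconv (P a) (h \<tau>) x \<le> ennreal (B + (K * a powr (- (real DIM('a) / 2))) * 0)"
    proof (rule nconv_P_bound[OF a, where v="\<lambda>y. 0"])
      show "P a x \<le> K * a powr (- (real DIM('a) / 2))" for x by (rule P_le_local[OF a])
      fix y
      have "\<bar>h \<tau> y\<bar> \<le> B * \<tau> powr (- 1 - \<alpha>)" using False by (intro sourceD(3)[OF h]) auto
      also have "\<dots> \<le> B * \<tau> powr 0" using False B \<alpha> by (intro mult_left_mono powr_mono) auto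
      finally show "\<bar>h \<tau> y\<bar> \<le> B + 0" using False by simp
    qed (use B in auto)
    also have "B + (K * a powr (- (real DIM('a) / 2))) * 0 \<le> (1 + K) * B * (1 + a powr (- 1 / 2))"
      using K B mult_mono[of 1 "1 + K" B "B * (1 + a powr (- 1 / 2))"] by (simp add: mult.assoc)
    finally show ?thesis unfolding a_def by (simp add: ennreal_leI)
  qed
qed

lemma nduh_source_local:
  assumes h: "source B h" and B: "0 < B" and t: "0 \<le> t"
  shows "nduh h t x \<le> ennreal ((1 + K) * B * (t + 2 * sqrt t))"
proof -
  have "nduh h t x \<le> time_integral 0 t (\<lambda>\<tau>. ((1 + K) * B) * (1 + (t - \<tau>) powr (- 1 / 2)))"
    unfolding nduh_def
  proof (intro nn_integral_mono)
    fix \<tau>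
    show "(if 0 < \<tau> \<and> \<tau> < t then nconv (P (t - \<tau>)) (h \<tau>) x else 0) \<le>
       ennreal (if 0 < \<tau> \<and> \<tau> < t then ((1 + K) * B) * (1 + (t - \<tau>) powr (- 1 / 2)) else 0)"
      using nconv_source_local[OF h B, of \<tau> t x] by auto
  qed
  also have "\<dots> \<le> ennreal ((1 + K) * B * (t + 2 * sqrt t))"
    using K B t by (intro nn_integral_one_plus_inverse_sqrt) auto
  finally show ?thesis .
qed

lemma nduh_source_L1:
  assumes h: "source B h" and B: "0 < B" and t: "0 \<le> t"
  shows "(\<integral>\<^sup>+x. nduh h t x \<partial>lborel) \<le> ennreal (B / \<beta> * t powr \<beta>)"
proof -
  have "(\<integral>\<^sup>+x. nduh h t x \<partial>lborel) \<le> (\<integral>\<^sup>+\<tau>. ennreal B * ennreal (if 0 < \<tau> \<and> \<tau> < t then \<tau> powr (\<beta> - 1) else 0) \<partial>lborel)"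
    unfolding nduh_L1[OF sourceD(1)[OF h]]
    using source_L1(2)[OF h] B by (intro nn_integral_mono) (auto simp flip: ennreal_mult)
  also have "\<dots> = ennreal B * time_integral 0 t (\<lambda>\<tau>. \<tau> powr (\<beta> - 1))"
    by (rule nn_integral_cmult) measurable
  also have "\<dots> \<le> ennreal B * ennreal (t powr \<beta> / \<beta>)"
    by (intro mult_left_mono nn_integral_powr_0 \<beta> t) simp
  also have "\<dots> = ennreal (B / \<beta> * t powr \<beta>)" using B \<beta> by (simp flip: ennreal_mult)
  finally show ?thesis .
qed

text \<open>Up to t/2 the supremum of the kernel meets the mass of the source; after t/2 the mass of
  the kernel meets the pointwise decay (t/2)^(-1-\<alpha>) over a time of length at most t. The
  assumption t \<ge> 2 gives t/2 \<ge> 1, so the exponent d/(2s) may be lowered to \<alpha> +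
  \<beta> and the pointwise bound is available.\<close>

lemma nduh_source_decay:
  assumes h: "source B h" and B: "0 < B" and t: "2 \<le> t"
  shows "nduh h t x \<le> ennreal (B * (t / 2) powr (- \<alpha>) * (2 * K / \<beta> + 2))"
proof -
  note [measurable (raw)] = jointly_measurableD[OF sourceD(1)[OF h]]
  define c1 where "c1 = K * (t/2) powr (- (\<alpha> + \<beta>)) * B"
  define c2 where "c2 = B * (t/2) powr (- 1 - \<alpha>)"
  have c: "0 \<le> c1" "0 \<le> c2" unfolding c1_def c2_def using K B by auto
  have ptw: "(if 0 < \<tau> \<and> \<tau> < t then nconv (P (t - \<tau>)) (h \<tau>) x else 0) \<le>
     ennreal c1 * ennreal (if 0 < \<tau> \<and> \<tau> < t then \<tau> powr (\<beta> - 1) else 0) + ennreal (if 0 < \<tau> \<and> \<tau> < t then c2 else 0)" for \<tau>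
  proof (cases "0 < \<tau> \<and> \<tau> < t")
    case True
    then have \<tau>: "0 < \<tau>" "0 < t - \<tau>" by auto
    have "nconv (P (t - \<tau>)) (h \<tau>) x \<le> ennreal (c1 * \<tau> powr (\<beta> - 1) + c2)"
    proof (cases "\<tau> \<le> t / 2")
      case True
      have "nconv (P (t - \<tau>)) (h \<tau>) x \<le> ennreal (0 + (K * (t/2) powr (- (\<alpha> + \<beta>))) * (B * \<tau> powr (\<beta> - 1)))"
      proof (rule nconv_P_bound[OF \<tau>(2), where v="\<lambda>y. \<bar>h \<tau> y\<bar>"])
        fix x
        have "P (t - \<tau>) x \<le> K * (t - \<tau>) powr (- (real DIM('a) / (2 * s)))" by (rule P_le_frac[OF \<tau>(2)])
        also have "\<dots> \<le> K * (t/2) powr (- (real DIM('a) / (2 * s)))"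
          using True K t s by (intro mult_left_mono powr_mono2') auto
        also have "\<dots> \<le> K * (t/2) powr (- (\<alpha> + \<beta>))"
          using t K \<alpha>\<beta> by (intro mult_left_mono powr_mono) auto
        finally show "P (t - \<tau>) x \<le> K * (t/2) powr (- (\<alpha> + \<beta>))" .
      qed (use B source_L1(2)[OF h _ \<tau>(1)] in \<open>simp_all, measurable\<close>)
      also have "0 + (K * (t/2) powr (- (\<alpha> + \<beta>))) * (B * \<tau> powr (\<beta> - 1)) \<le> c1 * \<tau> powr (\<beta> - 1) + c2"
        using c unfolding c1_def by (simp add: mult.assoc)
      finally show ?thesis by (simp add: ennreal_leI)
    next
      case False
      have "nconv (P (t - \<tau>)) (h \<tau>) x \<le> ennreal (c2 + (K * (t - \<tau>) powr (- (real DIM('a) / 2))) * 0)"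
      proof (rule nconv_P_bound[OF \<tau>(2), where v="\<lambda>y. 0"])
        show "P (t - \<tau>) x \<le> K * (t - \<tau>) powr (- (real DIM('a) / 2))" for x by (rule P_le_local[OF \<tau>(2)])
        fix y
        have "\<bar>h \<tau> y\<bar> \<le> B * \<tau> powr (- 1 - \<alpha>)" using False t by (intro sourceD(3)[OF h]) auto
        also have "\<dots> \<le> c2" unfolding c2_def using False t B \<alpha> by (intro mult_left_mono powr_mono2') auto
        finally show "\<bar>h \<tau> y\<bar> \<le> c2 + 0" by simp
      qed (use c in auto)
      also have "c2 + (K * (t - \<tau>) powr (- (real DIM('a) / 2))) * 0 \<le> c1 * \<tau> powr (\<beta> - 1) + c2"
        using c by simp
      finally show ?thesis by (simp add: ennreal_leI)
    qed
    then show ?thesis using True c by (simp add: ennreal_mult)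
  next
    case False
    then show ?thesis by (simp only: if_False zero_le)
  qed
  have "nduh h t x \<le> (\<integral>\<^sup>+\<tau>. ennreal c1 * ennreal (if 0 < \<tau> \<and> \<tau> < t then \<tau> powr (\<beta> - 1) else 0) + ennreal (if 0 < \<tau> \<and> \<tau> < t then c2 else 0) \<partial>lborel)"
    unfolding nduh_def by (intro nn_integral_mono ptw)
  also have "\<dots> = (\<integral>\<^sup>+\<tau>. ennreal c1 * ennreal (if 0 < \<tau> \<and> \<tau> < t then \<tau> powr (\<beta> - 1) else 0) \<partial>lborel) + time_integral 0 t (\<lambda>\<tau>. c2)"
    by (rule nn_integral_add) measurable
  also have "(\<integral>\<^sup>+\<tau>. ennreal c1 * ennreal (if 0 < \<tau> \<and> \<tau> < t then \<tau> powr (\<beta> - 1) else 0) \<partial>lborel)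
     = ennreal c1 * time_integral 0 t (\<lambda>\<tau>. \<tau> powr (\<beta> - 1))"
    by (rule nn_integral_cmult) measurable
  also have "time_integral 0 t (\<lambda>\<tau>. c2) = ennreal (c2 * t)"
    using t c by (intro nn_integral_const_interval) auto
  also have "ennreal c1 * time_integral 0 t (\<lambda>\<tau>. \<tau> powr (\<beta> - 1)) + ennreal (c2 * t)
     \<le> ennreal c1 * ennreal (t powr \<beta> / \<beta>) + ennreal (c2 * t)"
    using t by (intro add_right_mono mult_left_mono nn_integral_powr_0 \<beta>) auto
  also have "\<dots> = ennreal (c1 * (t powr \<beta> / \<beta>) + c2 * t)"
    using c \<beta> t by (simp flip: ennreal_mult ennreal_plus)
  also have "c1 * (t powr \<beta> / \<beta>) + c2 * t \<le> B * (t / 2) powr (- \<alpha>) * (2 * K / \<beta> + 2)"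
  proof -
    define r where "r = t / 2"
    have r: "0 < r" "t = 2 * r" using t unfolding r_def by auto
    have "t powr \<beta> = 2 powr \<beta> * r powr \<beta>" using r by (simp add: powr_mult)
    also have "\<dots> \<le> 2 powr 1 * r powr \<beta>" using \<beta> by (intro mult_right_mono powr_mono) auto
    finally have tb: "t powr \<beta> \<le> 2 * r powr \<beta>" by simp
    have "c1 * (t powr \<beta> / \<beta>) \<le> c1 * (2 * r powr \<beta> / \<beta>)"
      using tb c \<beta> by (intro mult_left_mono divide_right_mono) auto
    also have "\<dots> = (r powr (- (\<alpha> + \<beta>)) * r powr \<beta>) * (B * (2 * K / \<beta>))"
      unfolding c1_def r_def[symmetric] by simp
    also have "r powr (- (\<alpha> + \<beta>)) * r powr \<beta> = r powr (- \<alpha>)" by (simp flip: powr_add)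
    finally have 1: "c1 * (t powr \<beta> / \<beta>) \<le> r powr (- \<alpha>) * (B * (2 * K / \<beta>))" .
    have "c2 * t = (r powr (- 1 - \<alpha>) * r powr 1) * (B * 2)"
      unfolding c2_def r_def[symmetric] using r by simp
    also have "r powr (- 1 - \<alpha>) * r powr 1 = r powr (- \<alpha>)" by (simp only: powr_add[symmetric]) simp
    finally have 2: "c2 * t = r powr (- \<alpha>) * (B * 2)" .
    show ?thesis unfolding r_def[symmetric] using 1 2 by (simp add: algebra_simps)
  qed
  finally show ?thesis by (simp add: ennreal_leI)
qed

text \<open>One summand for each estimate: t \<le> 2, where t + 2 sqrt t \<le> 6 and the weight is
  at least 2^(-\<alpha>); t \<ge> 2; and the L^1 bound.\<close>

definition A0 :: real where
  "A0 = (1 + K) * 6 * 2 powr \<alpha> + 2 powr \<alpha> * (2 * K / \<beta> + 2) + 1 / \<beta>"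

lemma A0_pos: "0 < A0"
  unfolding A0_def using K \<beta> by (simp add: add_pos_pos)

lemma nduh_source:
  assumes h: "source B h" and B: "0 < B" and t: "0 < t"
  shows "nduh h t x \<le> ennreal (A0 * B * max 1 t powr (- \<alpha>))"
    and "(\<integral>\<^sup>+x. nduh h t x \<partial>lborel) \<le> ennreal (A0 * B * max 1 t powr \<beta>)"
proof -
  have A0: "(1 + K) * 6 * 2 powr \<alpha> \<le> A0" "2 powr \<alpha> * (2 * K / \<beta> + 2) \<le> A0" "1 / \<beta> \<le> A0"
    unfolding A0_def using K \<beta> by auto
  have "B / \<beta> * t powr \<beta> \<le> A0 * B * max 1 t powr \<beta>"
  proof (rule mult_mono)
    show "B / \<beta> \<le> A0 * B" using mult_right_mono[OF A0(3), of B] B by simp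
  qed (use A0_pos B \<beta> t in \<open>auto intro!: powr_mono2\<close>)
  then show "(\<integral>\<^sup>+x. nduh h t x \<partial>lborel) \<le> ennreal (A0 * B * max 1 t powr \<beta>)"
    using nduh_source_L1[OF h B, of t] t by (meson ennreal_leI order_trans less_imp_le)
  show "nduh h t x \<le> ennreal (A0 * B * max 1 t powr (- \<alpha>))"
  proof (cases "t \<le> 2")
    case True
    have "sqrt t \<le> 2" using True by (intro real_le_lsqrt) (auto simp: t less_imp_le)
    then have "(1 + K) * B * (t + 2 * sqrt t) \<le> (1 + K) * B * 6" using True K B by (intro mult_left_mono) auto
    also have "\<dots> = (1 + K) * 6 * 2 powr \<alpha> * B * 2 powr (- \<alpha>)" by (simp add: powr_minus)
    also have "\<dots> \<le> A0 * B * max 1 t powr (- \<alpha>)"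
      using A0(1) A0_pos B True \<alpha> by (intro mult_mono powr_mono2') auto
    finally show ?thesis using nduh_source_local[OF h B, of t x] t by (meson ennreal_leI order_trans less_imp_le)
  next
    case False
    then have "(t / 2) powr (- \<alpha>) = 2 powr \<alpha> * t powr (- \<alpha>)" by (simp add: powr_divide powr_minus field_simps)
    then have "B * (t / 2) powr (- \<alpha>) * (2 * K / \<beta> + 2) = (2 powr \<alpha> * (2 * K / \<beta> + 2)) * (B * t powr (- \<alpha>))" by simp
    also have "\<dots> \<le> A0 * (B * t powr (- \<alpha>))" using A0(2) B by (intro mult_right_mono) auto
    also have "\<dots> = A0 * B * max 1 t powr (- \<alpha>)" using False by simp
    finally show ?thesis using nduh_source_decay[OF h B, of t x] False by (meson ennreal_leI order_trans linear)
  qed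
qed

lemma good_duh:
  assumes h: "source B h" and B: "0 < B"
  shows "good (A0 * B) (duh h)"
  unfolding good_def
proof (intro conjI allI impI duh_joint sourceD(1)[OF h])
  fix t :: real assume t: "0 < t"
  show "\<bar>duh h t x\<bar> \<le> A0 * B * max 1 t powr (- \<alpha>)" for x
    using order_trans[OF duh_le_nduh nduh_source(1)[OF h B t], of x] A0_pos B by (subst (asm) ennreal_le_iff) auto
  have "mass (duh h t) \<le> (\<integral>\<^sup>+x. nduh h t x \<partial>lborel)"
    by (intro nn_integral_mono duh_le_nduh)
  then show "mass (duh h t) \<le> ennreal (A0 * B * max 1 t powr \<beta>)"
    using nduh_source(2)[OF h B t] by (rule order_trans)
qed

lemma conv_source_integrable:
  assumes h: "source B h" and B: "0 < B" and \<tau>: "0 < \<tau>" "\<tau> < t"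
  shows "integrable lborel (\<lambda>y. P (t - \<tau>) (x - y) * h \<tau> y)"
proof (rule integrableI_bounded)
  note [measurable (raw)] = jointly_measurableD[OF sourceD(1)[OF h]]
  show "(\<lambda>y. P (t - \<tau>) (x - y) * h \<tau> y) \<in> borel_measurable lborel" by measurable
  show "(\<integral>\<^sup>+y. ennreal (norm (P (t - \<tau>) (x - y) * h \<tau> y)) \<partial>lborel) < \<infinity>"
    using nconv_source_local[OF h B \<tau>, of x] unfolding nconv_def real_norm_def
    by (metis ennreal_less_top infinity_ennreal_def le_less_trans)
qed

lemma duh_source_integrable:
  assumes h: "source B h" and B: "0 < B" and t: "0 < t"
  shows "integrable lborel (\<lambda>\<tau>. if 0 < \<tau> \<and> \<tau> < t then conv (P (t - \<tau>)) (h \<tau>) x else 0)"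
proof (rule integrableI_bounded)
  note [measurable (raw)] = jointly_measurableD[OF sourceD(1)[OF h]]
  show "(\<lambda>\<tau>. if 0 < \<tau> \<and> \<tau> < t then conv (P (t - \<tau>)) (h \<tau>) x else 0) \<in> borel_measurable lborel"
    unfolding conv_def by measurable
  have "(\<integral>\<^sup>+\<tau>. ennreal (norm (if 0 < \<tau> \<and> \<tau> < t then conv (P (t - \<tau>)) (h \<tau>) x else 0)) \<partial>lborel) \<le> nduh h t x"
    unfolding nduh_def by (intro nn_integral_mono) (simp add: conv_le_nconv)
  also have "\<dots> < \<infinity>" using nduh_source(1)[OF h B t, of x]
    by (metis ennreal_less_top infinity_ennreal_def le_less_trans)
  finally show "(\<integral>\<^sup>+\<tau>. ennreal (norm (if 0 < \<tau> \<and> \<tau> < t then conv (P (t - \<tau>)) (h \<tau>) x else 0)) \<partial>lborel) < \<infinity>" .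
qed

text \<open>Additivity of Bochner integrals needs integrability of both terms; the source bounds
  give it at every point, in space and then in time.\<close>

lemma duh_diff:
  assumes h: "source B h" "source B' h'" and B: "0 < B" "0 < B'" and t: "0 < t"
  shows "duh (\<lambda>\<tau> y. h \<tau> y - h' \<tau> y) t x = duh h t x - duh h' t x"
proof -
  have "conv (P (t - \<tau>)) (\<lambda>y. h \<tau> y - h' \<tau> y) x = conv (P (t - \<tau>)) (h \<tau>) x - conv (P (t - \<tau>)) (h' \<tau>) x"
    if "0 < \<tau>" "\<tau> < t" for \<tau>
    unfolding conv_def right_diff_distrib
    by (intro Bochner_Integration.integral_diff conv_source_integrable[OF h(1) B(1)] conv_source_integrable[OF h(2) B(2)] that)
  then have "duh (\<lambda>\<tau> y. h \<tau> y - h' \<tau> y) t x = (LBINT \<tau>. (if 0 < \<tau> \<and> \<tau> < t then conv (P (t - \<tau>)) (h \<tau>) x else 0) - (if 0 < \<tau> \<and> \<tau> < t then conv (P (t - \<tau>)) (h' \<tau>) x else 0))"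
    unfolding duh_def by (intro Bochner_Integration.integral_cong) auto
  also have "\<dots> = duh h t x - duh h' t x"
    unfolding duh_def by (intro Bochner_Integration.integral_diff duh_source_integrable[OF h(1) B(1) t] duh_source_integrable[OF h(2) B(2) t])
  finally show ?thesis .
qed

end

lemma le_add_powr_div:
  fixes z M r :: real
  assumes "0 < M" "0 \<le> z" "1 \<le> r"
  shows "z \<le> M + z powr r / M powr (r - 1)"
proof (cases "z \<le> M")
  case True
  then show ?thesis by (simp add: add_increasing2)
next
  case False
  then have "1 \<le> (z / M) powr (r - 1)" using assms by (intro ge_one_powr_ge_zero) (simp_all add: le_divide_eq)
  then have "z * 1 \<le> z * (z / M) powr (r - 1)" using assms by (intro mult_left_mono) auto
  also have "\<dots> = z powr r / M powr (r - 1)"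
    using assms False by (simp add: powr_divide powr_mult_base)
  finally show ?thesis using assms by simp
qed

text \<open>The embedding of exp L^p into L^a for a \<ge> p, homogeneous in the scale \<mu>. It is
  used with the critical exponent of the problem and with a = p.\<close>

lemma modular_powr_integral:
  assumes p: "1 \<le> p" and a: "p \<le> a"
  obtains c where "1 \<le> c" "\<And>\<mu> u. 0 < \<mu> \<Longrightarrow> u \<in> borel_measurable borel \<Longrightarrow> modular p \<mu> u \<le> 1 \<Longrightarrow>
     (\<integral>\<^sup>+(x::'a::euclidean_space). ennreal (\<bar>u x\<bar> powr a) \<partial>lborel) \<le> ennreal (c * \<mu> powr a)"
proof -
  obtain c where c: "1 \<le> c" "\<And>y. 0 \<le> y \<Longrightarrow> y powr a * exp (y powr p / 4) \<le> c * young p y"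
    using powr_exp_le_young[OF p a] by metis
  have "(\<integral>\<^sup>+(x::'a). ennreal (\<bar>u x\<bar> powr a) \<partial>lborel) \<le> ennreal (c * \<mu> powr a)"
    if \<mu>: "0 < \<mu>" and u[measurable]: "u \<in> borel_measurable borel" and m: "modular p \<mu> u \<le> 1" for \<mu> and u :: "'a \<Rightarrow> real"
  proof -
    have le: "\<bar>u x\<bar> powr a \<le> (c * \<mu> powr a) * young p (\<bar>u x\<bar> / \<mu>)" for x
    proof -
      have "(\<bar>u x\<bar> / \<mu>) powr a * 1 \<le> (\<bar>u x\<bar> / \<mu>) powr a * exp ((\<bar>u x\<bar> / \<mu>) powr p / 4)"
        by (intro mult_left_mono) auto
      also have "\<dots> \<le> c * young p (\<bar>u x\<bar> / \<mu>)" using \<mu> by (intro c) auto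
      finally have "\<mu> powr a * (\<bar>u x\<bar> / \<mu>) powr a \<le> \<mu> powr a * (c * young p (\<bar>u x\<bar> / \<mu>))" by (intro mult_left_mono) auto
      then show ?thesis using \<mu> by (simp add: powr_divide mult_ac)
    qed
    have "(\<integral>\<^sup>+(x::'a). ennreal (\<bar>u x\<bar> powr a) \<partial>lborel) \<le> (\<integral>\<^sup>+x. ennreal (c * \<mu> powr a) * ennreal (young p (\<bar>u x\<bar> / \<mu>)) \<partial>lborel)"
      using le c(1) young_nonneg[of p] by (intro nn_integral_mono) (simp flip: ennreal_mult add: ennreal_leI)
    also have "\<dots> = ennreal (c * \<mu> powr a) * modular p \<mu> u"
      unfolding modular_def by (rule nn_integral_cmult) measurable
    also have "\<dots> \<le> ennreal (c * \<mu> powr a) * 1" by (intro mult_left_mono m) simp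
    finally show ?thesis by simp
  qed
  with c(1) show thesis by (rule that)
qed

context heat_exponents
begin

lemma goodD:
  assumes "good A D"
  shows "jointly_measurable D"
    and "0 < t \<Longrightarrow> \<bar>D t x\<bar> \<le> A * max 1 t powr (- \<alpha>)"
    and "0 < t \<Longrightarrow> mass (D t) \<le> ennreal (A * max 1 t powr \<beta>)"
  using assms unfolding good_def by auto

lemma good_mono:
  assumes D: "good A D" and A: "A \<le> B"
  shows "good B D"
  unfolding good_def
proof (intro conjI allI impI goodD(1)[OF D])
  fix t :: real assume t: "0 < t"
  show "\<bar>D t x\<bar> \<le> B * max 1 t powr (- \<alpha>)" for x
    using goodD(2)[OF D t, of x] mult_right_mono[OF A, of "max 1 t powr (- \<alpha>)"] by simp
  have "A * max 1 t powr \<beta> \<le> B * max 1 t powr \<beta>" using A by (intro mult_right_mono) auto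
  then show "mass (D t) \<le> ennreal (B * max 1 t powr \<beta>)"
    using goodD(3)[OF D t] by (meson ennreal_leI order_trans)
qed

lemma good_cong:
  assumes D: "good A D" and "jointly_measurable D'" and "\<And>t x. 0 < t \<Longrightarrow> D' t x = D t x"
  shows "good A D'"
  using assms unfolding good_def by simp

lemma good_zero: "good 0 (\<lambda>t x. 0)"
  unfolding good_def jointly_measurable_def by simp

lemma jointly_measurable_add:
  assumes D: "jointly_measurable D" "jointly_measurable E"
  shows "jointly_measurable (\<lambda>t x. D t x + E t x)"
  using D unfolding jointly_measurable_def by measurable

lemma jointly_measurable_diff:
  assumes D: "jointly_measurable D" "jointly_measurable E"
  shows "jointly_measurable (\<lambda>t x. D t x - E t x)"
  using D unfolding jointly_measurable_def by measurable

lemma good_add: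
  assumes D: "good A D" and E: "good B E" and AB: "0 \<le> A" "0 \<le> B"
  shows "good (A + B) (\<lambda>t x. D t x + E t x)"
  unfolding good_def
proof (intro conjI allI impI)
  note [measurable (raw)] = jointly_measurableD[OF goodD(1)[OF D]] jointly_measurableD[OF goodD(1)[OF E]]
  show "jointly_measurable (\<lambda>t x. D t x + E t x)"
    by (intro jointly_measurable_add goodD(1)[OF D] goodD(1)[OF E])
  fix t :: real assume t: "0 < t"
  show "\<bar>D t x + E t x\<bar> \<le> (A + B) * max 1 t powr (- \<alpha>)" for x
    using goodD(2)[OF D t, of x] goodD(2)[OF E t, of x] unfolding distrib_right by linarith
  have "mass (\<lambda>x. D t x + E t x) \<le> (\<integral>\<^sup>+x. ennreal \<bar>D t x\<bar> + ennreal \<bar>E t x\<bar> \<partial>lborel)"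
    by (intro nn_integral_mono) (simp flip: ennreal_plus add: ennreal_leI abs_triangle_ineq)
  also have "\<dots> = mass (D t) + mass (E t)"
    by (rule nn_integral_add) measurable
  also have "\<dots> \<le> ennreal (A * max 1 t powr \<beta>) + ennreal (B * max 1 t powr \<beta>)"
    by (intro add_mono goodD(3)[OF D t] goodD(3)[OF E t])
  also have "\<dots> = ennreal ((A + B) * max 1 t powr \<beta>)" using AB by (simp add: distrib_right)
  finally show "mass (\<lambda>x. D t x + E t x) \<le> ennreal ((A + B) * max 1 t powr \<beta>)" .
qed

text \<open>Pointwise convergence suffices: the supremum bound passes to the limit directly and the
  L^1 bound by Fatou's lemma.\<close>

lemma good_limit:
  assumes F: "\<And>k::nat. good A (F k)" and D: "jointly_measurable D"
    and lim: "\<And>t x. 0 < t \<Longrightarrow> (\<lambda>k. F k t x) \<longlonglongrightarrow> D t x"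
  shows "good A D"
  unfolding good_def
proof (intro conjI allI impI D)
  fix t :: real assume t: "0 < t"
  have [measurable]: "F k t \<in> borel_measurable borel" for k
  proof -
    note [measurable (raw)] = jointly_measurableD[OF goodD(1)[OF F[of k]]]
    show ?thesis by measurable
  qed
  have lim': "(\<lambda>k. \<bar>F k t x\<bar>) \<longlonglongrightarrow> \<bar>D t x\<bar>" for x by (intro tendsto_rabs lim t)
  show "\<bar>D t x\<bar> \<le> A * max 1 t powr (- \<alpha>)" for x
    by (rule LIMSEQ_le_const2[OF lim'[of x]]) (use goodD(2)[OF F t] in auto)
  have "mass (D t) = (\<integral>\<^sup>+x. liminf (\<lambda>k. ennreal \<bar>F k t x\<bar>) \<partial>lborel)"
  proof (intro nn_integral_cong)
    fix x
    have "(\<lambda>k. ennreal \<bar>F k t x\<bar>) \<longlonglongrightarrow> ennreal \<bar>D t x\<bar>" by (intro tendsto_ennrealI lim')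
    from lim_imp_Liminf[OF _ this] show "ennreal \<bar>D t x\<bar> = liminf (\<lambda>k. ennreal \<bar>F k t x\<bar>)" by simp
  qed
  also have "\<dots> \<le> liminf (\<lambda>k. \<integral>\<^sup>+x. ennreal \<bar>F k t x\<bar> \<partial>lborel)" by (rule nn_integral_liminf) measurable
  also have "\<dots> \<le> ennreal (A * max 1 t powr \<beta>)"
    using goodD(3)[OF F t] by (intro Liminf_le) auto
  finally show "mass (D t) \<le> ennreal (A * max 1 t powr \<beta>)" .
qed

end

section \<open>The linear semigroup on exponential spaces\<close>

locale mild_problem = heat_kernel P s K for P :: "real \<Rightarrow> 'a::euclidean_space \<Rightarrow> real" and s K +
  fixes m p C lam :: real and f :: "real \<Rightarrow> real"
  assumes pm: "p \<le> m" and p1: "1 < p" and p_le: "p \<le> real DIM('a) * (m - 1) / (2 * s)"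
    and f0: "f 0 = 0" and C: "0 < C" and lam: "0 < lam"
    and f_lip: "\<And>u v. \<bar>f u - f v\<bar> \<le> C * \<bar>u - v\<bar> *
       (\<bar>u\<bar> powr (m - 1) * exp (lam * \<bar>u\<bar> powr p) + \<bar>v\<bar> powr (m - 1) * exp (lam * \<bar>v\<bar> powr p))"
begin

text \<open>\<alpha> m = 1 + \<alpha>, so the nonlinearity decays one power of time faster than the
  solution. \<beta> - 1 = - \<alpha> (m - p) is the decay that remains after p of the m powers of u
  are spent on the modular.\<close>

definition \<alpha> :: real where "\<alpha> = 1 / (m - 1)"
definition \<beta> :: real where "\<beta> = (p - 1) / (m - 1)"

lemma m1: "1 < m" using pm p1 by linarith

lemma \<alpha>_m: "\<alpha> * (m - 1) = 1" "\<alpha> * m = 1 + \<alpha>" "\<alpha> * (m - p) = 1 - \<beta>" "\<alpha> * (p - 1) = \<beta>" "\<alpha> + \<beta> = \<alpha> * p" "0 < \<alpha>"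
  using m1 unfolding \<alpha>_def \<beta>_def by (simp_all add: field_simps)

lemma \<alpha>p_le: "\<alpha> * p \<le> real DIM('a) / (2 * s)"
proof -
  have "\<alpha> * p \<le> \<alpha> * (real DIM('a) * (m - 1) / (2 * s))" by (rule mult_left_mono[OF p_le less_imp_le[OF \<alpha>_m(6)]])
  also have "\<dots> = (\<alpha> * (m - 1)) * (real DIM('a) / (2 * s))" by simp
  finally show ?thesis using \<alpha>_m(1) by simp
qed

sublocale heat_exponents P s K \<alpha> \<beta>
proof
  show "0 < \<alpha>" by (rule \<alpha>_m)
  show "0 < \<beta>" using p1 m1 unfolding \<beta>_def by simp
  show "\<beta> \<le> 1" using pm m1 unfolding \<beta>_def by (simp add: divide_le_eq)
  show "\<alpha> + \<beta> \<le> real DIM('a) / (2 * s)" using \<alpha>p_le \<alpha>_m by simp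
qed

text \<open>The critical Lebesgue exponent d(m-1)/(2s): by \<alpha> r = d/(2s), the kernel bound
  t^(-d/(2s)) interpolates to the rate t^(-\<alpha>) from L^r to L^\<infinity>.\<close>

definition r :: real where "r = real DIM('a) / (2 * s * \<alpha>)"

lemma r: "\<alpha> * r = real DIM('a) / (2 * s)" "p \<le> r" "1 \<le> r"
proof -
  show 1: "\<alpha> * r = real DIM('a) / (2 * s)" using \<alpha>_m(6) unfolding r_def by simp
  have "\<alpha> * p \<le> \<alpha> * r" unfolding 1 by (rule \<alpha>p_le)
  then show "p \<le> r" using \<alpha>_m(6) by simp
  then show "1 \<le> r" using p1 by simp
qed

definition ts :: "real \<Rightarrow> real" where "ts t = max (t powr s) t"

lemma ts: "0 < t \<Longrightarrow> 0 < ts t" "0 < t \<Longrightarrow> ts t \<le> max 1 t" "1 \<le> t \<Longrightarrow> ts t = t"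
proof -
  show "0 < t \<Longrightarrow> 0 < ts t" unfolding ts_def by simp
  show "0 < t \<Longrightarrow> ts t \<le> max 1 t"
  proof (cases "t \<le> 1")
    case True
    then show "0 < t \<Longrightarrow> ts t \<le> max 1 t" using s unfolding ts_def by (simp add: powr_le1)
  next
    case False
    then have "t powr s \<le> t powr 1" using s by (intro powr_mono) auto
    then show "0 < t \<Longrightarrow> ts t \<le> max 1 t" using False unfolding ts_def by simp
  qed
  show "1 \<le> t \<Longrightarrow> ts t = t"
  proof -
    assume "1 \<le> t"
    then have "t powr s \<le> t powr 1" using s by (intro powr_mono) auto
    then show "ts t = t" using \<open>1 \<le> t\<close> unfolding ts_def by simp
  qed
qed

text \<open>(t^s)^(-d/(2s)) = t^(-d/2), so the maximum in t_s selects the local rate for small times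
  and the fractional rate for large times in a single formula.\<close>

lemma P_le_ts: "0 < t \<Longrightarrow> P t x \<le> K * ts t powr (- (real DIM('a) / (2 * s)))"
proof -
  assume t: "0 < t"
  have "(t powr s) powr (- (real DIM('a) / (2 * s))) = t powr (- (real DIM('a) / 2))"
    using s by (simp add: powr_powr)
  then show "P t x \<le> K * ts t powr (- (real DIM('a) / (2 * s)))"
    unfolding ts_def using P_le_local[OF t, of x] P_le_frac[OF t, of x] by (auto simp: max_def)
qed

definition sg :: "('a \<Rightarrow> real) \<Rightarrow> real \<Rightarrow> 'a \<Rightarrow> real" where
  "sg u0 t = conv (P t) u0"

lemma sg_joint:
  assumes [measurable]: "u0 \<in> borel_measurable borel"
  shows "jointly_measurable (sg u0)"
  unfolding jointly_measurable_def sg_def conv_def by measurable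

lemma modular_sg:
  assumes [measurable]: "u0 \<in> borel_measurable borel" and \<mu>: "0 < \<mu>" and t: "0 < t"
  shows "modular p \<mu> (sg u0 t) \<le> modular p \<mu> u0"
  using modular_conv[of p "P t" u0 1 \<mu>] p1 \<mu> P_abs_mass[OF t] unfolding sg_def by simp

text \<open>The datum is split at the expected size M = \<mu> t_s^(-\<alpha>). The excess |u0|^r /
  M^(r-1) is integrable by the embedding into L^r, and the kernel supremum K t_s^(-\<alpha> r)
  brings it back to a multiple of M.\<close>

lemma sg_sup_bound:
  obtains c where "1 \<le> c" "\<And>\<mu> u0 t x. 0 < \<mu> \<Longrightarrow> u0 \<in> borel_measurable borel \<Longrightarrow> modular p \<mu> u0 \<le> 1 \<Longrightarrow> 0 < t \<Longrightarrow>
    nconv (P t) u0 x \<le> ennreal (c * \<mu> * ts t powr (- \<alpha>))"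
proof -
  obtain c where c: "1 \<le> c" "\<And>\<mu> u. 0 < \<mu> \<Longrightarrow> u \<in> borel_measurable borel \<Longrightarrow> modular p \<mu> u \<le> 1 \<Longrightarrow>
     (\<integral>\<^sup>+(x::'a). ennreal (\<bar>u x\<bar> powr r) \<partial>lborel) \<le> ennreal (c * \<mu> powr r)"
    using modular_powr_integral[of p r, where 'a='a] p1 r by (metis less_imp_le)
  have "nconv (P t) u0 x \<le> ennreal ((1 + K * c) * \<mu> * ts t powr (- \<alpha>))"
    if \<mu>: "0 < \<mu>" and u0[measurable]: "u0 \<in> borel_measurable borel" and mo: "modular p \<mu> u0 \<le> 1" and t: "0 < t" for \<mu> u0 t x
  proof -
    define M where "M = \<mu> * ts t powr (- \<alpha>)"
    have tst: "0 < ts t" by (rule ts(1)[OF t])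
    have M: "0 < M" unfolding M_def using \<mu> tst by simp
    have "nconv (P t) u0 x \<le> ennreal (M + (K * ts t powr (- (real DIM('a) / (2 * s)))) * (c * \<mu> powr r / M powr (r - 1)))"
    proof (rule nconv_P_bound[OF t, where v="\<lambda>y. \<bar>u0 y\<bar> powr r / M powr (r - 1)"])
      show "\<bar>u0 y\<bar> \<le> M + \<bar>u0 y\<bar> powr r / M powr (r - 1)" for y using M r by (intro le_add_powr_div) auto
      have "(\<integral>\<^sup>+y. ennreal (\<bar>u0 y\<bar> powr r / M powr (r - 1)) \<partial>lborel) = (\<integral>\<^sup>+y. ennreal (\<bar>u0 y\<bar> powr r) * ennreal (1 / M powr (r - 1)) \<partial>lborel)"
        using M by (intro nn_integral_cong) (simp flip: ennreal_mult)
      also have "\<dots> = (\<integral>\<^sup>+y. ennreal (\<bar>u0 y\<bar> powr r) \<partial>lborel) * ennreal (1 / M powr (r - 1))"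
        by (rule nn_integral_multc) measurable
      also have "\<dots> \<le> ennreal (c * \<mu> powr r) * ennreal (1 / M powr (r - 1))"
        by (intro mult_right_mono c \<mu> u0 mo) simp
      also have "\<dots> = ennreal (c * \<mu> powr r / M powr (r - 1))" using c by (simp flip: ennreal_mult)
      finally show "(\<integral>\<^sup>+y. ennreal (\<bar>u0 y\<bar> powr r / M powr (r - 1)) \<partial>lborel) \<le> ennreal (c * \<mu> powr r / M powr (r - 1))" .
    qed (use M c P_le_ts[OF t] in \<open>simp_all, measurable\<close>)
    also have "M + (K * ts t powr (- (real DIM('a) / (2 * s)))) * (c * \<mu> powr r / M powr (r - 1)) = (1 + K * c) * \<mu> * ts t powr (- \<alpha>)"
    proof -
      have "M powr (r - 1) = \<mu> powr (r - 1) * ts t powr (- \<alpha> * (r - 1))"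
        unfolding M_def using \<mu> by (simp add: powr_mult powr_powr)
      moreover have "\<mu> powr r = \<mu> powr (r - 1) * \<mu>" using \<mu> by (simp add: powr_mult_base mult.commute)
      moreover have "inverse (ts t powr (- \<alpha> * (r - 1))) = ts t powr (\<alpha> * (r - 1))" by (simp add: powr_minus)
      ultimately have "c * \<mu> powr r / M powr (r - 1) = c * \<mu> * ts t powr (\<alpha> * (r - 1))"
        using \<mu> by (simp add: divide_inverse)
      moreover have "ts t powr (- (real DIM('a) / (2 * s))) * ts t powr (\<alpha> * (r - 1)) = ts t powr (- \<alpha>)"
        unfolding r(1)[symmetric] by (simp only: powr_add[symmetric]) (simp add: algebra_simps)
      ultimately have "(K * ts t powr (- (real DIM('a) / (2 * s)))) * (c * \<mu> powr r / M powr (r - 1)) = K * c * \<mu> * ts t powr (- \<alpha>)"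
        by (simp add: mult_ac)
      then show ?thesis unfolding M_def by (simp add: algebra_simps)
    qed
    finally show ?thesis .
  qed
  moreover have "1 \<le> 1 + K * c" using K c by simp
  ultimately show thesis by (rule that[rotated])
qed

lemma sg_sup:
  obtains c where "1 \<le> c" "\<And>\<mu> u0 t x. 0 < \<mu> \<Longrightarrow> u0 \<in> borel_measurable borel \<Longrightarrow> modular p \<mu> u0 \<le> 1 \<Longrightarrow> 0 < t \<Longrightarrow>
    \<bar>sg u0 t x\<bar> \<le> c * \<mu> * ts t powr (- \<alpha>)"
proof -
  obtain c where c: "1 \<le> c" "\<And>\<mu> u0 t x. 0 < \<mu> \<Longrightarrow> u0 \<in> borel_measurable borel \<Longrightarrow> modular p \<mu> u0 \<le> 1 \<Longrightarrow> 0 < t \<Longrightarrow>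
    nconv (P t) u0 x \<le> ennreal (c * \<mu> * ts t powr (- \<alpha>))" using sg_sup_bound by blast
  have "\<bar>sg u0 t x\<bar> \<le> c * \<mu> * ts t powr (- \<alpha>)"
    if "0 < \<mu>" "u0 \<in> borel_measurable borel" "modular p \<mu> u0 \<le> 1" "0 < t" for \<mu> u0 t x
    using order_trans[OF conv_le_nconv c(2)[OF that]] c(1) that(1) unfolding sg_def
    by (subst (asm) ennreal_le_iff) auto
  with c(1) show thesis by (rule that)
qed

text \<open>Before time 1 only the modular is controlled, because the linear part has no pointwise
  bound uniform in t there. A single constant N scales the modular and the pointwise decay, so both
  fit the ratio |u|/N.\<close>

definition admissible :: "real \<Rightarrow> (real \<Rightarrow> 'a \<Rightarrow> real) \<Rightarrow> bool" where
  "admissible N u \<longleftrightarrow> jointly_measurable u \<and> (\<forall>\<tau>>0. modular p N (u \<tau>) \<le> 1) \<and>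
     (\<forall>\<tau>\<ge>1. \<forall>y. \<bar>u \<tau> y\<bar> \<le> N * \<tau> powr (- \<alpha>))"

text \<open>The time weights cancel: with w = \<open>max 1 t\<close>, the product (A
  w^(-\<alpha>))^(p-1) A w^\<beta> equals A^p because \<alpha> (p - 1) = \<beta>. Hence the scale is
  the same for all times although the L^1 norm may grow.\<close>

lemma modular_good:
  assumes D: "good A D" and A: "0 < A" and t: "0 < t"
  shows "modular p (3 * A) (D t) \<le> 1"
proof (rule modular_bounded)
  note [measurable (raw)] = jointly_measurableD[OF goodD(1)[OF D]]
  let ?w = "max 1 t"
  show "D t \<in> borel_measurable borel" by measurable
  show "\<bar>D t x\<bar> \<le> A * ?w powr (- \<alpha>)" for x by (rule goodD(2)[OF D t])
  show "mass (D t) \<le> ennreal (A * ?w powr \<beta>)" by (rule goodD(3)[OF D t])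
  have "?w powr (- \<alpha>) \<le> ?w powr 0" using \<alpha> by (intro powr_mono) auto
  then have "?w powr (- \<alpha>) \<le> 1" by (simp add: max_def split: if_splits)
  then have "A * ?w powr (- \<alpha>) \<le> A * 3" using A by (intro mult_left_mono) auto
  then show "A * ?w powr (- \<alpha>) \<le> 3 * A" by simp
  have "(A * ?w powr (- \<alpha>)) powr (p - 1) = A powr (p - 1) * ?w powr (- \<beta>)"
    using A \<alpha>_m(4) by (simp add: powr_mult powr_powr)
  then have "3 * (A * ?w powr (- \<alpha>)) powr (p - 1) * (A * ?w powr \<beta>) = 3 * (A powr (p - 1) * A) * (?w powr (- \<beta>) * ?w powr \<beta>)"
    by simp
  also have "A powr (p - 1) * A = A powr p" using A by (simp add: powr_mult_base mult.commute)
  also have "?w powr (- \<beta>) * ?w powr \<beta> = 1" by (simp only: powr_add[symmetric]) (simp add: max_def)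
  also have "3 * A powr p * 1 \<le> 3 powr p * A powr p"
    using p1 powr_mono[of 1 p "3::real"] by (simp add: mult_right_mono)
  also have "\<dots> = (3 * A) powr p" using A by (simp add: powr_mult)
  finally show "3 * (A * ?w powr (- \<alpha>)) powr (p - 1) * (A * ?w powr \<beta>) \<le> (3 * A) powr p" .
qed (use A p1 in auto)

lemma admissible_sg_add:
  obtains c where "1 \<le> c"
    "\<And>e u0 D. 0 < e \<Longrightarrow> u0 \<in> borel_measurable borel \<Longrightarrow> modular p e u0 \<le> 1 \<Longrightarrow> good e D \<Longrightarrow>
       admissible (c * e) (\<lambda>t x. sg u0 t x + D t x)"
proof -
  obtain c where c: "1 \<le> c" "\<And>\<mu> u0 t x. 0 < \<mu> \<Longrightarrow> u0 \<in> borel_measurable borel \<Longrightarrow> modular p \<mu> u0 \<le> 1 \<Longrightarrow> 0 < t \<Longrightarrow>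
    \<bar>sg u0 t x\<bar> \<le> c * \<mu> * ts t powr (- \<alpha>)" using sg_sup by blast
  \<comment> \<open>Since c \<ge> 1, the constant c + 3 covers e + 3e in the modular bound and (c +
    1) e in the pointwise bound.\<close>
  have "admissible ((c + 3) * e) (\<lambda>t x. sg u0 t x + D t x)"
    if e: "0 < e" and u0[measurable]: "u0 \<in> borel_measurable borel" and mo: "modular p e u0 \<le> 1" and D: "good e D" for e u0 D
    unfolding admissible_def
  proof (intro conjI allI impI)
    note [measurable (raw)] = jointly_measurableD[OF goodD(1)[OF D]] jointly_measurableD[OF sg_joint[OF u0]]
    show "jointly_measurable (\<lambda>t x. sg u0 t x + D t x)"
      by (intro jointly_measurable_add sg_joint u0 goodD(1)[OF D])
    fix \<tau> :: real
    {
      assume \<tau>: "0 < \<tau>"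
      have "modular p (e + 3 * e) (\<lambda>x. sg u0 \<tau> x + D \<tau> x) \<le> 1"
      proof (rule modular_add)
        show "modular p e (sg u0 \<tau>) \<le> 1" using modular_sg[OF u0 e \<tau>] mo by (rule order_trans)
        show "modular p (3 * e) (D \<tau>) \<le> 1" by (rule modular_good[OF D e \<tau>])
      qed (use e p1 in simp_all)
      moreover have "modular p ((c + 3) * e) (\<lambda>x. sg u0 \<tau> x + D \<tau> x) \<le> modular p (e + 3 * e) (\<lambda>x. sg u0 \<tau> x + D \<tau> x)"
        using p1 e c(1) by (intro modular_mono) (auto simp: algebra_simps)
      ultimately show "modular p ((c + 3) * e) (\<lambda>x. sg u0 \<tau> x + D \<tau> x) \<le> 1" by (rule order_trans[rotated])
    }
    {
      fix y assume \<tau>: "1 \<le> \<tau>"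
      have "\<bar>sg u0 \<tau> y\<bar> \<le> c * e * \<tau> powr (- \<alpha>)" using c(2)[OF e u0 mo, of \<tau> y] \<tau> ts(3)[OF \<tau>] by simp
      moreover have "\<bar>D \<tau> y\<bar> \<le> e * \<tau> powr (- \<alpha>)" using goodD(2)[OF D, of \<tau> y] \<tau> by (simp add: max_def split: if_splits)
      moreover have "0 \<le> e * \<tau> powr (- \<alpha>)" using e by simp
      ultimately show "\<bar>sg u0 \<tau> y + D \<tau> y\<bar> \<le> (c + 3) * e * \<tau> powr (- \<alpha>)"
        by (simp add: distrib_right)
    }
  qed
  moreover have "1 \<le> c + 3" using c by simp
  ultimately show thesis by (rule that[rotated])
qed

section \<open>The nonlinearity\<close>

lemma admissibleD:
  assumes "admissible N u"
  shows "jointly_measurable u"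
    and "0 < \<tau> \<Longrightarrow> modular p N (u \<tau>) \<le> 1"
    and "1 \<le> \<tau> \<Longrightarrow> \<bar>u \<tau> y\<bar> \<le> N * \<tau> powr (- \<alpha>)"
  using assms unfolding admissible_def by auto

definition gr :: "real \<Rightarrow> real" where
  "gr z = \<bar>z\<bar> powr (m - 1) * exp (lam * \<bar>z\<bar> powr p)"

lemma gr_nonneg: "0 \<le> gr z" unfolding gr_def by simp

lemma gr_measurable [measurable]: "gr \<in> borel_measurable borel"
  unfolding gr_def[abs_def] by measurable

lemma f_diff_le: "\<bar>f u - f v\<bar> \<le> C * \<bar>u - v\<bar> * (gr u + gr v)"
  unfolding gr_def by (rule f_lip)

lemma f_le: "\<bar>f u\<bar> \<le> C * \<bar>u\<bar> * gr u"
  using f_diff_le[of u 0] f0 by (simp add: gr_def)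

lemma continuous_f: "continuous_on UNIV f"
proof -
  have "isCont f u" for u
  proof -
    have gr_cont: "isCont gr u"
      unfolding gr_def using m1 p1 by (intro continuous_intros) auto
    have "(\<lambda>v. C * \<bar>v - u\<bar> * (gr v + gr u)) \<midarrow>u\<rightarrow> C * \<bar>u - u\<bar> * (gr u + gr u)"
      using gr_cont unfolding isCont_def by (intro tendsto_intros)
    then have "(\<lambda>v. C * \<bar>v - u\<bar> * (gr v + gr u)) \<midarrow>u\<rightarrow> 0" by simp
    then have "(\<lambda>v. f v - f u) \<midarrow>u\<rightarrow> 0"
      by (rule Lim_null_comparison[rotated]) (simp add: f_diff_le)
    then show ?thesis unfolding isCont_def by (simp add: LIM_zero_iff)
  qed
  then show ?thesis by (simp add: continuous_on_eq_continuous_at)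
qed

lemma f_measurable [measurable]: "f \<in> borel_measurable borel"
  by (rule borel_measurable_continuous_onI[OF continuous_f])

text \<open>The exponential growth of f at height z must stay below a quarter of the Young exponent
  at scale N. The factor DIM('a) is there because the d-th power of f multiplies its exponent by
  d.\<close>

definition smallness :: "real \<Rightarrow> bool" where
  "smallness N \<longleftrightarrow> 0 < N \<and> real DIM('a) * lam * N powr p \<le> 1 / 4"

lemma smallnessD:
  assumes "smallness N"
  shows "0 < N" "lam * \<bar>z\<bar> powr p \<le> (\<bar>z\<bar> / N) powr p / 4" "real DIM('a) * (lam * \<bar>z\<bar> powr p) \<le> (\<bar>z\<bar> / N) powr p / 4"
proof -
  show N: "0 < N" using assms unfolding smallness_def by simp
  have z: "\<bar>z\<bar> powr p = N powr p * (\<bar>z\<bar> / N) powr p" using N by (simp add: powr_divide)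
  have "real DIM('a) * lam * N powr p * (\<bar>z\<bar> / N) powr p \<le> 1 / 4 * (\<bar>z\<bar> / N) powr p"
    using assms unfolding smallness_def by (intro mult_right_mono) auto
  then show 1: "real DIM('a) * (lam * \<bar>z\<bar> powr p) \<le> (\<bar>z\<bar> / N) powr p / 4" unfolding z by (simp add: mult_ac)
  have "1 * (lam * \<bar>z\<bar> powr p) \<le> real DIM('a) * (lam * \<bar>z\<bar> powr p)"
    using lam by (intro mult_right_mono) (auto simp: Suc_leI)
  with 1 show "lam * \<bar>z\<bar> powr p \<le> (\<bar>z\<bar> / N) powr p / 4" by simp
qed

lemma gr_le:
  assumes N: "smallness N"
  shows "gr z \<le> N powr (m - 1) * ((\<bar>z\<bar> / N) powr (m - 1) * exp ((\<bar>z\<bar> / N) powr p / 4))"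
proof -
  have z: "\<bar>z\<bar> powr (m - 1) = N powr (m - 1) * (\<bar>z\<bar> / N) powr (m - 1)"
    using smallnessD(1)[OF N] by (simp add: powr_divide)
  show ?thesis unfolding gr_def z mult.assoc
    using smallnessD(2)[OF N, of z] by (intro mult_left_mono) auto
qed

lemma gr_power_le:
  assumes N: "smallness N"
  shows "gr z ^ DIM('a) \<le> (N powr (m - 1)) ^ DIM('a) * ((\<bar>z\<bar> / N) powr ((m - 1) * real DIM('a)) * exp ((\<bar>z\<bar> / N) powr p / 4))"
proof -
  have z: "\<bar>z\<bar> powr (m - 1) = N powr (m - 1) * (\<bar>z\<bar> / N) powr (m - 1)"
    using smallnessD(1)[OF N] by (simp add: powr_divide)
  have "gr z ^ DIM('a) = (N powr (m - 1)) ^ DIM('a) * (((\<bar>z\<bar> / N) powr (m - 1)) ^ DIM('a) * exp (real DIM('a) * (lam * \<bar>z\<bar> powr p)))"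
    unfolding gr_def z power_mult_distrib exp_of_nat_mult by simp
  also have "((\<bar>z\<bar> / N) powr (m - 1)) ^ DIM('a) = (\<bar>z\<bar> / N) powr ((m - 1) * real DIM('a))"
    by (cases "z = 0") (use smallnessD(1)[OF N] in \<open>simp_all add: powr_power mult.commute\<close>)
  finally show ?thesis
    using smallnessD(1,3)[OF N] by (simp add: mult_left_mono)
qed

lemma modular_young_integral:
  assumes "admissible N u" "0 < \<tau>"
  shows "(\<integral>\<^sup>+y. ennreal (young p (\<bar>u \<tau> y\<bar> / N)) \<partial>lborel) \<le> 1"
  using admissibleD(2)[OF assms] unfolding modular_def .

lemma admissible_young_le:
  assumes u: "admissible N u" and \<tau>: "0 < \<tau>" and k: "0 \<le> k" and le: "\<And>y. g y \<le> k * young p (\<bar>u \<tau> y\<bar> / N)"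
  shows "(\<integral>\<^sup>+y. ennreal (g y) \<partial>lborel) \<le> ennreal k"
proof -
  note [measurable (raw)] = jointly_measurableD[OF admissibleD(1)[OF u]]
  have "(\<integral>\<^sup>+y. ennreal (g y) \<partial>lborel) \<le> (\<integral>\<^sup>+y. ennreal k * ennreal (young p (\<bar>u \<tau> y\<bar> / N)) \<partial>lborel)"
    using k young_nonneg[of p] le by (intro nn_integral_mono) (simp flip: ennreal_mult add: ennreal_leI)
  also have "\<dots> = ennreal k * (\<integral>\<^sup>+y. ennreal (young p (\<bar>u \<tau> y\<bar> / N)) \<partial>lborel)"
    by (rule nn_integral_cmult) measurable
  also have "\<dots> \<le> ennreal k * 1" by (intro mult_left_mono modular_young_integral[OF u \<tau>]) simp
  finally show ?thesis by simp
qed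

lemma ratio_le_decay:
  assumes u: "admissible N u" and N: "0 < N" and \<tau>: "1 \<le> \<tau>" and a: "0 \<le> a"
  shows "(\<bar>u \<tau> y\<bar> / N) powr a \<le> \<tau> powr (- (\<alpha> * a))" "exp ((\<bar>u \<tau> y\<bar> / N) powr p / 4) \<le> 2"
proof -
  have y: "\<bar>u \<tau> y\<bar> / N \<le> \<tau> powr (- \<alpha>)" using admissibleD(3)[OF u \<tau>, of y] N by (simp add: divide_le_eq mult.commute)
  then have "(\<bar>u \<tau> y\<bar> / N) powr a \<le> (\<tau> powr (- \<alpha>)) powr a" using a N by (intro powr_mono2) auto
  then show "(\<bar>u \<tau> y\<bar> / N) powr a \<le> \<tau> powr (- (\<alpha> * a))" by (simp add: powr_powr)
  have "\<tau> powr (- \<alpha>) \<le> \<tau> powr 0" using \<tau> \<alpha> by (intro powr_mono) auto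
  then have "\<bar>u \<tau> y\<bar> / N \<le> 1" using y \<tau> by simp
  then have "(\<bar>u \<tau> y\<bar> / N) powr p \<le> 1" using N p1 by (intro powr_le1) auto
  then have "exp ((\<bar>u \<tau> y\<bar> / N) powr p / 4) \<le> exp (1/4)" by simp
  also have "exp (1/4 :: real) \<le> 2" using exp_bound[of "1/4::real"] by (simp add: power2_eq_square)
  finally show "exp ((\<bar>u \<tau> y\<bar> / N) powr p / 4) \<le> 2" .
qed

text \<open>From time 1 on, p of the m powers of |u|/N go into the Young function and the other m -
  p decay like \<tau>^(\<beta>-1); letting all m decay gives \<tau>^(-1-\<alpha>). Before time 1
  only the modular is available, and the exponents m and m d are both at least p, so the Young
  function absorbs them.\<close>

lemma source_f:
  obtains c where "1 \<le> c" "\<And>N u. smallness N \<Longrightarrow> admissible N u \<Longrightarrow> source (c * N powr m) (\<lambda>\<tau> y. f (u \<tau> y))"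
proof -
  let ?d = "real DIM('a)"
  have d1: "1 \<le> ?d" by (simp add: Suc_leI)
  have "p * 1 \<le> m * ?d" using pm p1 d1 by (intro mult_mono) auto
  then have md: "p \<le> m * ?d" by simp
  obtain c1 where c1: "1 \<le> c1" "\<And>y. 0 \<le> y \<Longrightarrow> y powr m * exp (y powr p / 4) \<le> c1 * young p y"
    using powr_exp_le_young[of p m] p1 pm by (metis less_imp_le)
  obtain c3 where c3: "1 \<le> c3" "\<And>y. 0 \<le> y \<Longrightarrow> y powr (m * ?d) * exp (y powr p / 4) \<le> c3 * young p y"
    using powr_exp_le_young[of p "m * ?d"] p1 md by (metis less_imp_le)
  \<comment> \<open>The summand 2 accounts for the exponential factor at times \<ge> 1, where |u|/N
    \<le> 1; the final 1 makes c \<ge> 1.\<close>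
  define c where "c = C * (c1 + c3 + 2) + 1"
  have c: "1 \<le> c" unfolding c_def using c1 c3 C by simp
  have "source (c * N powr m) (\<lambda>\<tau> y. f (u \<tau> y))" if N: "smallness N" and u: "admissible N u" for N u
  proof -
    note [measurable (raw)] = jointly_measurableD[OF admissibleD(1)[OF u]]
    have N0: "0 < N" by (rule smallnessD(1)[OF N])
    define B where "B = c * N powr m"
    have cB: "C * N powr m * k \<le> B" if "k \<le> c1 + c3 + 2" for k
    proof -
      have "C * N powr m * k \<le> C * N powr m * (c1 + c3 + 2)" using that C by (intro mult_left_mono) auto
      also have "\<dots> \<le> B" unfolding B_def c_def by (simp add: algebra_simps)
      finally show ?thesis .
    qed
    have fu: "\<bar>f z\<bar> \<le> C * N powr m * ((\<bar>z\<bar> / N) powr m * exp ((\<bar>z\<bar> / N) powr p / 4))" for z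
    proof (cases "z = 0")
      case False
      have e: "\<bar>z\<bar> = N * (\<bar>z\<bar> / N)" using N0 by simp
      have "N powr m = N * N powr (m - 1)" using N0 by (simp add: powr_mult_base)
      moreover have "(\<bar>z\<bar> / N) powr m = (\<bar>z\<bar> / N) * (\<bar>z\<bar> / N) powr (m - 1)" using N0 by (subst powr_mult_base) auto
      moreover have "\<bar>f z\<bar> \<le> C * (N * (\<bar>z\<bar> / N)) * (N powr (m - 1) * ((\<bar>z\<bar> / N) powr (m - 1) * exp ((\<bar>z\<bar> / N) powr p / 4)))"
        using order_trans[OF f_le[of z] mult_left_mono[OF gr_le[OF N, of z]]] C e by simp
      ultimately show ?thesis using N0 by (simp add: mult_ac)
    qed (use f0 in simp)
    show ?thesis
      unfolding source_def B_def[symmetric]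
    proof (intro conjI allI impI)
      show "jointly_measurable (\<lambda>\<tau> y. f (u \<tau> y))" unfolding jointly_measurable_def by measurable
      fix \<tau> :: real
      {
        assume \<tau>: "0 < \<tau>"
        show "mass (\<lambda>y. f (u \<tau> y)) \<le> ennreal (B * max 1 \<tau> powr (\<beta> - 1))"
        proof (cases "\<tau> \<le> 1")
          case True
          have "mass (\<lambda>y. f (u \<tau> y)) \<le> ennreal (C * N powr m * c1)"
          proof (rule admissible_young_le[OF u \<tau>])
            fix y
            have "\<bar>f (u \<tau> y)\<bar> \<le> C * N powr m * ((\<bar>u \<tau> y\<bar> / N) powr m * exp ((\<bar>u \<tau> y\<bar> / N) powr p / 4))" by (rule fu)
            also have "\<dots> \<le> C * N powr m * (c1 * young p (\<bar>u \<tau> y\<bar> / N))"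
              using N0 C by (intro mult_left_mono c1) auto
            finally show "\<bar>f (u \<tau> y)\<bar> \<le> C * N powr m * c1 * young p (\<bar>u \<tau> y\<bar> / N)" by (simp add: mult.assoc)
          qed (use c1 C in auto)
          also have "C * N powr m * c1 \<le> B" using cB c3 by simp
          finally show ?thesis using True by (simp add: max_absorb1 ennreal_leI)
        next
          case False
          then have \<tau>1: "1 \<le> \<tau>" by simp
          have "mass (\<lambda>y. f (u \<tau> y)) \<le> ennreal (C * N powr m * 2 * \<tau> powr (\<beta> - 1))"
          proof (rule admissible_young_le[OF u \<tau>])
            fix y
            let ?y = "\<bar>u \<tau> y\<bar> / N"
            have "?y powr m = ?y powr (m - p) * ?y powr p" by (simp flip: powr_add)
            also have "\<dots> \<le> \<tau> powr (- (\<alpha> * (m - p))) * young p ?y"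
              using pm by (intro mult_mono ratio_le_decay[OF u N0 \<tau>1] powr_le_young) auto
            finally have "?y powr m * exp (?y powr p / 4) \<le> (\<tau> powr (- (\<alpha> * (m - p))) * young p ?y) * 2"
              by (intro mult_mono ratio_le_decay[OF u N0 \<tau>1]) (auto simp: young_nonneg p1 less_imp_le)
            then have "C * N powr m * (?y powr m * exp (?y powr p / 4)) \<le> C * N powr m * ((\<tau> powr (- (\<alpha> * (m - p))) * young p ?y) * 2)"
              using C by (intro mult_left_mono) auto
            then show "\<bar>f (u \<tau> y)\<bar> \<le> C * N powr m * 2 * \<tau> powr (\<beta> - 1) * young p ?y"
              using fu[of "u \<tau> y"] unfolding \<alpha>_m(3) by (simp add: mult_ac)
          qed (use C in auto)
          also have "C * N powr m * 2 * \<tau> powr (\<beta> - 1) \<le> B * \<tau> powr (\<beta> - 1)"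
            using c1 c3 by (intro mult_right_mono cB) auto
          finally show ?thesis using False by (simp add: max_def ennreal_leI)
        qed
      }
      {
        fix y assume \<tau>: "1 \<le> \<tau>"
        let ?y = "\<bar>u \<tau> y\<bar> / N"
        have "?y powr m * exp (?y powr p / 4) \<le> \<tau> powr (- (\<alpha> * m)) * 2"
          using m1 by (intro mult_mono ratio_le_decay[OF u N0 \<tau>]) (auto simp: p1 less_imp_le)
        then have "C * N powr m * (?y powr m * exp (?y powr p / 4)) \<le> C * N powr m * (\<tau> powr (- (\<alpha> * m)) * 2)"
          using C by (intro mult_left_mono) auto
        then have "\<bar>f (u \<tau> y)\<bar> \<le> (C * N powr m * 2) * \<tau> powr (- 1 - \<alpha>)"
          using fu[of "u \<tau> y"] unfolding \<alpha>_m(2) by (simp add: mult_ac)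
        also have "\<dots> \<le> B * \<tau> powr (- 1 - \<alpha>)" using c1 c3 by (intro mult_right_mono cB) auto
        finally show "\<bar>f (u \<tau> y)\<bar> \<le> B * \<tau> powr (- 1 - \<alpha>)" .
      }
      {
        assume \<tau>: "0 < \<tau>" "\<tau> \<le> 1"
        have "(\<integral>\<^sup>+y. ennreal (\<bar>f (u \<tau> y)\<bar> ^ DIM('a)) \<partial>lborel) \<le> ennreal ((C * N powr m) ^ DIM('a) * c3)"
        proof (rule admissible_young_le[OF u \<tau>(1)])
          fix y
          let ?y = "\<bar>u \<tau> y\<bar> / N"
          have "\<bar>f (u \<tau> y)\<bar> ^ DIM('a) \<le> (C * N powr m) ^ DIM('a) * (?y powr (m * ?d) * exp (?y powr p / 4))"
          proof (cases "u \<tau> y = 0")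
            case False
            let ?z = "\<bar>u \<tau> y\<bar>"
            have "\<bar>f (u \<tau> y)\<bar> ^ DIM('a) \<le> (C * ?z * gr (u \<tau> y)) ^ DIM('a)" by (intro power_mono f_le) simp
            also have "\<dots> = (C * ?z) ^ DIM('a) * gr (u \<tau> y) ^ DIM('a)" by (rule power_mult_distrib)
            also have "\<dots> \<le> (C * ?z) ^ DIM('a) * ((N powr (m - 1)) ^ DIM('a) * (?y powr ((m - 1) * ?d) * exp (?y powr p / 4)))"
              using C by (intro mult_left_mono gr_power_le N) auto
            also have "(C * ?z) ^ DIM('a) = C ^ DIM('a) * N ^ DIM('a) * ?y ^ DIM('a)"
              using N0 by (simp add: power_mult_distrib power_divide)
            also have "C ^ DIM('a) * N ^ DIM('a) * ?y ^ DIM('a) * ((N powr (m - 1)) ^ DIM('a) * (?y powr ((m - 1) * ?d) * exp (?y powr p / 4)))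
               = (C * (N * N powr (m - 1))) ^ DIM('a) * ((?y ^ DIM('a) * ?y powr ((m - 1) * ?d)) * exp (?y powr p / 4))"
              by (simp only: power_mult_distrib mult_ac)
            also have "N * N powr (m - 1) = N powr m" using N0 by (simp add: powr_mult_base)
            also have "?y ^ DIM('a) * ?y powr ((m - 1) * ?d) = ?y powr (m * ?d)"
              using False N0 by (subst powr_realpow[symmetric]) (simp_all add: left_diff_distrib flip: powr_add)
            finally show ?thesis .
          qed (simp add: f0 zero_power)
          also have "\<dots> \<le> (C * N powr m) ^ DIM('a) * (c3 * young p ?y)"
            using C N0 by (intro mult_left_mono c3) auto
          finally show "\<bar>f (u \<tau> y)\<bar> ^ DIM('a) \<le> (C * N powr m) ^ DIM('a) * c3 * young p ?y" by (simp add: mult.assoc)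
        qed (use C c3 in auto)
        also have "(C * N powr m) ^ DIM('a) * c3 \<le> B ^ DIM('a)"
        proof -
          \<comment> \<open>As c3 \<ge> 1, it may be moved under the d-th power, where the constant
            B of the source has to appear.\<close>
          have "c3 \<le> c3 ^ DIM('a)" using c3(1) by (intro self_le_power) auto
          then have "(C * N powr m) ^ DIM('a) * c3 \<le> (C * N powr m) ^ DIM('a) * c3 ^ DIM('a)" using C by (intro mult_left_mono) auto
          also have "\<dots> = (C * N powr m * c3) ^ DIM('a)" by (rule power_mult_distrib[symmetric])
          also have "\<dots> \<le> B ^ DIM('a)" using C c1 c3 by (intro power_mono cB) auto
          finally show ?thesis .
        qed
        finally show "(\<integral>\<^sup>+y. ennreal (\<bar>f (u \<tau> y)\<bar> ^ DIM('a)) \<partial>lborel) \<le> ennreal (B ^ DIM('a))" by (simp add: ennreal_leI)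
      }
    qed
  qed
  with c show thesis by (rule that)
qed

text \<open>The growth factor is split as \<open>gr (u) \<le> k * (1 + young p (u / N))\<close>, so that integrating it
  against \<open>w\<close> only needs \<open>w\<close> in \<open>L\<^sup>1 \<inter> L\<^sup>\<infinity>\<close>.\<close>

lemma weighted_young_integral:
  assumes u: "admissible N u" and \<tau>: "0 < \<tau>" and k: "0 \<le> k" and [measurable]: "w \<in> borel_measurable borel"
    and w: "\<And>y. 0 \<le> w y" "\<And>y. w y \<le> a" "(\<integral>\<^sup>+y. ennreal (w y) \<partial>lborel) \<le> ennreal b" "0 \<le> b"
    and le: "\<And>y. g y \<le> w y * (k * exp ((\<bar>u \<tau> y\<bar> / N) powr p))"
  shows "(\<integral>\<^sup>+y. ennreal (g y) \<partial>lborel) \<le> ennreal (k * (a + b))"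
proof -
  note [measurable (raw)] = jointly_measurableD[OF admissibleD(1)[OF u]]
  have a: "0 \<le> a" using w(1,2)[of 0] by linarith
  have "(\<integral>\<^sup>+y. ennreal (g y) \<partial>lborel) \<le> (\<integral>\<^sup>+y. ennreal (k * a) * ennreal (young p (\<bar>u \<tau> y\<bar> / N)) + ennreal k * ennreal (w y) \<partial>lborel)"
  proof (intro nn_integral_mono)
    fix y
    let ?Y = "young p (\<bar>u \<tau> y\<bar> / N)"
    have "g y \<le> w y * (k * (?Y + 1))" using le[of y] unfolding young_def by simp
    also have "\<dots> = k * (w y * ?Y) + k * w y" by (simp add: algebra_simps)
    also have "\<dots> \<le> k * (a * ?Y) + k * w y"
      using k w young_nonneg by (intro add_right_mono mult_left_mono mult_right_mono) auto
    finally show "ennreal (g y) \<le> ennreal (k * a) * ennreal ?Y + ennreal k * ennreal (w y)"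
      using k a w young_nonneg by (simp flip: ennreal_mult ennreal_plus add: ennreal_leI mult.assoc)
  qed
  also have "\<dots> = (\<integral>\<^sup>+y. ennreal (k * a) * ennreal (young p (\<bar>u \<tau> y\<bar> / N)) \<partial>lborel) + (\<integral>\<^sup>+y. ennreal k * ennreal (w y) \<partial>lborel)"
    by (rule nn_integral_add) measurable
  also have "(\<integral>\<^sup>+y. ennreal (k * a) * ennreal (young p (\<bar>u \<tau> y\<bar> / N)) \<partial>lborel) = ennreal (k * a) * (\<integral>\<^sup>+y. ennreal (young p (\<bar>u \<tau> y\<bar> / N)) \<partial>lborel)"
    by (rule nn_integral_cmult) measurable
  also have "(\<integral>\<^sup>+y. ennreal k * ennreal (w y) \<partial>lborel) = ennreal k * (\<integral>\<^sup>+y. ennreal (w y) \<partial>lborel)"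
    by (rule nn_integral_cmult) measurable
  also have "ennreal (k * a) * (\<integral>\<^sup>+y. ennreal (young p (\<bar>u \<tau> y\<bar> / N)) \<partial>lborel) + ennreal k * (\<integral>\<^sup>+y. ennreal (w y) \<partial>lborel)
     \<le> ennreal (k * a) * 1 + ennreal k * ennreal b"
    by (intro add_mono mult_left_mono modular_young_integral[OF u \<tau>] w) auto
  also have "\<dots> = ennreal (k * (a + b))" using k a w by (simp flip: ennreal_mult ennreal_plus add: distrib_left)
  finally show ?thesis .
qed

text \<open>One power of u is replaced by the difference, so only m - 1 powers remain. These may be
  fewer than p, and the Young function alone cannot absorb them; before time 1 the difference itself
  serves as the integrable weight. From time 1 on the growth factor is at most 2n/\<tau>, and
  1/\<tau> turns the weights of \<open>good\<close> into those of \<open>source\<close>.\<close>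

lemma source_f_diff:
  obtains c where "1 \<le> c" "\<And>N u v \<rho>. smallness N \<Longrightarrow> admissible N u \<Longrightarrow> admissible N v \<Longrightarrow> 0 < \<rho> \<Longrightarrow>
     good \<rho> (\<lambda>\<tau> y. u \<tau> y - v \<tau> y) \<Longrightarrow> source (c * N powr (m - 1) * \<rho>) (\<lambda>\<tau> y. f (u \<tau> y) - f (v \<tau> y))"
proof -
  let ?d = "real DIM('a)"
  obtain c2 where c2: "1 \<le> c2" "\<And>y. 0 \<le> y \<Longrightarrow> y powr (m - 1) * exp (y powr p / 4) \<le> c2 * exp (y powr p)"
    using powr_exp_le_exp[of p "m - 1"] p1 m1 by (auto simp: less_imp_le)
  obtain c4 where c4: "1 \<le> c4" "\<And>y. 0 \<le> y \<Longrightarrow> y powr ((m - 1) * ?d) * exp (y powr p / 4) \<le> c4 * exp (y powr p)"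
    using powr_exp_le_exp[of p "(m - 1) * ?d"] p1 m1 by (auto simp: less_imp_le)
  define c where "c = C * (8 * (c2 + c4 + 1)) + 1"
  have c: "1 \<le> c" unfolding c_def using c2 c4 C by simp
  have "source (c * N powr (m - 1) * \<rho>) (\<lambda>\<tau> y. f (u \<tau> y) - f (v \<tau> y))"
    if N: "smallness N" and u: "admissible N u" and v: "admissible N v" and \<rho>: "0 < \<rho>" and D: "good \<rho> (\<lambda>\<tau> y. u \<tau> y - v \<tau> y)"
    for N u v \<rho>
  proof -
    note [measurable (raw)] = jointly_measurableD[OF admissibleD(1)[OF u]] jointly_measurableD[OF admissibleD(1)[OF v]]
    have N0: "0 < N" by (rule smallnessD(1)[OF N])
    define n where "n = N powr (m - 1)"
    have n: "0 < n" unfolding n_def using N0 by simp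
    define B where "B = c * n * \<rho>"
    have cB: "C * n * \<rho> * k \<le> B" if "k \<le> 8 * (c2 + c4 + 1)" for k
    proof -
      have "C * n * \<rho> * k \<le> C * n * \<rho> * (8 * (c2 + c4 + 1))" using that C n \<rho> by (intro mult_left_mono) auto
      also have "\<dots> \<le> B" unfolding B_def c_def using n \<rho> by (simp add: algebra_simps)
      finally show ?thesis .
    qed
    define w where "w \<tau> y = \<bar>u \<tau> y - v \<tau> y\<bar>" for \<tau> y
    have [measurable]: "w \<tau> \<in> borel_measurable borel" for \<tau> unfolding w_def[abs_def] by measurable
    have w0: "0 \<le> w \<tau> y" for \<tau> y unfolding w_def by simp
    have fd: "\<bar>f (u \<tau> y) - f (v \<tau> y)\<bar> \<le> C * (w \<tau> y * gr (u \<tau> y)) + C * (w \<tau> y * gr (v \<tau> y))" for \<tau> y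
      using f_diff_le[of "u \<tau> y" "v \<tau> y"] unfolding w_def by (simp add: algebra_simps)
    have grL: "gr z \<le> n * c2 * exp ((\<bar>z\<bar> / N) powr p)" for z
    proof -
      have "gr z \<le> n * ((\<bar>z\<bar> / N) powr (m - 1) * exp ((\<bar>z\<bar> / N) powr p / 4))" unfolding n_def by (rule gr_le[OF N])
      also have "\<dots> \<le> n * (c2 * exp ((\<bar>z\<bar> / N) powr p))" using n N0 by (intro mult_left_mono c2) auto
      finally show ?thesis by (simp add: mult.assoc)
    qed
    have grD: "gr (z \<tau> y) \<le> 2 * n / \<tau>" if z: "admissible N z" and \<tau>: "1 \<le> \<tau>" for z \<tau> y
    proof -
      have "gr (z \<tau> y) \<le> n * ((\<bar>z \<tau> y\<bar> / N) powr (m - 1) * exp ((\<bar>z \<tau> y\<bar> / N) powr p / 4))" unfolding n_def by (rule gr_le[OF N])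
      also have "\<dots> \<le> n * (\<tau> powr (- (\<alpha> * (m - 1))) * 2)"
        using n m1 by (intro mult_left_mono mult_mono ratio_le_decay[OF z N0 \<tau>]) (auto simp: p1 less_imp_le)
      also have "\<dots> = 2 * n / \<tau>" unfolding \<alpha>_m(1) using \<tau> by (simp add: powr_minus_divide)
      finally show ?thesis .
    qed
    have wsmall: "w \<tau> y \<le> \<rho>" "(\<integral>\<^sup>+y. ennreal (w \<tau> y) \<partial>lborel) \<le> ennreal \<rho>" if "0 < \<tau>" "\<tau> \<le> 1" for \<tau> y
      using goodD(2,3)[OF D that(1)] that(2) unfolding w_def by (simp_all add: max_absorb1)
    show ?thesis
      unfolding source_def n_def[symmetric] B_def[symmetric]
    proof (intro conjI allI impI)
      show "jointly_measurable (\<lambda>\<tau> y. f (u \<tau> y) - f (v \<tau> y))" unfolding jointly_measurable_def by measurable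
      fix \<tau> :: real
      {
        assume \<tau>: "0 < \<tau>"
        show "mass (\<lambda>y. f (u \<tau> y) - f (v \<tau> y)) \<le> ennreal (B * max 1 \<tau> powr (\<beta> - 1))"
        proof (cases "\<tau> < 1")
          case True
          have part: "(\<integral>\<^sup>+y. ennreal (C * (w \<tau> y * gr (z \<tau> y))) \<partial>lborel) \<le> ennreal (C * n * c2 * (\<rho> + \<rho>))" if z: "admissible N z" for z
          proof (rule weighted_young_integral[OF z \<tau>, where w="w \<tau>"])
            show "C * (w \<tau> y * gr (z \<tau> y)) \<le> w \<tau> y * (C * n * c2 * exp ((\<bar>z \<tau> y\<bar> / N) powr p))" for y
              using mult_left_mono[OF grL[of "z \<tau> y"], of "C * w \<tau> y"] C w0[of \<tau> y] by (simp add: mult_ac)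
            show "w \<tau> y \<le> \<rho>" "(\<integral>\<^sup>+y. ennreal (w \<tau> y) \<partial>lborel) \<le> ennreal \<rho>" for y
              using wsmall[OF \<tau>] True by auto
          qed (use C n c2 \<rho> w0 in auto)
          have "mass (\<lambda>y. f (u \<tau> y) - f (v \<tau> y)) \<le> (\<integral>\<^sup>+y. ennreal (C * (w \<tau> y * gr (u \<tau> y))) + ennreal (C * (w \<tau> y * gr (v \<tau> y))) \<partial>lborel)"
            using C w0 gr_nonneg fd by (intro nn_integral_mono) (simp flip: ennreal_plus add: ennreal_leI)
          also have "\<dots> = (\<integral>\<^sup>+y. ennreal (C * (w \<tau> y * gr (u \<tau> y))) \<partial>lborel) + (\<integral>\<^sup>+y. ennreal (C * (w \<tau> y * gr (v \<tau> y))) \<partial>lborel)"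
            by (rule nn_integral_add) measurable
          also have "\<dots> \<le> ennreal (C * n * c2 * (\<rho> + \<rho>)) + ennreal (C * n * c2 * (\<rho> + \<rho>))"
            by (intro add_mono part u v)
          also have "\<dots> = ennreal (C * n * \<rho> * (4 * c2))"
            using C n c2 \<rho> by (simp flip: ennreal_plus add: algebra_simps)
          also have "C * n * \<rho> * (4 * c2) \<le> B" using cB[of "4 * c2"] c2 c4 by simp
          finally show ?thesis using True by (simp add: max_absorb1 ennreal_leI)
        next
          case False
          then have \<tau>1: "1 \<le> \<tau>" by simp
          have "\<bar>f (u \<tau> y) - f (v \<tau> y)\<bar> \<le> (C * (4 * n / \<tau>)) * w \<tau> y" for y
          proof -
            have "C * (w \<tau> y * gr (u \<tau> y)) \<le> C * (w \<tau> y * (2 * n / \<tau>))" "C * (w \<tau> y * gr (v \<tau> y)) \<le> C * (w \<tau> y * (2 * n / \<tau>))"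
              by (intro mult_left_mono grD u v \<tau>1 w0 less_imp_le[OF C])+
            moreover have "C * (w \<tau> y * (2 * n / \<tau>)) + C * (w \<tau> y * (2 * n / \<tau>)) = (C * (4 * n / \<tau>)) * w \<tau> y"
              by (simp add: add_divide_distrib[symmetric])
            ultimately show ?thesis using fd[of \<tau> y] by linarith
          qed
          then have "mass (\<lambda>y. f (u \<tau> y) - f (v \<tau> y)) \<le> (\<integral>\<^sup>+y. ennreal (C * (4 * n / \<tau>)) * ennreal (w \<tau> y) \<partial>lborel)"
            using C n \<tau> w0 by (intro nn_integral_mono) (simp flip: ennreal_mult add: ennreal_leI)
          also have "\<dots> = ennreal (C * (4 * n / \<tau>)) * (\<integral>\<^sup>+y. ennreal (w \<tau> y) \<partial>lborel)"
            by (rule nn_integral_cmult) measurable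
          also have "\<dots> \<le> ennreal (C * (4 * n / \<tau>)) * ennreal (\<rho> * max 1 \<tau> powr \<beta>)"
            unfolding w_def by (intro mult_left_mono goodD(3)[OF D \<tau>]) simp
          also have "\<dots> = ennreal (C * (4 * n / \<tau>) * (\<rho> * \<tau> powr \<beta>))"
            using C n \<tau> \<rho> by (simp add: max_absorb2[OF \<tau>1] flip: ennreal_mult)
          also have "C * (4 * n / \<tau>) * (\<rho> * \<tau> powr \<beta>) = C * n * \<rho> * 4 * \<tau> powr (\<beta> - 1)"
            using \<tau> by (simp add: powr_diff)
          also have "C * n * \<rho> * 4 * \<tau> powr (\<beta> - 1) \<le> B * \<tau> powr (\<beta> - 1)"
            using c2 c4 by (intro mult_right_mono cB) auto
          finally show ?thesis using \<tau>1 by (simp add: ennreal_leI)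
        qed
      }
      {
        fix y assume \<tau>: "1 \<le> \<tau>"
        have wy: "w \<tau> y \<le> \<rho> * \<tau> powr (- \<alpha>)" using goodD(2)[OF D, of \<tau> y] \<tau> unfolding w_def by simp
        have "C * (w \<tau> y * gr z) \<le> C * ((\<rho> * \<tau> powr (- \<alpha>)) * (2 * n / \<tau>))" if "gr z \<le> 2 * n / \<tau>" for z
          using C \<rho> that by (intro mult_left_mono mult_mono wy gr_nonneg) auto
        from this[OF grD[OF u \<tau>]] this[OF grD[OF v \<tau>]] fd[of \<tau> y]
        have "\<bar>f (u \<tau> y) - f (v \<tau> y)\<bar> \<le> 2 * (C * ((\<rho> * \<tau> powr (- \<alpha>)) * (2 * n / \<tau>)))" by (smt (verit))
        also have "\<dots> = C * n * \<rho> * 4 * \<tau> powr (- 1 - \<alpha>)"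
          using \<tau> by (simp add: powr_diff powr_minus_divide mult_ac)
        also have "\<dots> \<le> B * \<tau> powr (- 1 - \<alpha>)" using c2 c4 by (intro mult_right_mono cB) auto
        finally show "\<bar>f (u \<tau> y) - f (v \<tau> y)\<bar> \<le> B * \<tau> powr (- 1 - \<alpha>)" .
      }
      {
        assume \<tau>: "0 < \<tau>" "\<tau> \<le> 1"
        let ?D = "DIM('a)"
        define k where "k = (2 * C * n) ^ ?D * c4"
        have k: "0 \<le> k" unfolding k_def using C n c4 by simp
        have wd: "(\<integral>\<^sup>+y. ennreal (w \<tau> y ^ ?D) \<partial>lborel) \<le> ennreal (\<rho> ^ ?D)"
        proof -
          obtain j where j: "?D = Suc j" using DIM_positive[where 'a='a] gr0_implies_Suc by blast
          have "w \<tau> y ^ ?D \<le> \<rho> ^ j * w \<tau> y" for y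
            unfolding j power_Suc2 using w0 wsmall(1)[OF \<tau>] by (intro mult_right_mono power_mono) auto
          then have "(\<integral>\<^sup>+y. ennreal (w \<tau> y ^ ?D) \<partial>lborel) \<le> (\<integral>\<^sup>+y. ennreal (\<rho> ^ j) * ennreal (w \<tau> y) \<partial>lborel)"
            using \<rho> w0 by (intro nn_integral_mono) (simp flip: ennreal_mult add: ennreal_leI)
          also have "\<dots> = ennreal (\<rho> ^ j) * (\<integral>\<^sup>+y. ennreal (w \<tau> y) \<partial>lborel)" by (rule nn_integral_cmult) measurable
          also have "\<dots> \<le> ennreal (\<rho> ^ j) * ennreal \<rho>" by (intro mult_left_mono wsmall \<tau>) simp
          also have "\<dots> = ennreal (\<rho> ^ ?D)" unfolding j using \<rho> by (simp flip: ennreal_mult add: mult.commute)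
          finally show ?thesis .
        qed
        have part: "(\<integral>\<^sup>+y. ennreal (w \<tau> y ^ ?D * ((2 * C) ^ ?D * gr (z \<tau> y) ^ ?D)) \<partial>lborel) \<le> ennreal (k * (\<rho> ^ ?D + \<rho> ^ ?D))" if z: "admissible N z" for z
        proof (rule weighted_young_integral[OF z \<tau>(1) k, where w="\<lambda>y. w \<tau> y ^ ?D"])
          fix y
          have "(2 * C) ^ ?D * gr (z \<tau> y) ^ ?D \<le> (2 * C) ^ ?D * (n ^ ?D * (c4 * exp ((\<bar>z \<tau> y\<bar> / N) powr p)))"
            using C n N0 unfolding n_def
            by (intro mult_left_mono order_trans[OF gr_power_le[OF N]] c4) auto
          also have "\<dots> = k * exp ((\<bar>z \<tau> y\<bar> / N) powr p)" unfolding k_def by (simp only: power_mult_distrib mult_ac)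
          finally show "w \<tau> y ^ ?D * ((2 * C) ^ ?D * gr (z \<tau> y) ^ ?D) \<le> w \<tau> y ^ ?D * (k * exp ((\<bar>z \<tau> y\<bar> / N) powr p))"
            using w0 by (intro mult_left_mono) auto
          show "w \<tau> y ^ ?D \<le> \<rho> ^ ?D" using w0 wsmall(1)[OF \<tau>] by (intro power_mono) auto
        qed (use w0 wd \<rho> in \<open>simp_all, measurable\<close>)
        have "\<bar>f (u \<tau> y) - f (v \<tau> y)\<bar> ^ ?D \<le> w \<tau> y ^ ?D * ((2 * C) ^ ?D * gr (u \<tau> y) ^ ?D) + w \<tau> y ^ ?D * ((2 * C) ^ ?D * gr (v \<tau> y) ^ ?D)" for y
        proof -
          \<comment> \<open>The d-th power of a sum is handled through the maximum, whose power is
            at most the sum of the powers; the factor (2 C)^d is the cost.\<close>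
          define M where "M = max (gr (u \<tau> y)) (gr (v \<tau> y))"
          have M: "0 \<le> M" unfolding M_def using gr_nonneg by (simp add: le_max_iff_disj)
          have "\<bar>f (u \<tau> y) - f (v \<tau> y)\<bar> \<le> C * w \<tau> y * (gr (u \<tau> y) + gr (v \<tau> y))"
            using f_diff_le unfolding w_def .
          also have "\<dots> \<le> C * w \<tau> y * (M + M)" using C w0 unfolding M_def by (intro mult_left_mono add_mono) auto
          also have "\<dots> = w \<tau> y * ((2 * C) * M)" by simp
          finally have "\<bar>f (u \<tau> y) - f (v \<tau> y)\<bar> ^ ?D \<le> (w \<tau> y * ((2 * C) * M)) ^ ?D" by (intro power_mono) auto
          also have "\<dots> = w \<tau> y ^ ?D * ((2 * C) ^ ?D * M ^ ?D)" by (simp only: power_mult_distrib)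
          also have "\<dots> \<le> w \<tau> y ^ ?D * ((2 * C) ^ ?D * (gr (u \<tau> y) ^ ?D + gr (v \<tau> y) ^ ?D))"
            using C w0 gr_nonneg unfolding M_def by (intro mult_left_mono) (auto simp: max_def)
          finally show ?thesis by (simp add: distrib_left)
        qed
        then have "(\<integral>\<^sup>+y. ennreal (\<bar>f (u \<tau> y) - f (v \<tau> y)\<bar> ^ ?D) \<partial>lborel)
           \<le> (\<integral>\<^sup>+y. ennreal (w \<tau> y ^ ?D * ((2 * C) ^ ?D * gr (u \<tau> y) ^ ?D)) + ennreal (w \<tau> y ^ ?D * ((2 * C) ^ ?D * gr (v \<tau> y) ^ ?D)) \<partial>lborel)"
          using C w0 gr_nonneg by (intro nn_integral_mono) (simp flip: ennreal_plus add: ennreal_leI)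
        also have "\<dots> = (\<integral>\<^sup>+y. ennreal (w \<tau> y ^ ?D * ((2 * C) ^ ?D * gr (u \<tau> y) ^ ?D)) \<partial>lborel) + (\<integral>\<^sup>+y. ennreal (w \<tau> y ^ ?D * ((2 * C) ^ ?D * gr (v \<tau> y) ^ ?D)) \<partial>lborel)"
          by (rule nn_integral_add) measurable
        also have "\<dots> \<le> ennreal (k * (\<rho> ^ ?D + \<rho> ^ ?D)) + ennreal (k * (\<rho> ^ ?D + \<rho> ^ ?D))"
          by (intro add_mono part u v)
        also have "\<dots> = ennreal (4 * k * \<rho> ^ ?D)"
          using k \<rho> by (simp flip: ennreal_plus add: algebra_simps)
        also have "4 * k * \<rho> ^ ?D \<le> B ^ ?D"
        proof -
          have "4 * c4 \<le> (4 * c4) ^ ?D" using c4(1) by (intro self_le_power) auto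
          then have "(2 * C * n * \<rho>) ^ ?D * (4 * c4) \<le> (2 * C * n * \<rho>) ^ ?D * (4 * c4) ^ ?D"
            using C n \<rho> by (intro mult_left_mono) auto
          also have "\<dots> = (C * n * \<rho> * (8 * c4)) ^ ?D" unfolding power_mult_distrib[symmetric] by (simp add: mult_ac)
          also have "\<dots> \<le> B ^ ?D" using C n \<rho> c2 c4 by (intro power_mono cB) auto
          finally show ?thesis unfolding k_def by (simp add: power_mult_distrib mult_ac)
        qed
        finally show "(\<integral>\<^sup>+y. ennreal (\<bar>f (u \<tau> y) - f (v \<tau> y)\<bar> ^ ?D) \<partial>lborel) \<le> ennreal (B ^ ?D)" by (simp add: ennreal_leI)
      }
    qed
  qed
  with c show thesis by (rule that)
qed

section \<open>The fixed point\<close>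

definition mild :: "('a \<Rightarrow> real) \<Rightarrow> (real \<Rightarrow> 'a \<Rightarrow> real) \<Rightarrow> real \<Rightarrow> 'a \<Rightarrow> real" where
  "mild u0 D t x = sg u0 t x + D t x"

lemma weight_le_one: "max 1 t powr (- \<alpha>) \<le> 1"
  using powr_mono[of "- \<alpha>" 0 "max 1 t"] \<alpha> by (simp add: max_def split: if_splits)

text \<open>Because m > 1, a power N^(m-1) with N = k e is left over both in the size of the Duhamel
  term, which is a multiple of N^(m-1) e, and in its Lipschitz constant. For small e this beats the
  constants and gives the factor 1/2 twice.\<close>

lemma contraction:
  obtains e0 N where "0 < e0" "\<And>e. 0 < e \<Longrightarrow> 0 < N e"
    "\<And>e u0 D. 0 < e \<Longrightarrow> e \<le> e0 \<Longrightarrow> u0 \<in> borel_measurable borel \<Longrightarrow> modular p e u0 \<le> 1 \<Longrightarrow> good e D \<Longrightarrow>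
       smallness (N e) \<and> admissible (N e) (mild u0 D) \<and>
       (\<exists>B>0. source B (\<lambda>\<tau> y. f (mild u0 D \<tau> y))) \<and> good (e / 2) (duh (\<lambda>\<tau> y. f (mild u0 D \<tau> y)))"
    "\<And>e u0 D E \<rho>. 0 < e \<Longrightarrow> e \<le> e0 \<Longrightarrow> u0 \<in> borel_measurable borel \<Longrightarrow> modular p e u0 \<le> 1 \<Longrightarrow> good e D \<Longrightarrow> good e E \<Longrightarrow>
       0 < \<rho> \<Longrightarrow> good \<rho> (\<lambda>t x. D t x - E t x) \<Longrightarrow>
       good (\<rho> / 2) (\<lambda>t x. duh (\<lambda>\<tau> y. f (mild u0 D \<tau> y)) t x - duh (\<lambda>\<tau> y. f (mild u0 E \<tau> y)) t x)"
proof -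
  obtain k where k: "1 \<le> k" "\<And>e u0 D. 0 < e \<Longrightarrow> u0 \<in> borel_measurable borel \<Longrightarrow> modular p e u0 \<le> 1 \<Longrightarrow> good e D \<Longrightarrow>
       admissible (k * e) (mild u0 D)"
    using admissible_sg_add unfolding mild_def[abs_def] by blast
  obtain c1 where c1: "1 \<le> c1" "\<And>N u. smallness N \<Longrightarrow> admissible N u \<Longrightarrow> source (c1 * N powr m) (\<lambda>\<tau> y. f (u \<tau> y))"
    using source_f by blast
  obtain c2 where c2: "1 \<le> c2" "\<And>N u v \<rho>. smallness N \<Longrightarrow> admissible N u \<Longrightarrow> admissible N v \<Longrightarrow> 0 < \<rho> \<Longrightarrow>
     good \<rho> (\<lambda>\<tau> y. u \<tau> y - v \<tau> y) \<Longrightarrow> source (c2 * N powr (m - 1) * \<rho>) (\<lambda>\<tau> y. f (u \<tau> y) - f (v \<tau> y))"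
    using source_f_diff by blast
  define d where "d = real DIM('a)"
  have d: "0 < d" unfolding d_def by simp
  \<comment> \<open>The three thresholds for N: the smallness of the exponential rate, mapping the
    ball of radius e into the one of radius e/2, and the contraction factor 1/2.\<close>
  define a where "a = min ((1 / (4 * (d * lam))) powr (1 / p)) (min ((1 / (2 * A0 * c1 * k)) powr (1 / (m - 1))) ((1 / (2 * A0 * c2)) powr (1 / (m - 1))))"
  have a: "0 < a" unfolding a_def using d lam A0_pos c1 c2 k by auto
  have a1: "d * lam * N powr p \<le> 1 / 4" if "0 < N" "N \<le> a" for N
  proof -
    have "N \<le> (1 / (4 * (d * lam))) powr (1 / p)" using that unfolding a_def by simp
    then have "N powr p \<le> ((1 / (4 * (d * lam))) powr (1 / p)) powr p" using that p1 by (intro powr_mono2) auto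
    also have "\<dots> = 1 / (4 * (d * lam))" using p1 d lam by (simp add: powr_powr)
    finally show ?thesis using d lam by (simp add: field_simps)
  qed
  have pw: "N powr (m - 1) \<le> q" if "0 < N" "N \<le> q powr (1 / (m - 1))" "0 < q" for N q
  proof -
    have "N powr (m - 1) \<le> (q powr (1 / (m - 1))) powr (m - 1)" using that m1 by (intro powr_mono2) auto
    also have "\<dots> = q" using m1 that by (simp add: powr_powr)
    finally show ?thesis .
  qed
  have a2: "A0 * c1 * k * N powr (m - 1) \<le> 1 / 2" if "0 < N" "N \<le> a" for N
    using pw[of N "1 / (2 * A0 * c1 * k)"] that A0_pos c1 k unfolding a_def by (simp add: field_simps)
  have a3: "A0 * c2 * N powr (m - 1) \<le> 1 / 2" if "0 < N" "N \<le> a" for N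
    using pw[of N "1 / (2 * A0 * c2)"] that A0_pos c2 unfolding a_def by (simp add: field_simps)
  define e0 where "e0 = a / k"
  have e0: "0 < e0" unfolding e0_def using a k by simp
  have N: "0 < k * e" "k * e \<le> a" if "0 < e" "e \<le> e0" for e
    using that k unfolding e0_def by (auto simp: field_simps)
  have sm: "smallness (k * e)" if "0 < e" "e \<le> e0" for e
    unfolding smallness_def using a1[of "k * e"] N[OF that] unfolding d_def by simp
  show thesis
  proof (rule that[OF e0, of "\<lambda>e. k * e"])
    show "0 < k * e" if "0 < e" for e using that k by simp
    fix e D and u0 :: "'a \<Rightarrow> real" assume e: "0 < e" "e \<le> e0" and u0: "u0 \<in> borel_measurable borel" "modular p e u0 \<le> 1" and D: "good e D"
    note ad = k(2)[OF e(1) u0 D]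
    have so: "source (c1 * (k * e) powr m) (\<lambda>\<tau> y. f (mild u0 D \<tau> y))" by (rule c1(2)[OF sm[OF e] ad])
    have "0 < (k * e) powr m" using N(1)[OF e] by (simp only: powr_gt_zero)
    then have pos: "0 < c1 * (k * e) powr m" using c1(1) by simp
    have "(k * e) powr m = (k * e) * (k * e) powr (m - 1)" using N(1)[OF e] by (subst powr_mult_base) auto
    then have "A0 * (c1 * (k * e) powr m) = (A0 * c1 * k * (k * e) powr (m - 1)) * e" by simp
    also have "\<dots> \<le> 1 / 2 * e" using a2[OF N[OF e]] e by (intro mult_right_mono) auto
    finally have "good (e / 2) (duh (\<lambda>\<tau> y. f (mild u0 D \<tau> y)))"
      by (intro good_mono[OF good_duh[OF so pos]]) simp
    then show "smallness (k * e) \<and> admissible (k * e) (mild u0 D) \<and>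
       (\<exists>B>0. source B (\<lambda>\<tau> y. f (mild u0 D \<tau> y))) \<and> good (e / 2) (duh (\<lambda>\<tau> y. f (mild u0 D \<tau> y)))"
      using sm[OF e] ad so pos by blast
  next
    fix e D E \<rho> and u0 :: "'a \<Rightarrow> real"
    assume e: "0 < e" "e \<le> e0" and u0: "u0 \<in> borel_measurable borel" "modular p e u0 \<le> 1" and D: "good e D" and E: "good e E"
      and \<rho>: "0 < \<rho>" and DE: "good \<rho> (\<lambda>t x. D t x - E t x)"
    have soD: "source (c1 * (k * e) powr m) (\<lambda>\<tau> y. f (mild u0 D \<tau> y))" by (rule c1(2)[OF sm[OF e] k(2)[OF e(1) u0 D]])
    have soE: "source (c1 * (k * e) powr m) (\<lambda>\<tau> y. f (mild u0 E \<tau> y))" by (rule c1(2)[OF sm[OF e] k(2)[OF e(1) u0 E]])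
    have "0 < (k * e) powr m" using N(1)[OF e] by (simp only: powr_gt_zero)
    then have pos: "0 < c1 * (k * e) powr m" using c1(1) by simp
    have so: "source (c2 * (k * e) powr (m - 1) * \<rho>) (\<lambda>\<tau> y. f (mild u0 D \<tau> y) - f (mild u0 E \<tau> y))"
    proof (rule c2(2)[OF sm[OF e] k(2)[OF e(1) u0 D] k(2)[OF e(1) u0 E] \<rho>])
      show "good \<rho> (\<lambda>\<tau> y. mild u0 D \<tau> y - mild u0 E \<tau> y)" using DE unfolding mild_def by simp
    qed
    have "0 < (k * e) powr (m - 1)" using N(1)[OF e] by (simp only: powr_gt_zero)
    then have pos2: "0 < c2 * (k * e) powr (m - 1) * \<rho>" using c2(1) \<rho> by simp
    have "A0 * (c2 * (k * e) powr (m - 1) * \<rho>) = (A0 * c2 * (k * e) powr (m - 1)) * \<rho>" by simp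
    also have "\<dots> \<le> 1 / 2 * \<rho>" using a3[OF N[OF e]] \<rho> by (intro mult_right_mono) auto
    finally have g: "good (\<rho> / 2) (duh (\<lambda>\<tau> y. f (mild u0 D \<tau> y) - f (mild u0 E \<tau> y)))"
      by (intro good_mono[OF good_duh[OF so pos2]]) simp
    show "good (\<rho> / 2) (\<lambda>t x. duh (\<lambda>\<tau> y. f (mild u0 D \<tau> y)) t x - duh (\<lambda>\<tau> y. f (mild u0 E \<tau> y)) t x)"
      by (rule good_cong[OF g])
        (auto intro!: jointly_measurable_diff duh_joint sourceD(1)[OF soD] sourceD(1)[OF soE] duh_diff[OF soD soE pos pos, symmetric])
  qed
qed

lemma jointly_measurable_lim:
  assumes "\<And>n::nat. jointly_measurable (F n)"
  shows "jointly_measurable (\<lambda>t x. lim (\<lambda>n. F n t x))"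
  using assms unfolding jointly_measurable_def by (rule borel_measurable_lim_metric)

text \<open>Picard iteration with the bounds of \<open>good\<close> as the measure of distance. They
  include a supremum bound, so the iterates converge at every point and the limit satisfies the
  Duhamel equation at every x and t > 0, not only almost everywhere.\<close>

theorem fixed_point:
  obtains e0 where "0 < e0"
    "\<And>e u0. 0 < e \<Longrightarrow> e \<le> e0 \<Longrightarrow> u0 \<in> borel_measurable borel \<Longrightarrow> modular p e u0 \<le> 1 \<Longrightarrow>
       \<exists>D N B. good e D \<and> smallness N \<and> admissible N (mild u0 D) \<and> 0 < B \<and> source B (\<lambda>\<tau> y. f (mild u0 D \<tau> y)) \<and>
         (\<forall>t>0. \<forall>x. D t x = duh (\<lambda>\<tau> y. f (mild u0 D \<tau> y)) t x)"
proof (rule contraction)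
  fix e0 :: real and N :: "real \<Rightarrow> real"
  assume e0: "0 < e0" and "\<And>e. 0 < e \<Longrightarrow> 0 < N e"
    and ct: "\<And>e u0 D. 0 < e \<Longrightarrow> e \<le> e0 \<Longrightarrow> u0 \<in> borel_measurable borel \<Longrightarrow> modular p e u0 \<le> 1 \<Longrightarrow> good e D \<Longrightarrow>
       smallness (N e) \<and> admissible (N e) (mild u0 D) \<and>
       (\<exists>B>0. source B (\<lambda>\<tau> y. f (mild u0 D \<tau> y))) \<and> good (e / 2) (duh (\<lambda>\<tau> y. f (mild u0 D \<tau> y)))"
    and ct2: "\<And>e u0 D E \<rho>. 0 < e \<Longrightarrow> e \<le> e0 \<Longrightarrow> u0 \<in> borel_measurable borel \<Longrightarrow> modular p e u0 \<le> 1 \<Longrightarrow> good e D \<Longrightarrow> good e E \<Longrightarrow>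
       0 < \<rho> \<Longrightarrow> good \<rho> (\<lambda>t x. D t x - E t x) \<Longrightarrow>
       good (\<rho> / 2) (\<lambda>t x. duh (\<lambda>\<tau> y. f (mild u0 D \<tau> y)) t x - duh (\<lambda>\<tau> y. f (mild u0 E \<tau> y)) t x)"
  have "\<exists>D N B. good e D \<and> smallness N \<and> admissible N (mild u0 D) \<and> 0 < B \<and> source B (\<lambda>\<tau> y. f (mild u0 D \<tau> y)) \<and>
         (\<forall>t>0. \<forall>x. D t x = duh (\<lambda>\<tau> y. f (mild u0 D \<tau> y)) t x)"
    if e: "0 < e" "e \<le> e0" and u0: "u0 \<in> borel_measurable borel" "modular p e u0 \<le> 1" for e and u0 :: "'a \<Rightarrow> real"
  proof -
    define \<Phi> where "\<Phi> D = duh (\<lambda>\<tau> y. f (mild u0 D \<tau> y))" for D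
    define F where "F n = (\<Phi> ^^ n) (\<lambda>t x. 0)" for n
    have F0: "F 0 = (\<lambda>t x. 0)" and FS: "F (Suc n) = \<Phi> (F n)" for n unfolding F_def by simp_all
    \<comment> \<open>The increments are bounded by e/2, e/4, and so on, so the partial sums e (1 -
      (1/2)^n) never leave the ball of radius e, where the contraction estimate holds.\<close>
    have main: "good (e * (1 - (1/2)^n)) (F n) \<and> good (e * (1/2)^Suc n) (\<lambda>t x. F (Suc n) t x - F n t x)" for n
    proof (induction n)
      case 0
      have "good e (\<lambda>t x. 0)" by (rule good_mono[OF good_zero]) (use e in simp)
      then have "good (e / 2) (\<Phi> (\<lambda>t x. 0))" using ct[OF e u0] unfolding \<Phi>_def by blast
      then show ?case unfolding FS F0 using good_zero by simp
    next
      case (Suc n)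
      have pos: "0 \<le> e * (1 - (1/2)^n)" "0 < e * (1/2)^Suc n" using e by (auto simp: power_le_one)
      have "good (e * (1 - (1/2)^n) + e * (1/2)^Suc n) (\<lambda>t x. F n t x + (F (Suc n) t x - F n t x))"
        using Suc pos by (intro good_add) auto
      then have 1: "good (e * (1 - (1/2)^Suc n)) (F (Suc n))" by (simp add: field_simps)
      have le: "e * (1 - (1/2)^k) \<le> e" for k using e by (simp add: mult_left_le)
      have "good (e * (1/2)^Suc n / 2) (\<lambda>t x. \<Phi> (F (Suc n)) t x - \<Phi> (F n) t x)"
        unfolding \<Phi>_def
        by (rule ct2[OF e u0 good_mono[OF 1 le] good_mono[OF conjunct1[OF Suc] le] pos(2) conjunct2[OF Suc]])
      then show ?case using 1 unfolding FS by simp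
    qed
    have le: "e * (1 - (1/2)^k) \<le> e" for k using e by (simp add: mult_left_le)
    have gF: "good e (F n)" for n using good_mono[OF conjunct1[OF main] le] .
    have gdiff: "good (e * ((1/2)^n - (1/2)^(n + k))) (\<lambda>t x. F (n + k) t x - F n t x)" for n k
    proof (induction k)
      case 0
      then show ?case using good_zero by simp
    next
      case (Suc k)
      have "good (e * ((1/2)^n - (1/2)^(n + k)) + e * (1/2)^Suc (n + k)) (\<lambda>t x. (F (n + k) t x - F n t x) + (F (Suc (n + k)) t x - F (n + k) t x))"
        using Suc main[of "n + k"] e by (intro good_add) (auto intro!: mult_nonneg_nonneg power_decreasing)
      then show ?case by (simp add: field_simps)
    qed
    have gdiff': "good (e * (1/2)^n) (\<lambda>t x. F (n + k) t x - F n t x)" for n k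
      by (rule good_mono[OF gdiff]) (use e in simp)
    define D where "D t x = lim (\<lambda>n. F n t x)" for t x
    have Dj: "jointly_measurable D" unfolding D_def[abs_def] by (rule jointly_measurable_lim) (rule goodD(1)[OF gF])
    have geo: "(\<lambda>n. e * (1/2)^n) \<longlonglongrightarrow> 0"
      using tendsto_mult_left[OF LIMSEQ_realpow_zero[of "1/2 :: real"], of e] by simp
    have conv: "(\<lambda>n. F n t x) \<longlonglongrightarrow> D t x" if t: "0 < t" for t x
    proof -
      have w1: "max 1 t powr (- \<alpha>) \<le> 1" by (rule weight_le_one)
      have dF: "\<bar>F (n + k) t x - F n t x\<bar> \<le> e * (1/2)^n" for n k
      proof -
        have "\<bar>F (n + k) t x - F n t x\<bar> \<le> e * (1/2)^n * max 1 t powr (- \<alpha>)" by (rule goodD(2)[OF gdiff' t])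
        also have "\<dots> \<le> e * (1/2)^n * 1" using e by (intro mult_left_mono w1) auto
        finally show ?thesis by simp
      qed
      have "Cauchy (\<lambda>n. F n t x)"
      proof (rule CauchyI')
        fix \<epsilon> :: real assume "0 < \<epsilon>"
        from order_tendstoD(2)[OF geo this] obtain M where M: "e * (1/2)^M < \<epsilon> / 1" "\<And>n. n \<ge> M \<Longrightarrow> e * (1/2)^n < \<epsilon>"
          by (auto simp: eventually_sequentially)
        have "dist (F i t x) (F j t x) < \<epsilon>" if "M \<le> i" "i < j" for i j
          using dF[of i "j - i"] M(2)[OF that(1)] that by (simp add: dist_real_def abs_minus_commute)
        then show "\<exists>M. \<forall>i\<ge>M. \<forall>j>i. dist (F i t x) (F j t x) < \<epsilon>" by blast
      qed
      then have "convergent (\<lambda>n. F n t x)" by (simp add: Cauchy_convergent_iff)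
      then show ?thesis unfolding D_def by (simp add: convergent_LIMSEQ_iff)
    qed
    have gDF: "good (e * (1/2)^n) (\<lambda>t x. D t x - F n t x)" for n
    proof (rule good_limit[OF gdiff'])
      show "jointly_measurable (\<lambda>t x. D t x - F n t x)" by (intro jointly_measurable_diff Dj goodD(1)[OF gF])
      show "(\<lambda>k. F (n + k) t x - F n t x) \<longlonglongrightarrow> D t x - F n t x" if "0 < t" for t x
        using LIMSEQ_ignore_initial_segment[OF conv[OF that, of x], of n]
        by (intro tendsto_diff tendsto_const) (simp add: add.commute)
    qed
    have gD: "good e D" by (rule good_limit[OF gF Dj conv])
    have fix1: "D t x = \<Phi> D t x" if t: "0 < t" for t x
    proof -
      have w1: "max 1 t powr (- \<alpha>) \<le> 1" by (rule weight_le_one)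
      have bnd: "\<bar>D t x - \<Phi> D t x\<bar> \<le> e * (1/2)^n" for n
      proof -
        have pos: "0 < e * (1/2)^n" using e by simp
        have g: "good (e * (1/2)^n / 2) (\<lambda>t x. \<Phi> D t x - \<Phi> (F n) t x)"
          unfolding \<Phi>_def by (rule ct2[OF e u0 gD gF pos gDF])
        have "\<bar>D t x - F (Suc n) t x\<bar> \<le> e * (1/2)^Suc n * max 1 t powr (- \<alpha>)" by (rule goodD(2)[OF gDF t])
        also have "\<dots> \<le> e * (1/2)^Suc n * 1" using e by (intro mult_left_mono w1) auto
        finally have 1: "\<bar>D t x - F (Suc n) t x\<bar> \<le> e * (1/2)^n / 2" by simp
        have "\<bar>\<Phi> D t x - \<Phi> (F n) t x\<bar> \<le> e * (1/2)^n / 2 * max 1 t powr (- \<alpha>)" by (rule goodD(2)[OF g t])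
        also have "\<dots> \<le> e * (1/2)^n / 2 * 1" using e by (intro mult_left_mono w1) auto
        finally have 2: "\<bar>\<Phi> D t x - F (Suc n) t x\<bar> \<le> e * (1/2)^n / 2" unfolding FS by simp
        show ?thesis using 1 2 by linarith
      qed
      have "\<bar>D t x - \<Phi> D t x\<bar> \<le> 0" by (rule LIMSEQ_le_const[OF geo]) (use bnd in auto)
      then show ?thesis by simp
    qed
    show ?thesis using ct[OF e u0 gD] gD fix1 unfolding \<Phi>_def by blast
  qed
  with e0 show thesis by (rule that)
qed

end

section \<open>Continuity in time\<close>

text \<open>The Heine-Cantor theorem for an abstract closeness relation, by a Lebesgue number of the
  cover. The second point may lie outside S, as a rounded time may.\<close>

lemma compact_uniform_closeness:
  fixes R :: "real \<Rightarrow> real \<Rightarrow> real \<Rightarrow> bool"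
  assumes S: "compact S"
    and sym: "\<And>e a b. R e a b \<Longrightarrow> R e b a"
    and tri: "\<And>e e' a b c. R e a b \<Longrightarrow> R e' b c \<Longrightarrow> R (e + e') a c"
    and refl: "\<And>e a. 0 < e \<Longrightarrow> R e a a"
    and loc: "\<And>e a. a \<in> S \<Longrightarrow> 0 < e \<Longrightarrow> \<forall>\<^sub>F b in at a. R e b a"
    and e: "0 < e"
  obtains \<delta> where "0 < \<delta>" "\<And>a b. a \<in> S \<Longrightarrow> \<bar>b - a\<bar> < \<delta> \<Longrightarrow> R e b a"
proof -
  have "\<exists>U. open U \<and> a \<in> U \<and> (\<forall>b\<in>U. R (e/2) b a)" if "a \<in> S" for a
  proof -
    have "\<forall>\<^sub>F b in at a. R (e/2) b a" using loc[OF that, of "e/2"] e by simp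
    then obtain U where "open U" "a \<in> U" "\<And>b. b \<in> U \<Longrightarrow> b \<noteq> a \<Longrightarrow> R (e/2) b a"
      unfolding eventually_at_topological by blast
    then show ?thesis using refl[of "e/2" a] e by (intro exI[of _ U]) force
  qed
  then obtain U where U: "\<And>a. a \<in> S \<Longrightarrow> open (U a)" "\<And>a. a \<in> S \<Longrightarrow> a \<in> U a" "\<And>a b. a \<in> S \<Longrightarrow> b \<in> U a \<Longrightarrow> R (e/2) b a"
    by metis
  obtain \<delta> where \<delta>: "0 < \<delta>" "\<And>x. x \<in> S \<Longrightarrow> \<exists>G \<in> U ` S. ball x \<delta> \<subseteq> G"
    using Heine_Borel_lemma[OF S, of "U ` S"] U by blast
  have "R e b a" if a: "a \<in> S" and b: "\<bar>b - a\<bar> < \<delta>" for a b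
  proof -
    obtain c where c: "c \<in> S" "ball a \<delta> \<subseteq> U c" using \<delta>(2)[OF a] by auto
    have "b \<in> U c" using c(2) b by (auto simp: dist_real_def abs_minus_commute)
    moreover have "a \<in> U c" using c(2) \<delta>(1) by auto
    ultimately have "R (e/2 + e/2) b a" using U(3)[OF c(1)] by (intro tri[of _ b c]) (auto intro: sym)
    then show ?thesis by simp
  qed
  with \<delta>(1) show thesis by (rule that)
qed

text \<open>Closeness in L^1 and L^\<infinity> together. It dominates the exp L^p norm up to a
  factor 3, and a small kernel maps L^1 into small functions.\<close>

definition small :: "real \<Rightarrow> ('a::euclidean_space \<Rightarrow> real) \<Rightarrow> bool" where
  "small e g \<longleftrightarrow> (\<forall>x. \<bar>g x\<bar> \<le> e) \<and> mass g \<le> ennreal e"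

lemma smallD:
  assumes "small e g"
  shows "\<bar>g x\<bar> \<le> e" "mass g \<le> ennreal e" "0 \<le> e"
proof -
  show 1: "\<bar>g x\<bar> \<le> e" for x using assms unfolding small_def by simp
  show "mass g \<le> ennreal e" using assms unfolding small_def by simp
  show "0 \<le> e" using 1[of 0] by linarith
qed

lemma small_mono: "small e g \<Longrightarrow> e \<le> e' \<Longrightarrow> small e' g"
  unfolding small_def by (meson ennreal_leI order_trans)

lemma small_zero: "0 \<le> e \<Longrightarrow> small e (\<lambda>x. 0)"
  unfolding small_def by simp

lemma small_swap: "small e (\<lambda>x. g x - h x) \<Longrightarrow> small e (\<lambda>x. h x - g x)"
  unfolding small_def by (simp add: abs_minus_commute)

lemma small_add:
  assumes [measurable]: "g \<in> borel_measurable borel" "h \<in> borel_measurable borel"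
    and g: "small a g" and h: "small b h"
  shows "small (a + b) (\<lambda>x. g x + h x)"
  unfolding small_def
proof (intro conjI allI)
  show "\<bar>g x + h x\<bar> \<le> a + b" for x using smallD(1)[OF g, of x] smallD(1)[OF h, of x] by linarith
  have "mass (\<lambda>x. g x + h x) \<le> (\<integral>\<^sup>+x. ennreal \<bar>g x\<bar> + ennreal \<bar>h x\<bar> \<partial>lborel)"
    by (intro nn_integral_mono) (simp flip: ennreal_plus add: ennreal_leI abs_triangle_ineq)
  also have "\<dots> = mass g + mass h"
    by (rule nn_integral_add) measurable
  also have "\<dots> \<le> ennreal a + ennreal b" by (intro add_mono smallD(2) g h)
  also have "\<dots> = ennreal (a + b)" using smallD(3)[OF g] smallD(3)[OF h] by simp
  finally show "mass (\<lambda>x. g x + h x) \<le> ennreal (a + b)" .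
qed

lemma small_triangle:
  assumes [measurable]: "g \<in> borel_measurable borel" "h \<in> borel_measurable borel" "k \<in> borel_measurable borel"
    and "small a (\<lambda>x. g x - h x)" "small b (\<lambda>x. h x - k x)"
  shows "small (a + b) (\<lambda>x. g x - k x)"
  using small_add[OF _ _ assms(4,5)] by simp

lemma modular_small:
  assumes p: "1 \<le> p" and g: "g \<in> borel_measurable borel" and e: "0 < e" and s: "small e g"
  shows "modular p (3 * e) g \<le> 1"
proof (rule modular_bounded[OF p g])
  show "\<bar>g x\<bar> \<le> e" for x by (rule smallD(1)[OF s])
  show "mass g \<le> ennreal e" by (rule smallD(2)[OF s])
  have "3 * e powr (p - 1) * e = 3 * e powr p" using e by (simp add: powr_mult_base mult.commute)
  also have "\<dots> \<le> 3 powr p * e powr p" using p powr_mono[of 1 p "3::real"] by (simp add: mult_right_mono)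
  finally show "3 * e powr (p - 1) * e \<le> (3 * e) powr p" using e by (simp add: powr_mult)
qed (use e in auto)

lemma curve_uniform:
  fixes S :: "real set" and G :: "real \<Rightarrow> 'a::euclidean_space \<Rightarrow> real"
  assumes S: "compact S" and G: "\<And>t. G t \<in> borel_measurable borel"
    and loc: "\<And>a e. a \<in> S \<Longrightarrow> 0 < e \<Longrightarrow> \<forall>\<^sub>F b in at a. small e (\<lambda>x. G b x - G a x)" and e: "0 < e"
  obtains \<delta> where "0 < \<delta>" "\<And>a b. a \<in> S \<Longrightarrow> \<bar>b - a\<bar> < \<delta> \<Longrightarrow> small e (\<lambda>x. G b x - G a x)"
proof (rule compact_uniform_closeness[OF S, of "\<lambda>e b a. small e (\<lambda>x. G b x - G a x)" e])
  show "small e (\<lambda>x. G a x - G a x)" if "0 < e" for e a using small_zero[of e] that by simp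
qed (use G e in \<open>auto intro: small_swap small_triangle loc that\<close>)

lemma nconv_diff_kernel:
  assumes Q: "small e Q" and [measurable]: "Q \<in> borel_measurable borel" "u \<in> borel_measurable borel"
    and u: "mass u \<le> ennreal B" and B: "0 \<le> B"
  shows "nconv Q u x \<le> ennreal (e * B)" "(\<integral>\<^sup>+x. nconv Q u x \<partial>lborel) \<le> ennreal (e * B)"
proof -
  have "nconv Q u x \<le> ennreal (e * 0 + e * B)"
    by (rule nconv_bound[where v="\<lambda>y. \<bar>u y\<bar>"]) (use smallD[OF Q] u B in \<open>simp_all, measurable\<close>)
  then show "nconv Q u x \<le> ennreal (e * B)" by simp
  have "(\<integral>\<^sup>+x. nconv Q u x \<partial>lborel) \<le> ennreal e * ennreal B"
    by (subst nconv_L1) (use smallD(2)[OF Q] u in \<open>auto intro!: mult_mono\<close>)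
  then show "(\<integral>\<^sup>+x. nconv Q u x \<partial>lborel) \<le> ennreal (e * B)"
    using smallD(3)[OF Q] B by (simp add: ennreal_mult)
qed

lemma conv_diff_kernel:
  assumes "nconv Q u x < \<infinity>" "nconv Q' u x < \<infinity>" and [measurable]: "Q \<in> borel_measurable borel" "Q' \<in> borel_measurable borel" "u \<in> borel_measurable borel"
  shows "conv (\<lambda>z. Q z - Q' z) u x = conv Q u x - conv Q' u x"
proof -
  have "integrable lborel (\<lambda>y. Q (x - y) * u y)" "integrable lborel (\<lambda>y. Q' (x - y) * u y)"
    using assms(1,2) unfolding nconv_def by (auto intro!: integrableI_bounded)
  then show ?thesis unfolding conv_def by (simp add: left_diff_distrib)
qed

lemma conv_diff_function:
  assumes "nconv Q u x < \<infinity>" "nconv Q u' x < \<infinity>" and [measurable]: "Q \<in> borel_measurable borel" "u' \<in> borel_measurable borel" "u \<in> borel_measurable borel"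
  shows "conv Q (\<lambda>z. u z - u' z) x = conv Q u x - conv Q u' x"
proof -
  have "integrable lborel (\<lambda>y. Q (x - y) * u y)" "integrable lborel (\<lambda>y. Q (x - y) * u' y)"
    using assms(1,2) unfolding nconv_def by (auto intro!: integrableI_bounded)
  then show ?thesis unfolding conv_def by (simp add: right_diff_distrib)
qed

lemma if_le_ennreal_if:
  "(A \<Longrightarrow> A') \<Longrightarrow> (A \<Longrightarrow> y \<le> ennreal z) \<Longrightarrow> (if A then y else 0) \<le> ennreal (if A' then z else 0)"
  by auto

lemma nn_integral_if_const: "(\<integral>\<^sup>+x. (if A then g x else 0) \<partial>M) = (if A then (\<integral>\<^sup>+x. g x \<partial>M) else 0)"
  by simp

lemma nn_integral_tail_const:
  fixes l t c :: real
  assumes "l \<le> t" "0 \<le> c"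
  shows "time_integral l t (\<lambda>\<tau>. c) = ennreal (c * (t - l))"
proof -
  have "time_integral l t (\<lambda>\<tau>. c) = (\<integral>\<^sup>+\<tau>. ennreal c * indicator {l<..<t} \<tau> \<partial>lborel)"
    by (intro nn_integral_cong) (auto simp: indicator_def)
  also have "\<dots> = ennreal (c * (t - l))" using assms by (simp add: nn_integral_cmult_indicator ennreal_mult)
  finally show ?thesis .
qed

lemma nn_integral_tail_inverse_sqrt:
  fixes l t c :: real
  assumes t: "l \<le> t" and c: "0 \<le> c"
  shows "time_integral l t (\<lambda>\<tau>. c * (1 + (t - \<tau>) powr (- 1 / 2))) \<le> ennreal (c * ((t - l) + 2 * sqrt (t - l)))"
proof -
  let ?g = "\<lambda>\<tau>. ennreal (if 0 < \<tau> \<and> \<tau> < t - l then c * (1 + ((t - l) - \<tau>) powr (- 1 / 2)) else 0)"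
  have "time_integral l t (\<lambda>\<tau>. c * (1 + (t - \<tau>) powr (- 1 / 2)))
     = (\<integral>\<^sup>+\<tau>. ?g (\<tau> - l) \<partial>lborel)"
    by (intro nn_integral_cong) auto
  also have "\<dots> = (\<integral>\<^sup>+\<tau>. ?g \<tau> \<partial>lborel)" by (rule nn_integral_lborel_shift[of ?g]) measurable
  also have "\<dots> \<le> ennreal (c * ((t - l) + 2 * sqrt (t - l)))"
    using t c by (intro nn_integral_one_plus_inverse_sqrt) auto
  finally show ?thesis .
qed

context heat_kernel
begin

lemma P_small:
  assumes t: "0 < t" and e: "0 < e"
  shows "\<forall>\<^sub>F t' in at t. small e (\<lambda>x. P t' x - P t x)"
proof -
  have "\<forall>\<^sub>F t' in at t. mass (\<lambda>x. P t' x - P t x) < ennreal e"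
    by (rule order_tendstoD(2)[OF P_L1[OF t]]) (use e in simp)
  with P_uniform[OF t e] show ?thesis
    by eventually_elim (simp add: small_def less_imp_le)
qed

lemma P_small_uniform:
  assumes "0 < l" and e: "0 < e"
  obtains \<delta> where "0 < \<delta>" "\<And>a b. a \<in> {l..T} \<Longrightarrow> \<bar>b - a\<bar> < \<delta> \<Longrightarrow> small e (\<lambda>x. P b x - P a x)"
  using curve_uniform[of "{l..T}" P e] P_small assms by auto

lemma nconv_P_L1_bound:
  assumes t: "0 < t" and u: "u \<in> borel_measurable borel" "mass u \<le> ennreal B"
  shows "(\<integral>\<^sup>+x. nconv (P t) u x \<partial>lborel) \<le> ennreal B"
  using nconv_P_L1[OF t u(1)] u(2) by simp

lemma nconv_P_sup_bound:
  assumes t: "0 < t" and [measurable]: "u \<in> borel_measurable borel" and u: "mass u \<le> ennreal B" and B: "0 \<le> B"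
  shows "nconv (P t) u x \<le> ennreal (K * t powr (- (real DIM('a) / 2)) * B)"
proof -
  have "nconv (P t) u x \<le> ennreal (0 + (K * t powr (- (real DIM('a) / 2))) * B)"
    by (rule nconv_P_bound[OF t, where v="\<lambda>y. \<bar>u y\<bar>"]) (use P_le_local[OF t] u B in \<open>simp_all, measurable\<close>)
  then show ?thesis by simp
qed

end

context heat_exponents
begin

text \<open>Up to time a - \<eta> both kernels are evaluated at times \<ge> \<eta>, away from their
  singularity, and differ by at most \<omega>. The remaining intervals (a - \<eta>, b) and (a -
  \<eta>, a) have length at most r, and there each integral is small by itself because the
  singularity is integrable.\<close>

lemma duh_increment:
  assumes h: "source B h" and B: "0 < B" and ab: "0 < a" "a < b" and \<eta>: "0 < \<eta>" "\<eta> < a" and w: "0 < \<omega>"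
    and close: "\<And>\<tau>. 0 < \<tau> \<Longrightarrow> \<tau> \<le> a - \<eta> \<Longrightarrow> small \<omega> (\<lambda>x. P (b - \<tau>) x - P (a - \<tau>) x)"
  defines "r \<equiv> b - a + \<eta>"
  shows "small (\<omega> * B * b + 2 * ((1 + K) * B) * (r + 2 * sqrt r)) (\<lambda>x. duh h b x - duh h a x)"
proof -
  note [measurable (raw)] = jointly_measurableD[OF sourceD(1)[OF h]]
  define l where "l = a - \<eta>"
  define c where "c = (1 + K) * B"
  have c: "0 < c" unfolding c_def using K B by (intro mult_pos_pos) auto
  have Bc: "B \<le> c" unfolding c_def using K B by (simp add: distrib_right)
  have r: "0 < r" "r = b - l" "a - l \<le> r" unfolding r_def l_def using ab \<eta> by auto
  define F where "F t \<tau> x = (if 0 < \<tau> \<and> \<tau> < t then conv (P (t - \<tau>)) (h \<tau>) x else 0)" for t \<tau> x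
  define m where "m \<tau> x = (if 0 < \<tau> \<and> \<tau> \<le> l then nconv (\<lambda>z. P (b - \<tau>) z - P (a - \<tau>) z) (h \<tau>) x else 0)
     + ((if l < \<tau> \<and> \<tau> < b then nconv (P (b - \<tau>)) (h \<tau>) x else 0) + (if l < \<tau> \<and> \<tau> < a then nconv (P (a - \<tau>)) (h \<tau>) x else 0))" for \<tau> x
  have m_meas [measurable]: "(\<lambda>z. m (fst z) (snd z)) \<in> borel_measurable (lborel \<Otimes>\<^sub>M lborel)"
    unfolding m_def nconv_def by measurable
  have fin: "nconv (P (t - \<tau>)) (h \<tau>) x < \<infinity>" if "0 < \<tau>" "\<tau> < t" for t \<tau> x
    using nconv_source_local[OF h B that, of x] by (metis ennreal_less_top infinity_ennreal_def le_less_trans)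
  have l0: "0 < l" unfolding l_def using \<eta> by simp
  have Fm: "ennreal \<bar>F b \<tau> x - F a \<tau> x\<bar> \<le> m \<tau> x" for \<tau> x
  proof (cases "0 < \<tau> \<and> \<tau> \<le> l")
    case True
    then have \<tau>: "0 < \<tau>" "\<tau> < a" "\<tau> < b" using ab \<eta> unfolding l_def by auto
    have "F b \<tau> x - F a \<tau> x = conv (\<lambda>z. P (b - \<tau>) z - P (a - \<tau>) z) (h \<tau>) x"
      unfolding F_def using \<tau> by (subst conv_diff_kernel) (auto intro!: fin[unfolded infinity_ennreal_def])
    then have "ennreal \<bar>F b \<tau> x - F a \<tau> x\<bar> \<le> nconv (\<lambda>z. P (b - \<tau>) z - P (a - \<tau>) z) (h \<tau>) x"
      using conv_le_nconv by metis
    then show ?thesis unfolding m_def using True by auto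
  next
    case False
    have 1: "ennreal \<bar>F t \<tau> x\<bar> \<le> (if l < \<tau> \<and> \<tau> < t then nconv (P (t - \<tau>)) (h \<tau>) x else 0)" for t
      unfolding F_def using False conv_le_nconv by auto
    have "ennreal \<bar>F b \<tau> x - F a \<tau> x\<bar> \<le> ennreal \<bar>F b \<tau> x\<bar> + ennreal \<bar>F a \<tau> x\<bar>"
      by (simp flip: ennreal_plus add: ennreal_leI abs_triangle_ineq4)
    also have "\<dots> \<le> m \<tau> x" unfolding m_def if_not_P[OF False] add_0_left by (intro add_mono 1)
    finally show ?thesis .
  qed
  have diff: "ennreal \<bar>duh h b x - duh h a x\<bar> \<le> (\<integral>\<^sup>+\<tau>. m \<tau> x \<partial>lborel)" for x
  proof -
    have "duh h b x - duh h a x = (LBINT \<tau>. F b \<tau> x - F a \<tau> x)"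
      unfolding duh_def F_def using ab
      by (intro Bochner_Integration.integral_diff[symmetric] duh_source_integrable[OF h B]) auto
    then have "ennreal \<bar>duh h b x - duh h a x\<bar> \<le> mass (\<lambda>\<tau>. F b \<tau> x - F a \<tau> x)"
      by (simp add: abs_integral_le_nn_integral)
    also have "\<dots> \<le> (\<integral>\<^sup>+\<tau>. m \<tau> x \<partial>lborel)" by (intro nn_integral_mono Fm)
    finally show ?thesis .
  qed
  \<comment> \<open>One function of time bounds both the supremum and the L^1 norm of the majorant
    \<open>m\<close>: on the tails the mass bound B is below the singular pointwise bound.\<close>
  define M where "M \<tau> = (if 0 < \<tau> \<and> \<tau> < b then \<omega> * B else 0)
     + ((if l < \<tau> \<and> \<tau> < b then c * (1 + (b - \<tau>) powr (- 1 / 2)) else 0) + (if l < \<tau> \<and> \<tau> < a then c * (1 + (a - \<tau>) powr (- 1 / 2)) else 0))" for \<tau>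
  have hm [measurable]: "h \<tau> \<in> borel_measurable borel" for \<tau> by measurable
  have nc: "0 \<le> \<omega> * B" "0 \<le> c * (1 + (t - \<tau>) powr (- 1 / 2))" for t \<tau> using w B c by auto
  have head: "nconv (\<lambda>z. P (b - \<tau>) z - P (a - \<tau>) z) (h \<tau>) x \<le> ennreal (\<omega> * B)"
    "(\<integral>\<^sup>+x. nconv (\<lambda>z. P (b - \<tau>) z - P (a - \<tau>) z) (h \<tau>) x \<partial>lborel) \<le> ennreal (\<omega> * B)"
    if "0 < \<tau>" "\<tau> \<le> l" for \<tau> x
    using nconv_diff_kernel[OF close[OF that[unfolded l_def]] _ hm source_L1(1)[OF h _ that(1)]] B by auto
  have tailS: "nconv (P (t - \<tau>)) (h \<tau>) x \<le> ennreal (c * (1 + (t - \<tau>) powr (- 1 / 2)))" if "l < \<tau>" "\<tau> < t" for t \<tau> x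
    unfolding c_def using that l0 by (intro nconv_source_local[OF h B]) auto
  have tailL: "(\<integral>\<^sup>+x. nconv (P (t - \<tau>)) (h \<tau>) x \<partial>lborel) \<le> ennreal (c * (1 + (t - \<tau>) powr (- 1 / 2)))" if "l < \<tau>" "\<tau> < t" for t \<tau>
  proof -
    have "(\<integral>\<^sup>+x. nconv (P (t - \<tau>)) (h \<tau>) x \<partial>lborel) \<le> ennreal B"
      using that l0 B by (intro nconv_P_L1_bound hm source_L1(1)[OF h]) auto
    also have "B \<le> c * (1 + (t - \<tau>) powr (- 1 / 2))" using c Bc by (simp add: distrib_left add_increasing2)
    finally show ?thesis by (simp add: ennreal_leI)
  qed
  have split: "ennreal (M \<tau>) = ennreal (if 0 < \<tau> \<and> \<tau> < b then \<omega> * B else 0)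
     + (ennreal (if l < \<tau> \<and> \<tau> < b then c * (1 + (b - \<tau>) powr (- 1 / 2)) else 0) + ennreal (if l < \<tau> \<and> \<tau> < a then c * (1 + (a - \<tau>) powr (- 1 / 2)) else 0))" for \<tau>
    unfolding M_def using nc by (subst ennreal_plus, simp, simp, subst ennreal_plus) auto
  have mM: "m \<tau> x \<le> ennreal (M \<tau>)" for \<tau> x
    unfolding split m_def using ab l0 \<eta>
    by (intro add_mono if_le_ennreal_if head(1) tailS) (auto simp: l_def)
  have mL: "(\<integral>\<^sup>+x. m \<tau> x \<partial>lborel) \<le> ennreal (M \<tau>)" for \<tau>
  proof -
    have "(\<integral>\<^sup>+x. m \<tau> x \<partial>lborel) = (\<integral>\<^sup>+x. (if 0 < \<tau> \<and> \<tau> \<le> l then nconv (\<lambda>z. P (b - \<tau>) z - P (a - \<tau>) z) (h \<tau>) x else 0) \<partial>lborel)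
      + (\<integral>\<^sup>+x. (if l < \<tau> \<and> \<tau> < b then nconv (P (b - \<tau>)) (h \<tau>) x else 0) + (if l < \<tau> \<and> \<tau> < a then nconv (P (a - \<tau>)) (h \<tau>) x else 0) \<partial>lborel)"
      unfolding m_def by (rule nn_integral_add) measurable
    also have "(\<integral>\<^sup>+x. (if l < \<tau> \<and> \<tau> < b then nconv (P (b - \<tau>)) (h \<tau>) x else 0) + (if l < \<tau> \<and> \<tau> < a then nconv (P (a - \<tau>)) (h \<tau>) x else 0) \<partial>lborel)
      = (\<integral>\<^sup>+x. (if l < \<tau> \<and> \<tau> < b then nconv (P (b - \<tau>)) (h \<tau>) x else 0) \<partial>lborel) + (\<integral>\<^sup>+x. (if l < \<tau> \<and> \<tau> < a then nconv (P (a - \<tau>)) (h \<tau>) x else 0) \<partial>lborel)"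
      by (rule nn_integral_add) measurable
    finally show ?thesis unfolding split nn_integral_if_const using ab l0 \<eta>
      by (simp only:, intro add_mono if_le_ennreal_if head(2) tailL) (auto simp: l_def)
  qed
  have MI: "(\<integral>\<^sup>+\<tau>. ennreal (M \<tau>) \<partial>lborel) \<le> ennreal (\<omega> * B * b + 2 * c * (r + 2 * sqrt r))"
  proof -
    have "(\<integral>\<^sup>+\<tau>. ennreal (M \<tau>) \<partial>lborel) = time_integral 0 b (\<lambda>\<tau>. \<omega> * B)
      + (\<integral>\<^sup>+\<tau>. ennreal (if l < \<tau> \<and> \<tau> < b then c * (1 + (b - \<tau>) powr (- 1 / 2)) else 0) + ennreal (if l < \<tau> \<and> \<tau> < a then c * (1 + (a - \<tau>) powr (- 1 / 2)) else 0) \<partial>lborel)"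
      unfolding split by (rule nn_integral_add) measurable
    also have "(\<integral>\<^sup>+\<tau>. ennreal (if l < \<tau> \<and> \<tau> < b then c * (1 + (b - \<tau>) powr (- 1 / 2)) else 0) + ennreal (if l < \<tau> \<and> \<tau> < a then c * (1 + (a - \<tau>) powr (- 1 / 2)) else 0) \<partial>lborel)
      = time_integral l b (\<lambda>\<tau>. c * (1 + (b - \<tau>) powr (- 1 / 2))) + time_integral l a (\<lambda>\<tau>. c * (1 + (a - \<tau>) powr (- 1 / 2)))"
      by (rule nn_integral_add) measurable
    also have "time_integral 0 b (\<lambda>\<tau>. \<omega> * B)
      + (time_integral l b (\<lambda>\<tau>. c * (1 + (b - \<tau>) powr (- 1 / 2))) + time_integral l a (\<lambda>\<tau>. c * (1 + (a - \<tau>) powr (- 1 / 2))))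
      \<le> ennreal (\<omega> * B * (b - 0)) + (ennreal (c * ((b - l) + 2 * sqrt (b - l))) + ennreal (c * ((a - l) + 2 * sqrt (a - l))))"
      using ab \<eta> c nc(1) by (intro add_mono nn_integral_tail_inverse_sqrt eq_refl[OF nn_integral_tail_const]) (auto simp: l_def)
    also have "\<dots> = ennreal (\<omega> * B * b + (c * ((b - l) + 2 * sqrt (b - l)) + c * ((a - l) + 2 * sqrt (a - l))))"
      using ab \<eta> c w B by (simp flip: ennreal_plus add: l_def)
    also have "\<dots> \<le> ennreal (\<omega> * B * b + 2 * c * (r + 2 * sqrt r))"
    proof (intro ennreal_leI add_left_mono)
      have "sqrt (a - l) \<le> sqrt r" using r by simp
      then have "(a - l) + 2 * sqrt (a - l) \<le> r + 2 * sqrt r" using r(3) by linarith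
      from mult_left_mono[OF this, of c] c
      show "c * ((b - l) + 2 * sqrt (b - l)) + c * ((a - l) + 2 * sqrt (a - l)) \<le> 2 * c * (r + 2 * sqrt r)"
        unfolding r(2)[symmetric] by simp
    qed
    finally show ?thesis .
  qed
  have pos: "0 \<le> \<omega> * B * b + 2 * c * (r + 2 * sqrt r)" using w B ab c r by simp
  show ?thesis
    unfolding small_def c_def[symmetric]
  proof (intro conjI allI)
    fix x
    have "ennreal \<bar>duh h b x - duh h a x\<bar> \<le> (\<integral>\<^sup>+\<tau>. ennreal (M \<tau>) \<partial>lborel)"
      by (rule order_trans[OF diff]) (intro nn_integral_mono mM)
    from order_trans[OF this MI] pos show "\<bar>duh h b x - duh h a x\<bar> \<le> \<omega> * B * b + 2 * c * (r + 2 * sqrt r)"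
      by (subst (asm) ennreal_le_iff) auto
  next
    have "mass (\<lambda>x. duh h b x - duh h a x) \<le> (\<integral>\<^sup>+x. (\<integral>\<^sup>+\<tau>. m \<tau> x \<partial>lborel) \<partial>lborel)"
      by (intro nn_integral_mono diff)
    also have "\<dots> = (\<integral>\<^sup>+\<tau>. (\<integral>\<^sup>+x. m \<tau> x \<partial>lborel) \<partial>lborel)"
      by (rule lborel_pair.Fubini') (use m_meas in \<open>simp add: case_prod_beta'\<close>)
    also have "\<dots> \<le> (\<integral>\<^sup>+\<tau>. ennreal (M \<tau>) \<partial>lborel)" by (intro nn_integral_mono mL)
    finally show "mass (\<lambda>x. duh h b x - duh h a x) \<le> ennreal (\<omega> * B * b + 2 * c * (r + 2 * sqrt r))"
      using MI by (rule order_trans)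
  qed
qed

lemma duh_continuous:
  assumes h: "source B h" and B: "0 < B" and t: "0 < t" and e: "0 < e"
  shows "\<forall>\<^sub>F t' in at t. small e (\<lambda>x. duh h t' x - duh h t x)"
proof -
  define c where "c = (1 + K) * B"
  have c: "0 < c" unfolding c_def using K B by simp
  have "((\<lambda>r. 2 * c * (r + 2 * sqrt r)) \<longlongrightarrow> 2 * c * (0 + 2 * sqrt 0)) (at_right 0)"
    by (intro tendsto_intros)
  then have "\<forall>\<^sub>F r in at_right 0. 2 * c * (r + 2 * sqrt r) < e / 2"
    by (rule order_tendstoD(2)) (use e in simp)
  then obtain r0 where r0: "0 < r0" "\<And>r. 0 < r \<Longrightarrow> r < r0 \<Longrightarrow> 2 * c * (r + 2 * sqrt r) < e / 2"
    unfolding eventually_at_right_field by auto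
  \<comment> \<open>The order of choices matters: \<eta> first makes the singular tails smaller than
    e/2, and only then does uniform continuity of the kernel on [\<eta>, 2t] provide
    \<delta>.\<close>
  define \<eta> where "\<eta> = min (r0 / 2) (t / 4)"
  have \<eta>: "0 < \<eta>" "\<eta> \<le> r0 / 2" "\<eta> \<le> t / 4" unfolding \<eta>_def using r0 t by auto
  define \<omega> where "\<omega> = e / (4 * B * t)"
  have \<omega>: "0 < \<omega>" unfolding \<omega>_def using e B t by simp
  obtain \<delta> where \<delta>: "0 < \<delta>" "\<And>a b. a \<in> {\<eta>..2 * t} \<Longrightarrow> \<bar>b - a\<bar> < \<delta> \<Longrightarrow> small \<omega> (\<lambda>x. P b x - P a x)"
    using P_small_uniform[OF \<eta>(1) \<omega>, of "2 * t"] by metis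
  have key: "small e (\<lambda>x. duh h b x - duh h a x)"
    if ab: "t / 2 < a" "a < b" "b < 2 * t" "b - a < \<delta>" "b - a < r0 / 2" for a b
  proof -
    have "small (\<omega> * B * b + 2 * ((1 + K) * B) * ((b - a + \<eta>) + 2 * sqrt (b - a + \<eta>))) (\<lambda>x. duh h b x - duh h a x)"
    proof (rule duh_increment[OF h B _ ab(2) \<eta>(1) _ \<omega>])
      show "small \<omega> (\<lambda>x. P (b - \<tau>) x - P (a - \<tau>) x)" if "0 < \<tau>" "\<tau> \<le> a - \<eta>" for \<tau>
        using that ab \<eta> by (intro \<delta>(2)) auto
    qed (use ab t \<eta> in auto)
    moreover have "\<omega> * B * b \<le> \<omega> * B * (2 * t)" using \<omega> B ab by (intro mult_left_mono) auto
    moreover have "\<omega> * B * (2 * t) = e / 2" unfolding \<omega>_def using B t by (simp add: field_simps)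
    moreover have "2 * c * ((b - a + \<eta>) + 2 * sqrt (b - a + \<eta>)) < e / 2" using ab \<eta> by (intro r0(2)) auto
    ultimately show ?thesis unfolding c_def by (elim small_mono) linarith
  qed
  have "\<forall>\<^sub>F t' in at t. dist t' t < min (t / 2) (min \<delta> (r0 / 2))"
    unfolding eventually_at using t \<delta>(1) r0(1) by (intro exI[of _ "min (t / 2) (min \<delta> (r0 / 2))"]) auto
  then show ?thesis
  proof eventually_elim
    case (elim t')
    then have d: "\<bar>t' - t\<bar> < t / 2" "\<bar>t' - t\<bar> < \<delta>" "\<bar>t' - t\<bar> < r0 / 2" by (auto simp: dist_real_def)
    consider "t' < t" | "t' = t" | "t < t'" by linarith
    then show ?case
    proof cases
      case 1
      then show ?thesis using d by (intro small_swap[OF key]) auto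
    next
      case 2
      then show ?thesis using small_zero[of e] e by simp
    next
      case 3
      then show ?thesis using d by (intro key) auto
    qed
  qed
qed

end

context mild_problem
begin

text \<open>A weaker closeness than \<open>small\<close>, for the linear part: the datum need not be
  integrable, so the modular takes the place of the L^1 norm.\<close>

definition near :: "real \<Rightarrow> ('a \<Rightarrow> real) \<Rightarrow> bool" where
  "near e g \<longleftrightarrow> modular p e g \<le> 1 \<and> (\<forall>x. \<bar>g x\<bar> \<le> e)"

lemma near_add:
  assumes "g \<in> borel_measurable borel" "h \<in> borel_measurable borel" "0 < a" "0 < b" and g: "near a g" and h: "near b h"
  shows "near (a + b) (\<lambda>x. g x + h x)"
  unfolding near_def
proof (intro conjI allI modular_add)
  show "\<bar>g x + h x\<bar> \<le> a + b" for x
    using g h unfolding near_def by (meson abs_triangle_ineq add_mono order_trans)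
qed (use assms p1 in \<open>auto simp: near_def\<close>)

lemma near_small: "g \<in> borel_measurable borel \<Longrightarrow> 0 < e \<Longrightarrow> small e g \<Longrightarrow> near (3 * e) g"
  unfolding near_def using modular_small[of p g e] p1 smallD(1)[of e g] by (force intro: order_trans)

lemma eventually_pos_at: "0 < (t::real) \<Longrightarrow> \<forall>\<^sub>F t' in at t. 0 < t'"
  using order_tendstoD(1)[OF tendsto_ident_at, of 0 t UNIV] by simp

lemma nconv_sg_finite:
  assumes "u0 \<in> borel_measurable borel" "0 < \<mu>" "modular p \<mu> u0 \<le> 1" "0 < t"
  shows "nconv (P t) u0 x < \<infinity>"
proof (rule sg_sup_bound)
  fix c assume "\<And>\<mu> u0 t x. 0 < \<mu> \<Longrightarrow> u0 \<in> borel_measurable borel \<Longrightarrow> modular p \<mu> u0 \<le> 1 \<Longrightarrow> 0 < t \<Longrightarrow>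
    nconv (P t) u0 x \<le> ennreal (c * \<mu> * ts t powr (- \<alpha>))"
  from this[OF assms(2,1,3,4)] show ?thesis by (rule le_less_trans) simp
qed

text \<open>The difference of two kernels has both mass and supremum at most \<kappa>. The mass
  controls the modular by Jensen's inequality, and the supremum controls the pointwise size after
  the split |u0| \<le> 1 + |u0|^p.\<close>

lemma sg_continuous:
  assumes u0[measurable]: "u0 \<in> borel_measurable borel" and \<mu>: "0 < \<mu>" and mo: "modular p \<mu> u0 \<le> 1" and t: "0 < t" and e: "0 < e"
  shows "\<forall>\<^sub>F t' in at t. near e (\<lambda>x. sg u0 t' x - sg u0 t x)"
proof -
  obtain c where c: "1 \<le> c" "\<And>\<mu> u. 0 < \<mu> \<Longrightarrow> u \<in> borel_measurable borel \<Longrightarrow> modular p \<mu> u \<le> 1 \<Longrightarrow>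
     (\<integral>\<^sup>+(x::'a). ennreal (\<bar>u x\<bar> powr p) \<partial>lborel) \<le> ennreal (c * \<mu> powr p)"
    using modular_powr_integral[of p p, where 'a='a] p1 by (metis less_imp_le order_refl)
  define V where "V = c * \<mu> powr p"
  have V: "0 \<le> V" "(\<integral>\<^sup>+x. ennreal (\<bar>u0 x\<bar> powr p) \<partial>lborel) \<le> ennreal V"
    unfolding V_def using c(1) c(2)[OF \<mu> u0 mo] by auto
  \<comment> \<open>Chosen to satisfy both \<kappa> \<mu> \<le> e, for the modular, and \<kappa> (1
    + V) \<le> e, for the pointwise bound.\<close>
  define \<kappa> where "\<kappa> = e / (1 + \<mu> + V)"
  have \<kappa>: "0 < \<kappa>" unfolding \<kappa>_def using e \<mu> V by simp
  have \<kappa>2: "\<kappa> * (1 + \<mu> + V) = e" unfolding \<kappa>_def using \<mu> V by simp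
  have "\<kappa> * \<mu> \<le> \<kappa> * (1 + \<mu> + V)" "\<kappa> * (1 + V) \<le> \<kappa> * (1 + \<mu> + V)" using \<kappa> \<mu> V by (auto intro!: mult_left_mono)
  then have \<kappa>3: "\<kappa> * \<mu> \<le> e" "\<kappa> * (1 + V) \<le> e" unfolding \<kappa>2 .
  show ?thesis using P_small[OF t \<kappa>] eventually_pos_at[OF t]
  proof eventually_elim
    case (elim t')
    define Q where "Q = (\<lambda>x. P t' x - P t x)"
    have [measurable]: "Q \<in> borel_measurable borel" unfolding Q_def by measurable
    have Q: "small \<kappa> Q" using elim(1) unfolding Q_def .
    have eq: "(\<lambda>x. sg u0 t' x - sg u0 t x) = conv Q u0"
      unfolding Q_def sg_def
      by (rule ext, rule conv_diff_kernel[symmetric]) (auto intro!: nconv_sg_finite[OF u0 \<mu> mo, unfolded infinity_ennreal_def] t elim(2))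
    have "modular p (\<kappa> * \<mu>) (conv Q u0) \<le> modular p \<mu> u0"
      using p1 smallD(2)[OF Q] by (intro modular_conv \<kappa> \<mu>) auto
    then have m: "modular p (\<kappa> * \<mu>) (conv Q u0) \<le> 1" using mo by (rule order_trans)
    have "modular p e (conv Q u0) \<le> modular p (\<kappa> * \<mu>) (conv Q u0)"
      using p1 \<kappa>3 \<kappa> \<mu> by (intro modular_mono) auto
    then have "modular p e (conv Q u0) \<le> 1" using m by (rule order_trans)
    moreover have "\<bar>conv Q u0 x\<bar> \<le> e" for x
    proof -
      have "ennreal \<bar>conv Q u0 x\<bar> \<le> nconv Q u0 x" by (rule conv_le_nconv)
      also have "\<dots> \<le> ennreal (\<kappa> * 1 + \<kappa> * V)"
      proof (rule nconv_bound[where v="\<lambda>y. \<bar>u0 y\<bar> powr p"])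
        show "\<bar>u0 y\<bar> \<le> 1 + \<bar>u0 y\<bar> powr p" for y using le_add_powr_div[of 1 "\<bar>u0 y\<bar>" p] p1 by simp
      qed (use smallD[OF Q] V \<kappa> in simp_all)
      also have "\<dots> \<le> ennreal e" using \<kappa>3(2) by (intro ennreal_leI) (simp add: distrib_left)
      finally show ?thesis using e by simp
    qed
    ultimately show ?case unfolding eq near_def by simp
  qed
qed

text \<open>For |z| \<le> N the exponent m - 1 may be lowered to p - 1 because m \<ge> p; for larger
  |z| one more power is added and the Young function absorbs everything. The power p - 1 is the one
  that combines with a single factor of a difference to the p-th power.\<close>

lemma gr_le_young:
  assumes N: "smallness N"
  obtains k where "0 < k" "\<And>z. gr z \<le> k * ((\<bar>z\<bar> / N) powr (p - 1) + young p (\<bar>z\<bar> / N))"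
proof -
  obtain c1 where c1: "1 \<le> c1" "\<And>y. 0 \<le> y \<Longrightarrow> y powr m * exp (y powr p / 4) \<le> c1 * young p y"
    using powr_exp_le_young[of p m] p1 pm by (metis less_imp_le)
  define k where "k = N powr (m - 1) * (2 + c1)"
  have N0: "0 < N" by (rule smallnessD(1)[OF N])
  have "gr z \<le> k * ((\<bar>z\<bar> / N) powr (p - 1) + young p (\<bar>z\<bar> / N))" for z
  proof -
    define y where "y = \<bar>z\<bar> / N"
    have y: "0 \<le> y" unfolding y_def using N0 by simp
    have "y powr (m - 1) * exp (y powr p / 4) \<le> (2 + c1) * (y powr (p - 1) + young p y)"
    proof (cases "y \<le> 1")
      case True
      have "y powr p \<le> 1" using y True p1 by (intro powr_le1) auto
      then have "exp (y powr p / 4) \<le> exp (1/4)" by simp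
      also have "exp (1/4 :: real) \<le> 2" using exp_bound[of "1/4::real"] by (simp add: power2_eq_square)
      finally have "y powr (m - 1) * exp (y powr p / 4) \<le> y powr (p - 1) * 2"
        using y True pm by (intro mult_mono powr_mono') auto
      also have "\<dots> \<le> (y powr (p - 1) + young p y) * (2 + c1)"
        using c1 young_nonneg[of p y] by (intro mult_mono) auto
      finally show ?thesis by (simp add: mult.commute)
    next
      case False
      then have "y powr (m - 1) * exp (y powr p / 4) \<le> y powr m * exp (y powr p / 4)"
        by (intro mult_right_mono powr_mono) auto
      also have "\<dots> \<le> c1 * young p y" by (rule c1(2)[OF y])
      also have "\<dots> \<le> (2 + c1) * (y powr (p - 1) + young p y)"
        using c1 young_nonneg[of p y] by (intro mult_mono) auto
      finally show ?thesis .
    qed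
    then have "N powr (m - 1) * (y powr (m - 1) * exp (y powr p / 4)) \<le> N powr (m - 1) * ((2 + c1) * (y powr (p - 1) + young p y))"
      by (intro mult_left_mono) auto
    then show ?thesis using gr_le[OF N, of z] unfolding k_def y_def by (simp add: mult.assoc)
  qed
  moreover have "0 < k" unfolding k_def using N0 c1 by simp
  ultimately show thesis by (rule that[rotated])
qed

text \<open>f is Lipschitz from the closeness \<open>near\<close> into L^1. Comparing z and y gives
  z y^(p-1) \<le> z^p + y^p, which separates the difference from the growth factor; z \<le> 1
  handles the remaining product. Three modulars, each at most 1, then bound the integral.\<close>

lemma f_L1_near:
  assumes N: "smallness N"
  obtains c where "0 < c" "\<And>\<kappa> a b. 0 < \<kappa> \<Longrightarrow> a \<in> borel_measurable borel \<Longrightarrow> b \<in> borel_measurable borel \<Longrightarrow>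
    modular p N a \<le> 1 \<Longrightarrow> modular p N b \<le> 1 \<Longrightarrow> near \<kappa> (\<lambda>x. a x - b x) \<Longrightarrow>
    mass (\<lambda>x. f (a x) - f (b x)) \<le> ennreal (c * \<kappa>)"
proof -
  obtain k where k: "0 < k" "\<And>z. gr z \<le> k * ((\<bar>z\<bar> / N) powr (p - 1) + young p (\<bar>z\<bar> / N))"
    using gr_le_young[OF N] by metis
  have N0: "0 < N" by (rule smallnessD(1)[OF N])
  have "mass (\<lambda>x. f (a x) - f (b x)) \<le> ennreal (6 * C * k * \<kappa>)"
    if \<kappa>: "0 < \<kappa>" and [measurable]: "a \<in> borel_measurable borel" "b \<in> borel_measurable borel"
      and ma: "modular p N a \<le> 1" and mb: "modular p N b \<le> 1" and nr: "near \<kappa> (\<lambda>x. a x - b x)" for \<kappa> a b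
  proof -
    define q where "q = C * k * \<kappa>"
    have q: "0 < q" unfolding q_def using C k \<kappa> by simp
    define Z where "Z x = young p (\<bar>a x - b x\<bar> / \<kappa>)" for x
    define A where "A x = young p (\<bar>a x\<bar> / N)" for x
    define Bb where "Bb x = young p (\<bar>b x\<bar> / N)" for x
    have nn: "0 \<le> Z x" "0 \<le> A x" "0 \<le> Bb x" for x unfolding Z_def A_def Bb_def by (auto simp: young_nonneg)
    have [measurable]: "Z \<in> borel_measurable borel" "A \<in> borel_measurable borel" "Bb \<in> borel_measurable borel"
      unfolding Z_def[abs_def] A_def[abs_def] Bb_def[abs_def] by measurable
    have pt: "C * \<bar>a x - b x\<bar> * gr w \<le> q * (Z x + 2 * young p (\<bar>w\<bar> / N))" for x w
    proof -
      define z where "z = \<bar>a x - b x\<bar> / \<kappa>"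
      define y where "y = \<bar>w\<bar> / N"
      have zy: "0 \<le> z" "0 \<le> y" "z \<le> 1" unfolding z_def y_def using \<kappa> N0 nr by (auto simp: near_def)
      have "z * y powr (p - 1) \<le> z powr p + y powr p"
      proof (cases "z \<le> y")
        case True
        have "z * y powr (p - 1) \<le> y * y powr (p - 1)" using True by (intro mult_right_mono) auto
        also have "\<dots> = y powr p" using zy by (subst powr_mult_base) auto
        finally show ?thesis by (simp add: add_increasing)
      next
        case False
        have "z * y powr (p - 1) \<le> z * z powr (p - 1)" using False zy p1 by (intro mult_left_mono powr_mono2) auto
        also have "\<dots> = z powr p" using zy by (subst powr_mult_base) auto
        finally show ?thesis by (simp add: add_increasing2)
      qed
      also have "\<dots> \<le> young p z + young p y" by (intro add_mono powr_le_young)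
      finally have 1: "z * y powr (p - 1) \<le> young p z + young p y" .
      have 2: "z * young p y \<le> young p y" using zy young_nonneg[of p y] by (intro mult_left_le_one_le) auto
      have "\<bar>a x - b x\<bar> = \<kappa> * z" unfolding z_def using \<kappa> by simp
      then have "C * \<bar>a x - b x\<bar> * gr w = C * \<kappa> * (z * gr w)" by simp
      also have "\<dots> \<le> C * \<kappa> * (z * (k * (y powr (p - 1) + young p y)))"
        unfolding y_def using C \<kappa> zy by (intro mult_left_mono k(2)) auto
      also have "\<dots> = q * (z * y powr (p - 1) + z * young p y)" unfolding q_def by (simp add: algebra_simps)
      also have "\<dots> \<le> q * (young p z + 2 * young p y)" using q 1 2 by (intro mult_left_mono) auto
      finally show ?thesis unfolding Z_def z_def y_def .
    qed
    have le: "\<bar>f (a x) - f (b x)\<bar> \<le> q * (2 * Z x + (2 * A x + 2 * Bb x))" for x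
    proof -
      have "\<bar>f (a x) - f (b x)\<bar> \<le> C * \<bar>a x - b x\<bar> * gr (a x) + C * \<bar>a x - b x\<bar> * gr (b x)"
        using f_diff_le[of "a x" "b x"] by (simp add: distrib_left)
      also have "\<dots> \<le> q * (Z x + 2 * A x) + q * (Z x + 2 * Bb x)"
        unfolding A_def Bb_def by (intro add_mono pt)
      finally show ?thesis by (simp add: algebra_simps)
    qed
    have "mass (\<lambda>x. f (a x) - f (b x)) \<le> (\<integral>\<^sup>+x. ennreal (2 * q) * (ennreal (Z x) + (ennreal (A x) + ennreal (Bb x))) \<partial>lborel)"
    proof (intro nn_integral_mono)
      fix x
      have "\<bar>f (a x) - f (b x)\<bar> \<le> (2 * q) * (Z x + (A x + Bb x))" using le[of x] by (simp add: algebra_simps)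
      then show "ennreal \<bar>f (a x) - f (b x)\<bar> \<le> ennreal (2 * q) * (ennreal (Z x) + (ennreal (A x) + ennreal (Bb x)))"
        using q nn[of x] by (simp flip: ennreal_plus ennreal_mult add: ennreal_leI)
    qed
    also have "\<dots> = ennreal (2 * q) * (\<integral>\<^sup>+x. ennreal (Z x) + (ennreal (A x) + ennreal (Bb x)) \<partial>lborel)"
      by (rule nn_integral_cmult) measurable
    also have "(\<integral>\<^sup>+x. ennreal (Z x) + (ennreal (A x) + ennreal (Bb x)) \<partial>lborel) = (\<integral>\<^sup>+x. ennreal (Z x) \<partial>lborel) + (\<integral>\<^sup>+x. ennreal (A x) + ennreal (Bb x) \<partial>lborel)"
      by (rule nn_integral_add) measurable
    also have "(\<integral>\<^sup>+x. ennreal (A x) + ennreal (Bb x) \<partial>lborel) = (\<integral>\<^sup>+x. ennreal (A x) \<partial>lborel) + (\<integral>\<^sup>+x. ennreal (Bb x) \<partial>lborel)"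
      by (rule nn_integral_add) measurable
    also have "ennreal (2 * q) * ((\<integral>\<^sup>+x. ennreal (Z x) \<partial>lborel) + ((\<integral>\<^sup>+x. ennreal (A x) \<partial>lborel) + (\<integral>\<^sup>+x. ennreal (Bb x) \<partial>lborel))) \<le> ennreal (2 * q) * (1 + (1 + 1))"
      using ma mb nr unfolding near_def modular_def Z_def A_def Bb_def by (intro mult_left_mono add_mono) auto
    also have "\<dots> = ennreal (2 * q) * ennreal 3" by simp
    also have "\<dots> = ennreal (6 * C * k * \<kappa>)" using q by (simp only: ennreal_mult[symmetric]) (simp add: q_def mult_ac flip: ennreal_mult)
    finally show ?thesis .
  qed
  moreover have "0 < 6 * C * k" using C k by simp
  ultimately show thesis by (rule that[rotated])
qed

end

locale mild_solution = mild_problem P s K m p C lam f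
  for P :: "real \<Rightarrow> 'a::euclidean_space \<Rightarrow> real" and s K m p C lam :: real and f :: "real \<Rightarrow> real" +
  fixes u0 :: "'a \<Rightarrow> real" and D :: "real \<Rightarrow> 'a \<Rightarrow> real" and e N B :: real
  assumes u0 [measurable]: "u0 \<in> borel_measurable borel" and e: "0 < e" and mo: "modular p e u0 \<le> 1"
    and gD: "good e D" and sN: "smallness N" and ad: "admissible N (mild u0 D)"
    and B: "0 < B" and so: "source B (\<lambda>\<tau> y. f (mild u0 D \<tau> y))"
    and fp: "\<And>t x. 0 < t \<Longrightarrow> D t x = duh (\<lambda>\<tau> y. f (mild u0 D \<tau> y)) t x"
begin

abbreviation u :: "real \<Rightarrow> 'a \<Rightarrow> real" where "u \<equiv> mild u0 D"
abbreviation h :: "real \<Rightarrow> 'a \<Rightarrow> real" where "h \<equiv> \<lambda>\<tau> y. f (u \<tau> y)"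

lemmas D_measurable [measurable (raw)] = jointly_measurableD[OF goodD(1)[OF gD]]
lemmas u_measurable [measurable (raw)] = jointly_measurableD[OF admissibleD(1)[OF ad]]
lemmas h_measurable [measurable (raw)] = jointly_measurableD[OF sourceD(1)[OF so]]
lemmas sg_measurable [measurable (raw)] = jointly_measurableD[OF sg_joint[OF u0]]

lemma borel_slices [measurable]:
  "D t \<in> borel_measurable borel" "u t \<in> borel_measurable borel" "sg u0 t \<in> borel_measurable borel"
  by measurable

lemma N0: "0 < N" by (rule smallnessD(1)[OF sN])

lemma D_continuous:
  assumes t: "0 < t" and \<epsilon>: "0 < \<epsilon>"
  shows "\<forall>\<^sub>F t' in at t. small \<epsilon> (\<lambda>x. D t' x - D t x)"
  using duh_continuous[OF so B t \<epsilon>] eventually_pos_at[OF t]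
  by eventually_elim (simp add: fp t)

lemma u_continuous:
  assumes t: "0 < t" and \<epsilon>: "0 < \<epsilon>"
  shows "\<forall>\<^sub>F t' in at t. near \<epsilon> (\<lambda>x. u t' x - u t x)"
proof -
  have r6: "0 < \<epsilon> / 6" "0 < \<epsilon> / 2" using \<epsilon> by auto
  show ?thesis using sg_continuous[OF u0 e mo t r6(2)] D_continuous[OF t r6(1)]
  proof eventually_elim
    case (elim t')
    have "near (3 * (\<epsilon> / 6)) (\<lambda>x. D t' x - D t x)" using elim(2) r6 by (intro near_small) auto
    then have "near (\<epsilon> / 2 + \<epsilon> / 2) (\<lambda>x. (sg u0 t' x - sg u0 t x) + (D t' x - D t x))"
      using elim(1) r6 by (intro near_add) auto
    then show ?case unfolding mild_def by (simp add: algebra_simps)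
  qed
qed

lemma h_continuous:
  assumes t: "0 < t" and \<epsilon>: "0 < \<epsilon>"
  shows "\<forall>\<^sub>F t' in at t. mass (\<lambda>x. h t' x - h t x) \<le> ennreal \<epsilon>"
proof (rule f_L1_near[OF sN])
  fix c assume c: "0 < c" "\<And>\<kappa> a b. 0 < \<kappa> \<Longrightarrow> a \<in> borel_measurable borel \<Longrightarrow> b \<in> borel_measurable borel \<Longrightarrow>
    modular p N a \<le> 1 \<Longrightarrow> modular p N b \<le> 1 \<Longrightarrow> near \<kappa> (\<lambda>x. a x - b x) \<Longrightarrow>
    mass (\<lambda>x. f (a x) - f (b x)) \<le> ennreal (c * \<kappa>)"
  have rc: "0 < \<epsilon> / c" using \<epsilon> c by simp
  show ?thesis using u_continuous[OF t rc] eventually_pos_at[OF t]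
  proof eventually_elim
    case (elim t')
    have "mass (\<lambda>x. f (u t' x) - f (u t x)) \<le> ennreal (c * (\<epsilon> / c))"
      using elim t by (intro c(2) rc admissibleD(2)[OF ad]) auto
    then show ?case using c(1) by simp
  qed
qed

definition G :: "real \<Rightarrow> real \<Rightarrow> 'a \<Rightarrow> real" where
  "G t \<tau> = (if 0 < \<tau> \<and> \<tau> < t then conv (P (t - \<tau>)) (h \<tau>) else (\<lambda>x. 0))"

lemma G_joint: "jointly_measurable (G t)"
proof -
  have "(\<lambda>z. if 0 < fst z \<and> fst z < t then conv (P (t - fst z)) (h (fst z)) (snd z) else 0) \<in> borel_measurable (borel \<Otimes>\<^sub>M borel)"
    unfolding conv_def by measurable
  moreover have "(\<lambda>z. G t (fst z) (snd z)) = (\<lambda>z. if 0 < fst z \<and> fst z < t then conv (P (t - fst z)) (h (fst z)) (snd z) else 0)"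
    unfolding G_def by (auto simp: fun_eq_iff)
  ultimately show ?thesis unfolding jointly_measurable_def by simp
qed

lemma h_borel [measurable]: "h \<tau> \<in> borel_measurable borel"
  by measurable

lemma G_bound:
  assumes \<tau>: "0 < \<tau>" "\<tau> < t"
  shows "small ((1 + K) * B * (1 + (t - \<tau>) powr (- 1 / 2))) (G t \<tau>)"
  unfolding small_def
proof (intro conjI allI)
  let ?c = "(1 + K) * B * (1 + (t - \<tau>) powr (- 1 / 2))"
  have c: "B \<le> ?c" using K B by (simp add: distrib_left distrib_right add_increasing2)
  have c0: "0 \<le> ?c" using c B by linarith
  show "\<bar>G t \<tau> x\<bar> \<le> ?c" for x
    using order_trans[OF conv_le_nconv nconv_source_local[OF so B \<tau>, of x]] \<tau>
    unfolding G_def ennreal_le_iff[OF c0] by simp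
  have "mass (G t \<tau>) \<le> (\<integral>\<^sup>+x. nconv (P (t - \<tau>)) (h \<tau>) x \<partial>lborel)"
    unfolding G_def using \<tau> by (intro nn_integral_mono) (simp add: conv_le_nconv)
  also have "\<dots> \<le> ennreal B" using \<tau> B by (intro nconv_P_L1_bound h_borel source_L1(1)[OF so]) auto
  also have "\<dots> \<le> ennreal ?c" using c by (rule ennreal_leI)
  finally show "mass (G t \<tau>) \<le> ennreal ?c" .
qed

text \<open>The source and the kernel are changed one after the other. The source is continuous in
  time only in L^1, which suffices because the kernel at times \<ge> (t - \<tau>)/2 maps L^1
  boundedly into L^\<infinity>.\<close>

lemma G_continuous:
  assumes \<tau>: "0 < \<tau>" "\<tau> < t" and \<epsilon>: "0 < \<epsilon>"
  shows "\<forall>\<^sub>F \<tau>' in at \<tau>. small \<epsilon> (\<lambda>x. G t \<tau>' x - G t \<tau> x)"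
proof -
  \<comment> \<open>Bounds the supremum of the kernels P (t - \<tau>') for nearby \<tau>'; the added
    1 makes the same q serve for the L^1 part, where the kernel has mass one.\<close>
  define q where "q = 1 + K * ((t - \<tau>) / 2) powr (- (real DIM('a) / 2))"
  have q: "1 \<le> q" unfolding q_def using K by simp
  define \<kappa> where "\<kappa> = \<epsilon> / (2 * B)"
  have \<kappa>: "0 < \<kappa>" unfolding \<kappa>_def using \<epsilon> B by simp
  define \<rho> where "\<rho> = \<epsilon> / (2 * q)"
  have \<rho>: "0 < \<rho>" unfolding \<rho>_def using \<epsilon> q by simp
  have lim: "((\<lambda>\<tau>'. t - \<tau>') \<longlongrightarrow> t - \<tau>) (at \<tau>)" by (intro tendsto_intros)
  have "\<forall>\<^sub>F \<tau>' in at \<tau>. small \<kappa> (\<lambda>x. P (t - \<tau>') x - P (t - \<tau>) x)"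
  proof -
    have "\<forall>\<^sub>F a in at (t - \<tau>). small \<kappa> (\<lambda>x. P a x - P (t - \<tau>) x)" using \<tau> by (intro P_small \<kappa>) auto
    moreover have "filterlim (\<lambda>\<tau>'. t - \<tau>') (at (t - \<tau>)) (at \<tau>)"
      unfolding filterlim_at using lim by (auto simp: eventually_at_filter)
    ultimately show ?thesis by (rule eventually_compose_filterlim)
  qed
  moreover have "\<forall>\<^sub>F \<tau>' in at \<tau>. (t - \<tau>) / 2 < t - \<tau>'" by (rule order_tendstoD(1)[OF lim]) (use \<tau> in simp)
  moreover note h_continuous[OF \<tau>(1) \<rho>] eventually_pos_at[OF \<tau>(1)]
  ultimately show ?thesis
  proof eventually_elim
    case (elim \<tau>')
    have \<tau>': "0 < \<tau>'" "\<tau>' < t" using elim \<tau> by auto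
    define Q where "Q = (\<lambda>x. P (t - \<tau>') x - P (t - \<tau>) x)"
    have [measurable]: "Q \<in> borel_measurable borel" unfolding Q_def by measurable
    have Q: "small \<kappa> Q" using elim(1) unfolding Q_def .
    define k where "k = (\<lambda>y. h \<tau>' y - h \<tau> y)"
    have [measurable]: "k \<in> borel_measurable borel" unfolding k_def by measurable
    have kL: "mass k \<le> ennreal \<rho>" using elim(3) unfolding k_def .
    have hL: "mass (h \<sigma>) \<le> ennreal B" if "0 < \<sigma>" for \<sigma> using B that by (intro source_L1(1)[OF so]) auto
    have fin: "nconv (P a) (h \<sigma>) x < \<infinity>" if "0 < \<sigma>" "0 < a" for a \<sigma> x
      using nconv_P_sup_bound[OF that(2) h_borel hL[OF that(1)], of x] B by (metis ennreal_less_top infinity_ennreal_def le_less_trans less_imp_le)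
    have eq: "G t \<tau>' x - G t \<tau> x = conv (P (t - \<tau>')) k x + conv Q (h \<tau>) x" for x
    proof -
      have "conv (P (t - \<tau>')) k x = conv (P (t - \<tau>')) (h \<tau>') x - conv (P (t - \<tau>')) (h \<tau>) x"
        unfolding k_def using \<tau> \<tau>' by (intro conv_diff_function fin) auto
      moreover have "conv Q (h \<tau>) x = conv (P (t - \<tau>')) (h \<tau>) x - conv (P (t - \<tau>)) (h \<tau>) x"
        unfolding Q_def using \<tau> \<tau>' by (intro conv_diff_kernel fin) auto
      ultimately show ?thesis unfolding G_def using \<tau> \<tau>' by simp
    qed
    have qb: "K * (t - \<tau>') powr (- (real DIM('a) / 2)) \<le> q"
    proof -
      have "K * (t - \<tau>') powr (- (real DIM('a) / 2)) \<le> K * ((t - \<tau>) / 2) powr (- (real DIM('a) / 2))"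
        using K elim(2) \<tau> by (intro mult_left_mono powr_mono2') auto
      then show ?thesis unfolding q_def by simp
    qed
    have r2: "q * \<rho> = \<epsilon> / 2" "\<kappa> * B = \<epsilon> / 2" unfolding \<rho>_def \<kappa>_def using q B by auto
    have "\<rho> \<le> q * \<rho>" using q \<rho> by simp
    have s1: "small (\<epsilon> / 2) (conv (P (t - \<tau>')) k)"
      unfolding small_def
    proof (intro conjI allI)
      fix x
      have "ennreal \<bar>conv (P (t - \<tau>')) k x\<bar> \<le> ennreal (K * (t - \<tau>') powr (- (real DIM('a) / 2)) * \<rho>)"
        using \<tau>' \<rho> by (intro order_trans[OF conv_le_nconv nconv_P_sup_bound] kL) auto
      also have "\<dots> \<le> ennreal (\<epsilon> / 2)" unfolding r2(1)[symmetric] using \<rho> by (intro ennreal_leI mult_right_mono qb) auto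
      finally show "\<bar>conv (P (t - \<tau>')) k x\<bar> \<le> \<epsilon> / 2" using \<epsilon> by simp
    next
      have "mass (\<lambda>x. conv (P (t - \<tau>')) k x) \<le> (\<integral>\<^sup>+x. nconv (P (t - \<tau>')) k x \<partial>lborel)"
        by (intro nn_integral_mono conv_le_nconv)
      also have "\<dots> \<le> ennreal \<rho>" using \<tau>' by (intro nconv_P_L1_bound kL) auto
      also have "\<dots> \<le> ennreal (\<epsilon> / 2)" using \<open>\<rho> \<le> q * \<rho>\<close> unfolding r2 by (rule ennreal_leI)
      finally show "mass (\<lambda>x. conv (P (t - \<tau>')) k x) \<le> ennreal (\<epsilon> / 2)" .
    qed
    have nq: "nconv Q (h \<tau>) x \<le> ennreal (\<kappa> * B)" "(\<integral>\<^sup>+x. nconv Q (h \<tau>) x \<partial>lborel) \<le> ennreal (\<kappa> * B)" for x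
      using nconv_diff_kernel[OF Q _ h_borel hL[OF \<tau>(1)]] B by auto
    have s2: "small (\<epsilon> / 2) (conv Q (h \<tau>))"
      unfolding small_def
    proof (intro conjI allI)
      fix x
      show "\<bar>conv Q (h \<tau>) x\<bar> \<le> \<epsilon> / 2"
        using order_trans[OF conv_le_nconv nq(1)[of x]] \<epsilon> unfolding r2 by (subst (asm) ennreal_le_iff) auto
    next
      have "mass (conv Q (h \<tau>)) \<le> (\<integral>\<^sup>+x. nconv Q (h \<tau>) x \<partial>lborel)"
        by (intro nn_integral_mono conv_le_nconv)
      then show "mass (conv Q (h \<tau>)) \<le> ennreal (\<epsilon> / 2)"
        using nq(2) unfolding r2 by (rule order_trans)
    qed
    have "small (\<epsilon> / 2 + \<epsilon> / 2) (\<lambda>x. conv (P (t - \<tau>')) k x + conv Q (h \<tau>) x)"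
      by (intro small_add s1 s2 conv_measurable) measurable
    then show ?case unfolding eq by simp
  qed
qed

end

section \<open>The Bochner integral in \<open>exp L\<^sup>p\<close>\<close>

lemma expL_modular:
  fixes g :: "'a::euclidean_space \<Rightarrow> real"
  assumes "0 < \<mu>"
  shows "(\<integral>\<^sup>+x. ennreal (exp (\<bar>g x\<bar> powr p / \<mu> powr p) - 1) \<partial>lebesgue) = modular p \<mu> g"
  unfolding modular_def nn_integral_completion young_def using assms
  by (intro nn_integral_cong) (simp add: powr_divide)

lemma expL_norm_le:
  assumes "0 < \<mu>" "modular p \<mu> g \<le> 1"
  shows "expL_norm p g \<le> ennreal \<mu>"
  unfolding expL_norm_def using assms by (intro Inf_lower) (auto simp: expL_modular)

text \<open>A strict bound yields a scale from the defining set directly, without deciding whether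
  the infimum is attained.\<close>

lemma expL_norm_less:
  assumes "expL_norm p g < ennreal \<nu>"
  obtains \<mu> where "0 < \<mu>" "\<mu> < \<nu>" "modular p \<mu> g \<le> 1"
proof -
  obtain z where z: "z \<in> {ennreal \<mu> | \<mu>. 0 < \<mu> \<and> (\<integral>\<^sup>+x. ennreal (exp (\<bar>g x\<bar> powr p / \<mu> powr p) - 1) \<partial>lebesgue) \<le> 1}" "z < ennreal \<nu>"
    using assms unfolding expL_norm_def Inf_less_iff by blast
  then obtain \<mu> where \<mu>: "z = ennreal \<mu>" "0 < \<mu>" "(\<integral>\<^sup>+x. ennreal (exp (\<bar>g x\<bar> powr p / \<mu> powr p) - 1) \<partial>lebesgue) \<le> 1" by blast
  have "\<mu> < \<nu>" using z(2) \<mu>(1,2) by (simp add: ennreal_less_iff)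
  with \<mu> show thesis by (intro that) (auto simp: expL_modular)
qed

lemma le_one_plus_young:
  assumes p: "1 \<le> p" and z: "0 \<le> z"
  shows "z \<le> 1 + young p z"
proof -
  have "z \<le> 1 + z powr p" using le_add_powr_div[of 1 z p] p z by simp
  then show ?thesis using powr_le_young[of z p] by linarith
qed

lemma expL_I:
  fixes g :: "'a::euclidean_space \<Rightarrow> real"
  assumes p: "1 \<le> p" and [measurable]: "g \<in> borel_measurable borel" and \<mu>: "0 < \<mu>" and m: "modular p \<mu> g \<le> 1"
  shows "g \<in> expL p"
proof -
  have "set_integrable lebesgue Kc g" if Kc: "compact Kc" for Kc :: "'a set"
  proof -
    have KS [measurable]: "Kc \<in> sets borel" using Kc by (simp add: borel_compact)
    have "(\<integral>\<^sup>+x. ennreal (norm (indicator Kc x *\<^sub>R g x)) \<partial>lborel)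
       \<le> (\<integral>\<^sup>+x. ennreal \<mu> * indicator Kc x + ennreal \<mu> * ennreal (young p (\<bar>g x\<bar> / \<mu>)) \<partial>lborel)"
    proof (intro nn_integral_mono)
      fix x
      show "ennreal (norm (indicator Kc x *\<^sub>R g x)) \<le> ennreal \<mu> * indicator Kc x + ennreal \<mu> * ennreal (young p (\<bar>g x\<bar> / \<mu>))"
      proof (cases "x \<in> Kc")
        case True
        have "\<mu> * (\<bar>g x\<bar> / \<mu>) \<le> \<mu> * (1 + young p (\<bar>g x\<bar> / \<mu>))"
          using \<mu> by (intro mult_left_mono le_one_plus_young p) auto
        then have "ennreal \<bar>g x\<bar> \<le> ennreal (\<mu> + \<mu> * young p (\<bar>g x\<bar> / \<mu>))"
          using \<mu> by (intro ennreal_leI) (simp add: distrib_left)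
        also have "\<dots> = ennreal \<mu> + ennreal \<mu> * ennreal (young p (\<bar>g x\<bar> / \<mu>))"
          using \<mu> young_nonneg by (simp add: ennreal_mult)
        finally show ?thesis using True by simp
      qed simp
    qed
    also have "\<dots> = (\<integral>\<^sup>+x. ennreal \<mu> * indicator Kc x \<partial>lborel) + (\<integral>\<^sup>+x. ennreal \<mu> * ennreal (young p (\<bar>g x\<bar> / \<mu>)) \<partial>lborel)"
      by (rule nn_integral_add) measurable
    also have "(\<integral>\<^sup>+x. ennreal \<mu> * ennreal (young p (\<bar>g x\<bar> / \<mu>)) \<partial>lborel) = ennreal \<mu> * modular p \<mu> g"
      unfolding modular_def by (rule nn_integral_cmult) measurable
    also have "(\<integral>\<^sup>+x. ennreal \<mu> * indicator Kc x \<partial>lborel) = ennreal \<mu> * emeasure lborel Kc"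
      by (rule nn_integral_cmult_indicator) simp
    also have "ennreal \<mu> * emeasure lborel Kc + ennreal \<mu> * modular p \<mu> g < \<infinity>"
      using emeasure_compact_finite[OF Kc] m by (auto simp: ennreal_mult_less_top intro: le_less_trans)
    finally have fin: "(\<integral>\<^sup>+x. ennreal (norm (indicator Kc x *\<^sub>R g x)) \<partial>lborel) < \<infinity>" .
    have "integrable lborel (\<lambda>x. indicator Kc x *\<^sub>R g x)"
      by (rule integrableI_bounded[OF _ fin]) measurable
    then show ?thesis unfolding set_integrable_def by (subst integrable_completion) (auto simp: borel_measurable_integrable)
  qed
  then have "g \<in> L1_loc" unfolding L1_loc_def by blast
  moreover have "\<exists>\<mu>>0. (\<integral>\<^sup>+x. ennreal (exp (\<bar>g x\<bar> powr p / \<mu> powr p) - 1) \<partial>lebesgue) < \<infinity>"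
    using \<mu> m by (intro exI[of _ \<mu>]) (simp add: expL_modular le_less_trans)
  ultimately show ?thesis unfolding expL_def by blast
qed

text \<open>Exhaustion by balls: integrability on each compact ball carries the measurability of the
  cut-off function, and the cut-offs converge pointwise. This is how data and test functions are
  seen to be measurable.\<close>

lemma L1_loc_measurable:
  fixes g :: "'a::euclidean_space \<Rightarrow> real"
  assumes g: "g \<in> L1_loc"
  shows "g \<in> borel_measurable lebesgue"
proof (rule borel_measurable_LIMSEQ_real)
  fix n :: nat
  have "set_integrable lebesgue (cball 0 (real n)) g" using g unfolding L1_loc_def by simp
  then show "(\<lambda>x. indicator (cball 0 (real n)) x *\<^sub>R g x) \<in> borel_measurable lebesgue"
    unfolding set_integrable_def by (rule borel_measurable_integrable)
next
  fix x :: 'a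
  obtain k :: nat where k: "norm x \<le> real k" using real_arch_simple by blast
  have "\<forall>\<^sub>F n in sequentially. indicator (cball 0 (real n)) x *\<^sub>R g x = g x"
    unfolding eventually_sequentially using k by (intro exI[of _ k]) auto
  then show "(\<lambda>n. indicator (cball 0 (real n)) x *\<^sub>R g x) \<longlonglongrightarrow> g x" by (rule tendsto_eventually)
qed

lemma zero_in_expL:
  assumes "1 \<le> p" shows "(\<lambda>x. 0) \<in> expL p"
  by (rule expL_I[OF assms, of _ 1]) (simp_all add: modular_def)

text \<open>A finitely valued Borel change of time makes any curve simple, whatever the space in
  which it takes its values.\<close>

lemma simple_function_step:
  assumes j: "j \<in> borel_measurable borel" and fin: "finite (j ` \<Omega>)"
  shows "simple_function (lebesgue_on \<Omega>) (\<lambda>t::real. U (j t :: real))"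
proof -
  have "j \<in> borel_measurable (lebesgue_on \<Omega>)"
    using j by (intro measurable_restrict_space1 measurable_completion) simp
  then have "simple_function (lebesgue_on \<Omega>) j"
    using fin by (intro simple_function_borel_measurable) (auto simp: space_restrict_space)
  then show ?thesis by (rule simple_function_compose1)
qed

lemma expL_measurableI:
  fixes u :: "real \<Rightarrow> 'a::euclidean_space \<Rightarrow> real" and j :: "nat \<Rightarrow> real \<Rightarrow> real"
  assumes u: "\<And>t. t \<in> \<Omega> \<Longrightarrow> u t \<in> expL p" and j: "\<And>n. j n \<in> borel_measurable borel" "\<And>n. finite (j n ` \<Omega>)"
    and U: "\<And>n t. t \<in> \<Omega> \<Longrightarrow> U n (j n t) \<in> expL p"
    and lim: "\<And>t. t \<in> \<Omega> \<Longrightarrow> (\<lambda>n. expL_norm p (\<lambda>x. U n (j n t) x - u t x)) \<longlonglongrightarrow> 0"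
  shows "expL_measurable p \<Omega> u"
  unfolding expL_measurable_def
proof (intro conjI exI[of _ "\<lambda>n t. U n (j n t)"] allI ballI)
  show "AE t in lebesgue_on \<Omega>. u t \<in> expL p" by (rule AE_I2) (simp add: u space_restrict_space)
  show "AE t in lebesgue_on \<Omega>. (\<lambda>n. expL_norm p (\<lambda>x. U n (j n t) x - u t x)) \<longlonglongrightarrow> 0"
    by (rule AE_I2) (simp add: lim space_restrict_space)
  show "simple_function (lebesgue_on \<Omega>) (\<lambda>t. U n (j n t))" for n by (rule simple_function_step[OF j])
qed (use U in auto)

lemma tendsto_ennreal_zeroI:
  fixes g :: "'b \<Rightarrow> ennreal"
  assumes "\<And>r. 0 < r \<Longrightarrow> \<forall>\<^sub>F n in F. g n \<le> ennreal r"
  shows "(g \<longlongrightarrow> 0) F"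
proof (rule order_tendstoI)
  fix a :: ennreal assume a: "0 < a"
  obtain r where r: "0 < r" "ennreal r < a"
  proof (cases a)
    case (real r)
    then show ?thesis using a that[of "r/2"] by (auto simp: ennreal_less_iff)
  next
    case top
    then show ?thesis using that[of 1] by simp
  qed
  from assms[OF r(1)] show "\<forall>\<^sub>F n in F. g n < a" by eventually_elim (use r(2) in auto)
qed simp

text \<open>Times in \<open>(0,\<infinity>)\<close> are rounded up to stay away from \<open>0\<close>, where the solution need not be continuous;
  in \<open>(0,t)\<close> they are rounded down to stay away from the singularity of \<open>P (t - \<tau>)\<close> at \<open>\<tau> = t\<close>.\<close>

definition grid_up :: "nat \<Rightarrow> real \<Rightarrow> real" where
  "grid_up n t = (if t \<le> real (Suc n) then real_of_int \<lceil>t * real (Suc n)\<rceil> / real (Suc n) else 0)"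

definition grid_down :: "real \<Rightarrow> nat \<Rightarrow> real \<Rightarrow> real" where
  "grid_down T n t = T * real_of_int \<lfloor>t * real (Suc n) / T\<rfloor> / real (Suc n)"

lemma grid_up:
  shows "grid_up n \<in> borel_measurable borel" "finite (grid_up n ` {0<..})"
    "0 < t \<Longrightarrow> t \<le> real (Suc n) \<Longrightarrow> t \<le> grid_up n t \<and> grid_up n t < t + 1 / real (Suc n)"
proof -
  show "grid_up n \<in> borel_measurable borel" unfolding grid_up_def[abs_def] by measurable
  have "grid_up n t \<in> (\<lambda>k. real_of_int k / real (Suc n)) ` {0..int (Suc n) * int (Suc n)}" if "0 < t" for t
  proof (cases "t \<le> real (Suc n)")
    case True
    have "\<lceil>t * real (Suc n)\<rceil> \<le> int (Suc n) * int (Suc n)"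
    proof (rule ceiling_le)
      have "t * real (Suc n) \<le> real (Suc n) * real (Suc n)" using True by (intro mult_right_mono) auto
      then show "t * real (Suc n) \<le> real_of_int (int (Suc n) * int (Suc n))" by simp
    qed
    moreover have "0 \<le> \<lceil>t * real (Suc n)\<rceil>"
    proof -
      have "0 < t * real (Suc n)" using that by simp
      then show ?thesis by linarith
    qed
    ultimately show ?thesis unfolding grid_up_def using True by (auto intro!: image_eqI)
  next
    case False
    then show ?thesis unfolding grid_up_def by (auto intro!: image_eqI[of _ _ 0])
  qed
  then show "finite (grid_up n ` {0<..})"
    by (intro finite_subset[of "grid_up n ` {0<..}" "(\<lambda>k. real_of_int k / real (Suc n)) ` {0..int (Suc n) * int (Suc n)}"]) auto
  show "0 < t \<Longrightarrow> t \<le> real (Suc n) \<Longrightarrow> t \<le> grid_up n t \<and> grid_up n t < t + 1 / real (Suc n)"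
  proof -
    assume t: "0 < t" "t \<le> real (Suc n)"
    define q where "q = real (Suc n)"
    have q: "0 < q" unfolding q_def by simp
    have "t * q \<le> real_of_int \<lceil>t * q\<rceil>" "real_of_int \<lceil>t * q\<rceil> < t * q + 1" by linarith+
    then have "t \<le> real_of_int \<lceil>t * q\<rceil> / q \<and> real_of_int \<lceil>t * q\<rceil> / q < t + 1 / q"
      using q by (simp add: field_simps)
    then show "t \<le> grid_up n t \<and> grid_up n t < t + 1 / real (Suc n)" unfolding grid_up_def q_def using t by simp
  qed
qed

lemma grid_down:
  assumes T: "0 < T"
  shows "grid_down T n \<in> borel_measurable borel" "finite (grid_down T n ` {0<..<T})"
    "0 < t \<Longrightarrow> t < T \<Longrightarrow> 0 \<le> grid_down T n t \<and> grid_down T n t \<le> t \<and> t - grid_down T n t < T / real (Suc n)"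
proof -
  show "grid_down T n \<in> borel_measurable borel" unfolding grid_down_def[abs_def] by measurable
  define q where "q = real (Suc n)"
  have q: "0 < q" unfolding q_def by simp
  have b: "0 \<le> \<lfloor>t * q / T\<rfloor>" "\<lfloor>t * q / T\<rfloor> \<le> int (Suc n)" if "0 < t" "t < T" for t
  proof -
    show "0 \<le> \<lfloor>t * q / T\<rfloor>" using that T q by simp
    have "t * q / T \<le> q" using that T q by (simp add: field_simps)
    then have "\<lfloor>t * q / T\<rfloor> \<le> \<lfloor>q\<rfloor>" by (rule floor_mono)
    then show "\<lfloor>t * q / T\<rfloor> \<le> int (Suc n)" unfolding q_def by simp
  qed
  then have "grid_down T n ` {0<..<T} \<subseteq> (\<lambda>k. T * real_of_int k / q) ` {0..int (Suc n)}"
    unfolding grid_down_def q_def by (auto intro!: imageI)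
  then show "finite (grid_down T n ` {0<..<T})" by (rule finite_subset) simp
  show "0 < t \<Longrightarrow> t < T \<Longrightarrow> 0 \<le> grid_down T n t \<and> grid_down T n t \<le> t \<and> t - grid_down T n t < T / real (Suc n)"
  proof -
    assume t: "0 < t" "t < T"
    define k where "k = real_of_int \<lfloor>t * q / T\<rfloor>"
    have "k \<le> t * q / T" "t * q / T < k + 1" unfolding k_def by linarith+
    then have k: "k * T \<le> t * q" "t * q < (k + 1) * T" using T by (simp_all add: le_divide_eq divide_less_eq)
    have "(t * q - k * T) / q < T / q" using k q by (intro divide_strict_right_mono) (auto simp: algebra_simps)
    moreover have "(t * q - k * T) / q = t - T * k / q" using q by (simp add: diff_divide_distrib mult.commute)
    moreover have "T * k / q \<le> t" using k q by (simp add: divide_le_eq mult.commute)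
    ultimately have "T * real_of_int \<lfloor>t * q / T\<rfloor> / q \<le> t \<and> t - T * real_of_int \<lfloor>t * q / T\<rfloor> / q < T / q"
      unfolding k_def by simp
    moreover have "0 \<le> T * real_of_int \<lfloor>t * q / T\<rfloor> / q" using b(1)[OF t] T q by simp
    ultimately show "0 \<le> grid_down T n t \<and> grid_down T n t \<le> t \<and> t - grid_down T n t < T / real (Suc n)"
      unfolding grid_down_def q_def by simp
  qed
qed

lemma tendsto_of_abs_le_inverse:
  fixes X :: "nat \<Rightarrow> real"
  assumes "\<forall>\<^sub>F n in sequentially. \<bar>X n - t\<bar> \<le> c / real (Suc n)"
  shows "X \<longlonglongrightarrow> t"
proof -
  have "(\<lambda>n. c * inverse (real (Suc n))) \<longlonglongrightarrow> c * 0"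
    by (intro tendsto_mult_left LIMSEQ_inverse_real_of_nat)
  then have "(\<lambda>n. c / real (Suc n)) \<longlonglongrightarrow> 0" by (simp add: divide_inverse)
  then have "(\<lambda>n. X n - t) \<longlonglongrightarrow> 0"
    by (rule Lim_null_comparison[rotated]) (use assms in simp)
  then show ?thesis by (simp add: LIM_zero_iff)
qed

lemma eventually_at_tendsto:
  fixes X :: "nat \<Rightarrow> real"
  assumes ev: "\<forall>\<^sub>F b in at t. Q b" and Qt: "Q t" and X: "X \<longlonglongrightarrow> t"
  shows "\<forall>\<^sub>F n in sequentially. Q (X n)"
proof -
  have "\<forall>\<^sub>F b in nhds t. Q b" using ev unfolding eventually_at_filter by (rule eventually_mono) (use Qt in auto)
  then show ?thesis using X by (rule eventually_compose_filterlim)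
qed

context mild_solution
begin

lemma p_ge1: "1 \<le> p" using p1 by simp

lemma u_expL: "0 < t \<Longrightarrow> u t \<in> expL p"
  using expL_I[OF p_ge1 borel_slices(2) N0 admissibleD(2)[OF ad]] .

lemma small_expL_norm: "g \<in> borel_measurable borel \<Longrightarrow> 0 < \<epsilon> \<Longrightarrow> small \<epsilon> g \<Longrightarrow> expL_norm p g \<le> ennreal (3 * \<epsilon>)"
  by (intro expL_norm_le modular_small p_ge1) auto

lemma u_in_Linf: "u \<in> Linf_expL p {0<..}"
  unfolding Linf_expL_def
proof (intro CollectI conjI ballI)
  show "u t \<in> expL p" if "t \<in> {0<..}" for t using that by (intro u_expL) simp
  show "\<exists>B. AE t in lebesgue_on {0<..}. expL_norm p (u t) \<le> ennreal B"
    by (intro exI[of _ N] AE_I2) (auto simp: space_restrict_space intro!: expL_norm_le N0 admissibleD(2)[OF ad])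
  show "expL_measurable p {0<..} u"
  \<comment> \<open>Times beyond n + 1 are sent to 0 to keep the range finite. There the zero
    function stands in, since u is placed in exp L^p at positive times only.\<close>
  proof (rule expL_measurableI[where j=grid_up and U="\<lambda>n t. if 0 < t then u t else (\<lambda>x. 0)"])
    show "(if 0 < grid_up n t then u (grid_up n t) else (\<lambda>x. 0)) \<in> expL p" for n t
      by (simp add: u_expL zero_in_expL[OF p_ge1])
    fix t :: real assume "t \<in> {0<..}"
    then have t: "0 < t" by simp
    obtain k :: nat where k: "t \<le> real k" using real_arch_simple by blast
    have ev: "\<forall>\<^sub>F n in sequentially. t \<le> real (Suc n)"
      unfolding eventually_sequentially using k by (intro exI[of _ k]) auto
    have g: "(\<lambda>n. grid_up n t) \<longlonglongrightarrow> t"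
    proof (rule tendsto_of_abs_le_inverse[where c=1])
      show "\<forall>\<^sub>F n in sequentially. \<bar>grid_up n t - t\<bar> \<le> 1 / real (Suc n)"
        using ev by eventually_elim (use grid_up(3)[OF t] in force)
    qed
    show "(\<lambda>n. expL_norm p (\<lambda>x. (if 0 < grid_up n t then u (grid_up n t) else (\<lambda>x. 0)) x - u t x)) \<longlonglongrightarrow> 0"
    proof (rule tendsto_ennreal_zeroI)
      fix r' :: real assume r': "0 < r'"
      have "\<forall>\<^sub>F n in sequentially. near r' (\<lambda>x. u (grid_up n t) x - u t x)"
      proof (rule eventually_at_tendsto[OF u_continuous[OF t r'] _ g])
        show "near r' (\<lambda>x. u t x - u t x)" unfolding near_def modular_def using r' by simp
      qed
      then show "\<forall>\<^sub>F n in sequentially. expL_norm p (\<lambda>x. (if 0 < grid_up n t then u (grid_up n t) else (\<lambda>x. 0)) x - u t x) \<le> ennreal r'"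
        using ev
      proof eventually_elim
        case (elim n)
        have "0 < grid_up n t" using grid_up(3)[OF t elim(2)] t by linarith
        then show ?case using elim(1) r' by (auto simp: near_def intro: expL_norm_le)
      qed
    qed
  qed (use u_expL grid_up in auto)
qed

lemma G_borel [measurable]: "G t \<tau> \<in> borel_measurable borel"
proof -
  note [measurable (raw)] = jointly_measurableD[OF G_joint[of t]]
  show ?thesis by measurable
qed

abbreviation S :: "real \<Rightarrow> nat \<Rightarrow> real \<Rightarrow> 'a \<Rightarrow> real" where
  "S t n \<tau> \<equiv> G t (grid_down t n \<tau>)"

definition cG :: real where "cG = (1 + K) * B"

lemma cG: "0 < cG" unfolding cG_def using K B by (intro mult_pos_pos) auto

lemma G_small: "0 < \<tau> \<Longrightarrow> \<tau> < t \<Longrightarrow> small (cG * (1 + (t - \<tau>) powr (- 1 / 2))) (G t \<tau>)"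
  unfolding cG_def by (rule G_bound)

text \<open>Rounding down moves the time away from the singularity at t, so the step curves obey the
  same bound as \<open>G\<close> itself, uniformly in n.\<close>

lemma S_small:
  assumes \<tau>: "0 < \<tau>" "\<tau> < t"
  shows "small (cG * (1 + (t - \<tau>) powr (- 1 / 2))) (S t n \<tau>)"
proof (cases "0 < grid_down t n \<tau>")
  case True
  have t: "0 < t" using \<tau> by simp
  have g: "grid_down t n \<tau> \<le> \<tau>" using grid_down(3)[OF t \<tau>] by simp
  show ?thesis
  proof (rule small_mono[OF G_small[OF True]])
    show "grid_down t n \<tau> < t" using g \<tau> by simp
    have "(t - grid_down t n \<tau>) powr (- 1 / 2) \<le> (t - \<tau>) powr (- 1 / 2)" using g \<tau> by (intro powr_mono2') auto
    then show "cG * (1 + (t - grid_down t n \<tau>) powr (- 1 / 2)) \<le> cG * (1 + (t - \<tau>) powr (- 1 / 2))"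
      using cG by (intro mult_left_mono) auto
  qed
next
  case False
  then have "S t n \<tau> = (\<lambda>x. 0)" unfolding G_def by simp
  then show ?thesis using small_zero[of "cG * (1 + (t - \<tau>) powr (- 1 / 2))"] cG by simp
qed

text \<open>On [d, t - d] uniform continuity makes the error at most \<eta>; near the two ends it is
  at most twice the common bound of \<open>G\<close> and the step curve, which is integrable. The
  explicit Borel majorant M controls the integral of the norms and the norm of the integrals
  alike.\<close>

lemma step_majorant:
  assumes t: "0 < t" and r: "0 < \<epsilon>"
  shows "\<forall>\<^sub>F n in sequentially. \<exists>M. M \<in> borel_measurable borel \<and> (\<forall>\<tau>. 0 < \<tau> \<longrightarrow> \<tau> < t \<longrightarrow> 0 < M \<tau> \<and> small (M \<tau>) (\<lambda>x. S t n \<tau> x - G t \<tau> x))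
     \<and> time_integral 0 t M \<le> ennreal \<epsilon>"
proof -
  \<comment> \<open>Bounds the error on (0, d): there t - \<tau> \<ge> t/2, because d \<le>
    t/4.\<close>
  define c where "c = 2 * cG * (1 + (t/2) powr (- 1 / 2))"
  have c: "0 < c" unfolding c_def using cG by (simp add: add_pos_nonneg)
  have "((\<lambda>d. c * d + 2 * cG * (d + 2 * sqrt d)) \<longlongrightarrow> c * 0 + 2 * cG * (0 + 2 * sqrt 0)) (at_right 0)"
    by (intro tendsto_intros)
  then have "\<forall>\<^sub>F d in at_right 0. c * d + 2 * cG * (d + 2 * sqrt d) < \<epsilon> / 2"
    by (rule order_tendstoD(2)) (use r in simp)
  then obtain d0 where d0: "0 < d0" "\<And>d. 0 < d \<Longrightarrow> d < d0 \<Longrightarrow> c * d + 2 * cG * (d + 2 * sqrt d) < \<epsilon> / 2"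
    unfolding eventually_at_right_field by auto
  define d where "d = min (d0 / 2) (t / 4)"
  have d: "0 < d" "d < d0" "d \<le> t / 4" unfolding d_def using d0 t by auto
  define \<eta> where "\<eta> = \<epsilon> / (2 * t)"
  have \<eta>: "0 < \<eta>" "\<eta> * t = \<epsilon> / 2" unfolding \<eta>_def using r t by auto
  obtain \<delta> where \<delta>: "0 < \<delta>" "\<And>a b. a \<in> {d..t - d} \<Longrightarrow> \<bar>b - a\<bar> < \<delta> \<Longrightarrow> small \<eta> (\<lambda>x. G t b x - G t a x)"
  proof (rule curve_uniform[of "{d..t - d}" "G t" \<eta>])
    show "\<forall>\<^sub>F b in at a. small e (\<lambda>x. G t b x - G t a x)" if "a \<in> {d..t - d}" "0 < e" for a e
      using that d by (intro G_continuous) auto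
  qed (use \<eta> in auto)
  have "(\<lambda>n. t * inverse (real (Suc n))) \<longlonglongrightarrow> t * 0" by (intro tendsto_mult_left LIMSEQ_inverse_real_of_nat)
  then have "\<forall>\<^sub>F n in sequentially. t * inverse (real (Suc n)) < \<delta>" by (rule order_tendstoD(2)) (use \<delta> in simp)
  then show ?thesis
  proof eventually_elim
    case (elim n)
    then have n: "t / real (Suc n) < \<delta>" by (simp add: divide_inverse)
    define m where "m \<tau> = 2 * cG * (1 + (t - \<tau>) powr (- 1 / 2))" for \<tau>
    have m: "0 < m \<tau>" for \<tau> unfolding m_def using cG by (simp add: add_pos_nonneg)
    define M where "M \<tau> = (if d \<le> \<tau> \<and> \<tau> \<le> t - d then \<eta> else m \<tau>)" for \<tau>
    have M1: "M \<in> borel_measurable borel" unfolding M_def[abs_def] m_def by measurable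
    have M2: "0 < M \<tau> \<and> small (M \<tau>) (\<lambda>x. S t n \<tau> x - G t \<tau> x)" if \<tau>: "0 < \<tau>" "\<tau> < t" for \<tau>
    proof (cases "d \<le> \<tau> \<and> \<tau> \<le> t - d")
      case True
      have "\<bar>grid_down t n \<tau> - \<tau>\<bar> < \<delta>" using grid_down(3)[OF t \<tau>, of n] n by linarith
      then show ?thesis unfolding M_def using True \<eta> \<delta>(2)[of \<tau>] by auto
    next
      case False
      define k where "k = cG * (1 + (t - \<tau>) powr (- 1 / 2))"
      have 1: "small k (\<lambda>x. S t n \<tau> x - 0)" using S_small[OF \<tau>, of n] unfolding k_def by simp
      have 2: "small k (\<lambda>x. 0 - G t \<tau> x)" using small_swap[of k "G t \<tau>" "\<lambda>x. 0"] G_small[OF \<tau>] unfolding k_def by simp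
      have "small (k + k) (\<lambda>x. S t n \<tau> x - G t \<tau> x)" by (rule small_triangle[OF _ _ _ 1 2]) simp_all
      moreover have "k + k = m \<tau>" unfolding k_def m_def by simp
      ultimately have "small (m \<tau>) (\<lambda>x. S t n \<tau> x - G t \<tau> x)" by (simp only:)
      then show ?thesis unfolding M_def if_not_P[OF False] using m by simp
    qed
    have le: "ennreal (if 0 < \<tau> \<and> \<tau> < t then M \<tau> else 0) \<le> ennreal (if 0 < \<tau> \<and> \<tau> < t then \<eta> else 0)
       + (ennreal (if 0 < \<tau> \<and> \<tau> < d then c else 0) + ennreal (if t - d < \<tau> \<and> \<tau> < t then 2 * cG * (1 + (t - \<tau>) powr (- 1 / 2)) else 0))" for \<tau>
    proof (cases "0 < \<tau> \<and> \<tau> < t")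
      case True
      consider "d \<le> \<tau> \<and> \<tau> \<le> t - d" | "\<tau> < d" | "t - d < \<tau>" by linarith
      then show ?thesis
      proof cases
        case 1
        then show ?thesis using True unfolding M_def by simp
      next
        case 2
        have "m \<tau> \<le> c" unfolding m_def c_def using 2 d t cG
          by (intro mult_left_mono add_left_mono powr_mono2') auto
        then have "ennreal (M \<tau>) \<le> ennreal c" unfolding M_def using 2 by (simp add: ennreal_leI)
        also have "\<dots> \<le> ennreal \<eta> + (ennreal c + ennreal (if t - d < \<tau> \<and> \<tau> < t then 2 * cG * (1 + (t - \<tau>) powr (- 1 / 2)) else 0))"
          by (simp add: add_increasing add_increasing2)
        finally show ?thesis using True 2 by simp
      next
        case 3
        then have "ennreal (M \<tau>) = ennreal (2 * cG * (1 + (t - \<tau>) powr (- 1 / 2)))" unfolding M_def m_def by simp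
        then show ?thesis using True 3 by (simp add: add_increasing)
      qed
    next
      case False
      show ?thesis unfolding if_not_P[OF False] by simp
    qed
    have "time_integral 0 t M \<le> (\<integral>\<^sup>+\<tau>. ennreal (if 0 < \<tau> \<and> \<tau> < t then \<eta> else 0)
       + (ennreal (if 0 < \<tau> \<and> \<tau> < d then c else 0) + ennreal (if t - d < \<tau> \<and> \<tau> < t then 2 * cG * (1 + (t - \<tau>) powr (- 1 / 2)) else 0)) \<partial>lborel)"
      by (intro nn_integral_mono le)
    also have "\<dots> = time_integral 0 t (\<lambda>\<tau>. \<eta>) + (\<integral>\<^sup>+\<tau>. ennreal (if 0 < \<tau> \<and> \<tau> < d then c else 0) + ennreal (if t - d < \<tau> \<and> \<tau> < t then 2 * cG * (1 + (t - \<tau>) powr (- 1 / 2)) else 0) \<partial>lborel)"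
      by (rule nn_integral_add) measurable
    also have "(\<integral>\<^sup>+\<tau>. ennreal (if 0 < \<tau> \<and> \<tau> < d then c else 0) + ennreal (if t - d < \<tau> \<and> \<tau> < t then 2 * cG * (1 + (t - \<tau>) powr (- 1 / 2)) else 0) \<partial>lborel)
      = time_integral 0 d (\<lambda>\<tau>. c) + (\<integral>\<^sup>+\<tau>. ennreal (if t - d < \<tau> \<and> \<tau> < t then 2 * cG * (1 + (t - \<tau>) powr (- 1 / 2)) else 0) \<partial>lborel)"
      by (rule nn_integral_add) measurable
    also have "time_integral 0 t (\<lambda>\<tau>. \<eta>) + (time_integral 0 d (\<lambda>\<tau>. c) + (\<integral>\<^sup>+\<tau>. ennreal (if t - d < \<tau> \<and> \<tau> < t then 2 * cG * (1 + (t - \<tau>) powr (- 1 / 2)) else 0) \<partial>lborel))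
      \<le> ennreal (\<eta> * t) + (ennreal (c * d) + ennreal (2 * cG * ((t - (t - d)) + 2 * sqrt (t - (t - d)))))"
      using t d c \<eta> cG by (intro add_mono nn_integral_tail_inverse_sqrt eq_refl[OF nn_integral_const_interval]) auto
    also have "\<dots> = ennreal (\<eta> * t + (c * d + 2 * cG * (d + 2 * sqrt d)))"
      using t d c \<eta>(1) cG by (simp flip: ennreal_plus)
    also have "\<dots> \<le> ennreal \<epsilon>" using d0(2)[OF d(1,2)] \<eta>(2) by (intro ennreal_leI) linarith
    finally show ?case using M1 M2 by blast
  qed
qed

lemma S_joint: "jointly_measurable (S t n)" if "0 < t"
proof -
  note [measurable (raw)] = jointly_measurableD[OF G_joint[of t]]
  have [measurable]: "grid_down t n \<in> borel_measurable borel" by (rule grid_down[OF that])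
  show ?thesis unfolding jointly_measurable_def by measurable
qed

lemma S_integrable:
  assumes t: "0 < t"
  shows "integrable lborel (\<lambda>\<tau>. if 0 < \<tau> \<and> \<tau> < t then S t n \<tau> x else 0)"
proof (rule integrableI_bounded)
  note [measurable (raw)] = jointly_measurableD[OF S_joint[OF t, of n]]
  show "(\<lambda>\<tau>. if 0 < \<tau> \<and> \<tau> < t then S t n \<tau> x else 0) \<in> borel_measurable lborel" by measurable
  have "(\<integral>\<^sup>+\<tau>. ennreal (norm (if 0 < \<tau> \<and> \<tau> < t then S t n \<tau> x else 0)) \<partial>lborel)
    \<le> time_integral 0 t (\<lambda>\<tau>. cG * (1 + (t - \<tau>) powr (- 1 / 2)))"
  proof (intro nn_integral_mono ennreal_leI)
    fix \<tau>
    show "norm (if 0 < \<tau> \<and> \<tau> < t then S t n \<tau> x else 0) \<le> (if 0 < \<tau> \<and> \<tau> < t then cG * (1 + (t - \<tau>) powr (- 1 / 2)) else 0)"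
      using smallD(1)[OF S_small[of \<tau> t n], of x] by auto
  qed
  also have "\<dots> \<le> ennreal (cG * (t + 2 * sqrt t))" using t cG by (intro nn_integral_one_plus_inverse_sqrt) auto
  also have "\<dots> < \<infinity>" by simp
  finally show "(\<integral>\<^sup>+\<tau>. ennreal (norm (if 0 < \<tau> \<and> \<tau> < t then S t n \<tau> x else 0)) \<partial>lborel) < \<infinity>" .
qed

text \<open>The step curves approximate \<open>G t\<close> in the integrated norm, and their time
  integrals, taken at each x, approximate \<open>D t\<close> in L^1 and L^\<infinity>. Both errors
  are bounded by the time integral of the same majorant.\<close>

lemma duh_has_expL_integral:
  assumes t: "0 < t"
  shows "has_expL_integral p 0 t (G t) (D t)"
  unfolding has_expL_integral_def
proof (intro conjI exI[of _ "S t"] allI ballI)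
  have Gx: "G t \<tau> \<in> expL p" for \<tau>
  proof (cases "0 < \<tau> \<and> \<tau> < t")
    case True
    have "0 < cG * (1 + (t - \<tau>) powr (- 1 / 2))" using cG by (simp add: add_pos_nonneg)
    then show ?thesis using True
      by (intro expL_I[OF p_ge1 _ _ modular_small[OF p_ge1 _ _ G_small]]) auto
  next
    case False
    then have "G t \<tau> = (\<lambda>x. 0)" unfolding G_def by auto
    then show ?thesis by (simp add: zero_in_expL[OF p_ge1])
  qed
  show "S t n \<tau> \<in> expL p" for n \<tau> by (rule Gx)
  show sf: "simple_function (lebesgue_on {0<..<t}) (S t n)" for n
    by (rule simple_function_step[OF grid_down(1,2)[OF t]])
  show "D t \<in> expL p"
    using e by (intro expL_I[OF p_ge1 _ _ modular_good[OF gD e t]]) auto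
  show "expL_measurable p {0<..<t} (G t)"
  proof (rule expL_measurableI[where j="grid_down t" and U="\<lambda>n. G t"])
    fix \<tau> assume "\<tau> \<in> {0<..<t}"
    then have \<tau>: "0 < \<tau>" "\<tau> < t" by auto
    have g: "(\<lambda>n. grid_down t n \<tau>) \<longlonglongrightarrow> \<tau>"
    proof (rule tendsto_of_abs_le_inverse[where c=t], rule always_eventually, rule allI)
      show "\<bar>grid_down t n \<tau> - \<tau>\<bar> \<le> t / real (Suc n)" for n using grid_down(3)[OF t \<tau>, of n] by linarith
    qed
    show "(\<lambda>n. expL_norm p (\<lambda>x. S t n \<tau> x - G t \<tau> x)) \<longlonglongrightarrow> 0"
    proof (rule tendsto_ennreal_zeroI)
      fix r' :: real assume r': "0 < r'"
      then have r3: "0 < r' / 3" by simp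
      have "\<forall>\<^sub>F n in sequentially. small (r' / 3) (\<lambda>x. S t n \<tau> x - G t \<tau> x)"
        by (rule eventually_at_tendsto[OF G_continuous[OF \<tau> r3] _ g]) (use small_zero[of "r' / 3"] r' in simp)
      then show "\<forall>\<^sub>F n in sequentially. expL_norm p (\<lambda>x. S t n \<tau> x - G t \<tau> x) \<le> ennreal r'"
      proof eventually_elim
        case (elim n)
        have "expL_norm p (\<lambda>x. S t n \<tau> x - G t \<tau> x) \<le> ennreal (3 * (r' / 3))"
          by (intro small_expL_norm r3 elim) simp
        then show ?case by simp
      qed
    qed
  qed (use Gx grid_down[OF t] in auto)
  show "(\<lambda>n. \<integral>\<^sup>+\<tau>. expL_norm p (\<lambda>x. S t n \<tau> x - G t \<tau> x) \<partial>lebesgue_on {0<..<t}) \<longlonglongrightarrow> 0"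
  proof (rule tendsto_ennreal_zeroI)
    fix r' :: real assume r': "0 < r'"
    then have r3: "0 < r' / 3" by simp
    show "\<forall>\<^sub>F n in sequentially. (\<integral>\<^sup>+\<tau>. expL_norm p (\<lambda>x. S t n \<tau> x - G t \<tau> x) \<partial>lebesgue_on {0<..<t}) \<le> ennreal r'"
      using step_majorant[OF t r3]
    proof eventually_elim
      case (elim n)
      then obtain M where M [measurable]: "M \<in> borel_measurable borel" and M2: "\<And>\<tau>. 0 < \<tau> \<Longrightarrow> \<tau> < t \<Longrightarrow> 0 < M \<tau> \<and> small (M \<tau>) (\<lambda>x. S t n \<tau> x - G t \<tau> x)"
        and M3: "time_integral 0 t M \<le> ennreal (r' / 3)" by blast
      have "(\<integral>\<^sup>+\<tau>. expL_norm p (\<lambda>x. S t n \<tau> x - G t \<tau> x) \<partial>lebesgue_on {0<..<t})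
        = (\<integral>\<^sup>+\<tau>. expL_norm p (\<lambda>x. S t n \<tau> x - G t \<tau> x) * indicator {0<..<t} \<tau> \<partial>lborel)"
        by (subst nn_integral_restrict_space) (simp_all add: nn_integral_completion)
      also have "\<dots> \<le> (\<integral>\<^sup>+\<tau>. ennreal 3 * ennreal (if 0 < \<tau> \<and> \<tau> < t then M \<tau> else 0) \<partial>lborel)"
      proof (intro nn_integral_mono)
        fix \<tau>
        show "expL_norm p (\<lambda>x. S t n \<tau> x - G t \<tau> x) * indicator {0<..<t} \<tau> \<le> ennreal 3 * ennreal (if 0 < \<tau> \<and> \<tau> < t then M \<tau> else 0)"
        proof (cases "0 < \<tau> \<and> \<tau> < t")
          case True
          then have "expL_norm p (\<lambda>x. S t n \<tau> x - G t \<tau> x) \<le> ennreal (3 * M \<tau>)"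
            using M2[of \<tau>] by (intro small_expL_norm) auto
          then show ?thesis using True M2[of \<tau>] by (simp add: ennreal_mult)
        qed auto
      qed
      also have "\<dots> = ennreal 3 * time_integral 0 t M"
        by (rule nn_integral_cmult) measurable
      also have "\<dots> \<le> ennreal 3 * ennreal (r' / 3)" by (intro mult_left_mono M3) simp
      also have "\<dots> = ennreal (3 * (r' / 3))" using r' by (subst ennreal_mult) auto
      finally show ?case by simp
    qed
  qed
  show "(\<lambda>n. expL_norm p (\<lambda>x. (LINT \<tau>|lebesgue_on {0<..<t}. S t n \<tau> x) - D t x)) \<longlonglongrightarrow> 0"
  proof (rule tendsto_ennreal_zeroI)
    fix r' :: real assume r': "0 < r'"
    then have r3: "0 < r' / 3" by simp
    show "\<forall>\<^sub>F n in sequentially. expL_norm p (\<lambda>x. (LINT \<tau>|lebesgue_on {0<..<t}. S t n \<tau> x) - D t x) \<le> ennreal r'"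
      using step_majorant[OF t r3]
    proof eventually_elim
      case (elim n)
      then obtain M where M [measurable]: "M \<in> borel_measurable borel" and M2: "\<And>\<tau>. 0 < \<tau> \<Longrightarrow> \<tau> < t \<Longrightarrow> 0 < M \<tau> \<and> small (M \<tau>) (\<lambda>x. S t n \<tau> x - G t \<tau> x)"
        and M3: "time_integral 0 t M \<le> ennreal (r' / 3)" by blast
      note [measurable (raw)] = jointly_measurableD[OF S_joint[OF t, of n]] jointly_measurableD[OF G_joint[of t]]
      define F where "F \<tau> x = (if 0 < \<tau> \<and> \<tau> < t then S t n \<tau> x - G t \<tau> x else 0)" for \<tau> x
      have F_meas [measurable]: "(\<lambda>z. F (fst z) (snd z)) \<in> borel_measurable (lborel \<Otimes>\<^sub>M lborel)"
        unfolding F_def by measurable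
      have eq: "(LINT \<tau>|lebesgue_on {0<..<t}. S t n \<tau> x) - D t x = (LBINT \<tau>. F \<tau> x)" for x
      proof -
        have "(LINT \<tau>|lebesgue_on {0<..<t}. S t n \<tau> x) = (LINT \<tau>|lebesgue. indicator {0<..<t} \<tau> *\<^sub>R S t n \<tau> x)"
          by (rule integral_restrict_space) simp
        also have "\<dots> = (LBINT \<tau>. indicator {0<..<t} \<tau> *\<^sub>R S t n \<tau> x)"
          by (rule integral_completion) measurable
        also have "\<dots> = (LBINT \<tau>. if 0 < \<tau> \<and> \<tau> < t then S t n \<tau> x else 0)"
          by (intro Bochner_Integration.integral_cong) (auto simp: indicator_def)
        finally have 1: "(LINT \<tau>|lebesgue_on {0<..<t}. S t n \<tau> x) = (LBINT \<tau>. if 0 < \<tau> \<and> \<tau> < t then S t n \<tau> x else 0)" .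
        have gi: "integrable lborel (\<lambda>\<tau>. if 0 < \<tau> \<and> \<tau> < t then G t \<tau> x else 0)"
          using duh_source_integrable[OF so B t, of x] unfolding G_def by (simp cong: if_cong)
        have 2: "D t x = (LBINT \<tau>. if 0 < \<tau> \<and> \<tau> < t then G t \<tau> x else 0)"
          unfolding fp[OF t] duh_def G_def by (simp cong: if_cong)
        show ?thesis unfolding 1 2 F_def
          by (subst Bochner_Integration.integral_diff[symmetric, OF S_integrable[OF t] gi])
            (intro Bochner_Integration.integral_cong refl; simp)
      qed
      have FM: "\<bar>F \<tau> x\<bar> \<le> (if 0 < \<tau> \<and> \<tau> < t then M \<tau> else 0)" for \<tau> x
        unfolding F_def using M2[of \<tau>] smallD(1)[of "M \<tau>" "\<lambda>x. S t n \<tau> x - G t \<tau> x" x] by auto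
      have "small (r' / 3) (\<lambda>x. LBINT \<tau>. F \<tau> x)"
        unfolding small_def
      proof (intro conjI allI)
        fix x
        have "ennreal \<bar>LBINT \<tau>. F \<tau> x\<bar> \<le> mass (\<lambda>\<tau>. F \<tau> x)" by (rule abs_integral_le_nn_integral)
        also have "\<dots> \<le> time_integral 0 t M"
          by (intro nn_integral_mono ennreal_leI FM)
        finally show "\<bar>LBINT \<tau>. F \<tau> x\<bar> \<le> r' / 3" using M3 r3 by (meson ennreal_le_iff less_imp_le order_trans)
      next
        have "mass (\<lambda>x. LBINT \<tau>. F \<tau> x) \<le> (\<integral>\<^sup>+x. mass (\<lambda>\<tau>. F \<tau> x) \<partial>lborel)"
          by (intro nn_integral_mono abs_integral_le_nn_integral)
        also have "\<dots> = (\<integral>\<^sup>+\<tau>. mass (F \<tau>) \<partial>lborel)"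
          by (rule lborel_pair.Fubini') (use F_meas in \<open>simp add: case_prod_beta'\<close>)
        also have "\<dots> \<le> time_integral 0 t M"
        proof (intro nn_integral_mono)
          fix \<tau>
          show "mass (F \<tau>) \<le> ennreal (if 0 < \<tau> \<and> \<tau> < t then M \<tau> else 0)"
            unfolding F_def using M2[of \<tau>] smallD(2)[of "M \<tau>" "\<lambda>x. S t n \<tau> x - G t \<tau> x"] by auto
        qed
        finally show "mass (\<lambda>x. LBINT \<tau>. F \<tau> x) \<le> ennreal (r' / 3)" using M3 by (rule order_trans)
      qed
      moreover have "(\<lambda>x. LBINT \<tau>. F \<tau> x) \<in> borel_measurable borel" unfolding F_def by measurable
      ultimately have "expL_norm p (\<lambda>x. LBINT \<tau>. F \<tau> x) \<le> ennreal (3 * (r' / 3))" by (intro small_expL_norm r3)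
      then show ?case unfolding eq by simp
    qed
  qed
qed

end

section \<open>Weak-star convergence to the initial datum\<close>

lemma nn_integral_tail_tendsto:
  fixes k :: "'a \<Rightarrow> real" and g :: "'a \<Rightarrow> ennreal"
  assumes [measurable]: "g \<in> borel_measurable M" "k \<in> borel_measurable M" and fin: "(\<integral>\<^sup>+x. g x \<partial>M) < \<infinity>"
  shows "(\<lambda>n. \<integral>\<^sup>+x. (if real n < k x then g x else 0) \<partial>M) \<longlonglongrightarrow> 0"
proof -
  have "(\<lambda>n. \<integral>\<^sup>+x. (if real n < k x then g x else 0) \<partial>M) \<longlonglongrightarrow> (\<integral>\<^sup>+x. 0 \<partial>M)"
  proof (rule nn_integral_dominated_convergence[where w=g])
    show "AE x in M. (\<lambda>n. if real n < k x then g x else 0) \<longlonglongrightarrow> 0"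
    proof (rule AE_I2)
      fix x
      obtain n0 :: nat where n0: "k x \<le> real n0" using real_arch_simple by blast
      have "\<forall>\<^sub>F n in sequentially. (if real n < k x then g x else 0) = 0"
        unfolding eventually_sequentially using n0 by (intro exI[of _ n0]) auto
      then show "(\<lambda>n. if real n < k x then g x else 0) \<longlonglongrightarrow> 0" by (rule tendsto_eventually)
    qed
  qed (use fin in auto)
  then show ?thesis by simp
qed

text \<open>Truncates the value at height R and cuts off in space by one expression continuous in
  both variables, so cutting preserves continuity and a.e. convergence.\<close>

definition clamp_cut :: "real \<Rightarrow> 'a::euclidean_space \<Rightarrow> real \<Rightarrow> real" where
  "clamp_cut R x z = max (- R) (min R z) * max 0 (min 1 (R + 1 - norm x))"

lemma clamp_cut_bound:
  assumes "0 \<le> R"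
  shows "\<bar>clamp_cut R x z\<bar> \<le> R" "\<bar>clamp_cut R x z\<bar> \<le> \<bar>z\<bar>" "\<bar>clamp_cut R x z\<bar> \<le> R * indicator (cball 0 (R + 1)) x"
proof -
  define c where "c = max 0 (min 1 (R + 1 - norm x))"
  have c: "0 \<le> c" "c \<le> 1" unfolding c_def by auto
  have b: "\<bar>max (- R) (min R z)\<bar> \<le> R" "\<bar>max (- R) (min R z)\<bar> \<le> \<bar>z\<bar>" using assms by auto
  have eq: "\<bar>clamp_cut R x z\<bar> = \<bar>max (- R) (min R z)\<bar> * c" unfolding clamp_cut_def c_def[symmetric] using c by (simp add: abs_mult)
  have le: "\<bar>max (- R) (min R z)\<bar> * c \<le> \<bar>max (- R) (min R z)\<bar>" using c by (intro mult_right_le_one_le) auto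
  show "\<bar>clamp_cut R x z\<bar> \<le> R" "\<bar>clamp_cut R x z\<bar> \<le> \<bar>z\<bar>" using le b unfolding eq by linarith+
  show "\<bar>clamp_cut R x z\<bar> \<le> R * indicator (cball 0 (R + 1)) x"
  proof (cases "norm x \<le> R + 1")
    case True
    then show ?thesis using le b unfolding eq by simp
  next
    case False
    then have "c = 0" unfolding c_def by simp
    then show ?thesis unfolding eq using assms by simp
  qed
qed

lemma clamp_cut_eq: "\<bar>z\<bar> \<le> R \<Longrightarrow> norm x \<le> R \<Longrightarrow> clamp_cut R x z = z"
  unfolding clamp_cut_def by auto

text \<open>First \<phi> is cut to a bounded function with bounded support. An a.e. approximation of
  \<phi> by continuous functions is then cut in the same way, which makes R times the indicator of a
  ball an integrable majorant.\<close>

lemma continuous_L1_approximation: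
  fixes \<phi> :: "'a::euclidean_space \<Rightarrow> real"
  assumes \<phi>: "\<phi> \<in> borel_measurable borel" and fin: "mass \<phi> < \<infinity>" and e: "0 < e"
  obtains \<theta> R where "continuous_on UNIV \<theta>" "0 \<le> R" "\<And>x. \<bar>\<theta> x\<bar> \<le> R" "mass \<theta> < \<infinity>"
    "mass (\<lambda>x. \<phi> x - \<theta> x) \<le> ennreal e"
proof -
  have \<phi>l [measurable]: "\<phi> \<in> borel_measurable lebesgue" using \<phi> by (intro measurable_completion) simp
  have [measurable]: "\<phi> \<in> borel_measurable borel" by (rule \<phi>)
  have cc_meas: "(\<lambda>x. clamp_cut R x (g x)) \<in> borel_measurable borel" if [measurable]: "g \<in> borel_measurable borel" for R and g :: "'a \<Rightarrow> real"
    unfolding clamp_cut_def by measurable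
  have "(\<lambda>n. \<integral>\<^sup>+x. ennreal (norm (\<phi> x - clamp_cut (real n) x (\<phi> x))) \<partial>lborel) \<longlonglongrightarrow> 0"
  proof (rule nn_integral_dominated_convergence_norm[where w="\<lambda>x. \<bar>\<phi> x\<bar>"])
    show "(\<lambda>x. clamp_cut (real i) x (\<phi> x)) \<in> borel_measurable lborel" for i using cc_meas[OF \<phi>] by simp
    show "AE x in lborel. norm (clamp_cut (real j) x (\<phi> x)) \<le> \<bar>\<phi> x\<bar>" for j by (rule AE_I2) (simp add: clamp_cut_bound)
    show "AE x in lborel. (\<lambda>i. clamp_cut (real i) x (\<phi> x)) \<longlonglongrightarrow> \<phi> x"
    proof (rule AE_I2)
      fix x
      obtain n0 :: nat where n0: "max \<bar>\<phi> x\<bar> (norm x) \<le> real n0" using real_arch_simple by blast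
      have "\<forall>\<^sub>F n in sequentially. clamp_cut (real n) x (\<phi> x) = \<phi> x"
        unfolding eventually_sequentially using n0 by (intro exI[of _ n0] allI impI clamp_cut_eq) auto
      then show "(\<lambda>i. clamp_cut (real i) x (\<phi> x)) \<longlonglongrightarrow> \<phi> x" by (rule tendsto_eventually)
    qed
  qed (use fin in auto)
  then have "\<forall>\<^sub>F n in sequentially. (\<integral>\<^sup>+x. ennreal (norm (\<phi> x - clamp_cut (real n) x (\<phi> x))) \<partial>lborel) < ennreal (e / 2)"
    by (rule order_tendstoD(2)) (use e in simp)
  then obtain n where n: "(\<integral>\<^sup>+x. ennreal (norm (\<phi> x - clamp_cut (real n) x (\<phi> x))) \<partial>lborel) < ennreal (e / 2)"
    by (auto simp: eventually_sequentially)
  define R where "R = real n"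
  have R: "0 \<le> R" unfolding R_def by simp
  have "\<phi> measurable_on UNIV" using \<phi>l by (rule lebesgue_measurable_imp_measurable_on) simp
  then obtain Nn g where Ng: "negligible Nn" "\<And>k. continuous_on UNIV (g k)" "\<And>x. x \<notin> Nn \<Longrightarrow> (\<lambda>k. g k x) \<longlonglongrightarrow> \<phi> x"
    unfolding measurable_on_def by auto
  have gb: "g k \<in> borel_measurable borel" for k by (rule borel_measurable_continuous_onI[OF Ng(2)])
  have bound_fin: "(\<integral>\<^sup>+(x::'a). ennreal (R * indicator (cball 0 (R + 1)) x) \<partial>lborel) < \<infinity>"
  proof -
    have "(\<integral>\<^sup>+(x::'a). ennreal (R * indicator (cball 0 (R + 1)) x) \<partial>lborel) = (\<integral>\<^sup>+(x::'a). ennreal R * indicator (cball 0 (R + 1)) x \<partial>lborel)"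
      by (intro nn_integral_cong) (simp add: indicator_def)
    also have "\<dots> = ennreal R * emeasure lborel (cball (0::'a) (R + 1))" by (rule nn_integral_cmult_indicator) simp
    also have "\<dots> < \<infinity>" using emeasure_lborel_cball_finite[of "0::'a" "R + 1"] by (simp add: ennreal_mult_less_top)
    finally show ?thesis .
  qed
  have "(\<lambda>k. \<integral>\<^sup>+x. ennreal (norm (clamp_cut R x (\<phi> x) - clamp_cut R x (g k x))) \<partial>lebesgue) \<longlonglongrightarrow> 0"
  proof (rule nn_integral_dominated_convergence_norm[where w="\<lambda>x. R * indicator (cball 0 (R + 1)) x"])
    show "(\<lambda>x. clamp_cut R x (g i x)) \<in> borel_measurable lebesgue" for i
      using cc_meas[OF gb] by (intro measurable_completion) simp
    show "(\<lambda>x. clamp_cut R x (\<phi> x)) \<in> borel_measurable lebesgue"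
      using cc_meas[OF \<phi>] by (intro measurable_completion) simp
    show "(\<lambda>x. R * indicator (cball 0 (R + 1)) x) \<in> borel_measurable (lebesgue :: 'a measure)"
      by (intro measurable_completion borel_measurable_times borel_measurable_const borel_measurable_indicator) simp
    show "AE x in lebesgue. norm (clamp_cut R x (g j x)) \<le> R * indicator (cball 0 (R + 1)) x" for j
      by (rule AE_I2) (simp only: real_norm_def clamp_cut_bound(3)[OF R])
    show "(\<integral>\<^sup>+(x::'a). ennreal (R * indicator (cball 0 (R + 1)) x) \<partial>lebesgue) < \<infinity>"
      unfolding nn_integral_completion by (rule bound_fin)
    have "AE x in lebesgue. x \<notin> Nn" using Ng(1) by (intro AE_not_in) (simp add: negligible_iff_null_sets)
    then show "AE x in lebesgue. (\<lambda>i. clamp_cut R x (g i x)) \<longlonglongrightarrow> clamp_cut R x (\<phi> x)"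
    proof eventually_elim
      case (elim x)
      show ?case unfolding clamp_cut_def using Ng(3)[OF elim] by (intro tendsto_intros)
    qed
  qed
  then have "\<forall>\<^sub>F k in sequentially. (\<integral>\<^sup>+x. ennreal (norm (clamp_cut R x (\<phi> x) - clamp_cut R x (g k x))) \<partial>lebesgue) < ennreal (e / 2)"
    by (rule order_tendstoD(2)) (use e in simp)
  then obtain k where k: "mass (\<lambda>x. clamp_cut R x (\<phi> x) - clamp_cut R x (g k x)) < ennreal (e / 2)"
    by (auto simp: eventually_sequentially nn_integral_completion)
  define \<theta> where "\<theta> x = clamp_cut R x (g k x)" for x
  note [measurable] = cc_meas[OF gb] cc_meas[OF \<phi>]
  show thesis
  proof (rule that[of \<theta> R])
    show "continuous_on UNIV \<theta>" unfolding \<theta>_def clamp_cut_def by (intro continuous_intros Ng(2))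
    show "0 \<le> R" by (rule R)
    show "\<bar>\<theta> x\<bar> \<le> R" for x unfolding \<theta>_def by (rule clamp_cut_bound(1)[OF R])
    have "mass \<theta> \<le> (\<integral>\<^sup>+(x::'a). ennreal (R * indicator (cball 0 (R + 1)) x) \<partial>lborel)"
      unfolding \<theta>_def by (intro nn_integral_mono ennreal_leI clamp_cut_bound(3)[OF R])
    then show "mass \<theta> < \<infinity>" using bound_fin by (rule le_less_trans)
    have "mass (\<lambda>x. \<phi> x - \<theta> x) \<le> (\<integral>\<^sup>+x. ennreal \<bar>\<phi> x - clamp_cut R x (\<phi> x)\<bar> + ennreal \<bar>clamp_cut R x (\<phi> x) - clamp_cut R x (g k x)\<bar> \<partial>lborel)"
      unfolding \<theta>_def by (intro nn_integral_mono) (simp flip: ennreal_plus add: ennreal_leI)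
    also have "\<dots> = mass (\<lambda>x. \<phi> x - clamp_cut R x (\<phi> x)) + mass (\<lambda>x. clamp_cut R x (\<phi> x) - clamp_cut R x (g k x))"
      by (rule nn_integral_add) measurable
    also have "\<dots> \<le> ennreal (e / 2) + ennreal (e / 2)" using n k unfolding R_def real_norm_def by (intro add_mono) auto
    also have "\<dots> = ennreal e" using e by (simp flip: ennreal_plus)
    finally show "mass (\<lambda>x. \<phi> x - \<theta> x) \<le> ennreal e" .
  qed
qed

context heat_kernel
begin

lemma P_integrable: "0 < t \<Longrightarrow> integrable lborel (P t)" "0 < t \<Longrightarrow> (LBINT x. P t x) = 1"
proof -
  assume t: "0 < t"
  show i: "integrable lborel (P t)" using P_abs_mass[OF t] by (intro integrableI_bounded) auto
  show "(LBINT x. P t x) = 1" using P_mass[OF t] P_nonneg[OF t] by (subst integral_eq_nn_integral) auto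
qed

text \<open>Within distance d the oscillation of \<theta> is below e/2; beyond it the oscillation is
  at most 2 R and the mass of the kernel there tends to 0.\<close>

lemma conv_P_pointwise:
  assumes \<theta>: "continuous_on UNIV \<theta>" and R: "\<And>x. \<bar>\<theta> x\<bar> \<le> R"
  shows "((\<lambda>t. conv (P t) \<theta> x) \<longlongrightarrow> \<theta> x) (at_right 0)"
proof (rule tendstoI)
  have [measurable]: "\<theta> \<in> borel_measurable borel" by (rule borel_measurable_continuous_onI[OF \<theta>])
  have R0: "0 \<le> R" using R[of 0] by linarith
  fix e :: real assume e: "0 < e"
  have "isCont \<theta> x" using \<theta> by (simp add: continuous_on_eq_continuous_at)
  then obtain d where d: "0 < d" "\<And>y. dist y x < d \<Longrightarrow> dist (\<theta> y) (\<theta> x) < e / 2"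
    unfolding continuous_at_eps_delta using e by (metis half_gt_zero)
  have "((\<lambda>t. ennreal (2 * R) * (\<integral>\<^sup>+y. ennreal (P t y) * indicator {y. d \<le> norm y} y \<partial>lborel)) \<longlongrightarrow> ennreal (2 * R) * 0) (at_right 0)"
    by (intro ennreal_tendsto_cmult P_conc d) simp
  then have "\<forall>\<^sub>F t in at_right 0. ennreal (2 * R) * (\<integral>\<^sup>+y. ennreal (P t y) * indicator {y. d \<le> norm y} y \<partial>lborel) < ennreal (e / 2)"
    by (intro order_tendstoD(2)[of _ 0]) (use e in simp_all)
  moreover have "\<forall>\<^sub>F t :: real in at_right 0. 0 < t" by (rule eventually_at_right_less)
  ultimately show "\<forall>\<^sub>F t in at_right 0. dist (conv (P t) \<theta> x) (\<theta> x) < e"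
  proof eventually_elim
    case (elim t)
    have t: "0 < t" by fact
    have iP: "integrable lborel (\<lambda>y. P t (x - y))" using P_integrable(1)[OF t] integrable_lborel_reflect[of "P t" x] by simp
    have i\<theta>: "integrable lborel (\<lambda>y. P t (x - y) * \<theta> y)"
    proof (rule Bochner_Integration.integrable_bound)
      show "integrable lborel (\<lambda>y. P t (x - y) * R)" using iP by simp
      show "AE y in lborel. norm (P t (x - y) * \<theta> y) \<le> norm (P t (x - y) * R)"
        using R R0 by (intro AE_I2) (simp add: abs_mult mult_left_mono)
    qed measurable
    have "conv (P t) \<theta> x - \<theta> x = (LBINT y. P t (x - y) * (\<theta> y - \<theta> x))"
      unfolding conv_def right_diff_distrib using iP i\<theta> integral_lborel_reflect[of "P t" x] P_integrable(2)[OF t] by simp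
    then have "ennreal \<bar>conv (P t) \<theta> x - \<theta> x\<bar> \<le> mass (\<lambda>y. P t (x - y) * (\<theta> y - \<theta> x))"
      by (simp add: abs_integral_le_nn_integral)
    also have "\<dots> \<le> (\<integral>\<^sup>+y. ennreal (e / 2) * ennreal (P t (x - y)) + ennreal (2 * R) * (ennreal (P t (x - y)) * indicator {y. d \<le> norm y} (x - y)) \<partial>lborel)"
    proof (intro nn_integral_mono)
      fix y
      have P0: "0 \<le> P t (x - y)" by (rule P_nonneg[OF t])
      show "ennreal \<bar>P t (x - y) * (\<theta> y - \<theta> x)\<bar> \<le> ennreal (e / 2) * ennreal (P t (x - y)) + ennreal (2 * R) * (ennreal (P t (x - y)) * indicator {y. d \<le> norm y} (x - y))"
      proof (cases "norm (x - y) < d")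
        case True
        then have "\<bar>\<theta> y - \<theta> x\<bar> \<le> e / 2" using d(2)[of y] by (simp add: dist_norm norm_minus_commute)
        then have "\<bar>P t (x - y) * (\<theta> y - \<theta> x)\<bar> \<le> (e / 2) * P t (x - y)" using P0 mult_left_mono[of "\<bar>\<theta> y - \<theta> x\<bar>" "e / 2" "P t (x - y)"] by (simp add: abs_mult mult.commute)
        then show ?thesis using P0 e by (simp flip: ennreal_mult add: ennreal_leI add_increasing2)
      next
        case False
        have "\<bar>\<theta> y - \<theta> x\<bar> \<le> 2 * R" using R[of x] R[of y] by linarith
        then have "\<bar>P t (x - y) * (\<theta> y - \<theta> x)\<bar> \<le> (2 * R) * P t (x - y)"
          using P0 mult_left_mono[of "\<bar>\<theta> y - \<theta> x\<bar>" "2 * R" "P t (x - y)"] by (simp add: abs_mult mult.commute)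
        then have "ennreal \<bar>P t (x - y) * (\<theta> y - \<theta> x)\<bar> \<le> ennreal (2 * R) * ennreal (P t (x - y))"
          using P0 R0 by (simp flip: ennreal_mult add: ennreal_leI)
        then show ?thesis using False by (simp add: add_increasing)
      qed
    qed
    also have "\<dots> = (\<integral>\<^sup>+y. ennreal (e / 2) * ennreal (P t y) + ennreal (2 * R) * (ennreal (P t y) * indicator {y. d \<le> norm y} y) \<partial>lborel)"
      by (rule nn_integral_lborel_reflect[of "\<lambda>y. ennreal (e / 2) * ennreal (P t y) + ennreal (2 * R) * (ennreal (P t y) * indicator {y. d \<le> norm y} y)"]) measurable
    also have "\<dots> = (\<integral>\<^sup>+y. ennreal (e / 2) * ennreal (P t y) \<partial>lborel) + (\<integral>\<^sup>+y. ennreal (2 * R) * (ennreal (P t y) * indicator {y. d \<le> norm y} y) \<partial>lborel)"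
      by (rule nn_integral_add) measurable
    also have "(\<integral>\<^sup>+y. ennreal (e / 2) * ennreal (P t y) \<partial>lborel) = ennreal (e / 2)"
      using P_mass[OF t] by (simp add: nn_integral_cmult)
    also have "(\<integral>\<^sup>+y. ennreal (2 * R) * (ennreal (P t y) * indicator {y. d \<le> norm y} y) \<partial>lborel)
       = ennreal (2 * R) * (\<integral>\<^sup>+y. ennreal (P t y) * indicator {y. d \<le> norm y} y \<partial>lborel)"
      by (rule nn_integral_cmult) measurable
    also have "ennreal (e / 2) + ennreal (2 * R) * (\<integral>\<^sup>+y. ennreal (P t y) * indicator {y. d \<le> norm y} y \<partial>lborel) < ennreal (e / 2) + ennreal (e / 2)"
      using elim(1) by (simp add: ennreal_add_left_cancel_less)
    also have "\<dots> = ennreal e" using e by (simp flip: ennreal_plus)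
    finally show ?case using e by (simp add: dist_real_def ennreal_less_iff)
  qed
qed

lemma conv_P_L1_le:
  assumes t: "0 < t" and [measurable]: "\<phi> \<in> borel_measurable borel"
  shows "mass (conv (P t) \<phi>) \<le> mass \<phi>"
proof -
  have "mass (conv (P t) \<phi>) \<le> (\<integral>\<^sup>+x. nconv (P t) \<phi> x \<partial>lborel)"
    by (intro nn_integral_mono conv_le_nconv)
  then show ?thesis by (simp add: nconv_P_L1[OF t])
qed

text \<open>Convolution with the kernel does not increase the L^1 norm, so Scheffe's lemma upgrades
  the pointwise convergence.\<close>

lemma conv_P_L1_continuous_function:
  assumes \<theta>: "continuous_on UNIV \<theta>" and R: "\<And>x. \<bar>\<theta> x\<bar> \<le> R" and fin: "mass \<theta> < \<infinity>"
  shows "((\<lambda>t. \<integral>\<^sup>+x. ennreal \<bar>conv (P t) \<theta> x - \<theta> x\<bar> \<partial>lborel) \<longlongrightarrow> 0) (at_right 0)"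
  unfolding tendsto_at_iff_sequentially
proof (intro allI impI, unfold o_def)
  fix T :: "nat \<Rightarrow> real" assume T: "\<forall>i. T i \<in> {0<..} - {0}" "T \<longlonglongrightarrow> 0"
  then have T0: "0 < T n" for n by auto
  have [measurable]: "\<theta> \<in> borel_measurable borel" by (rule borel_measurable_continuous_onI[OF \<theta>])
  have TF: "filterlim T (at_right 0) sequentially" using T(2) T0 by (intro tendsto_imp_filterlim_at_right) auto
  have "(\<lambda>n. \<integral>\<^sup>+x. ennreal (norm (conv (P (T n)) \<theta> x - \<theta> x)) \<partial>lborel) \<longlonglongrightarrow> 0"
  proof (rule Scheffe_lemma2)
    show "integrable lborel \<theta>" using fin by (intro integrableI_bounded) auto
    show "AE x in lborel. (\<lambda>n. conv (P (T n)) \<theta> x) \<longlonglongrightarrow> \<theta> x"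
      by (intro AE_I2 filterlim_compose[OF conv_P_pointwise[OF \<theta> R] TF])
    show "(\<integral>\<^sup>+x. ennreal (norm (conv (P (T n)) \<theta> x)) \<partial>lborel) \<le> (\<integral>\<^sup>+x. ennreal (norm (\<theta> x)) \<partial>lborel)" for n
      using conv_P_L1_le[OF T0, of \<theta> n] by simp
  qed measurable
  then show "(\<lambda>n. \<integral>\<^sup>+x. ennreal \<bar>conv (P (T n)) \<theta> x - \<theta> x\<bar> \<partial>lborel) \<longlonglongrightarrow> 0" by simp
qed

lemma conv_P_L1_tendsto:
  assumes \<phi>[measurable]: "\<phi> \<in> borel_measurable borel" and fin: "mass \<phi> < \<infinity>" and e: "0 < e"
  shows "\<forall>\<^sub>F t in at_right 0. mass (\<lambda>x. conv (P t) \<phi> x - \<phi> x) \<le> ennreal e"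
proof -
  have e3: "0 < e / 3" using e by simp
  obtain \<theta> R where \<theta>: "continuous_on UNIV \<theta>" "\<And>x. \<bar>\<theta> x\<bar> \<le> R" "mass \<theta> < \<infinity>"
    and ap: "mass (\<lambda>x. \<phi> x - \<theta> x) \<le> ennreal (e / 3)"
    using continuous_L1_approximation[OF \<phi> fin e3] by metis
  have [measurable]: "\<theta> \<in> borel_measurable borel" by (rule borel_measurable_continuous_onI[OF \<theta>(1)])
  have "\<forall>\<^sub>F t in at_right 0. mass (\<lambda>x. conv (P t) \<theta> x - \<theta> x) < ennreal (e / 3)"
    by (rule order_tendstoD(2)[OF conv_P_L1_continuous_function[OF \<theta>]]) (use e in simp)
  moreover have "\<forall>\<^sub>F t :: real in at_right 0. 0 < t" by (rule eventually_at_right_less)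
  ultimately show ?thesis
  proof eventually_elim
    case (elim t)
    have t: "0 < t" by fact
    have nf: "nconv (P t) w x < \<infinity>" if [measurable]: "w \<in> borel_measurable borel" and w: "mass w < \<infinity>" for w x
    proof -
      obtain b where b: "0 \<le> b" "mass w = ennreal b"
        using w by (cases "\<integral>\<^sup>+x. ennreal \<bar>w x\<bar> \<partial>lborel") auto
      show ?thesis
        by (rule le_less_trans[OF nconv_P_sup_bound[OF t that(1) eq_refl[OF b(2)] b(1)]]) simp
    qed
    have lin: "conv (P t) \<phi> x = conv (P t) (\<lambda>z. \<phi> z - \<theta> z) x + conv (P t) \<theta> x" for x
      using conv_diff_function[of "P t" \<phi> x \<theta>] nf[OF _ fin] nf[OF _ \<theta>(3)] by simp
    have "mass (\<lambda>x. conv (P t) \<phi> x - \<phi> x) \<le> (\<integral>\<^sup>+x. ennreal \<bar>conv (P t) (\<lambda>z. \<phi> z - \<theta> z) x\<bar> + (ennreal \<bar>conv (P t) \<theta> x - \<theta> x\<bar> + ennreal \<bar>\<phi> x - \<theta> x\<bar>) \<partial>lborel)"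
    proof (intro nn_integral_mono)
      fix x
      have "\<bar>conv (P t) \<phi> x - \<phi> x\<bar> \<le> \<bar>conv (P t) (\<lambda>z. \<phi> z - \<theta> z) x\<bar> + (\<bar>conv (P t) \<theta> x - \<theta> x\<bar> + \<bar>\<phi> x - \<theta> x\<bar>)"
        unfolding lin[of x] by linarith
      then show "ennreal \<bar>conv (P t) \<phi> x - \<phi> x\<bar> \<le> ennreal \<bar>conv (P t) (\<lambda>z. \<phi> z - \<theta> z) x\<bar> + (ennreal \<bar>conv (P t) \<theta> x - \<theta> x\<bar> + ennreal \<bar>\<phi> x - \<theta> x\<bar>)"
        by (simp flip: ennreal_plus add: ennreal_leI)
    qed
    also have "\<dots> = mass (\<lambda>x. conv (P t) (\<lambda>z. \<phi> z - \<theta> z) x) + (\<integral>\<^sup>+x. ennreal \<bar>conv (P t) \<theta> x - \<theta> x\<bar> + ennreal \<bar>\<phi> x - \<theta> x\<bar> \<partial>lborel)"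
      by (rule nn_integral_add) measurable
    also have "(\<integral>\<^sup>+x. ennreal \<bar>conv (P t) \<theta> x - \<theta> x\<bar> + ennreal \<bar>\<phi> x - \<theta> x\<bar> \<partial>lborel) = mass (\<lambda>x. conv (P t) \<theta> x - \<theta> x) + mass (\<lambda>x. \<phi> x - \<theta> x)"
      by (rule nn_integral_add) measurable
    also have "mass (\<lambda>x. conv (P t) (\<lambda>z. \<phi> z - \<theta> z) x) + (mass (\<lambda>x. conv (P t) \<theta> x - \<theta> x) + mass (\<lambda>x. \<phi> x - \<theta> x))
      \<le> ennreal (e / 3) + (ennreal (e / 3) + ennreal (e / 3))"
      using elim(1) ap by (intro add_mono order_trans[OF conv_P_L1_le[OF t]]) auto
    also have "\<dots> = ennreal e" using e by (simp flip: ennreal_plus)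
    finally show ?case .
  qed
qed

text \<open>Symmetry of the kernel moves the semigroup from the datum, for which convergence in exp
  L^p may fail, to the test function, where it converges in L^1.\<close>

lemma conv_P_dual:
  assumes t: "0 < t" and [measurable]: "v \<in> borel_measurable borel" "\<phi> \<in> borel_measurable borel"
    and fin: "(\<integral>\<^sup>+y. ennreal \<bar>v y\<bar> * nconv (P t) \<phi> y \<partial>lborel) < \<infinity>" and iv: "integrable lborel (\<lambda>x. v x * \<phi> x)"
  shows "(LBINT x. (conv (P t) v x - v x) * \<phi> x) = (LBINT y. v y * (conv (P t) \<phi> y - \<phi> y))"
    and "integrable lborel (\<lambda>x. (conv (P t) v x - v x) * \<phi> x)"
proof -
  have Pm: "P t (x - y) = P t (y - x)" for x y using P_minus[of t "y - x"] by simp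
  have int: "integrable (lborel \<Otimes>\<^sub>M lborel) (\<lambda>(x, y). P t (x - y) * v y * \<phi> x)"
  proof (rule integrableI_bounded)
    have "(\<integral>\<^sup>+z. ennreal (norm (case z of (x, y) \<Rightarrow> P t (x - y) * v y * \<phi> x)) \<partial>(lborel \<Otimes>\<^sub>M lborel))
      = (\<integral>\<^sup>+y. mass (\<lambda>x. P t (x - y) * v y * \<phi> x) \<partial>lborel)"
      by (subst lborel_pair.nn_integral_snd[symmetric]) auto
    also have "\<dots> = (\<integral>\<^sup>+y. ennreal \<bar>v y\<bar> * nconv (P t) \<phi> y \<partial>lborel)"
      unfolding nconv_def Pm by (subst nn_integral_cmult[symmetric]) (simp_all add: abs_mult mult_ac flip: ennreal_mult, measurable)
    finally show "(\<integral>\<^sup>+z. ennreal (norm (case z of (x, y) \<Rightarrow> P t (x - y) * v y * \<phi> x)) \<partial>(lborel \<Otimes>\<^sub>M lborel)) < \<infinity>"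
      using fin by simp
  qed measurable
  have i1: "integrable lborel (\<lambda>x. conv (P t) v x * \<phi> x)"
    using lborel_pair.integrable_fst[OF int] unfolding conv_def by simp
  have sw: "(LBINT x. P t (x - y) * v y * \<phi> x) = v y * conv (P t) \<phi> y" for y
    unfolding conv_def integral_mult_right_zero[symmetric] Pm[of _ y] by (simp add: mult_ac)
  have i2: "integrable lborel (\<lambda>y. v y * conv (P t) \<phi> y)"
    using lborel_pair.integrable_snd[OF int] by (simp add: sw)
  have "(LBINT x. conv (P t) v x * \<phi> x) = (LBINT x. LBINT y. P t (x - y) * v y * \<phi> x)" unfolding conv_def by simp
  also have "\<dots> = (LBINT y. v y * conv (P t) \<phi> y)"
    using lborel_pair.Fubini_integral[OF int] by (simp add: sw)
  finally have "(LBINT x. conv (P t) v x * \<phi> x) = (LBINT y. v y * conv (P t) \<phi> y)" .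
  then show "(LBINT x. (conv (P t) v x - v x) * \<phi> x) = (LBINT y. v y * (conv (P t) \<phi> y - \<phi> y))"
    using i1 i2 iv by (simp add: left_diff_distrib right_diff_distrib)
  show "integrable lborel (\<lambda>x. (conv (P t) v x - v x) * \<phi> x)"
    unfolding left_diff_distrib by (intro Bochner_Integration.integrable_diff i1 iv)
qed

end

text \<open>Either z is comparable to the logarithmic factor of w, which gives the second term, or w
  \<le> exp(z^p / 2), and then the exponential in the first term beats the product. The coefficient
  \<eta> is arbitrarily small, so the pairing is small once the logarithmic integral of w
  is.\<close>

lemma young_times_log_bound:
  fixes p \<eta> :: real
  assumes p: "1 \<le> p" and \<eta>: "0 < \<eta>"
  obtains c where "0 \<le> c" "\<And>z w. 0 \<le> z \<Longrightarrow> 0 \<le> w \<Longrightarrow> z * w \<le> \<eta> * young p z + c * (w * ln (2 + w) powr (1 / p))"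
proof -
  \<comment> \<open>z > Z forces y = z^p \<ge> 16/\<eta>, so an extra factor \<eta> y / 16 \<ge> 1
    may be inserted; y^2/8 \<le> exp(y/2) then absorbs both powers of y.\<close>
  define Z where "Z = max 1 (16 / \<eta>)"
  define c where "c = (2 * (1 + Z powr p)) powr (1 / p)"
  have Z: "1 \<le> Z" "16 / \<eta> \<le> Z" unfolding Z_def by auto
  have "z * w \<le> \<eta> * young p z + c * (w * ln (2 + w) powr (1 / p))" if z: "0 \<le> z" and w: "0 \<le> w" for z w
  proof (cases "z powr p \<le> 2 * ln (2 + w) + Z powr p")
    case True
    have "2 / 3 \<le> ln (2 + w)" using ln2_ge_two_thirds ln_mono[of 2 "2 + w"] w by linarith
    then have l: "1 \<le> 2 * ln (2 + w)" by linarith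
    have "1 * Z powr p \<le> (2 * ln (2 + w)) * Z powr p" using l by (intro mult_right_mono) auto
    then have le: "z powr p \<le> (2 * (1 + Z powr p)) * ln (2 + w)" using True by (simp add: algebra_simps)
    have "z = (z powr p) powr (1 / p)" using p z by (simp add: powr_powr)
    also have "\<dots> \<le> ((2 * (1 + Z powr p)) * ln (2 + w)) powr (1 / p)" using le p by (intro powr_mono2) auto
    also have "\<dots> = c * ln (2 + w) powr (1 / p)" unfolding c_def using l by (subst powr_mult) (auto simp: add_nonneg_nonneg)
    finally have "z * w \<le> c * ln (2 + w) powr (1 / p) * w" using w by (intro mult_right_mono)
    then show ?thesis using \<eta> young_nonneg[of p z] by (simp add: mult_ac add_increasing)
  next
    case False
    define y where "y = z powr p"
    have l0: "0 \<le> ln (2 + w)" using w by simp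
    have ly: "2 * ln (2 + w) \<le> y" using False powr_ge_zero[of Z p] unfolding y_def by linarith
    have "Z < z"
    proof (rule ccontr)
      assume "\<not> Z < z"
      then have "z powr p \<le> Z powr p" using z p by (intro powr_mono2) auto
      then show False using False l0 by linarith
    qed
    then have z1: "1 \<le> z" using Z by simp
    then have zy: "z \<le> y" unfolding y_def using p powr_mono[of 1 p z] by simp
    have yZ: "16 / \<eta> \<le> y" "1 \<le> y" using zy \<open>Z < z\<close> Z by auto
    have "2 + w = exp (ln (2 + w))" using w by simp
    also have "\<dots> \<le> exp (y / 2)" using ly by simp
    finally have we: "w \<le> exp (y / 2)" by simp
    have q: "y\<^sup>2 / 8 \<le> exp (y / 2)" using exp_lower_Taylor_quadratic[of "y / 2"] yZ(2) by (simp add: power2_eq_square)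
    have "z * w \<le> y * exp (y / 2)" using zy we w z1 by (intro mult_mono) auto
    also have "\<dots> \<le> (\<eta> * y / 16) * (y * exp (y / 2))"
    proof -
      have "1 \<le> \<eta> * y / 16" using yZ(1) \<eta> by (simp add: field_simps)
      then have "1 * (y * exp (y / 2)) \<le> (\<eta> * y / 16) * (y * exp (y / 2))" using yZ(2) by (intro mult_right_mono) auto
      then show ?thesis by simp
    qed
    also have "\<dots> = \<eta> / 2 * (y\<^sup>2 / 8 * exp (y / 2))" by (simp add: power2_eq_square)
    also have "\<dots> \<le> \<eta> / 2 * (exp (y / 2) * exp (y / 2))" using q \<eta> by (intro mult_left_mono mult_right_mono) auto
    also have "\<dots> = \<eta> * (exp y / 2)" by (simp flip: exp_add)
    also have "\<dots> \<le> \<eta> * young p z"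
    proof -
      have "exp y / 2 \<le> young p z" using exp_ge_add_one_self[of y] yZ(2) unfolding young_def y_def[symmetric] by linarith
      then show ?thesis using \<eta> by simp
    qed
    finally show ?thesis using w unfolding c_def by (simp add: add_increasing2)
  qed
  then show thesis by (intro that[of c]) (auto simp: c_def)
qed

lemma nn_integral_young_pairing:
  fixes g \<phi> :: "'a::euclidean_space \<Rightarrow> real"
  assumes p: "1 \<le> p" and \<eta>: "0 < \<eta>" and [measurable]: "g \<in> borel_measurable borel" "\<phi> \<in> borel_measurable borel"
    and \<mu>: "0 < \<mu>" and mo: "modular p \<mu> g \<le> 1" and c: "0 \<le> c"
    and Y: "\<And>z w. 0 \<le> z \<Longrightarrow> 0 \<le> w \<Longrightarrow> z * w \<le> \<eta> * young p z + c * (w * ln (2 + w) powr (1 / p))"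
  shows "mass (\<lambda>x. g x * \<phi> x) \<le> ennreal (\<mu> * \<eta>) + ennreal (\<mu> * c) * (\<integral>\<^sup>+x. ennreal (\<bar>\<phi> x\<bar> * ln (2 + \<bar>\<phi> x\<bar>) powr (1 / p)) \<partial>lborel)"
proof -
  have "mass (\<lambda>x. g x * \<phi> x) \<le> (\<integral>\<^sup>+x. ennreal (\<mu> * \<eta>) * ennreal (young p (\<bar>g x\<bar> / \<mu>)) + ennreal (\<mu> * c) * ennreal (\<bar>\<phi> x\<bar> * ln (2 + \<bar>\<phi> x\<bar>) powr (1 / p)) \<partial>lborel)"
  proof (intro nn_integral_mono)
    fix x
    have "\<bar>g x * \<phi> x\<bar> = \<mu> * (\<bar>g x\<bar> / \<mu> * \<bar>\<phi> x\<bar>)" using \<mu> by (simp add: abs_mult)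
    also have "\<dots> \<le> \<mu> * (\<eta> * young p (\<bar>g x\<bar> / \<mu>) + c * (\<bar>\<phi> x\<bar> * ln (2 + \<bar>\<phi> x\<bar>) powr (1 / p)))"
      using \<mu> by (intro mult_left_mono Y) auto
    finally have "\<bar>g x * \<phi> x\<bar> \<le> (\<mu> * \<eta>) * young p (\<bar>g x\<bar> / \<mu>) + (\<mu> * c) * (\<bar>\<phi> x\<bar> * ln (2 + \<bar>\<phi> x\<bar>) powr (1 / p))"
      by (simp add: distrib_left mult.assoc)
    then show "ennreal \<bar>g x * \<phi> x\<bar> \<le> ennreal (\<mu> * \<eta>) * ennreal (young p (\<bar>g x\<bar> / \<mu>)) + ennreal (\<mu> * c) * ennreal (\<bar>\<phi> x\<bar> * ln (2 + \<bar>\<phi> x\<bar>) powr (1 / p))"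
      using \<mu> \<eta> c young_nonneg[of p "\<bar>g x\<bar> / \<mu>"] by (simp flip: ennreal_mult ennreal_plus add: ennreal_leI)
  qed
  also have "\<dots> = (\<integral>\<^sup>+x. ennreal (\<mu> * \<eta>) * ennreal (young p (\<bar>g x\<bar> / \<mu>)) \<partial>lborel) + (\<integral>\<^sup>+x. ennreal (\<mu> * c) * ennreal (\<bar>\<phi> x\<bar> * ln (2 + \<bar>\<phi> x\<bar>) powr (1 / p)) \<partial>lborel)"
    by (rule nn_integral_add) measurable
  also have "(\<integral>\<^sup>+x. ennreal (\<mu> * \<eta>) * ennreal (young p (\<bar>g x\<bar> / \<mu>)) \<partial>lborel) = ennreal (\<mu> * \<eta>) * modular p \<mu> g"
    unfolding modular_def by (rule nn_integral_cmult) measurable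
  also have "(\<integral>\<^sup>+x. ennreal (\<mu> * c) * ennreal (\<bar>\<phi> x\<bar> * ln (2 + \<bar>\<phi> x\<bar>) powr (1 / p)) \<partial>lborel)
     = ennreal (\<mu> * c) * (\<integral>\<^sup>+x. ennreal (\<bar>\<phi> x\<bar> * ln (2 + \<bar>\<phi> x\<bar>) powr (1 / p)) \<partial>lborel)"
    by (rule nn_integral_cmult) measurable
  also have "ennreal (\<mu> * \<eta>) * modular p \<mu> g \<le> ennreal (\<mu> * \<eta>) * 1" by (intro mult_left_mono mo) simp
  finally show ?thesis by (simp add: add_right_mono)
qed

text \<open>Splits an unbounded factor at height \<open>M\<close>; since \<open>p > 1\<close> the second term is small for large \<open>M\<close>.\<close>

lemma nn_integral_bounded_pairing:
  fixes v :: "'a::euclidean_space \<Rightarrow> real" and g :: "'a \<Rightarrow> ennreal"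
  assumes p: "1 \<le> p" and \<mu>: "0 < \<mu>" and M: "0 < M" and L: "0 \<le> L" and [measurable]: "v \<in> borel_measurable borel" "g \<in> borel_measurable borel"
    and mo: "modular p \<mu> v \<le> 1" and g: "\<And>x. g x \<le> ennreal L"
  shows "(\<integral>\<^sup>+x. ennreal \<bar>v x\<bar> * g x \<partial>lborel) \<le> ennreal M * (\<integral>\<^sup>+x. g x \<partial>lborel) + ennreal (\<mu> powr p * L / M powr (p - 1))"
proof -
  let ?c = "\<mu> powr p * L / M powr (p - 1)"
  have "(\<integral>\<^sup>+x. ennreal \<bar>v x\<bar> * g x \<partial>lborel) \<le> (\<integral>\<^sup>+x. ennreal M * g x + ennreal ?c * ennreal (young p (\<bar>v x\<bar> / \<mu>)) \<partial>lborel)"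
  proof (intro nn_integral_mono)
    fix x
    have "\<bar>v x\<bar> powr p = \<mu> powr p * (\<bar>v x\<bar> / \<mu>) powr p" using \<mu> by (simp add: powr_divide)
    also have "\<dots> \<le> \<mu> powr p * young p (\<bar>v x\<bar> / \<mu>)" by (intro mult_left_mono powr_le_young) simp
    finally have "\<bar>v x\<bar> powr p / M powr (p - 1) \<le> \<mu> powr p * young p (\<bar>v x\<bar> / \<mu>) / M powr (p - 1)"
      by (intro divide_right_mono) auto
    then have "\<bar>v x\<bar> \<le> M + \<mu> powr p * young p (\<bar>v x\<bar> / \<mu>) / M powr (p - 1)"
      using le_add_powr_div[of M "\<bar>v x\<bar>" p] M p by simp
    then have "ennreal \<bar>v x\<bar> * g x \<le> ennreal (M + \<mu> powr p * young p (\<bar>v x\<bar> / \<mu>) / M powr (p - 1)) * g x"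
      by (intro mult_right_mono ennreal_leI) auto
    also have "\<dots> = ennreal M * g x + ennreal (\<mu> powr p * young p (\<bar>v x\<bar> / \<mu>) / M powr (p - 1)) * g x"
      using M young_nonneg[of p "\<bar>v x\<bar> / \<mu>"] by (simp add: distrib_right ennreal_plus)
    also have "\<dots> \<le> ennreal M * g x + ennreal (\<mu> powr p * young p (\<bar>v x\<bar> / \<mu>) / M powr (p - 1)) * ennreal L"
      by (intro add_left_mono mult_left_mono g) simp
    also have "\<dots> = ennreal M * g x + ennreal ?c * ennreal (young p (\<bar>v x\<bar> / \<mu>))"
      using L young_nonneg[of p "\<bar>v x\<bar> / \<mu>"] by (simp flip: ennreal_mult add: mult_ac)
    finally show "ennreal \<bar>v x\<bar> * g x \<le> ennreal M * g x + ennreal ?c * ennreal (young p (\<bar>v x\<bar> / \<mu>))" .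
  qed
  also have "\<dots> = (\<integral>\<^sup>+x. ennreal M * g x \<partial>lborel) + (\<integral>\<^sup>+x. ennreal ?c * ennreal (young p (\<bar>v x\<bar> / \<mu>)) \<partial>lborel)"
    by (rule nn_integral_add) measurable
  also have "(\<integral>\<^sup>+x. ennreal M * g x \<partial>lborel) = ennreal M * (\<integral>\<^sup>+x. g x \<partial>lborel)" by (rule nn_integral_cmult) measurable
  also have "(\<integral>\<^sup>+x. ennreal ?c * ennreal (young p (\<bar>v x\<bar> / \<mu>)) \<partial>lborel) = ennreal ?c * modular p \<mu> v"
    unfolding modular_def by (rule nn_integral_cmult) measurable
  also have "ennreal ?c * modular p \<mu> v \<le> ennreal ?c * 1" by (intro mult_left_mono mo) simp
  finally show ?thesis by (simp add: add_left_mono)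
qed

context mild_solution
begin

lemma D_sup: "0 < t \<Longrightarrow> \<bar>D t x\<bar> \<le> (1 + K) * B * (t + 2 * sqrt t)"
proof -
  assume t: "0 < t"
  have n: "0 \<le> (1 + K) * B * (t + 2 * sqrt t)" using K B t by simp
  have "ennreal \<bar>D t x\<bar> \<le> ennreal ((1 + K) * B * (t + 2 * sqrt t))"
    using order_trans[OF duh_le_nduh nduh_source_local[OF so B less_imp_le[OF t]]] by (simp add: fp[OF t])
  then show ?thesis using n by simp
qed

lemma D_L1: "0 < t \<Longrightarrow> mass (D t) \<le> ennreal (B / \<beta> * t powr \<beta>)"
proof -
  assume t: "0 < t"
  have "mass (D t) \<le> (\<integral>\<^sup>+x. nduh h t x \<partial>lborel)"
    by (intro nn_integral_mono) (simp add: fp[OF t] duh_le_nduh)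
  also have "\<dots> \<le> ennreal (B / \<beta> * t powr \<beta>)" by (rule nduh_source_L1[OF so B less_imp_le[OF t]])
  finally show ?thesis .
qed

text \<open>The large values of \<phi> have a small logarithmic integral and are paired with S(t) u0
  and u0 separately, uniformly in t. The bounded remainder is treated by duality and L^1
  convergence. The correction is paired with all of \<phi>, because it tends to 0 uniformly.\<close>

lemma weak_star_convergence:
  assumes \<phi>[measurable]: "\<phi> \<in> borel_measurable borel"
    and fin: "(\<integral>\<^sup>+x. ennreal (\<bar>\<phi> x\<bar> * ln (2 + \<bar>\<phi> x\<bar>) powr (1 / p)) \<partial>lborel) < \<infinity>"
  shows "((\<lambda>t. LBINT x. (u t x - u0 x) * \<phi> x) \<longlongrightarrow> 0) (at_right 0)"
proof (rule tendstoI)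
  fix \<epsilon> :: real assume \<epsilon>: "0 < \<epsilon>"
  \<comment> \<open>Four pairings contribute at most 2q, 2q, 2q and q, so their sum 7q stays below
    \<epsilon>.\<close>
  define q where "q = \<epsilon> / 10"
  have q: "0 < q" unfolding q_def using \<epsilon> by simp
  define w where "w z = z * ln (2 + z) powr (1 / p)" for z :: real
  have qe: "0 < q / e" using q e by simp
  obtain c where c: "0 \<le> c" and Y: "\<And>z a. 0 \<le> z \<Longrightarrow> 0 \<le> a \<Longrightarrow> z * a \<le> q / e * young p z + c * (a * ln (2 + a) powr (1 / p))"
    by (rule young_times_log_bound[OF p_ge1 qe]) blast
  \<comment> \<open>Makes e c \<delta> at most q; the added 1 covers the case c = 0.\<close>
  define \<delta> where "\<delta> = q / (e * (c + 1))"
  have \<delta>: "0 < \<delta>" unfolding \<delta>_def using q e c by simp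
  have ec\<delta>: "e * c * \<delta> \<le> q"
  proof -
    have "\<delta> * (e * (c + 1)) = q" unfolding \<delta>_def using e c by simp
    then have "e * c * \<delta> = q - e * \<delta>" by (simp add: algebra_simps)
    then show ?thesis using e \<delta> by simp
  qed
  have [measurable]: "w \<in> borel_measurable borel" unfolding w_def[abs_def] by measurable
  have "\<forall>\<^sub>F n in sequentially. (\<integral>\<^sup>+x. (if real n < \<bar>\<phi> x\<bar> then ennreal (w \<bar>\<phi> x\<bar>) else 0) \<partial>lborel) < ennreal \<delta>"
    by (rule order_tendstoD(2)[OF nn_integral_tail_tendsto]) (use fin \<delta> in \<open>simp_all add: w_def\<close>)
  then obtain n where n: "(\<integral>\<^sup>+x. (if real n < \<bar>\<phi> x\<bar> then ennreal (w \<bar>\<phi> x\<bar>) else 0) \<partial>lborel) < ennreal \<delta>"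
    by (auto simp: eventually_sequentially)
  define L where "L = real n"
  have L0: "0 \<le> L" unfolding L_def by simp
  define \<psi> where "\<psi> x = (if L < \<bar>\<phi> x\<bar> then \<phi> x else 0)" for x
  define \<theta> where "\<theta> x = (if L < \<bar>\<phi> x\<bar> then 0 else \<phi> x)" for x
  have [measurable]: "\<psi> \<in> borel_measurable borel" "\<theta> \<in> borel_measurable borel" unfolding \<psi>_def[abs_def] \<theta>_def[abs_def] by measurable
  have split: "\<phi> x = \<psi> x + \<theta> x" and \<theta>L: "\<bar>\<theta> x\<bar> \<le> L" and \<theta>\<phi>: "\<bar>\<theta> x\<bar> \<le> \<bar>\<phi> x\<bar>" for x using L0 unfolding \<psi>_def \<theta>_def by auto
  have \<psi>w: "(\<integral>\<^sup>+x. ennreal (\<bar>\<psi> x\<bar> * ln (2 + \<bar>\<psi> x\<bar>) powr (1 / p)) \<partial>lborel) \<le> ennreal \<delta>"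
  proof -
    have "(\<integral>\<^sup>+x. ennreal (\<bar>\<psi> x\<bar> * ln (2 + \<bar>\<psi> x\<bar>) powr (1 / p)) \<partial>lborel) = (\<integral>\<^sup>+x. (if real n < \<bar>\<phi> x\<bar> then ennreal (w \<bar>\<phi> x\<bar>) else 0) \<partial>lborel)"
      by (intro nn_integral_cong) (simp add: \<psi>_def w_def L_def)
    then show ?thesis using n by simp
  qed
  have \<phi>1: "mass \<phi> < \<infinity>"
  proof -
    have "mass \<phi> \<le> (\<integral>\<^sup>+x. ennreal 2 * ennreal (\<bar>\<phi> x\<bar> * ln (2 + \<bar>\<phi> x\<bar>) powr (1 / p)) \<partial>lborel)"
    proof (intro nn_integral_mono)
      fix x
      have l: "2 / 3 \<le> ln (2 + \<bar>\<phi> x\<bar>)" using ln2_ge_two_thirds ln_mono[of 2 "2 + \<bar>\<phi> x\<bar>"] by linarith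
      have "(2 / 3 :: real) powr 1 \<le> (2 / 3) powr (1 / p)" using p1 by (intro powr_mono') auto
      also have "\<dots> \<le> ln (2 + \<bar>\<phi> x\<bar>) powr (1 / p)" using l p1 by (intro powr_mono2) auto
      finally have "1 \<le> 2 * ln (2 + \<bar>\<phi> x\<bar>) powr (1 / p)" by simp
      then have "\<bar>\<phi> x\<bar> * 1 \<le> \<bar>\<phi> x\<bar> * (2 * ln (2 + \<bar>\<phi> x\<bar>) powr (1 / p))" by (intro mult_left_mono) auto
      then have "\<bar>\<phi> x\<bar> \<le> 2 * (\<bar>\<phi> x\<bar> * ln (2 + \<bar>\<phi> x\<bar>) powr (1 / p))" by simp
      then show "ennreal \<bar>\<phi> x\<bar> \<le> ennreal 2 * ennreal (\<bar>\<phi> x\<bar> * ln (2 + \<bar>\<phi> x\<bar>) powr (1 / p))"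
        by (simp only: ennreal_mult[symmetric] zero_le_numeral abs_ge_zero powr_ge_zero mult_nonneg_nonneg ennreal_leI)
    qed
    also have "\<dots> = ennreal 2 * (\<integral>\<^sup>+x. ennreal (\<bar>\<phi> x\<bar> * ln (2 + \<bar>\<phi> x\<bar>) powr (1 / p)) \<partial>lborel)"
      by (rule nn_integral_cmult) measurable
    also have "\<dots> < \<infinity>" using fin by (simp add: ennreal_mult_less_top)
    finally show ?thesis .
  qed
  obtain I where I: "0 \<le> I" "mass \<phi> = ennreal I"
    using \<phi>1 by (cases "\<integral>\<^sup>+x. ennreal \<bar>\<phi> x\<bar> \<partial>lborel") auto
  have "mass \<theta> \<le> ennreal I"
    unfolding I(2)[symmetric] by (intro nn_integral_mono ennreal_leI \<theta>\<phi>)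
  then have \<theta>1: "mass \<theta> < \<infinity>" by (rule le_less_trans) simp
  \<comment> \<open>The height at which the datum is split: above it, the pairing with a function
    bounded by 2 L is at most q. It is fixed before t, so that the part below M can use L^1
    convergence with tolerance q/M. The maximum with 1 keeps M positive when L = 0.\<close>
  define M where "M = (max 1 (e powr p * (2 * L) / q)) powr (1 / (p - 1))"
  have M0: "0 < M" unfolding M_def by (simp add: powr_gt_zero)
  have Mp: "M powr (p - 1) = max 1 (e powr p * (2 * L) / q)" unfolding M_def using p1 by (simp add: powr_powr)
  have Mq: "e powr p * (2 * L) / M powr (p - 1) \<le> q"
  proof -
    have "e powr p * (2 * L) = q * (e powr p * (2 * L) / q)" using q by simp
    also have "\<dots> \<le> q * M powr (p - 1)" unfolding Mp using q by (intro mult_left_mono) auto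
    finally show ?thesis unfolding Mp by (simp add: divide_le_eq)
  qed
  have qM: "0 < q / M" using q M0 by simp
  have "((\<lambda>t. (1 + K) * B * (t + 2 * sqrt t) * I) \<longlongrightarrow> (1 + K) * B * (0 + 2 * sqrt 0) * I) (at_right 0)"
    by (intro tendsto_intros)
  then have ev1: "\<forall>\<^sub>F t in at_right 0. (1 + K) * B * (t + 2 * sqrt t) * I < q"
    by (rule order_tendstoD(2)) (use q in simp)
  have ev2: "\<forall>\<^sub>F t :: real in at_right 0. 0 < t" by (rule eventually_at_right_less)
  have ev3: "\<forall>\<^sub>F t in at_right 0. mass (\<lambda>x. conv (P t) \<theta> x - \<theta> x) \<le> ennreal (q / M)"
    by (rule conv_P_L1_tendsto[OF _ \<theta>1 qM]) measurable
  show "\<forall>\<^sub>F t in at_right 0. dist (LBINT x. (u t x - u0 x) * \<phi> x) 0 < \<epsilon>"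
    using ev1 ev2 ev3
  proof eventually_elim
    case (elim t)
    have t: "0 < t" by fact
    have pair: "mass (\<lambda>x. g x * \<psi> x) \<le> ennreal (2 * q)"
      if [measurable]: "g \<in> borel_measurable borel" and g: "modular p e g \<le> 1" for g
    proof -
      have "mass (\<lambda>x. g x * \<psi> x) \<le> ennreal (e * (q / e)) + ennreal (e * c) * ennreal \<delta>"
        by (rule order_trans[OF nn_integral_young_pairing[OF p_ge1 qe _ _ e g c Y]])
          (auto intro!: add_left_mono mult_left_mono \<psi>w)
      also have "\<dots> = ennreal (q + e * c * \<delta>)" using e q c \<delta> by (simp flip: ennreal_mult ennreal_plus)
      also have "\<dots> \<le> ennreal (2 * q)" using ec\<delta> by (intro ennreal_leI) simp
      finally show ?thesis .
    qed
    have ip: "integrable lborel g \<and> \<bar>LBINT x. g x\<bar> \<le> a"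
      if [measurable]: "g \<in> borel_measurable borel" and "mass g \<le> ennreal a" "0 \<le> a" for g :: "'a \<Rightarrow> real" and a
    proof
      show "integrable lborel g" using le_less_trans[OF that(2)] by (intro integrableI_bounded) auto
      show "\<bar>LBINT x. g x\<bar> \<le> a" using order_trans[OF abs_integral_le_nn_integral that(2)] that(3) by simp
    qed
    have q0: "0 \<le> 2 * q" "0 \<le> q" using q by auto
    have 1: "integrable lborel (\<lambda>x. sg u0 t x * \<psi> x) \<and> \<bar>LBINT x. sg u0 t x * \<psi> x\<bar> \<le> 2 * q"
      by (rule ip[OF _ pair q0(1)]) (use order_trans[OF modular_sg[OF u0 e t] mo] in auto)
    have 2: "integrable lborel (\<lambda>x. u0 x * \<psi> x) \<and> \<bar>LBINT x. u0 x * \<psi> x\<bar> \<le> 2 * q"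
      by (rule ip[OF _ pair[OF u0 mo] q0(1)]) measurable
    have 3: "integrable lborel (\<lambda>x. D t x * \<phi> x) \<and> \<bar>LBINT x. D t x * \<phi> x\<bar> \<le> q"
    proof (rule ip[OF _ _ q0(2)])
      let ?d = "(1 + K) * B * (t + 2 * sqrt t)"
      have d0: "0 \<le> ?d" using K B t by simp
      have "mass (\<lambda>x. D t x * \<phi> x) \<le> (\<integral>\<^sup>+x. ennreal ?d * ennreal \<bar>\<phi> x\<bar> \<partial>lborel)"
        using D_sup[OF t] d0 by (intro nn_integral_mono) (auto simp: abs_mult simp flip: ennreal_mult intro!: ennreal_leI mult_right_mono)
      also have "\<dots> = ennreal (?d * I)" using d0 I by (simp add: nn_integral_cmult ennreal_mult)
      also have "\<dots> \<le> ennreal q" using elim(1) by (intro ennreal_leI) simp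
      finally show "mass (\<lambda>x. D t x * \<phi> x) \<le> ennreal q" .
    qed measurable
    have nc: "nconv (P t) \<theta> y \<le> ennreal L" for y
    proof -
      have "nconv (P t) \<theta> y \<le> ennreal (L + K * t powr (- (real DIM('a) / 2)) * 0)"
        by (rule nconv_P_bound[OF t, where v="\<lambda>y. 0"]) (use P_le_local[OF t] \<theta>L L0 in auto)
      then show ?thesis by simp
    qed
    have f1: "(\<integral>\<^sup>+y. ennreal \<bar>u0 y\<bar> * nconv (P t) \<theta> y \<partial>lborel) < \<infinity>"
    proof -
      have "(\<integral>\<^sup>+y. ennreal \<bar>u0 y\<bar> * nconv (P t) \<theta> y \<partial>lborel)
        \<le> ennreal 1 * (\<integral>\<^sup>+y. nconv (P t) \<theta> y \<partial>lborel) + ennreal (e powr p * L / 1 powr (p - 1))"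
        by (rule nn_integral_bounded_pairing[OF p_ge1 e _ L0 _ _ mo nc]) (simp, measurable)
      also have "\<dots> < \<infinity>" using \<theta>1 by (simp add: nconv_P_L1[OF t] ennreal_mult_less_top)
      finally show ?thesis .
    qed
    have f2: "integrable lborel (\<lambda>x. u0 x * \<theta> x)"
    proof (rule integrableI_bounded)
      have "(\<integral>\<^sup>+x. ennreal (norm (u0 x * \<theta> x)) \<partial>lborel) = (\<integral>\<^sup>+y. ennreal \<bar>u0 y\<bar> * ennreal \<bar>\<theta> y\<bar> \<partial>lborel)"
        by (intro nn_integral_cong) (simp add: abs_mult ennreal_mult)
      also have "\<dots> \<le> ennreal 1 * mass \<theta> + ennreal (e powr p * L / 1 powr (p - 1))"
        by (rule nn_integral_bounded_pairing[OF p_ge1 e _ L0 _ _ mo ennreal_leI[OF \<theta>L]]) (simp, measurable)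
      also have "\<dots> < \<infinity>" using \<theta>1 by (simp add: ennreal_mult_less_top)
      finally show "(\<integral>\<^sup>+x. ennreal (norm (u0 x * \<theta> x)) \<partial>lborel) < \<infinity>" .
    qed measurable
    have 4: "\<bar>LBINT x. (sg u0 t x - u0 x) * \<theta> x\<bar> \<le> 2 * q" "integrable lborel (\<lambda>x. (sg u0 t x - u0 x) * \<theta> x)"
    proof -
      have g2: "ennreal \<bar>conv (P t) \<theta> x - \<theta> x\<bar> \<le> ennreal (2 * L)" for x
      proof -
        have "\<bar>conv (P t) \<theta> x\<bar> \<le> L" using order_trans[OF conv_le_nconv nc, of x] L0 by simp
        then show ?thesis using \<theta>L[of x] by (intro ennreal_leI) linarith
      qed
      have "mass (\<lambda>y. u0 y * (conv (P t) \<theta> y - \<theta> y)) = (\<integral>\<^sup>+y. ennreal \<bar>u0 y\<bar> * ennreal \<bar>conv (P t) \<theta> y - \<theta> y\<bar> \<partial>lborel)"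
        by (intro nn_integral_cong) (simp add: abs_mult ennreal_mult)
      also have "\<dots> \<le> ennreal M * mass (\<lambda>y. conv (P t) \<theta> y - \<theta> y) + ennreal (e powr p * (2 * L) / M powr (p - 1))"
        by (rule nn_integral_bounded_pairing[OF p_ge1 e M0 _ _ _ mo g2]) (use L0 in \<open>simp, measurable\<close>)
      also have "\<dots> \<le> ennreal M * ennreal (q / M) + ennreal q"
        by (intro add_mono mult_left_mono elim(3) ennreal_leI Mq) auto
      also have "\<dots> = ennreal (2 * q)" using M0 q by (simp flip: ennreal_mult ennreal_plus)
      finally have "\<bar>LBINT y. u0 y * (conv (P t) \<theta> y - \<theta> y)\<bar> \<le> 2 * q" using ip[OF _ _ q0(1)] by simp
      then show "\<bar>LBINT x. (sg u0 t x - u0 x) * \<theta> x\<bar> \<le> 2 * q" "integrable lborel (\<lambda>x. (sg u0 t x - u0 x) * \<theta> x)"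
        using conv_P_dual[OF t u0 _ f1 f2] unfolding sg_def by simp_all
    qed
    have "(\<lambda>x. (u t x - u0 x) * \<phi> x) = (\<lambda>x. (sg u0 t x * \<psi> x - u0 x * \<psi> x) + ((sg u0 t x - u0 x) * \<theta> x + D t x * \<phi> x))"
      unfolding mild_def by (rule ext) (simp add: split algebra_simps)
    then have "(LBINT x. (u t x - u0 x) * \<phi> x) = ((LBINT x. sg u0 t x * \<psi> x) - (LBINT x. u0 x * \<psi> x)) + ((LBINT x. (sg u0 t x - u0 x) * \<theta> x) + (LBINT x. D t x * \<phi> x))"
      using 1 2 3 4 by simp
    then have "\<bar>LBINT x. (u t x - u0 x) * \<phi> x\<bar> \<le> 7 * q" using 1 2 3 4 by linarith
    also have "\<dots> < \<epsilon>" unfolding q_def using \<epsilon> by simp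
    finally show ?case by simp
  qed
qed

section \<open>Decay in \<open>L\<^sup>q\<close>\<close>

text \<open>The bounds in \<open>good\<close> do not vanish at t = 0. The bounds obtained from the
  Duhamel integral over (0, t) do: they are multiples of t + 2 sqrt t and t^\<beta>.\<close>

lemma D_tendsto_zero: "((\<lambda>t. expL_norm p (D t)) \<longlongrightarrow> 0) (at_right 0)"
proof (rule tendsto_ennreal_zeroI)
  fix \<epsilon> :: real assume \<epsilon>: "0 < \<epsilon>"
  have "((\<lambda>t. (1 + K) * B * (t + 2 * sqrt t)) \<longlongrightarrow> (1 + K) * B * (0 + 2 * sqrt 0)) (at_right 0)"
    by (intro tendsto_intros)
  then have 1: "\<forall>\<^sub>F t in at_right 0. (1 + K) * B * (t + 2 * sqrt t) < \<epsilon> / 3"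
    by (rule order_tendstoD(2)) (use \<epsilon> in simp)
  have "((\<lambda>t. B / \<beta> * t powr \<beta>) \<longlongrightarrow> B / \<beta> * 0) (at_right 0)"
    by (intro tendsto_mult_left tendsto_zero_powrI[OF tendsto_ident_at tendsto_const _ \<beta>(1)])
      (auto intro: eventually_at_right_less[THEN eventually_mono])
  then have 2: "\<forall>\<^sub>F t in at_right 0. B / \<beta> * t powr \<beta> < \<epsilon> / 3"
    by (rule order_tendstoD(2)) (use \<epsilon> in simp)
  have 3: "\<forall>\<^sub>F t :: real in at_right 0. 0 < t" by (rule eventually_at_right_less)
  show "\<forall>\<^sub>F t in at_right 0. expL_norm p (D t) \<le> ennreal \<epsilon>"
    using 1 2 3
  proof eventually_elim
    case (elim t)
    have "small (\<epsilon> / 3) (D t)"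
      unfolding small_def
    proof (intro conjI allI)
      show "\<bar>D t x\<bar> \<le> \<epsilon> / 3" for x using D_sup[OF elim(3), of x] elim(1) by linarith
      show "mass (D t) \<le> ennreal (\<epsilon> / 3)"
        by (rule order_trans[OF D_L1[OF elim(3)]]) (use elim(2) in \<open>auto intro!: ennreal_leI\<close>)
    qed
    then have "expL_norm p (D t) \<le> ennreal (3 * (\<epsilon> / 3))" by (intro small_expL_norm) (use \<epsilon> in auto)
    then show ?case by simp
  qed
qed

lemma Lq_decay:
  assumes q: "r < q"
  shows "\<exists>A>0. \<forall>t>0. u t \<in> Lq q \<and> Lq_norm q (u t) \<le> A * ts t powr (- (1 / (m - 1) - real DIM('a) / (2 * s * q)))"
proof -
  have q0: "0 < q" using q r(3) by simp
  obtain c where c: "1 \<le> c" "\<And>\<mu> u0 t x. 0 < \<mu> \<Longrightarrow> u0 \<in> borel_measurable borel \<Longrightarrow> modular p \<mu> u0 \<le> 1 \<Longrightarrow> 0 < t \<Longrightarrow>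
    \<bar>sg u0 t x\<bar> \<le> c * \<mu> * ts t powr (- \<alpha>)" using sg_sup by blast
  define A where "A = c * e + e"
  have A: "0 < A" unfolding A_def using c(1) e by (simp add: add_nonneg_pos)
  have sup: "\<bar>u t x\<bar> \<le> A * ts t powr (- \<alpha>)" if t: "0 < t" for t x
  proof -
    \<comment> \<open>As t_s \<le> \<open>max 1 t\<close>, the correction decays at least as fast as
      the linear part.\<close>
    have "max 1 t powr (- \<alpha>) \<le> ts t powr (- \<alpha>)" using ts(1,2)[OF t] \<alpha> by (intro powr_mono2') auto
    then have "e * max 1 t powr (- \<alpha>) \<le> e * ts t powr (- \<alpha>)" using e by simp
    then show ?thesis using c(2)[OF e u0 mo t, of x] goodD(2)[OF gD t, of x] unfolding mild_def A_def by (simp add: distrib_right)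
  qed
  obtain k where k: "1 \<le> k" "\<And>\<mu> u. 0 < \<mu> \<Longrightarrow> u \<in> borel_measurable borel \<Longrightarrow> modular p \<mu> u \<le> 1 \<Longrightarrow>
     (\<integral>\<^sup>+(x::'a). ennreal (\<bar>u x\<bar> powr r) \<partial>lborel) \<le> ennreal (k * \<mu> powr r)"
    by (rule modular_powr_integral[OF p_ge1 r(2), where 'a='a]) blast
  define k' where "k' = A powr (q - r) * (k * N powr r)"
  have k': "0 < k'" unfolding k'_def using A k N0 by simp
  \<comment> \<open>The q-th root of the interpolated bound has the stated rate because \<alpha> r =
    d/(2s).\<close>
  have ex: "- \<alpha> * (q - r) * (1 / q) = - (1 / (m - 1) - real DIM('a) / (2 * s * q))"
  proof -
    have "- \<alpha> * (q - r) * (1 / q) = - (\<alpha> - \<alpha> * r / q)" using q0 by (simp add: field_simps)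
    also have "\<alpha> * r / q = real DIM('a) / (2 * s * q)" unfolding r(1) by simp
    finally show ?thesis unfolding \<alpha>_def .
  qed
  have "u t \<in> Lq q \<and> Lq_norm q (u t) \<le> k' powr (1 / q) * ts t powr (- (1 / (m - 1) - real DIM('a) / (2 * s * q)))" if t: "0 < t" for t
  proof -
    let ?b = "ts t powr (- \<alpha> * (q - r))"
    have bp: "(A * ts t powr (- \<alpha>)) powr (q - r) = A powr (q - r) * ?b" using A by (simp add: powr_mult powr_powr)
    have "(\<integral>\<^sup>+x. ennreal (\<bar>u t x\<bar> powr q) \<partial>lborel) \<le> (\<integral>\<^sup>+x. ennreal (A powr (q - r) * ?b) * ennreal (\<bar>u t x\<bar> powr r) \<partial>lborel)"
    proof (intro nn_integral_mono)
      fix x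
      have "\<bar>u t x\<bar> powr q = \<bar>u t x\<bar> powr (q - r) * \<bar>u t x\<bar> powr r" by (simp flip: powr_add)
      also have "\<dots> \<le> (A powr (q - r) * ?b) * \<bar>u t x\<bar> powr r"
        unfolding bp[symmetric] using q sup[OF t, of x] by (intro mult_right_mono powr_mono2) auto
      finally show "ennreal (\<bar>u t x\<bar> powr q) \<le> ennreal (A powr (q - r) * ?b) * ennreal (\<bar>u t x\<bar> powr r)"
        by (simp flip: ennreal_mult add: ennreal_leI)
    qed
    also have "\<dots> = ennreal (A powr (q - r) * ?b) * (\<integral>\<^sup>+x. ennreal (\<bar>u t x\<bar> powr r) \<partial>lborel)"
      by (rule nn_integral_cmult) measurable
    also have "\<dots> \<le> ennreal (A powr (q - r) * ?b) * ennreal (k * N powr r)"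
      by (intro mult_left_mono k(2) N0 admissibleD(2)[OF ad t]) auto
    also have "\<dots> = ennreal (k' * ?b)" unfolding k'_def using k(1) by (simp flip: ennreal_mult add: mult_ac)
    finally have I: "(\<integral>\<^sup>+x. ennreal (\<bar>u t x\<bar> powr q) \<partial>lborel) \<le> ennreal (k' * ?b)" .
    have int: "integrable lborel (\<lambda>x. \<bar>u t x\<bar> powr q)"
      using le_less_trans[OF I] by (intro integrableI_bounded) auto
    have "(LBINT x. \<bar>u t x\<bar> powr q) \<le> k' * ?b"
      using I k' by (subst integral_eq_nn_integral) (auto intro!: enn2real_leI)
    then have "(LINT x|lebesgue. \<bar>u t x\<bar> powr q) \<le> k' * ?b" by (subst integral_completion) auto
    then have "Lq_norm q (u t) \<le> (k' * ?b) powr (1 / q)" unfolding Lq_norm_def using q0 by (intro powr_mono2) auto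
    also have "\<dots> = k' powr (1 / q) * ts t powr (- \<alpha> * (q - r) * (1 / q))" using k' by (subst powr_mult) (auto simp: powr_powr)
    finally have "Lq_norm q (u t) \<le> k' powr (1 / q) * ts t powr (- (1 / (m - 1) - real DIM('a) / (2 * s * q)))" unfolding ex .
    moreover have "u t \<in> Lq q"
      unfolding Lq_def using int by (auto intro!: measurable_completion simp: integrable_completion)
    ultimately show ?thesis by simp
  qed
  then show ?thesis using k' by (intro exI[of _ "k' powr (1 / q)"]) (simp add: powr_gt_zero)
qed

end

text \<open>The first two regimes state the bound 2 q > 2 r. In the third, s > d(p-1)/(2p) is
  equivalent to d(m-1)/s < 2(m-1)p/(p-1), so its lower bound for q is larger still.\<close>

lemma (in mild_problem) decay_exponent_gt:
  assumes "decay_exponent (real DIM('a)) s m p q"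
  shows "r < q"
proof -
  let ?d = "real DIM('a)"
  have m0: "0 < m - 1" using m1 by simp
  have r: "?d * (m - 1) / s = 2 * r" unfolding r_def \<alpha>_def using m0 s by (simp add: field_simps)
  consider "?d * (m - 1) / s < 2 * q" | "s > ?d * (p - 1) / (2 * p)" "2 * (m - 1) * p / (p - 1) < 2 * q"
    using assms unfolding decay_exponent_def by blast
  then show ?thesis
  proof cases
    case 1
    then show ?thesis unfolding r by simp
  next
    case 2
    have "?d * (p - 1) < 2 * p * s" using 2(1) p1 by (simp add: field_simps)
    then have "(m - 1) * (?d * (p - 1)) < (m - 1) * (2 * p * s)" using m0 by (rule mult_strict_left_mono)
    then have "?d * (m - 1) / s < 2 * (m - 1) * p / (p - 1)" using s p1 by (simp add: field_simps)
    then show ?thesis using 2(2) unfolding r by simp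
  qed
qed

section \<open>The weak-mild solution\<close>

lemma lebesgue_borel_version:
  fixes g :: "'a::euclidean_space \<Rightarrow> real"
  assumes g: "g \<in> borel_measurable lebesgue"
  obtains g' where "g' \<in> borel_measurable borel" "AE x in lborel. g x = g' x"
  using completion_ex_borel_measurable_real[OF g] that by auto

lemma has_expL_integral_cong:
  assumes "\<And>\<tau>. a < \<tau> \<Longrightarrow> \<tau> < b \<Longrightarrow> g \<tau> = g' \<tau>" and "has_expL_integral p a b g J"
  shows "has_expL_integral p a b g' J"
proof -
  have "(AE t in lebesgue_on {a<..<b}. Q t (g t)) \<longleftrightarrow> (AE t in lebesgue_on {a<..<b}. Q t (g' t))" for Q
    using assms(1) by (intro AE_cong) (simp add: space_restrict_space)
  note ae = this[of "\<lambda>t z. z \<in> expL p"] this[of "\<lambda>t z. (\<lambda>n. expL_norm p (\<lambda>x. S n t x - z x)) \<longlonglongrightarrow> 0" for S]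
  have nn: "(\<integral>\<^sup>+\<tau>. expL_norm p (\<lambda>x. S \<tau> x - g \<tau> x) \<partial>lebesgue_on {a<..<b}) = (\<integral>\<^sup>+\<tau>. expL_norm p (\<lambda>x. S \<tau> x - g' \<tau> x) \<partial>lebesgue_on {a<..<b})" for S
    using assms(1) by (intro nn_integral_cong) (simp add: space_restrict_space)
  show ?thesis using assms(2) unfolding has_expL_integral_def expL_measurable_def ae nn .
qed

text \<open>The function is changed on a null set only under the integral, so the two sides agree at
  every point and not merely almost everywhere. This connects the Lebesgue measurable data with the
  Borel calculus of the kernel.\<close>

lemma heat_semigroup_eq:
  fixes \<phi> :: "'a::euclidean_space \<Rightarrow> real"
  assumes s: "0 < s" "s < 1" and t: "0 < t" and \<phi>: "\<phi> \<in> borel_measurable lebesgue"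
    and [measurable]: "\<phi>' \<in> borel_measurable borel" and eq: "AE x in lborel. \<phi> x = \<phi>' x"
  shows "heat_semigroup s t \<phi> = conv (mker s t) \<phi>'"
proof
  fix x
  have "jointly_measurable (mker s :: real \<Rightarrow> 'a \<Rightarrow> real)" unfolding jointly_measurable_def by (rule mker_measurable[OF s])
  note [measurable (raw)] = jointly_measurableD[OF this]
  have "heat_semigroup s t \<phi> x = (LINT y|lebesgue. mker s t (x - y) * \<phi> y)"
    unfolding heat_semigroup_def mixed_heat_kernel_eq[OF s t] using t by simp
  also have "\<dots> = (LINT y|lebesgue. mker s t (x - y) * \<phi>' y)"
  proof (rule integral_cong_AE)
    have [measurable]: "(\<lambda>y. mker s t (x - y)) \<in> borel_measurable lebesgue" "\<phi>' \<in> borel_measurable lebesgue"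
      by (rule measurable_completion, measurable)+
    show "(\<lambda>y. mker s t (x - y) * \<phi> y) \<in> borel_measurable lebesgue" using \<phi> by measurable
    show "(\<lambda>y. mker s t (x - y) * \<phi>' y) \<in> borel_measurable lebesgue" by measurable
    show "AE y in lebesgue. mker s t (x - y) * \<phi> y = mker s t (x - y) * \<phi>' y"
      using AE_completion[OF eq] by eventually_elim simp
  qed
  also have "\<dots> = conv (mker s t) \<phi>' x" unfolding conv_def by (rule integral_completion) measurable
  finally show "heat_semigroup s t \<phi> x = conv (mker s t) \<phi>' x" .
qed

text \<open>v0 is the given datum and u0 a Borel representative. They have the same evolution at
  every positive time, so the solution built from u0 solves the problem for v0.\<close>

lemma mild_solution_global_weak_mild:
  fixes v0 u0 :: "'a::euclidean_space \<Rightarrow> real"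
  assumes sol: "mild_solution (mker s) s K m p C lam f u0 D e N B"
    and v0: "v0 \<in> expL p" and eq: "AE x in lborel. v0 x = u0 x"
  shows "global_weak_mild_solution s p f v0 (mild_problem.mild (mker s) u0 D)"
    and "((\<lambda>t. expL_norm p (\<lambda>x. mild_problem.mild (mker s) u0 D t x - heat_semigroup s t v0 x)) \<longlongrightarrow> 0) (at_right 0)"
proof -
  interpret mild_solution "mker s" s K m p C lam f u0 D e N B by (rule sol)
  have leb: "g \<in> borel_measurable lebesgue" if "g \<in> borel_measurable borel" for g :: "'a \<Rightarrow> real"
    using that by (intro measurable_completion) simp
  have v0m: "v0 \<in> borel_measurable lebesgue" using v0 unfolding expL_def by (auto intro: L1_loc_measurable)
  have sgv: "heat_semigroup s t v0 = sg u0 t" if "0 < t" for t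
    unfolding sg_def by (rule heat_semigroup_eq[OF s that v0m u0 eq])
  have hG: "heat_semigroup s (t - \<tau>) (h \<tau>) = G t \<tau>" if "0 < \<tau>" "\<tau> < t" for t \<tau>
    using heat_semigroup_eq[OF s _ leb[OF h_borel] h_borel, of "t - \<tau>" \<tau>] that unfolding G_def by simp
  have set: "{t. 0 < t \<and> ereal t < \<infinity>} = {0<..}" by auto
  have ws: "((\<lambda>t. LINT x|lebesgue. (u t x - v0 x) * \<phi> x) \<longlongrightarrow> 0) (at_right 0)" if \<phi>: "\<phi> \<in> L1_lnL (1 / p)" for \<phi>
  proof -
    have \<phi>m: "\<phi> \<in> borel_measurable lebesgue" using \<phi> unfolding L1_lnL_def by (auto intro: L1_loc_measurable)
    obtain \<phi>' where \<phi>': "\<phi>' \<in> borel_measurable borel" and e\<phi>: "AE x in lborel. \<phi> x = \<phi>' x" by (rule lebesgue_borel_version[OF \<phi>m])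
    have "(\<integral>\<^sup>+x. ennreal (\<bar>\<phi>' x\<bar> * ln (2 + \<bar>\<phi>' x\<bar>) powr (1 / p)) \<partial>lborel) = (\<integral>\<^sup>+x. ennreal (\<bar>\<phi> x\<bar> * ln (2 + \<bar>\<phi> x\<bar>) powr (1 / p)) \<partial>lborel)"
      by (rule nn_integral_cong_AE) (use e\<phi> in eventually_elim, simp)
    also have "\<dots> < \<infinity>" using \<phi> unfolding L1_lnL_def by (simp add: nn_integral_completion)
    finally have "((\<lambda>t. LBINT x. (u t x - u0 x) * \<phi>' x) \<longlongrightarrow> 0) (at_right 0)" by (rule weak_star_convergence[OF \<phi>'])
    moreover have "(LBINT x. (u t x - u0 x) * \<phi>' x) = (LINT x|lebesgue. (u t x - v0 x) * \<phi> x)" for t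
    proof -
      have "(LBINT x. (u t x - u0 x) * \<phi>' x) = (LINT x|lebesgue. (u t x - u0 x) * \<phi>' x)"
        using \<phi>' by (intro integral_completion[symmetric]) measurable
      also have "\<dots> = (LINT x|lebesgue. (u t x - v0 x) * \<phi> x)"
      proof (rule integral_cong_AE)
        show "(\<lambda>x. (u t x - u0 x) * \<phi>' x) \<in> borel_measurable lebesgue" using \<phi>' by (intro leb) measurable
        show "(\<lambda>x. (u t x - v0 x) * \<phi> x) \<in> borel_measurable lebesgue"
          by (intro borel_measurable_times borel_measurable_diff v0m \<phi>m leb borel_slices)
        show "AE x in lebesgue. (u t x - u0 x) * \<phi>' x = (u t x - v0 x) * \<phi> x"
          using AE_completion[OF eq] AE_completion[OF e\<phi>] by eventually_elim simp
      qed
      finally show ?thesis .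
    qed
    ultimately show ?thesis by simp
  qed
  show "global_weak_mild_solution s p f v0 u"
    unfolding weak_mild_solution_def set
  proof (intro conjI ballI ws v0 u_in_Linf AE_I2)
    fix t assume "t \<in> space (lebesgue_on {0::real<..})"
    then have t: "0 < t" by (simp add: space_restrict_space)
    {
      fix \<tau> assume "\<tau> \<in> space (lebesgue_on {0<..<t})"
      then have \<tau>: "0 < \<tau>" "\<tau> < t" by (simp_all add: space_restrict_space)
      show "heat_semigroup_converges s (t - \<tau>) (h \<tau>)"
        unfolding heat_semigroup_converges_def
      proof (rule AE_I2)
        fix x
        have "mixed_heat_kernel s (t - \<tau>) z = mker s (t - \<tau>) z" for z :: 'a using mixed_heat_kernel_eq[OF s, of "t - \<tau>" z] \<tau> by simp
        then show "integrable lebesgue (\<lambda>y. mixed_heat_kernel s (t - \<tau>) (x - y) * h \<tau> y)"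
          using conv_source_integrable[OF so B \<tau>, of x] by (subst integrable_completion) simp_all
      qed
    }
    show "\<exists>J. has_expL_integral p 0 t (\<lambda>\<tau>. heat_semigroup s (t - \<tau>) (h \<tau>)) J \<and> (AE x in lebesgue. u t x = heat_semigroup s t v0 x + J x)"
    proof (intro exI[of _ "D t"] conjI has_expL_integral_cong[OF _ duh_has_expL_integral[OF t]] AE_I2)
      show "G t \<tau> = heat_semigroup s (t - \<tau>) (h \<tau>)" if "0 < \<tau>" "\<tau> < t" for \<tau> by (rule hG[OF that, symmetric])
      show "u t x = heat_semigroup s t v0 x + D t x" for x by (simp add: sgv[OF t] mild_def)
    qed
  qed
  have "((\<lambda>t. expL_norm p (\<lambda>x. u t x - heat_semigroup s t v0 x)) \<longlongrightarrow> 0) (at_right 0)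
    \<longleftrightarrow> ((\<lambda>t. expL_norm p (D t)) \<longlongrightarrow> 0) (at_right 0)"
    by (intro tendsto_cong eventually_at_right_less[THEN eventually_mono]) (simp add: sgv mild_def)
  then show "((\<lambda>t. expL_norm p (\<lambda>x. u t x - heat_semigroup s t v0 x)) \<longlongrightarrow> 0) (at_right 0)"
    using D_tendsto_zero by simp
qed

lemma mker_heat_kernel:
  assumes s: "0 < s" "s < 1"
  obtains K where "heat_kernel (mker s :: real \<Rightarrow> 'a::euclidean_space \<Rightarrow> real) s K"
proof -
  obtain K where K: "0 < K"
    "\<And>t. 0 < t \<Longrightarrow> (LBINT \<xi>::'a. exp (- (t * psi s \<xi>))) \<le> K * t powr (- (real DIM('a) / 2))"
    "\<And>t. 0 < t \<Longrightarrow> (LBINT \<xi>::'a. exp (- (t * psi s \<xi>))) \<le> K * t powr (- (real DIM('a) / (2 * s)))"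
    by (rule psi_integral_bound[OF s, where 'a='a]) blast
  let ?c = "(2 * pi) ^ DIM('a)"
  have c: "0 < ?c" by simp
  have le: "mker s t x \<le> K / ?c * b" if "0 < t" "(LBINT \<xi>::'a. exp (- (t * psi s \<xi>))) \<le> K * b" for t b and x :: 'a
  proof -
    have "mker s t x \<le> (LBINT \<xi>::'a. exp (- (t * psi s \<xi>))) / ?c" using mker_bound[OF s that(1), of x] by linarith
    also have "\<dots> \<le> K * b / ?c" using that(2) c by (intro divide_right_mono) auto
    finally show ?thesis by simp
  qed
  show thesis
  proof (rule that[of "K / ?c"], unfold_locales)
    show "jointly_measurable (mker s :: real \<Rightarrow> 'a \<Rightarrow> real)" unfolding jointly_measurable_def by (rule mker_measurable[OF s])
    show "0 < K / ?c" using K(1) c by simp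
    show "mker s t x \<le> K / ?c * t powr (- (real DIM('a) / 2))" if "0 < t" for t and x :: 'a by (rule le[OF that K(2)[OF that]])
    show "mker s t x \<le> K / ?c * t powr (- (real DIM('a) / (2 * s)))" if "0 < t" for t and x :: 'a by (rule le[OF that K(3)[OF that]])
  qed (use s in \<open>auto intro: mker_nonneg mker_nn_integral mker_minus mker_uniform_continuous mker_L1_continuous mker_concentration\<close>)
qed

theorem theorem1p4:
  fixes s m p C lam :: real and f :: "real \<Rightarrow> real"
  assumes "0 < s" and "s < 1"
    and "p \<le> m" and "1 < p" and "p \<le> real DIM('a::euclidean_space) * (m - 1) / (2 * s)"
    and "f 0 = 0" and "0 < C" and "0 < lam"
    and "\<And>u v. \<bar>f u - f v\<bar> \<le> C * \<bar>u - v\<bar> *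
           (\<bar>u\<bar> powr (m - 1) * exp (lam * \<bar>u\<bar> powr p) + \<bar>v\<bar> powr (m - 1) * exp (lam * \<bar>v\<bar> powr p))"
  shows "\<exists>\<epsilon>>0. \<forall>u0 :: 'a \<Rightarrow> real. u0 \<in> expL p \<and> expL_norm p u0 \<le> ennreal \<epsilon> \<longrightarrow>
    (\<exists>u. global_weak_mild_solution s p f u0 u \<and>
      ((\<lambda>t. expL_norm p (\<lambda>x. u t x - heat_semigroup s t u0 x)) \<longlongrightarrow> 0) (at_right 0) \<and>
      (\<forall>q. decay_exponent (real DIM('a)) s m p q \<longrightarrow>
        (\<exists>K>0. \<forall>t>0. u t \<in> Lq q \<and>
          Lq_norm q (u t) \<le> K * max (t powr s) t powr
            (- (1 / (m - 1) - real DIM('a) / (2 * s * q))))))"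
proof -
  obtain K where "heat_kernel (mker s :: real \<Rightarrow> 'a \<Rightarrow> real) s K" using mker_heat_kernel[OF assms(1,2)] by blast
  then interpret hk: heat_kernel "mker s :: real \<Rightarrow> 'a \<Rightarrow> real" s K .
  interpret mp: mild_problem "mker s :: real \<Rightarrow> 'a \<Rightarrow> real" s K m p C lam f
    by unfold_locales (use assms in auto)
  show ?thesis
  proof (rule mp.fixed_point)
    fix e0 :: real
    assume e0: "0 < e0" and fp: "\<And>e u0. 0 < e \<Longrightarrow> e \<le> e0 \<Longrightarrow> u0 \<in> borel_measurable borel \<Longrightarrow> modular p e u0 \<le> 1 \<Longrightarrow>
       \<exists>D N B. mp.good e D \<and> mp.smallness N \<and> mp.admissible N (mp.mild u0 D) \<and> 0 < B \<and> mp.source B (\<lambda>\<tau> y. f (mp.mild u0 D \<tau> y)) \<and>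
         (\<forall>t>0. \<forall>x. D t x = hk.duh (\<lambda>\<tau> y. f (mp.mild u0 D \<tau> y)) t x)"
    show ?thesis
    proof (intro exI[of _ "e0 / 2"] conjI allI impI)
      show "0 < e0 / 2" using e0 by simp
      fix v0 :: "'a \<Rightarrow> real" assume v0: "v0 \<in> expL p \<and> expL_norm p v0 \<le> ennreal (e0 / 2)"
      \<comment> \<open>Halving e0 in the choice of \<epsilon> makes this inequality strict, so a
        scale \<mu> < e0 with modular at most 1 can be extracted from the infimum.\<close>
      have "expL_norm p v0 < ennreal e0" using v0 e0 by (auto intro: le_less_trans simp: ennreal_less_iff)
      then obtain \<mu> where \<mu>: "0 < \<mu>" "\<mu> < e0" "modular p \<mu> v0 \<le> 1" by (rule expL_norm_less)
      have v0m: "v0 \<in> borel_measurable lebesgue" using v0 unfolding expL_def by (auto intro: L1_loc_measurable)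
      obtain u0 where u0: "u0 \<in> borel_measurable borel" and eq: "AE x in lborel. v0 x = u0 x"
        by (rule lebesgue_borel_version[OF v0m])
      have "modular p e0 u0 = modular p e0 v0"
        unfolding modular_def by (rule nn_integral_cong_AE) (use eq in eventually_elim, simp)
      also have "\<dots> \<le> modular p \<mu> v0" using assms(4) \<mu> by (intro modular_mono) auto
      finally have mo: "modular p e0 u0 \<le> 1" using \<mu>(3) by simp
      obtain D N B where sol: "mp.good e0 D" "mp.smallness N" "mp.admissible N (mp.mild u0 D)" "0 < B"
        "mp.source B (\<lambda>\<tau> y. f (mp.mild u0 D \<tau> y))" "\<forall>t>0. \<forall>x. D t x = hk.duh (\<lambda>\<tau> y. f (mp.mild u0 D \<tau> y)) t x"
        using fp[OF e0 order_refl u0 mo] by blast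
      interpret ms: mild_solution "mker s" s K m p C lam f u0 D e0 N B
        by unfold_locales (use u0 e0 mo sol in auto)
      note main = mild_solution_global_weak_mild[OF ms.mild_solution_axioms conjunct1[OF v0] eq]
      show "\<exists>u. global_weak_mild_solution s p f v0 u \<and>
        ((\<lambda>t. expL_norm p (\<lambda>x. u t x - heat_semigroup s t v0 x)) \<longlongrightarrow> 0) (at_right 0) \<and>
        (\<forall>q. decay_exponent (real DIM('a)) s m p q \<longrightarrow>
          (\<exists>K>0. \<forall>t>0. u t \<in> Lq q \<and>
            Lq_norm q (u t) \<le> K * max (t powr s) t powr (- (1 / (m - 1) - real DIM('a) / (2 * s * q)))))"
        using main ms.Lq_decay[OF mp.decay_exponent_gt] unfolding mp.ts_def by blast
    qed
  qed
qed

end
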